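(* Let $(M,h)$ be a compact connected Riemannian manifold without boundary and let $A$ be a co-closed smooth real $1$-form on $M$. Then there exist constants $\rho>0$ and $C>0$ such that for all $r\in(0,\rho)$: $$\frac{\Vert A\Vert_{L^2(h)}^2}{\mathrm{vol}(M,h)}\,r^2-Cr^4\le \lambda_1(M,h,rA)\le \frac{\Vert A\Vert_{L^2(h)}^2}{\mathrm{vol}(M,h)}\,r^2 .$$ In particular, since $d_h(rA,\mathcal L^{*})^2=r^2\Vert A\Vert_{L^2(h)}^2$ for $r$ small, it follows that, if $A\neq 0$, $$\lim_{r\to 0^+}\frac{\mathrm{vol}(M,h)\,\lambda_1(M,h,rA)}{d_h(rA,\mathcal L^{*})^2}=1 .$$
   Context: For a smooth real $1$-form $A$ (magnetic potential) on a compact Riemannian manifold $(M,h)$ without boundary, the magnetic differential of $u\in C^\infty(M,\mathbb C)$ is $d^Au=du-iuA$, and the magnetic Laplacian is $\Delta_A=(d^A)^*d^A$, i.e. $\Delta_Au=\Delta u+2i\langle A,du\rangle_h+(|A|_h^2-i\delta A)u$, with $\Delta\ge 0$ the Laplace-Beltrami operator and $\delta$ the codifferential. $\lambda_1(M,h,A)$ denotes its lowest eigenvalue: $$\lambda_1(M,h,A)=\min_{0\neq u\in C^\infty(M,\mathbb C)}\frac{\int_M|du-iuA|_h^2\,dv_h}{\int_M|u|^2dv_h}.$$ Co-closed means $\delta A=0$. $\Vert A\Vert_{L^2(h)}^2=\int_M|A|_h^2dv_h$. $\mathcal L^*$ is the lattice of $h$-harmonic $1$-forms $\omega$ that have integral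 flux $\frac1{2\pi}\oint_c\omega\in\mathbb Z$ around every closed curve $c$ in $M$, and $d_h(A,\mathcal L^* )^2=\min\{\Vert\omega-A\Vert^2_{L^2(h)}:\omega\in\mathcal L^*\}$. *)

theory Defs
  imports "HOL-Analysis.Analysis"
begin

section \<open>Smooth maps between Euclidean spaces\<close>

text \<open>\<open>Ck_on k S f\<close> is meant for open \<open>S\<close>: all iterated partial derivatives of \<open>f\<close> up to
  order \<open>k\<close> exist and are continuous on \<open>S\<close>.\<close>

primrec Ck_on :: "nat \<Rightarrow> 'e set \<Rightarrow> ('e::euclidean_space \<Rightarrow> 'f::real_normed_vector) \<Rightarrow> bool" where
  "Ck_on 0 S f \<longleftrightarrow> continuous_on S f"
| "Ck_on (Suc k) S f \<longleftrightarrow>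
     (\<forall>x\<in>S. f differentiable (at x)) \<and>
     (\<forall>b\<in>Basis. Ck_on k S (\<lambda>x. frechet_derivative f (at x) b))"

definition smooth_on :: "'e set \<Rightarrow> ('e::euclidean_space \<Rightarrow> 'f::real_normed_vector) \<Rightarrow> bool" where
  "smooth_on S f \<longleftrightarrow> (\<forall>k. Ck_on k S f)"

definition partial_deriv ::
    "'n::finite \<Rightarrow> (real^'n \<Rightarrow> 'f::real_normed_vector) \<Rightarrow> real^'n \<Rightarrow> 'f" where
  "partial_deriv i f y = frechet_derivative f (at y) (axis i 1)"


section \<open>Smooth manifolds\<close>

text \<open>A chart is a pair of an open set \<open>U\<close> and a map that is a homeomorphism from \<open>U\<close> onto an open
  subset of \<open>\<real>\<^sup>n\<close>; values of the map outside \<open>U\<close> are irrelevant.\<close>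

type_synonym ('a, 'n) chart = "'a set \<times> ('a \<Rightarrow> real^'n)"

abbreviation chart_dom :: "('a, 'n::finite) chart \<Rightarrow> 'a set" where
  "chart_dom c \<equiv> fst c"

abbreviation chart_map :: "('a, 'n::finite) chart \<Rightarrow> 'a \<Rightarrow> real^'n" where
  "chart_map c \<equiv> snd c"

definition chart_im :: "('a, 'n::finite) chart \<Rightarrow> (real^'n) set" where
  "chart_im c = chart_map c ` chart_dom c"

definition chart_inv :: "('a, 'n::finite) chart \<Rightarrow> real^'n \<Rightarrow> 'a" where
  "chart_inv c = inv_into (chart_dom c) (chart_map c)"

definition is_chart :: "'a topology \<Rightarrow> ('a, 'n::finite) chart \<Rightarrow> bool" where
  "is_chart X c \<longleftrightarrow>
     openin X (chart_dom c) \<and> open (chart_im c) \<and>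
     homeomorphic_map (subtopology X (chart_dom c)) (top_of_set (chart_im c)) (chart_map c)"

definition transition ::
    "('a, 'n::finite) chart \<Rightarrow> ('a, 'n) chart \<Rightarrow> real^'n \<Rightarrow> real^'n" where
  "transition c c' = chart_map c' \<circ> chart_inv c"

text \<open>Manifolds are given by a (not necessarily maximal) smooth atlas. All charts map to
  open subsets of \<open>\<real>\<^sup>n\<close>, so there is no boundary.\<close>

definition smooth_manifold :: "'a topology \<Rightarrow> ('a, 'n::finite) chart set \<Rightarrow> bool" where
  "smooth_manifold X \<A> \<longleftrightarrow>
     Hausdorff_space X \<and> second_countable X \<and>
     (\<forall>c\<in>\<A>. is_chart X c) \<and>
     (\<Union>c\<in>\<A>. chart_dom c) = topspace X \<and>
     (\<forall>c\<in>\<A>. \<forall>c'\<in>\<A>.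
        smooth_on (chart_map c ` (chart_dom c \<inter> chart_dom c')) (transition c c'))"

definition chart_at :: "('a, 'n::finite) chart set \<Rightarrow> 'a \<Rightarrow> ('a, 'n) chart" where
  "chart_at \<A> p = (SOME c. c \<in> \<A> \<and> p \<in> chart_dom c)"

definition smooth_function ::
    "('a, 'n::finite) chart set \<Rightarrow> ('a \<Rightarrow> 'f::real_normed_vector) \<Rightarrow> bool" where
  "smooth_function \<A> f \<longleftrightarrow> (\<forall>c\<in>\<A>. smooth_on (chart_im c) (f \<circ> chart_inv c))"


section \<open>Tensor fields\<close>

text \<open>Tensor fields are given by their components: \<open>A c p\<close> is the vector of components at the
  point \<open>p\<close> of the 1-form \<open>A\<close> in the coordinates of the chart \<open>c\<close>, and similarly for a metric
  \<open>h\<close>. The components in different charts are related by the tensor transformation law.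
  Only the values for charts \<open>c\<close> of the atlas and points \<open>p\<close> of the domain of \<open>c\<close> matter.\<close>

type_synonym ('a, 'n) covector_field = "('a, 'n) chart \<Rightarrow> 'a \<Rightarrow> real^'n"
type_synonym ('a, 'n) metric_field = "('a, 'n) chart \<Rightarrow> 'a \<Rightarrow> real^'n^'n"

definition jacobian ::
    "('a, 'n::finite) chart \<Rightarrow> ('a, 'n) chart \<Rightarrow> 'a \<Rightarrow> real^'n^'n" where
  "jacobian c c' p = matrix (frechet_derivative (transition c c') (at (chart_map c p)))"

definition one_form :: "('a, 'n::finite) chart set \<Rightarrow> ('a, 'n) covector_field \<Rightarrow> bool" where
  "one_form \<A> A \<longleftrightarrow>
     (\<forall>c\<in>\<A>. smooth_on (chart_im c) (A c \<circ> chart_inv c)) \<and>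
     (\<forall>c\<in>\<A>. \<forall>c'\<in>\<A>. \<forall>p\<in>chart_dom c \<inter> chart_dom c'.
        A c p = transpose (jacobian c c' p) *v A c' p)"

definition zero_form :: "('a, 'n::finite) chart set \<Rightarrow> ('a, 'n) covector_field \<Rightarrow> bool" where
  "zero_form \<A> A \<longleftrightarrow> (\<forall>c\<in>\<A>. \<forall>p\<in>chart_dom c. A c p = 0)"

definition riemannian_metric ::
    "('a, 'n::finite) chart set \<Rightarrow> ('a, 'n) metric_field \<Rightarrow> bool" where
  "riemannian_metric \<A> h \<longleftrightarrow>
     (\<forall>c\<in>\<A>. smooth_on (chart_im c) (h c \<circ> chart_inv c)) \<and>
     (\<forall>c\<in>\<A>. \<forall>p\<in>chart_dom c.
        transpose (h c p) = h c p \<and> (\<forall>v. v \<noteq> 0 \<longrightarrow> v \<bullet> (h c p *v v) > 0)) \<and>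
     (\<forall>c\<in>\<A>. \<forall>c'\<in>\<A>. \<forall>p\<in>chart_dom c \<inter> chart_dom c'.
        h c p = transpose (jacobian c c' p) ** h c' p ** jacobian c c' p)"

text \<open>The squared norm induced by \<open>h\<close> on complex covectors at \<open>p\<close> is
  \<open>\<Sum>\<^sub>i\<^sub>j h\<^sup>i\<^sup>j \<xi>\<^sub>i cnj \<xi>\<^sub>j\<close>. The transformation laws make its value independent of the chart
  around \<open>p\<close>. Real covectors are embedded into complex ones.\<close>

definition conorm_sq ::
    "('a, 'n::finite) chart set \<Rightarrow> ('a, 'n) metric_field \<Rightarrow>
     (('a, 'n) chart \<Rightarrow> 'a \<Rightarrow> complex^'n) \<Rightarrow> 'a \<Rightarrow> real" where
  "conorm_sq \<A> h \<xi> p =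
     (let c = chart_at \<A> p in
      Re (\<Sum>i\<in>UNIV. \<Sum>j\<in>UNIV.
            complex_of_real (matrix_inv (h c p) $ i $ j) * (\<xi> c p $ i) * cnj (\<xi> c p $ j)))"

definition complexify ::
    "('a, 'n::finite) covector_field \<Rightarrow> ('a, 'n) chart \<Rightarrow> 'a \<Rightarrow> complex^'n" where
  "complexify A c p = (\<chi> i. complex_of_real (A c p $ i))"

definition diff_fun ::
    "('a \<Rightarrow> complex) \<Rightarrow> ('a, 'n::finite) chart \<Rightarrow> 'a \<Rightarrow> complex^'n" where
  "diff_fun u c p = (\<chi> i. partial_deriv i (u \<circ> chart_inv c) (chart_map c p))"

definition magnetic_diff ::
    "('a, 'n::finite) covector_field \<Rightarrow> ('a \<Rightarrow> complex) \<Rightarrow> ('a, 'n) chart \<Rightarrow> 'a \<Rightarrow> complex^'n" where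
  "magnetic_diff A u c p =
     (\<chi> i. diff_fun u c p $ i - \<i> * u p * complex_of_real (A c p $ i))"

definition closed_form :: "('a, 'n::finite) chart set \<Rightarrow> ('a, 'n) covector_field \<Rightarrow> bool" where
  "closed_form \<A> A \<longleftrightarrow>
     (\<forall>c\<in>\<A>. \<forall>p\<in>chart_dom c. \<forall>i j.
        partial_deriv i (\<lambda>y. A c (chart_inv c y) $ j) (chart_map c p) =
        partial_deriv j (\<lambda>y. A c (chart_inv c y) $ i) (chart_map c p))"

text \<open>\<open>codiff h A c p\<close> is the codifferential of \<open>A\<close> at \<open>p\<close> computed in the chart \<open>c\<close>:
  \<open>\<delta>A = - (det h)\<^sup>-\<^sup>1\<^sup>/\<^sup>2 \<Sum>\<^sub>i \<partial>\<^sub>i ((det h)\<^sup>1\<^sup>/\<^sup>2 \<Sum>\<^sub>j h\<^sup>i\<^sup>j A\<^sub>j)\<close>.\<close>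

definition codiff ::
    "('a, 'n::finite) metric_field \<Rightarrow> ('a, 'n) covector_field \<Rightarrow> ('a, 'n) chart \<Rightarrow> 'a \<Rightarrow> real" where
  "codiff h A c p =
     - (\<Sum>i\<in>UNIV.
          partial_deriv i
            (\<lambda>y. let q = chart_inv c y in
                 sqrt (det (h c q)) * (matrix_inv (h c q) *v A c q) $ i)
            (chart_map c p)) / sqrt (det (h c p))"

definition co_closed ::
    "('a, 'n::finite) chart set \<Rightarrow> ('a, 'n) metric_field \<Rightarrow> ('a, 'n) covector_field \<Rightarrow> bool" where
  "co_closed \<A> h A \<longleftrightarrow> (\<forall>c\<in>\<A>. \<forall>p\<in>chart_dom c. codiff h A c p = 0)"

definition harmonic_form ::
    "('a, 'n::finite) chart set \<Rightarrow> ('a, 'n) metric_field \<Rightarrow> ('a, 'n) covector_field \<Rightarrow> bool" where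
  "harmonic_form \<A> h A \<longleftrightarrow> one_form \<A> A \<and> closed_form \<A> A \<and> co_closed \<A> h A"


section \<open>Riemannian volume\<close>

text \<open>The Riemannian measure (no orientation needed) is the unique Borel measure on \<open>X\<close> that in
  every chart has density \<open>sqrt (det h)\<close> with respect to Lebesgue measure. Existence and
  uniqueness follow from second countability, the change of variables formula and the
  transformation law of the metric.\<close>

definition is_volume_measure ::
    "'a topology \<Rightarrow> ('a, 'n::finite) chart set \<Rightarrow> ('a, 'n) metric_field \<Rightarrow> 'a measure \<Rightarrow> bool" where
  "is_volume_measure X \<A> h \<mu> \<longleftrightarrow>
     space \<mu> = topspace X \<and>
     sets \<mu> = sigma_sets (topspace X) {U. openin X U} \<and>
     (\<forall>c\<in>\<A>. \<forall>E\<in>sets \<mu>. E \<subseteq> chart_dom c \<longrightarrow>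
        emeasure \<mu> E =
          (\<integral>\<^sup>+ y\<in>chart_map c ` E. ennreal (sqrt (det (h c (chart_inv c y)))) \<partial>lborel))"

definition volume_measure ::
    "'a topology \<Rightarrow> ('a, 'n::finite) chart set \<Rightarrow> ('a, 'n) metric_field \<Rightarrow> 'a measure" where
  "volume_measure X \<A> h = (THE \<mu>. is_volume_measure X \<A> h \<mu>)"

definition vol ::
    "'a topology \<Rightarrow> ('a, 'n::finite) chart set \<Rightarrow> ('a, 'n) metric_field \<Rightarrow> real" where
  "vol X \<A> h = measure (volume_measure X \<A> h) (topspace X)"

definition l2_norm ::
    "'a topology \<Rightarrow> ('a, 'n::finite) chart set \<Rightarrow> ('a, 'n) metric_field \<Rightarrow>
     ('a, 'n) covector_field \<Rightarrow> real" where
  "l2_norm X \<A> h A =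
     sqrt (\<integral>p. conorm_sq \<A> h (complexify A) p \<partial>volume_measure X \<A> h)"


section \<open>The lowest magnetic eigenvalue\<close>

definition rayleigh ::
    "'a topology \<Rightarrow> ('a, 'n::finite) chart set \<Rightarrow> ('a, 'n) metric_field \<Rightarrow>
     ('a, 'n) covector_field \<Rightarrow> ('a \<Rightarrow> complex) \<Rightarrow> real" where
  "rayleigh X \<A> h A u =
     (\<integral>p. conorm_sq \<A> h (magnetic_diff A u) p \<partial>volume_measure X \<A> h) /
     (\<integral>p. (cmod (u p))\<^sup>2 \<partial>volume_measure X \<A> h)"

text \<open>On a compact manifold this infimum is a minimum, by the spectral theory of the magnetic
  Laplacian.\<close>

definition lambda1 ::
    "'a topology \<Rightarrow> ('a, 'n::finite) chart set \<Rightarrow> ('a, 'n) metric_field \<Rightarrow>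
     ('a, 'n) covector_field \<Rightarrow> real" where
  "lambda1 X \<A> h A =
     Inf {rayleigh X \<A> h A u |u. smooth_function \<A> u \<and> (\<exists>p\<in>topspace X. u p \<noteq> 0)}"


section \<open>Flux and the lattice of integral harmonic forms\<close>

definition closed_curve ::
    "'a topology \<Rightarrow> ('a, 'n::finite) chart set \<Rightarrow> (real \<Rightarrow> 'a) \<Rightarrow> bool" where
  "closed_curve X \<A> \<gamma> \<longleftrightarrow>
     pathin X \<gamma> \<and> \<gamma> 0 = \<gamma> 1 \<and>
     (\<forall>c\<in>\<A>. \<forall>a b. 0 \<le> a \<and> a < b \<and> b \<le> 1 \<and> \<gamma> ` {a..b} \<subseteq> chart_dom c \<longrightarrow>
        (chart_map c \<circ> \<gamma>) piecewise_C1_differentiable_on {a..b})"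

text \<open>The integrand is \<open>\<omega>(\<gamma>'(t))\<close>, computed in some chart around \<open>\<gamma> t\<close>.\<close>

definition curve_integral ::
    "('a, 'n::finite) chart set \<Rightarrow> ('a, 'n) covector_field \<Rightarrow> (real \<Rightarrow> 'a) \<Rightarrow> real" where
  "curve_integral \<A> \<omega> \<gamma> =
     integral {0..1}
       (\<lambda>t. let c = chart_at \<A> (\<gamma> t) in
            \<omega> c (\<gamma> t) \<bullet> vector_derivative (chart_map c \<circ> \<gamma>) (at t))"

definition flux_lattice ::
    "'a topology \<Rightarrow> ('a, 'n::finite) chart set \<Rightarrow> ('a, 'n) metric_field \<Rightarrow>
     ('a, 'n) covector_field set" where
  "flux_lattice X \<A> h =
     {\<omega>. harmonic_form \<A> h \<omega> \<and>
         (\<forall>\<gamma>. closed_curve X \<A> \<gamma> \<longrightarrow> curve_integral \<A> \<omega> \<gamma> / (2 * pi) \<in> \<int>)}"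

definition lattice_dist ::
    "'a topology \<Rightarrow> ('a, 'n::finite) chart set \<Rightarrow> ('a, 'n) metric_field \<Rightarrow>
     ('a, 'n) covector_field \<Rightarrow> real" where
  "lattice_dist X \<A> h A =
     sqrt (Inf {(l2_norm X \<A> h (\<lambda>c p. \<omega> c p - A c p))\<^sup>2 |\<omega>. \<omega> \<in> flux_lattice X \<A> h})"

end

theory Submission
  imports Defs
begin

text \<open>The constant function \<open>1\<close> as a test function gives the upper bound. For the lower bound write
  \<open>u = m + w\<close> with \<open>m\<close> constant and \<open>w\<close> controlled by the Poincare inequality: the cross term between
  \<open>dw\<close> and \<open>r m A\<close> vanishes because \<open>A\<close> is co-closed, and the remaining terms in \<open>w\<close> are absorbed by
  \<open>\<parallel>dw\<parallel>\<^sup>2\<close> at the cost of \<open>O(r\<^sup>4)\<close>. The Poincare inequality itself is obtained from the one on coordinate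
  balls by chaining overlapping balls through the connected manifold, so no spectral theory is used.

  For the distance to the lattice it suffices that \<open>0\<close> is isolated in it. A form \<open>\<omega>\<close> in the lattice is
  \<open>dS\<close> for a function \<open>S\<close> with values in \<open>\<real>/2\<pi>\<int>\<close>, and \<open>exp (\<i> S)\<close> has energy \<open>\<parallel>\<omega>\<parallel>\<^sup>2\<close>. If this is small, the
  Poincare inequality makes \<open>exp (\<i> S)\<close> nearly constant, so on each ball of a finite cover \<open>\<omega>\<close> has a
  potential close to \<open>0\<close>. Two such potentials differ by a multiple of \<open>2\<pi>\<close> on overlaps, hence agree; so \<open>\<omega>\<close>
  is exact, and being co-closed it is \<open>0\<close>.\<close>

section \<open>Continuously differentiable functions\<close>

text \<open>Two obstacles shape the proof. The eigenvalue is an infimum over smooth functions and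
  the volume is given by a definite description, so the measure first has to be constructed from the
  chart densities, and every analytic tool has to come from Euclidean space through charts. All
  estimates live in the class of C1 functions: it contains the smooth test functions, the bump
  functions obtained by squaring a positive part, and the phase function \<open>cis S\<close>, which
  is built by path integration. The constant in the lower bound is \<open>8 * P * B\<^sup>2\<close>,
  with \<open>P\<close> a Poincare constant and \<open>B\<close> a bound for the squared length of
  \<open>A\<close>. For \<open>r\<^sup>2 * B\<close> at most \<open>1 / (8 * P)\<close>, half of the
  Dirichlet energy of \<open>u\<close> pays for all error terms quadratic in \<open>w\<close>. That
  \<open>0\<close> is isolated in the lattice is usually read off from the finite rank of the first
  cohomology. The argument used here needs thresholds that do not depend on \<open>\<omega>\<close>;
  hence a finite cover by coordinate balls is fixed beforehand, with lower bounds for the volume of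
  overlaps and a Poincare inequality on each ball.\<close>

definition C1_on :: "'e set \<Rightarrow> ('e::euclidean_space \<Rightarrow> 'f::real_normed_vector) \<Rightarrow> bool" where
  "C1_on S f \<longleftrightarrow> (\<forall>x\<in>S. f differentiable (at x)) \<and>
     (\<forall>v. continuous_on S (\<lambda>x. frechet_derivative f (at x) v))"

lemma C1_onI:
  assumes "\<And>x. x \<in> S \<Longrightarrow> (f has_derivative D x) (at x)"
    and "\<And>v. continuous_on S (\<lambda>x. D x v)"
  shows "C1_on S f"
proof -
  have "frechet_derivative f (at x) = D x" if "x \<in> S" for x
    using assms(1)[OF that] frechet_derivative_at by metis
  then show ?thesis
    using assms unfolding C1_on_def differentiable_def
    by (auto cong: continuous_on_cong_simp)
qed

lemma C1_on_has_derivative: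
  "C1_on S f \<Longrightarrow> x \<in> S \<Longrightarrow> (f has_derivative frechet_derivative f (at x)) (at x)"
  by (simp add: C1_on_def frechet_derivative_works[symmetric])

lemma C1_on_continuous_deriv:
  "C1_on S f \<Longrightarrow> continuous_on S (\<lambda>x. frechet_derivative f (at x) v)"
  by (simp add: C1_on_def)

lemma C1_on_imp_continuous_on: "C1_on S f \<Longrightarrow> continuous_on S f"
  by (meson C1_on_has_derivative continuous_at_imp_continuous_on has_derivative_continuous)

lemma C1_on_subset: "C1_on S f \<Longrightarrow> T \<subseteq> S \<Longrightarrow> C1_on T f"
  by (meson C1_on_def continuous_on_subset subset_iff)

lemma frechet_derivative_expand:
  fixes f :: "'e::euclidean_space \<Rightarrow> 'f::real_normed_vector"
  assumes "(f has_derivative D) F"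
  shows "D v = (\<Sum>b\<in>Basis. (v \<bullet> b) *\<^sub>R D b)"
proof -
  interpret bounded_linear D using assms by (rule has_derivative_bounded_linear)
  have "D v = D (\<Sum>b\<in>Basis. (v \<bullet> b) *\<^sub>R b)" by (simp add: euclidean_representation)
  also have "\<dots> = (\<Sum>b\<in>Basis. (v \<bullet> b) *\<^sub>R D b)" by (simp add: sum scaleR)
  finally show ?thesis .
qed

text \<open>\<open>Ck_on\<close> only speaks about basis directions, \<open>C1_on\<close> about all
  of them; linearity of the derivative bridges the gap.\<close>

lemma C1_on_Basis:
  assumes "\<And>x. x \<in> S \<Longrightarrow> f differentiable (at x)"
    and "\<And>b. b \<in> Basis \<Longrightarrow> continuous_on S (\<lambda>x. frechet_derivative f (at x) b)"
  shows "C1_on S f"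
  unfolding C1_on_def
proof (intro conjI allI ballI)
  fix v
  have "continuous_on S (\<lambda>x. \<Sum>b\<in>Basis. (v \<bullet> b) *\<^sub>R frechet_derivative f (at x) b)"
    by (intro continuous_intros assms)
  then show "continuous_on S (\<lambda>x. frechet_derivative f (at x) v)"
    by (rule continuous_on_eq)
      (metis assms(1) frechet_derivative_works frechet_derivative_expand)
qed (use assms in auto)

lemma Ck_on_Suc_imp_C1_on: "Ck_on (Suc k) S f \<Longrightarrow> C1_on S f"
proof (rule C1_on_Basis)
  fix b :: 'a assume *: "Ck_on (Suc k) S f" and b: "b \<in> Basis"
  have "Ck_on k S g \<Longrightarrow> continuous_on S g" for g :: "'a \<Rightarrow> 'b"
    by (cases k)
      (auto intro!: continuous_at_imp_continuous_on differentiable_imp_continuous_within)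
  then show "continuous_on S (\<lambda>x. frechet_derivative f (at x) b)"
    using * b by simp
qed simp

lemma smooth_on_imp_C1_on: "smooth_on S f \<Longrightarrow> C1_on S f"
  using Ck_on_Suc_imp_C1_on unfolding smooth_on_def by blast

text \<open>Continuity in the base point and the direction together, whereas \<open>C1_on\<close>
  fixes the direction. Expanding \<open>w x\<close> in the basis leaves finitely many continuous
  coefficients. The chain rule for \<open>C1_on\<close> rests on this.\<close>

lemma continuous_on_frechet_derivative:
  assumes f: "C1_on T f" and "continuous_on S g" "g ` S \<subseteq> T" "continuous_on S w"
  shows "continuous_on S (\<lambda>x. frechet_derivative f (at (g x)) (w x))"
proof -
  have "continuous_on S (\<lambda>x. \<Sum>b\<in>Basis. (w x \<bullet> b) *\<^sub>R frechet_derivative f (at (g x)) b)"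
    by (intro continuous_intros assms continuous_on_compose2[OF C1_on_continuous_deriv[OF f]])
  then show ?thesis
    using assms by (elim continuous_on_eq)
      (metis C1_on_has_derivative frechet_derivative_expand image_subset_iff)
qed

lemma C1_on_cong:
  assumes "C1_on S f" "open S" "\<And>x. x \<in> S \<Longrightarrow> f x = g x"
  shows "C1_on S g"
proof (rule C1_onI)
  show "(g has_derivative frechet_derivative f (at x)) (at x)" if "x \<in> S" for x
    using C1_on_has_derivative[OF assms(1) that] assms(2) that assms(3)
    by (rule has_derivative_transform_within_open)
qed (simp add: C1_on_continuous_deriv assms)

lemma C1_on_Un:
  assumes "C1_on S f" "C1_on T f" "open S" "open T"
  shows "C1_on (S \<union> T) f"
  using assms continuous_on_open_Un unfolding C1_on_def by blast

text \<open>The property is local. This serves functions that are given by different formulas on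
  different open sets, such as bump functions extended by zero.\<close>

lemma C1_on_Union:
  assumes "\<And>x. x \<in> S \<Longrightarrow> \<exists>T. open T \<and> x \<in> T \<and> C1_on T f"
  shows "C1_on S f"
  unfolding C1_on_def
proof (intro conjI allI ballI)
  fix v
  have "isCont (\<lambda>x. frechet_derivative f (at x) v) x" if "x \<in> S" for x
    using assms[OF that] C1_on_continuous_deriv continuous_on_eq_continuous_at by blast
  then show "continuous_on S (\<lambda>x. frechet_derivative f (at x) v)"
    by (simp add: continuous_at_imp_continuous_on)
qed (use assms C1_on_def in blast)

lemma C1_on_const [simp]: "C1_on S (\<lambda>x. c)"
  by (rule C1_onI[where D="\<lambda>_ _. 0"]) auto

lemma C1_on_bounded_linear:
  assumes "bounded_linear L" "C1_on S f"
  shows "C1_on S (\<lambda>x. L (f x))"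
proof (rule C1_onI)
  show "((\<lambda>x. L (f x)) has_derivative (\<lambda>v. L (frechet_derivative f (at x) v))) (at x)"
    if "x \<in> S" for x
    by (rule bounded_linear.has_derivative[OF assms(1) C1_on_has_derivative[OF assms(2) that]])
  show "continuous_on S (\<lambda>x. L (frechet_derivative f (at x) v))" for v
    by (rule bounded_linear.continuous_on[OF assms(1) C1_on_continuous_deriv[OF assms(2)]])
qed

lemma C1_on_linear: "bounded_linear L \<Longrightarrow> C1_on S L"
  by (rule C1_onI[where D="\<lambda>_. L"]) (auto intro: bounded_linear_imp_has_derivative)

lemma C1_on_add:
  assumes "C1_on S f" "C1_on S g"
  shows "C1_on S (\<lambda>x. f x + g x)"
proof (rule C1_onI)
  show "((\<lambda>x. f x + g x) has_derivative
      (\<lambda>v. frechet_derivative f (at x) v + frechet_derivative g (at x) v)) (at x)"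
    if "x \<in> S" for x
    using assms that by (intro has_derivative_add C1_on_has_derivative)
qed (intro continuous_intros C1_on_continuous_deriv assms)

lemma C1_on_diff:
  assumes "C1_on S f" "C1_on S g"
  shows "C1_on S (\<lambda>x. f x - g x)"
proof (rule C1_onI)
  show "((\<lambda>x. f x - g x) has_derivative
      (\<lambda>v. frechet_derivative f (at x) v - frechet_derivative g (at x) v)) (at x)"
    if "x \<in> S" for x
    using assms that by (intro has_derivative_diff C1_on_has_derivative)
qed (intro continuous_intros C1_on_continuous_deriv assms)

lemma C1_on_sum: "(\<And>i. i \<in> I \<Longrightarrow> C1_on S (f i)) \<Longrightarrow> C1_on S (\<lambda>x. \<Sum>i\<in>I. f i x)"
  by (induction I rule: infinite_finite_induct) (auto intro: C1_on_add)

lemma C1_on_bilinear: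
  assumes "bounded_bilinear B" "C1_on S f" "C1_on S g"
  shows "C1_on S (\<lambda>x. B (f x) (g x))"
proof (rule C1_onI)
  show "((\<lambda>x. B (f x) (g x)) has_derivative
      (\<lambda>v. B (f x) (frechet_derivative g (at x) v) + B (frechet_derivative f (at x) v) (g x))) (at x)"
    if "x \<in> S" for x
    by (rule bounded_bilinear.FDERIV[OF assms(1) C1_on_has_derivative[OF assms(2) that]
          C1_on_has_derivative[OF assms(3) that]])
qed (intro continuous_intros bounded_bilinear.continuous_on[OF assms(1)]
      C1_on_continuous_deriv C1_on_imp_continuous_on assms)

lemmas C1_on_mult = C1_on_bilinear[OF bounded_bilinear_mult]
  and C1_on_scaleR = C1_on_bilinear[OF bounded_bilinear_scaleR]
  and C1_on_inner = C1_on_bilinear[OF bounded_bilinear_inner]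

lemma C1_on_prod:
  fixes f :: "'i \<Rightarrow> 'e::euclidean_space \<Rightarrow> 'f::real_normed_field"
  shows "(\<And>i. i \<in> I \<Longrightarrow> C1_on S (f i)) \<Longrightarrow> C1_on S (\<lambda>x. \<Prod>i\<in>I. f i x)"
  by (induction I rule: infinite_finite_induct) (auto intro: C1_on_mult)

lemma has_derivative_compose_C1:
  assumes "C1_on S g" "C1_on T f" "x \<in> S" "g x \<in> T"
  shows "((\<lambda>x. f (g x)) has_derivative
      (\<lambda>v. frechet_derivative f (at (g x)) (frechet_derivative g (at x) v))) (at x)"
  by (rule has_derivative_compose[OF C1_on_has_derivative[OF assms(1,3)] C1_on_has_derivative[OF assms(2,4)]])

lemma C1_on_compose:
  assumes "C1_on S g" "C1_on T f" "g ` S \<subseteq> T"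
  shows "C1_on S (\<lambda>x. f (g x))"
proof (rule C1_onI)
  show "((\<lambda>x. f (g x)) has_derivative
      (\<lambda>v. frechet_derivative f (at (g x)) (frechet_derivative g (at x) v))) (at x)"
    if "x \<in> S" for x
    using assms that by (intro has_derivative_compose_C1[OF assms(1,2)]) auto
  show "continuous_on S (\<lambda>x. frechet_derivative f (at (g x)) (frechet_derivative g (at x) v))" for v
    by (rule continuous_on_frechet_derivative[OF assms(2) C1_on_imp_continuous_on[OF assms(1)]
          assms(3) C1_on_continuous_deriv[OF assms(1)]])
qed

lemma C1_on_real:
  fixes f :: "real \<Rightarrow> real"
  assumes "\<And>x. x \<in> S \<Longrightarrow> (f has_real_derivative f' x) (at x)" "continuous_on S f'"
  shows "C1_on S f"
  by (rule C1_onI[where D="\<lambda>x v. f' x * v"])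
    (use assms in \<open>auto simp: has_field_derivative_def intro!: continuous_intros\<close>)

lemma C1_on_inverse:
  fixes f :: "'e::euclidean_space \<Rightarrow> real"
  assumes "C1_on S f" "\<And>x. x \<in> S \<Longrightarrow> f x \<noteq> 0"
  shows "C1_on S (\<lambda>x. inverse (f x))"
proof (rule C1_on_compose[OF assms(1), where T="-{0}"])
  show "C1_on (-{0}) (inverse :: real \<Rightarrow> real)"
    by (rule C1_on_real[where f'="\<lambda>x. - (inverse x ^ Suc (Suc 0))"])
      (auto intro!: continuous_intros DERIV_inverse simp del: power_Suc)
qed (use assms in auto)

lemma C1_on_divide:
  fixes f g :: "'e::euclidean_space \<Rightarrow> real"
  assumes "C1_on S f" "C1_on S g" "\<And>x. x \<in> S \<Longrightarrow> g x \<noteq> 0"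
  shows "C1_on S (\<lambda>x. f x / g x)"
  unfolding divide_inverse by (intro C1_on_mult C1_on_inverse assms)

lemma C1_on_sqrt:
  fixes f :: "'e::euclidean_space \<Rightarrow> real"
  assumes "C1_on S f" "\<And>x. x \<in> S \<Longrightarrow> f x > 0"
  shows "C1_on S (\<lambda>x. sqrt (f x))"
proof (rule C1_on_compose[OF assms(1), where T="{0<..}"])
  show "C1_on {0<..} sqrt"
    by (rule C1_on_real[where f'="\<lambda>x. inverse (sqrt x) / 2"])
      (auto intro!: continuous_intros DERIV_real_sqrt)
qed (use assms in auto)

lemma C1_on_det:
  fixes M :: "'e::euclidean_space \<Rightarrow> real^'n^'n"
  assumes "\<And>i j. C1_on S (\<lambda>x. M x $ i $ j)"
  shows "C1_on S (\<lambda>x. det (M x))"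
  unfolding det_def by (intro C1_on_sum C1_on_mult C1_on_prod C1_on_const assms)

section \<open>Entries of inverse matrices\<close>

lemma matrix_inv_mult:
  fixes M :: "real^'n^'n"
  assumes "invertible M"
  shows "M ** matrix_inv M = mat 1" "matrix_inv M ** M = mat 1"
  using someI_ex[OF assms[unfolded invertible_def]] unfolding matrix_inv_def by auto

text \<open>Cramer's rule, applied to the system whose solution is column \<open>j\<close> of the
  inverse. It makes the entries of the inverse metric quotients of polynomials in the entries of the
  metric, hence as regular as these.\<close>

lemma matrix_inv_cramer:
  fixes M :: "real^'n^'n"
  assumes "det M \<noteq> 0"
  shows "matrix_inv M $ i $ j = det (\<chi> k l. if l = i then axis j 1 $ k else M $ k $ l) / det M"
proof -
  have "invertible M" using assms by (simp add: invertible_det_nz)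
  then have "M ** matrix_inv M = mat 1" by (rule matrix_inv_mult)
  then have "M *v (matrix_inv M *v axis j 1) = axis j 1"
    by (simp add: matrix_vector_mul_assoc)
  from iffD1[OF cramer[OF assms] this]
  show ?thesis
    by (metis (no_types, lifting) column_def matrix_vector_mult_basis vec_lambda_beta)
qed

lemma C1_on_matrix_inv:
  fixes M :: "'e::euclidean_space \<Rightarrow> real^'n^'n"
  assumes "\<And>i j. C1_on S (\<lambda>x. M x $ i $ j)" "\<And>x. x \<in> S \<Longrightarrow> det (M x) \<noteq> 0" "open S"
  shows "C1_on S (\<lambda>x. matrix_inv (M x) $ i $ j)"
proof (rule C1_on_cong[OF _ assms(3)])
  show "C1_on S (\<lambda>x. det (\<chi> k l. if l = i then axis j 1 $ k else M x $ k $ l) / det (M x))"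
  proof (intro C1_on_divide C1_on_det assms)
    fix k l
    show "C1_on S (\<lambda>x. (\<chi> k l. if l = i then axis j 1 $ k else M x $ k $ l) $ k $ l)"
      by (cases "l = i") (auto intro: assms)
  qed
qed (simp add: matrix_inv_cramer assms)

section \<open>Analysis on Euclidean space\<close>

text \<open>The change of variables formula of the library needs an index type of class \<open>wellorder\<close>, so the
  coordinates are renumbered by a copy of the index type that has such an order.\<close>

typedef ('n::finite) wo = "{..<CARD('n)}"
  by (auto intro!: exI[of _ 0])

instantiation wo :: (finite) "{finite, wellorder}"
begin

definition less_eq_wo :: "'a wo \<Rightarrow> 'a wo \<Rightarrow> bool" where
  "x \<le> y \<longleftrightarrow> Rep_wo x \<le> Rep_wo y"

definition less_wo :: "'a wo \<Rightarrow> 'a wo \<Rightarrow> bool" where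
  "x < y \<longleftrightarrow> Rep_wo x < Rep_wo y"

instance
proof
  show "finite (UNIV :: 'a wo set)"
    using type_definition.univ[OF type_definition_wo] by (metis finite_imageI finite_lessThan)
  fix P :: "'a wo \<Rightarrow> bool" and a
  assume *: "\<And>x. (\<And>y. y < x \<Longrightarrow> P y) \<Longrightarrow> P x"
  show "P a"
    by (induction a rule: measure_induct_rule[where f=Rep_wo]) (metis * less_wo_def)
qed (auto simp: less_eq_wo_def less_wo_def Rep_wo_inject)

end

lemma ex_bij_wo: "\<exists>\<phi> :: 'n::finite wo \<Rightarrow> 'n. bij \<phi>"
proof -
  have "CARD('n wo) = CARD('n)"
    using type_definition.card[OF type_definition_wo] by simp
  then show ?thesis
    using finite_same_card_bij[of "UNIV :: 'n wo set" "UNIV :: 'n set"] by auto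
qed

section \<open>Change of variables for arbitrary finite index types\<close>

definition reindex :: "('k::finite \<Rightarrow> 'n::finite) \<Rightarrow> real^'n \<Rightarrow> real^'k" where
  "reindex \<phi> x = (\<chi> k. x $ \<phi> k)"

lemma reindex_nth [simp]: "reindex \<phi> x $ k = x $ \<phi> k"
  by (simp add: reindex_def)

lemma bounded_linear_reindex: "bounded_linear (reindex \<phi>)"
  by (intro linear_conv_bounded_linear[THEN iffD1] linearI) (auto simp: vec_eq_iff)

lemma reindex_inv:
  assumes "bij \<phi>"
  shows "reindex \<phi> (reindex (inv \<phi>) x) = x" "reindex (inv \<phi>) (reindex \<phi> y) = y"
  using assms by (simp_all add: vec_eq_iff bij_is_inj bij_is_surj inv_f_f surj_f_inv_f)

text \<open>Lebesgue measure is determined by its values on boxes, and renumbering the coordinates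
  only permutes the side lengths of a box.\<close>

lemma distr_lborel_reindex:
  assumes "bij (\<phi> :: 'k::finite \<Rightarrow> 'n::finite)"
  shows "distr lborel borel (reindex \<phi>) = (lborel :: (real^'k) measure)"
proof (rule lborel_eqI[symmetric])
  fix l u :: "real^'k" assume lu: "\<And>b. b \<in> Basis \<Longrightarrow> l \<bullet> b \<le> u \<bullet> b"
  have le: "l $ k \<le> u $ k" for k
    using lu[of "axis k 1"] by (simp add: axis_in_Basis_iff inner_axis)
  have [measurable]: "reindex \<phi> \<in> borel_measurable borel"
    by (intro borel_measurable_continuous_onI linear_continuous_on bounded_linear_reindex)
  have k: "inv \<phi> (\<phi> k) = k" "\<phi> (inv \<phi> i) = i" for k i
    using assms by (simp_all add: bij_is_inj bij_is_surj surj_f_inv_f)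
  have "reindex \<phi> -` box l u = box (reindex (inv \<phi>) l) (reindex (inv \<phi>) u)"
    unfolding set_eq_iff mem_box_cart vimage_def by (auto; metis k)
  then have "emeasure (distr lborel borel (reindex \<phi>)) (box l u) =
      emeasure lborel (box (reindex (inv \<phi>) l) (reindex (inv \<phi>) u))"
    by (simp add: emeasure_distr)
  also have "\<dots> = ennreal (\<Prod>b\<in>Basis. (reindex (inv \<phi>) u - reindex (inv \<phi>) l) \<bullet> b)"
    by (rule emeasure_lborel_box) (auto simp: Basis_vec_def inner_axis le)
  also have "(\<Prod>b\<in>Basis. (reindex (inv \<phi>) u - reindex (inv \<phi>) l) \<bullet> b) = (\<Prod>i\<in>UNIV. u $ inv \<phi> i - l $ inv \<phi> i)"
    by (subst prod.reindex_bij_betw[where h="\<lambda>i. axis i 1" and S=UNIV, symmetric])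
      (auto simp: bij_betw_def inj_on_def axis_eq_axis Basis_vec_def inner_axis)
  also have "\<dots> = (\<Prod>k\<in>UNIV. u $ k - l $ k)"
    by (rule prod.reindex_bij_betw) (use assms bij_imp_bij_inv in blast)
  also have "\<dots> = (\<Prod>b\<in>Basis. (u - l) \<bullet> b)"
    by (subst prod.reindex_bij_betw[where h="\<lambda>i. axis i 1" and S=UNIV, symmetric])
      (auto simp: bij_betw_def inj_on_def axis_eq_axis Basis_vec_def inner_axis)
  finally show "emeasure (distr lborel borel (reindex \<phi>)) (box l u) = ennreal (\<Prod>b\<in>Basis. (u - l) \<bullet> b)" .
qed simp

text \<open>Conjugation by \<open>\<phi>\<close> matches the permutations of the two index types and
  preserves their sign, so the Leibniz expansions agree term by term.\<close>

lemma det_reindex: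
  fixes A :: "real^'n::finite^'n" and \<phi> :: "'k::finite \<Rightarrow> 'n"
  assumes "bij \<phi>"
  shows "det (\<chi> i j. A $ \<phi> i $ \<phi> j) = det A"
proof -
  let ?m = "\<lambda>p. \<phi> \<circ> p \<circ> inv \<phi>"
  have m: "map_permutation UNIV \<phi> p = ?m p" for p :: "'k \<Rightarrow> 'k"
    using assms by (auto simp: map_permutation_def restrict_id_def fun_eq_iff bij_is_surj)
  have k: "inv \<phi> (\<phi> k) = k" "\<phi> (inv \<phi> i) = i" for k i
    using assms by (simp_all add: bij_is_inj bij_is_surj surj_f_inv_f)
  have bp: "p permutes UNIV \<longleftrightarrow> bij p" for p :: "'i \<Rightarrow> 'i"
    by (auto intro: bij_imp_permutes dest: permutes_bij)
  have bij: "bij_betw ?m {p. p permutes UNIV} {p. p permutes UNIV}"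
    by (rule bij_betwI[where g="\<lambda>p. inv \<phi> \<circ> p \<circ> \<phi>"])
      (use assms in \<open>auto simp: bp k fun_eq_iff intro!: bij_comp bij_imp_bij_inv\<close>)
  have "det A = (\<Sum>p\<in>{p. p permutes (UNIV::'k set)}. of_int (sign (?m p)) * (\<Prod>i\<in>UNIV. A $ i $ ?m p i))"
    unfolding det_def by (rule sum.reindex_bij_betw[OF bij, symmetric])
  also have "\<dots> = (\<Sum>p\<in>{p. p permutes (UNIV::'k set)}. of_int (sign p) * (\<Prod>k\<in>UNIV. A $ \<phi> k $ \<phi> (p k)))"
  proof (rule sum.cong[OF refl], rule arg_cong2[where f="(*)"])
    fix p assume p: "p \<in> {p. p permutes (UNIV::'k set)}"
    have "sign (map_permutation UNIV \<phi> p) = sign p"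
      using p assms by (intro sign_map_permutation) (auto simp: bij_is_inj)
    then show "(of_int (sign (?m p)) :: real) = of_int (sign p)" by (simp add: m)
    show "(\<Prod>i\<in>UNIV. A $ i $ ?m p i) = (\<Prod>k\<in>UNIV. A $ \<phi> k $ \<phi> (p k))"
      by (subst prod.reindex_bij_betw[OF assms, symmetric]) (simp add: k)
  qed
  also have "\<dots> = det (\<chi> i j. A $ \<phi> i $ \<phi> j)"
    by (simp add: det_def)
  finally show ?thesis by simp
qed

text \<open>Translates a statement about non-negative Lebesgue integrals into absolute integrability
  together with the value of a gauge integral, the terms in which the change of variables formula is
  phrased.\<close>

lemma nn_set_integral_eq_iff:
  fixes F :: "'e::euclidean_space \<Rightarrow> real"
  assumes F: "\<And>x. x \<in> S \<Longrightarrow> 0 \<le> F x" and "(\<lambda>x. indicator S x * F x) \<in> borel_measurable borel"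
    and "0 \<le> b"
  shows "(\<integral>\<^sup>+x\<in>S. ennreal (F x) \<partial>lborel) = ennreal b \<longleftrightarrow>
    F absolutely_integrable_on S \<and> integral S F = b"
proof
  assume *: "(\<integral>\<^sup>+x\<in>S. ennreal (F x) \<partial>lborel) = ennreal b"
  have "(\<integral>\<^sup>+x. ennreal (indicator S x * F x) \<partial>lborel) = ennreal b"
    unfolding *[symmetric] by (intro nn_integral_cong) (auto simp: indicator_def)
  then have "((\<lambda>x. indicator S x * F x) has_integral b) UNIV"
    using assms by (intro nn_integral_has_integral) (auto simp: indicator_def)
  moreover have "(\<lambda>x. indicator S x * F x) = (\<lambda>x. if x \<in> S then F x else 0)"
    by (auto simp: indicator_def)
  ultimately have "(F has_integral b) S"
    by (simp add: has_integral_restrict_UNIV)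
  then show "F absolutely_integrable_on S \<and> integral S F = b"
    using F by (auto simp: absolutely_integrable_on_iff_nonneg has_integral_iff)
next
  assume "F absolutely_integrable_on S \<and> integral S F = b"
  then have "(F has_integral b) S"
    using set_lebesgue_integral_eq_integral(1) by blast
  then show "(\<integral>\<^sup>+x\<in>S. ennreal (F x) \<partial>lborel) = ennreal b"
    by (intro nn_integral_has_integral_lebesgue' F)
qed

lemma nn_integral_change_of_variables_wo:
  fixes g :: "real^'m::{finite,wellorder} \<Rightarrow> real^'m::_" and F :: "real^'m::_ \<Rightarrow> real"
  assumes S: "S \<in> sets borel"
    and der: "\<And>x. x \<in> S \<Longrightarrow> (g has_derivative g' x) (at x within S)"
    and inj: "inj_on g S"
    and F: "\<And>x. x \<in> S \<Longrightarrow> 0 \<le> F (g x)"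
    and m1: "(\<lambda>y. indicator (g ` S) y * F y) \<in> borel_measurable borel"
    and m2: "(\<lambda>x. indicator S x * (\<bar>det (matrix (g' x))\<bar> * F (g x))) \<in> borel_measurable borel"
  shows "(\<integral>\<^sup>+y\<in>g ` S. ennreal (F y) \<partial>lborel) =
    (\<integral>\<^sup>+x\<in>S. ennreal (\<bar>det (matrix (g' x))\<bar> * F (g x)) \<partial>lborel)" (is "?L = ?R")
proof -
  have L: "?L = ennreal b \<longleftrightarrow> F absolutely_integrable_on g ` S \<and> integral (g ` S) F = b" if "b \<ge> 0" for b
    by (rule nn_set_integral_eq_iff) (use F m1 that in auto)
  have R: "?R = ennreal b \<longleftrightarrow> (\<lambda>x. \<bar>det (matrix (g' x))\<bar> * F (g x)) absolutely_integrable_on S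
      \<and> integral S (\<lambda>x. \<bar>det (matrix (g' x))\<bar> * F (g x)) = b" if "b \<ge> 0" for b
    by (rule nn_set_integral_eq_iff) (use F m2 that in auto)
  have S': "S \<in> sets lebesgue" using S by (simp add: sets_completionI_sets)
  \<comment> \<open>The formula is stated for vector-valued integrands; the scalar \<open>F\<close>
    enters as a vector of dimension one.\<close>
  have "(\<lambda>x. \<bar>det (matrix (g' x))\<bar> *\<^sub>R vec (F (g x)) :: real^1) absolutely_integrable_on S \<and>
      integral S (\<lambda>x. \<bar>det (matrix (g' x))\<bar> *\<^sub>R vec (F (g x)) :: real^1) = vec b \<longleftrightarrow>
     (\<lambda>x. vec (F x) :: real^1) absolutely_integrable_on g ` S \<and> integral (g ` S) (\<lambda>x. vec (F x) :: real^1) = vec b" for b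
    by (rule has_absolute_integral_change_of_variables[OF S' der inj])
  \<comment> \<open>The two sides take the same finite values, so one of them is infinite exactly if
    the other is.\<close>
  then have iff: "?L = ennreal b \<longleftrightarrow> ?R = ennreal b" if "b \<ge> 0" for b
    unfolding L[OF that] R[OF that]
    by (simp add: absolutely_integrable_on_1_iff integral_on_1_eq vec_eq_iff integrable_on_1_iff)
  show ?thesis
  proof (cases ?L rule: ennreal_cases)
    case (real b)
    then show ?thesis using iff[of b] by simp
  next
    case top
    then show ?thesis using iff by (cases ?R rule: ennreal_cases) auto
  qed
qed

text \<open>Conjugating \<open>g\<close> with the renumbering \<open>L\<close> moves the statement
  to an index type of class \<open>wellorder\<close>. Neither Lebesgue measure nor the Jacobian
  determinant changes under this.\<close>

lemma nn_integral_change_of_variables: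
  fixes g :: "real^'n::finite \<Rightarrow> real^'n" and F :: "real^'n \<Rightarrow> real"
  assumes S: "S \<in> sets borel" "g ` S \<in> sets borel"
    and der: "\<And>x. x \<in> S \<Longrightarrow> (g has_derivative g' x) (at x)"
    and inj: "inj_on g S"
    and F: "\<And>x. x \<in> S \<Longrightarrow> 0 \<le> F (g x)"
    and m1: "(\<lambda>y. indicator (g ` S) y * F y) \<in> borel_measurable borel"
    and m2: "(\<lambda>x. indicator S x * (\<bar>det (matrix (g' x))\<bar> * F (g x))) \<in> borel_measurable borel"
  shows "(\<integral>\<^sup>+y\<in>g ` S. ennreal (F y) \<partial>lborel) =
    (\<integral>\<^sup>+x\<in>S. ennreal (\<bar>det (matrix (g' x))\<bar> * F (g x)) \<partial>lborel)"
proof -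
  obtain \<phi> :: "'n wo \<Rightarrow> 'n" where \<phi>: "bij \<phi>" using ex_bij_wo by blast
  define L where "L = reindex \<phi>"
  define L' where "L' = reindex (inv \<phi>)"
  have LL: "L (L' x) = x" "L' (L y) = y" for x y
    using \<phi> by (simp_all add: L_def L'_def reindex_inv)
  have bl: "bounded_linear L" "bounded_linear L'"
    by (simp_all add: L_def L'_def bounded_linear_reindex)
  have [measurable]: "L \<in> borel_measurable borel" "L' \<in> borel_measurable borel"
    by (intro borel_measurable_continuous_onI linear_continuous_on bl)+
  have dL': "distr lborel borel L' = lborel"
    unfolding L'_def by (intro distr_lborel_reindex bij_imp_bij_inv \<phi>)
  have img: "L ` T = L' -` T" for T
  proof (rule set_eqI)
    show "y \<in> L ` T \<longleftrightarrow> y \<in> L' -` T" for y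
      using LL(1)[of y] LL(2) by (auto intro: image_eqI[of y L "L' y"])
  qed
  have gS: "(L \<circ> g \<circ> L') ` (L ` S) = L ` g ` S"
    by (simp add: image_comp o_def LL)
  have mat: "det (matrix (L \<circ> g' (L' x) \<circ> L')) = det (matrix (g' (L' x)))" for x
  proof -
    have "L' (axis j 1) = axis (\<phi> j) 1" for j
      using inv_f_f[OF bij_is_inj[OF \<phi>]] surj_f_inv_f[OF bij_is_surj[OF \<phi>]]
      by (auto simp: L'_def vec_eq_iff axis_def)
    then have "matrix (L \<circ> g' (L' x) \<circ> L') = (\<chi> i j. matrix (g' (L' x)) $ \<phi> i $ \<phi> j)"
      by (simp add: matrix_def L_def)
    then show ?thesis by (simp only: det_reindex[OF \<phi>])
  qed
  note mat' = mat[unfolded o_def]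
  have nn: "(\<integral>\<^sup>+y\<in>T. ennreal (H y) \<partial>lborel) = (\<integral>\<^sup>+y\<in>L ` T. ennreal (H (L' y)) \<partial>lborel)"
    if m: "(\<lambda>y. indicator T y * H y) \<in> borel_measurable borel" for T and H :: "real^'n \<Rightarrow> real"
  proof -
    have eq: "ennreal (H y) * indicator T y = ennreal (indicator T y * H y)" for y
      by (simp add: indicator_def)
    have "(\<integral>\<^sup>+y\<in>T. ennreal (H y) \<partial>lborel) = (\<integral>\<^sup>+y. ennreal (indicator T y * H y) \<partial>distr lborel borel L')"
      by (simp add: dL' eq)
    also have "\<dots> = (\<integral>\<^sup>+y. ennreal (indicator T (L' y) * H (L' y)) \<partial>lborel)"
      using m by (intro nn_integral_distr) auto
    also have "\<dots> = (\<integral>\<^sup>+y\<in>L ` T. ennreal (H (L' y)) \<partial>lborel)"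
      by (intro nn_integral_cong) (auto simp: img indicator_def)
    finally show ?thesis .
  qed
  have "(\<integral>\<^sup>+y\<in>g ` S. ennreal (F y) \<partial>lborel) =
      (\<integral>\<^sup>+y\<in>(L \<circ> g \<circ> L') ` (L ` S). ennreal (F (L' y)) \<partial>lborel)"
    unfolding gS by (rule nn[OF m1])
  also have "\<dots> = (\<integral>\<^sup>+x\<in>L ` S. ennreal (\<bar>det (matrix (L \<circ> g' (L' x) \<circ> L'))\<bar> * F (L' ((L \<circ> g \<circ> L') x))) \<partial>lborel)"
  proof (rule nn_integral_change_of_variables_wo)
    show "L ` S \<in> sets borel"
      unfolding img using S by (intro measurable_sets_borel[of L' borel]) auto
    show "((L \<circ> g \<circ> L') has_derivative (L \<circ> g' (L' x) \<circ> L')) (at x within L ` S)" if "x \<in> L ` S" for x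
    proof -
      have "L' x \<in> S" using that LL by auto
      from der[OF this] have "(g has_derivative g' (L' x)) (at (L' x) within L' ` (L ` S))"
        by (rule has_derivative_at_withinI)
      then have "((\<lambda>x. L (g (L' x))) has_derivative (\<lambda>v. L (g' (L' x) (L' v)))) (at x within L ` S)"
        by (intro bounded_linear.has_derivative[OF bl(1)]
            has_derivative_in_compose[OF bounded_linear_imp_has_derivative[OF bl(2)]])
      then show ?thesis by (simp add: o_def)
    qed
    show "inj_on (L \<circ> g \<circ> L') (L ` S)"
      using inj LL(2) unfolding inj_on_def by (auto simp: LL) (metis LL(2))
    show "0 \<le> F (L' ((L \<circ> g \<circ> L') x))" if "x \<in> L ` S" for x
      using that F by (auto simp: LL)
    have "(\<lambda>y. indicator (g ` S) (L' y) * F (L' y)) \<in> borel_measurable borel"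
      by (rule measurable_compose[OF _ m1]) measurable
    then show "(\<lambda>y. indicator ((L \<circ> g \<circ> L') ` L ` S) y * F (L' y)) \<in> borel_measurable borel"
      unfolding gS unfolding img by (simp only: indicator_vimage)
    have "(\<lambda>y. indicator S (L' y) * (\<bar>det (matrix (g' (L' y)))\<bar> * F (g (L' y)))) \<in> borel_measurable borel"
      by (rule measurable_compose[OF _ m2]) measurable
    then show "(\<lambda>x. indicator (L ` S) x * (\<bar>det (matrix (L \<circ> g' (L' x) \<circ> L'))\<bar> *
        F (L' ((L \<circ> g \<circ> L') x)))) \<in> borel_measurable borel"
      unfolding o_def mat' LL img indicator_vimage .
  qed
  also have "\<dots> = (\<integral>\<^sup>+x\<in>S. ennreal (\<bar>det (matrix (g' x))\<bar> * F (g x)) \<partial>lborel)"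
    unfolding o_def mat' LL nn[OF m2] ..
  finally show ?thesis .
qed

section \<open>Derivatives of functions with compact support\<close>

text \<open>Translation invariance makes every difference quotient integrate to zero, and dominated
  convergence passes to the derivative.\<close>

lemma integral_directional_derivative:
  fixes f :: "'e::euclidean_space \<Rightarrow> 'b::{banach,second_countable_topology}"
  assumes f: "C1_on UNIV f" and supp: "\<And>x. R < norm x \<Longrightarrow> f x = 0"
  shows "integral\<^sup>L lborel (\<lambda>x. frechet_derivative f (at x) v) = 0"
proof -
  let ?D = "\<lambda>x. frechet_derivative f (at x) v"
  have cont: "continuous_on UNIV f" and contD: "continuous_on UNIV ?D"
    using f by (simp_all add: C1_on_imp_continuous_on C1_on_continuous_deriv)
  have [measurable]: "f \<in> borel_measurable borel" "?D \<in> borel_measurable borel"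
    by (rule borel_measurable_continuous_onI[OF cont], rule borel_measurable_continuous_onI[OF contD])
  have "integrable lborel (\<lambda>x. indicator (cball 0 R) x *\<^sub>R f x)"
    by (rule borel_integrable_compact) (auto intro: continuous_on_subset[OF cont])
  moreover have "(\<lambda>x. indicator (cball 0 R) x *\<^sub>R f x) = f"
    using supp by (auto simp: fun_eq_iff indicator_def not_le)
  ultimately have int: "integrable lborel f" by simp
  have shift: "integrable lborel (\<lambda>x. f (c + x)) \<and> integral\<^sup>L lborel (\<lambda>x. f (c + x)) = integral\<^sup>L lborel f" for c
    using integral_distr[of "(+) c" lborel borel f] integrable_distr_eq[of "(+) c" lborel borel f] int
    by (simp add: lborel_distr_plus)
  have D0: "?D x = 0" if "R < norm x" for x
  proof -
    have "((\<lambda>_. 0) has_derivative (\<lambda>_. 0)) (at x)" by simp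
    then have "(f has_derivative (\<lambda>_. 0)) (at x)"
      by (rule has_derivative_transform_within_open[of _ _ _ _ "{x. R < norm x}"])
        (use that supp in \<open>auto intro!: open_Collect_less continuous_intros\<close>)
    then show ?thesis by (metis frechet_derivative_at)
  qed
  have "bounded (?D ` cball 0 R)"
    by (intro compact_imp_bounded compact_continuous_image continuous_on_subset[OF contD]) auto
  then obtain B where B: "B > 0" "\<And>x. x \<in> cball 0 R \<Longrightarrow> norm (?D x) \<le> B"
    unfolding bounded_pos by auto
  have B': "norm (?D x) \<le> B" for x
    using B D0[of x] by (cases "x \<in> cball 0 R") auto
  have lip: "norm (f (x + t *\<^sub>R v) - f x) \<le> B * \<bar>t\<bar>" for x t
  proof -
    have "norm ((\<lambda>t. f (x + t *\<^sub>R v)) t - (\<lambda>t. f (x + t *\<^sub>R v)) 0) \<le> B * norm (t - 0)"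
    proof (rule differentiable_bound[of UNIV])
      fix s :: real
      have "((\<lambda>t. f (x + t *\<^sub>R v)) has_derivative (\<lambda>h. frechet_derivative f (at (x + s *\<^sub>R v)) (h *\<^sub>R v))) (at s)"
        by (rule has_derivative_compose[OF _ C1_on_has_derivative[OF f]])
          (auto intro!: derivative_eq_intros)
      then show "((\<lambda>t. f (x + t *\<^sub>R v)) has_derivative (\<lambda>h. h *\<^sub>R ?D (x + s *\<^sub>R v))) (at s within UNIV)"
        using linear_scale[OF has_derivative_linear[OF C1_on_has_derivative[OF f UNIV_I]]] by simp
      show "onorm (\<lambda>h. h *\<^sub>R ?D (x + s *\<^sub>R v)) \<le> B"
        by (rule onorm_le) (simp add: mult.commute[of B] mult_left_mono[OF B'])
    qed auto
    then show ?thesis by simp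
  qed
  define s where "s n x = real (Suc n) *\<^sub>R (f ((1 / real (Suc n)) *\<^sub>R v + x) - f x)" for n x
  \<comment> \<open>The step sizes are at most 1, so all difference quotients vanish outside the
    ball of radius \<open>R + norm v\<close>; on it they are bounded by the Lipschitz constant
    \<open>B\<close> in direction \<open>v\<close>.\<close>
  define w where "w x = indicator (cball 0 (R + norm v)) x * B" for x :: 'e
  have "(\<lambda>n. integral\<^sup>L lborel (s n)) \<longlonglongrightarrow> integral\<^sup>L lborel ?D"
  proof (rule integral_dominated_convergence[where w=w])
    show "integrable lborel w"
      unfolding w_def by (intro integrable_mult_left integrable_real_indicator) (use emeasure_bounded_finite[OF bounded_cball] in auto)
    show "AE x in lborel. (\<lambda>n. s n x) \<longlonglongrightarrow> ?D x"
    proof (rule AE_I2)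
      fix x
      have lin: "frechet_derivative f (at x) (h *\<^sub>R v) = h *\<^sub>R ?D x" for h
        using linear_scale[OF has_derivative_linear[OF C1_on_has_derivative[OF f UNIV_I]]] by simp
      have "((\<lambda>t. f (x + t *\<^sub>R v)) has_derivative (\<lambda>h. frechet_derivative f (at (x + 0 *\<^sub>R v)) (h *\<^sub>R v))) (at 0)"
        by (rule has_derivative_compose[OF _ C1_on_has_derivative[OF f]])
          (auto intro!: derivative_eq_intros)
      then have "(\<lambda>h. norm (f (x + h *\<^sub>R v) - f x - h *\<^sub>R ?D x) / norm h) \<midarrow>0\<rightarrow> 0"
        by (simp add: has_derivative_at lin)
      moreover have "filterlim (\<lambda>n. 1 / real (Suc n)) (at 0) sequentially"
        using LIMSEQ_inverse_real_of_nat
        by (simp add: filterlim_at inverse_eq_divide del: of_nat_Suc)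
      ultimately have "(\<lambda>n. norm (f (x + (1 / real (Suc n)) *\<^sub>R v) - f x - (1 / real (Suc n)) *\<^sub>R ?D x) / norm (1 / real (Suc n))) \<longlonglongrightarrow> 0"
        by (rule filterlim_compose)
      moreover have "norm (f (x + (1 / real (Suc n)) *\<^sub>R v) - f x - (1 / real (Suc n)) *\<^sub>R ?D x) / norm (1 / real (Suc n))
          = norm (s n x - ?D x)" for n
      proof -
        have "s n x - ?D x = real (Suc n) *\<^sub>R (f (x + (1 / real (Suc n)) *\<^sub>R v) - f x - (1 / real (Suc n)) *\<^sub>R ?D x)"
          by (simp add: s_def scaleR_diff_right add.commute del: of_nat_Suc)
        then show ?thesis by (simp del: of_nat_Suc)
      qed
      ultimately have "(\<lambda>n. norm (s n x - ?D x)) \<longlonglongrightarrow> 0" by simp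
      then show "(\<lambda>n. s n x) \<longlonglongrightarrow> ?D x"
        using LIM_zero_iff tendsto_norm_zero_iff by blast
    qed
    show "AE x in lborel. norm (s n x) \<le> w x" for n
    proof (rule AE_I2)
      fix x
      show "norm (s n x) \<le> w x"
      proof (cases "norm x \<le> R + norm v")
        case True
        have "norm (s n x) = real (Suc n) * norm (f (x + (1 / real (Suc n)) *\<^sub>R v) - f x)"
          by (simp add: s_def add.commute del: of_nat_Suc)
        also have "\<dots> \<le> real (Suc n) * (B * \<bar>1 / real (Suc n)\<bar>)"
          by (intro mult_left_mono lip) auto
        finally show ?thesis using True by (simp add: w_def)
      next
        case False
        have "norm x \<le> norm ((1 / real (Suc n)) *\<^sub>R v + x) + norm ((1 / real (Suc n)) *\<^sub>R v)"
          by (metis add_diff_cancel_left' norm_triangle_ineq4 add.commute)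
        moreover have "norm ((1 / real (Suc n)) *\<^sub>R v) \<le> norm v"
          unfolding norm_scaleR by (rule mult_left_le_one_le) auto
        ultimately have "R < norm ((1 / real (Suc n)) *\<^sub>R v + x)" "R < norm x"
          using False norm_ge_zero[of v] by linarith+
        then have "f ((1 / real (Suc n)) *\<^sub>R v + x) = 0" "f x = 0"
          by (simp_all only: supp)
        then show ?thesis using False by (simp add: s_def w_def)
      qed
    qed
    show "?D \<in> borel_measurable lborel"
      using borel_measurable_continuous_onI[OF contD] by simp
    show "s n \<in> borel_measurable lborel" for n
      unfolding s_def[abs_def] by measurable
  qed
  moreover have "integral\<^sup>L lborel (s n) = 0" for n
  proof -
    let ?c = "(1 / real (Suc n)) *\<^sub>R v"
    have "integral\<^sup>L lborel (s n) = real (Suc n) *\<^sub>R (\<integral>x. f (?c + x) - f x \<partial>lborel)"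
      unfolding s_def by (rule integral_scaleR_right)
    also have "(\<integral>x. f (?c + x) - f x \<partial>lborel) = (\<integral>x. f (?c + x) \<partial>lborel) - (\<integral>x. f x \<partial>lborel)"
      by (rule Bochner_Integration.integral_diff) (use shift[of ?c] int in blast)+
    also have "\<dots> = 0" using shift[of ?c] by (metis diff_self)
    finally show ?thesis by simp
  qed
  ultimately have "(\<lambda>_. 0) \<longlonglongrightarrow> integral\<^sup>L lborel ?D" by simp
  then show ?thesis by (simp add: LIMSEQ_const_iff)
qed

section \<open>Poincare inequality and Poincare lemma on Euclidean balls\<close>

definition grad_sq :: "('e::euclidean_space \<Rightarrow> 'f::real_normed_vector) \<Rightarrow> 'e \<Rightarrow> real" where
  "grad_sq f x = (\<Sum>b\<in>Basis. (norm (frechet_derivative f (at x) b))\<^sup>2)"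

lemma grad_sq_nonneg: "0 \<le> grad_sq f x"
  by (simp add: grad_sq_def sum_nonneg)

lemma continuous_on_grad_sq: "C1_on S f \<Longrightarrow> continuous_on S (grad_sq f)"
  unfolding grad_sq_def by (intro continuous_intros C1_on_continuous_deriv)

lemma norm_frechet_derivative_le:
  assumes "f differentiable (at x)"
  shows "norm (frechet_derivative f (at x) v) \<le> norm v * sqrt (grad_sq f x)"
proof -
  let ?D = "frechet_derivative f (at x)"
  have "norm (?D v) \<le> (\<Sum>b\<in>Basis. \<bar>v \<bullet> b\<bar> * norm (?D b))"
    using assms frechet_derivative_expand[of f ?D "at x" v]
    by (auto simp: frechet_derivative_works intro!: sum_norm_le)
  also have "\<dots> \<le> sqrt ((\<Sum>b\<in>Basis. \<bar>v \<bullet> b\<bar>\<^sup>2) * (\<Sum>b\<in>Basis. (norm (?D b))\<^sup>2))"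
    by (rule real_le_rsqrt) (rule Cauchy_Schwarz_ineq_sum)
  also have "(\<Sum>b\<in>Basis. \<bar>v \<bullet> b\<bar>\<^sup>2) = (norm v)\<^sup>2"
    by (simp add: norm_eq_sqrt_inner euclidean_inner[of v v] power2_eq_square sum_nonneg)
  finally show ?thesis by (simp add: grad_sq_def real_sqrt_mult)
qed

text \<open>The fundamental theorem of calculus along the segment, followed by the Cauchy-Schwarz
  inequality on the unit interval.\<close>

lemma dist_sq_le_integral_grad_sq:
  fixes f :: "'e::euclidean_space \<Rightarrow> 'b::banach"
  assumes f: "C1_on S f" and seg: "\<And>t. t \<in> {0..1} \<Longrightarrow> y + t *\<^sub>R (x - y) \<in> S"
  shows "(norm (f x - f y))\<^sup>2 \<le> (norm (x - y))\<^sup>2 * integral {0..1} (\<lambda>t. grad_sq f (y + t *\<^sub>R (x - y)))"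
proof -
  define z where "z t = y + t *\<^sub>R (x - y)" for t
  define \<psi>' where "\<psi>' t = frechet_derivative f (at (z t)) (x - y)" for t
  define p where "p t = norm (x - y) * sqrt (grad_sq f (z t))" for t
  have zS: "z t \<in> S" if "t \<in> {0..1}" for t using seg[OF that] by (simp add: z_def)
  have cz: "continuous_on {0..1} z" unfolding z_def by (intro continuous_intros)
  have cN: "continuous_on {0..1} (\<lambda>t. grad_sq f (z t))"
    by (rule continuous_on_compose2[OF continuous_on_grad_sq[OF f] cz]) (use zS in auto)
  have cp: "continuous_on {0..1} p" unfolding p_def by (intro continuous_intros cN)
  have "(\<psi>' has_integral (f (z 1) - f (z 0))) {0..1}"
  proof (rule fundamental_theorem_of_calculus)
    fix t :: real assume t: "t \<in> {0..1}"
    have D: "(f has_derivative frechet_derivative f (at (z t))) (at (z t))"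
      by (rule C1_on_has_derivative[OF f zS[OF t]])
    have "((\<lambda>t. f (z t)) has_derivative (\<lambda>h. frechet_derivative f (at (z t)) (h *\<^sub>R (x - y)))) (at t)"
      by (rule has_derivative_compose[where f=z and g=f, OF _ D])
        (auto simp: z_def[abs_def] intro!: derivative_eq_intros)
    then show "((\<lambda>t. f (z t)) has_vector_derivative \<psi>' t) (at t within {0..1})"
      using linear_scale[OF has_derivative_linear[OF D]]
      by (auto simp: has_vector_derivative_def \<psi>'_def intro: has_derivative_at_withinI)
  qed auto
  then have I: "integral {0..1} \<psi>' = f x - f y" and int: "\<psi>' integrable_on {0..1}"
    by (auto simp: has_integral_iff z_def)
  have "norm (f x - f y) \<le> integral {0..1} p"
    unfolding I[symmetric]
    by (rule integral_norm_bound_integral[OF int integrable_continuous_real[OF cp]])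
      (auto simp: \<psi>'_def p_def intro!: norm_frechet_derivative_le differentiableI[OF C1_on_has_derivative[OF f zS]])
  then have "(norm (f x - f y))\<^sup>2 \<le> (integral {0..1} p)\<^sup>2"
    by (simp add: power_mono)
  also have "\<dots> \<le> integral {0..1} (\<lambda>t. (p t)\<^sup>2)"
  proof -
    \<comment> \<open>Cauchy-Schwarz against the constant 1, in the form that the variance of
      \<open>p\<close> around its mean \<open>m\<close> is non-negative.\<close>
    define m where "m = integral {0..1} p"
    have ip: "p integrable_on {0..1}" "(\<lambda>t. (p t)\<^sup>2) integrable_on {0..1}"
      by (intro integrable_continuous_real continuous_intros cp)+
    have "0 \<le> integral {0..1} (\<lambda>t. (p t - m)\<^sup>2)"
      by (intro integral_nonneg integrable_continuous_real continuous_intros cp) auto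
    also have "integral {0..1} (\<lambda>t. (p t - m)\<^sup>2) = integral {0..1} (\<lambda>t. (p t)\<^sup>2 - (2 * m) * p t + m\<^sup>2)"
      by (simp add: power2_diff algebra_simps)
    also have "\<dots> = integral {0..1} (\<lambda>t. (p t)\<^sup>2) - (2 * m) * m + m\<^sup>2"
    proof (rule integral_unique)
      show "((\<lambda>t. (p t)\<^sup>2 - (2 * m) * p t + m\<^sup>2) has_integral
          (integral {0..1} (\<lambda>t. (p t)\<^sup>2) - (2 * m) * m + m\<^sup>2)) {0..1}"
        using has_integral_const_real[of "m\<^sup>2" 0 1] ip unfolding m_def
        by (intro has_integral_add has_integral_diff has_integral_mult_right integrable_integral) auto
    qed
    finally show ?thesis by (simp add: m_def power2_eq_square)
  qed
  also have "\<dots> = (norm (x - y))\<^sup>2 * integral {0..1} (\<lambda>t. grad_sq f (z t))"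
    by (simp add: p_def power_mult_distrib grad_sq_nonneg)
  finally show ?thesis by (simp add: z_def)
qed

text \<open>The substitution produces the inverse of \<open>t ^ DIM('e)\<close>, which is harmless
  as long as \<open>t\<close> stays away from 0.\<close>

lemma nn_integral_lborel_affine:
  fixes g :: "'e::euclidean_space \<Rightarrow> ennreal"
  assumes [measurable]: "g \<in> borel_measurable borel" and "1 / 2 \<le> t"
  shows "(\<integral>\<^sup>+x. g (c + t *\<^sub>R x) \<partial>lborel) \<le> 2 ^ DIM('e) * (\<integral>\<^sup>+x. g x \<partial>lborel)"
proof -
  have "(\<integral>\<^sup>+x. g x \<partial>lborel) = (\<integral>\<^sup>+x. g x \<partial>density (distr lborel borel (\<lambda>x. c + t *\<^sub>R x)) (\<lambda>_. \<bar>t\<bar> ^ DIM('e)))"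
    using lborel_affine[of t c] assms by simp
  also have "\<dots> = (\<integral>\<^sup>+x. ennreal (t ^ DIM('e)) * g (c + t *\<^sub>R x) \<partial>lborel)"
    using assms by (simp add: nn_integral_density nn_integral_distr)
  also have "\<dots> = ennreal (t ^ DIM('e)) * (\<integral>\<^sup>+x. g (c + t *\<^sub>R x) \<partial>lborel)"
    by (rule nn_integral_cmult) measurable
  finally have "2 ^ DIM('e) * (\<integral>\<^sup>+x. g x \<partial>lborel) =
      ennreal ((2 * t) ^ DIM('e)) * (\<integral>\<^sup>+x. g (c + t *\<^sub>R x) \<partial>lborel)"
    using assms by (simp add: mult.assoc[symmetric] ennreal_mult ennreal_power[symmetric] power_mult_distrib)
  moreover have "1 * (\<integral>\<^sup>+x. g (c + t *\<^sub>R x) \<partial>lborel) \<le>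
      ennreal ((2 * t) ^ DIM('e)) * (\<integral>\<^sup>+x. g (c + t *\<^sub>R x) \<partial>lborel)"
  proof (rule mult_right_mono)
    show "1 \<le> ennreal ((2 * t) ^ DIM('e))"
      unfolding ennreal_1[symmetric] using assms by (intro ennreal_leI one_le_power) auto
  qed simp
  ultimately show ?thesis by simp
qed

text \<open>The estimate along segments is averaged over both endpoints. For fixed \<open>t\<close>
  the point \<open>y + t *\<^sub>R (x - y)\<close> depends on \<open>x\<close> with coefficient
  \<open>t\<close> and on \<open>y\<close> with coefficient \<open>1 - t\<close>; one of the two is
  at least \<open>1 / 2\<close>, and integrating over that endpoint first controls the Jacobian. The
  double integral avoids speaking of the mean of a vector-valued function.\<close>

lemma poincare_ball:
  fixes a :: "'e::euclidean_space"
  obtains K where "0 \<le> K"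
    "\<And>S (f :: 'e \<Rightarrow> 'b::{banach,second_countable_topology}). C1_on S f \<Longrightarrow> ball a s \<subseteq> S \<Longrightarrow>
      (\<integral>\<^sup>+x\<in>ball a s. (\<integral>\<^sup>+y\<in>ball a s. ennreal ((norm (f x - f y))\<^sup>2) \<partial>lborel) \<partial>lborel)
        \<le> ennreal K * (\<integral>\<^sup>+z\<in>ball a s. ennreal (grad_sq f z) \<partial>lborel)"
proof
  let ?B = "ball a s"
  \<comment> \<open>The squared diameter, times the measure of the ball from the endpoint integrated
    last, times the Jacobian factor.\<close>
  let ?K = "(2 * s)\<^sup>2 * (measure lborel ?B * 2 ^ DIM('e))"
  show "0 \<le> ?K" by simp
  fix S and f :: "'e \<Rightarrow> 'b" assume f: "C1_on S f" and BS: "?B \<subseteq> S"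
  have fB: "C1_on ?B f" by (rule C1_on_subset[OF f BS])
  \<comment> \<open>Extension by zero makes the gradient term Borel on the whole space, so that
    affine substitution and the exchange of integrals apply without keeping track of
    domains.\<close>
  define G where "G z = ennreal (indicator ?B z *\<^sub>R grad_sq f z)" for z
  have "(\<lambda>z. indicator ?B z *\<^sub>R grad_sq f z) \<in> borel_measurable borel"
    by (intro borel_measurable_continuous_on_indicator continuous_on_grad_sq fB) auto
  then have G[measurable]: "G \<in> borel_measurable borel" unfolding G_def by measurable
  have GB: "(\<integral>\<^sup>+z\<in>?B. ennreal (grad_sq f z) \<partial>lborel) = (\<integral>\<^sup>+z. G z \<partial>lborel)"
    by (intro nn_integral_cong) (auto simp: G_def indicator_def)
  let ?g = "\<integral>\<^sup>+z. G z \<partial>lborel"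
  have eB: "emeasure lborel ?B = ennreal (measure lborel ?B)"
    by (intro emeasure_eq_ennreal_measure) (use emeasure_lborel_ball_finite[of a s] in auto)
  have [measurable]: "?B \<in> sets borel" by simp
  have step: "ennreal ((norm (f x - f y))\<^sup>2) \<le>
      ennreal ((2 * s)\<^sup>2) * (\<integral>\<^sup>+t\<in>{0..1}. G (y + t *\<^sub>R (x - y)) \<partial>lborel)" if xy: "x \<in> ?B" "y \<in> ?B" for x y
  proof -
    have seg: "y + t *\<^sub>R (x - y) \<in> ?B" if "t \<in> {0..1}" for t
      using convexD_alt[OF convex_ball xy(2,1), of t] that by (simp add: algebra_simps)
    have c: "continuous_on {0..1} (\<lambda>t. grad_sq f (y + t *\<^sub>R (x - y)))"
      by (rule continuous_on_compose2[OF continuous_on_grad_sq[OF fB]])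
        (use seg in \<open>auto intro!: continuous_intros\<close>)
    have "(norm (f x - f y))\<^sup>2 \<le> (norm (x - y))\<^sup>2 * integral {0..1} (\<lambda>t. grad_sq f (y + t *\<^sub>R (x - y)))"
      by (rule dist_sq_le_integral_grad_sq[OF fB seg])
    also have "\<dots> \<le> (2 * s)\<^sup>2 * integral {0..1} (\<lambda>t. grad_sq f (y + t *\<^sub>R (x - y)))"
    proof (intro mult_right_mono power_mono integral_nonneg integrable_continuous_real c)
      have "dist x y \<le> dist a x + dist a y" by (metis dist_commute dist_triangle)
      then show "norm (x - y) \<le> 2 * s" using xy by (simp add: dist_norm)
    qed (auto simp: grad_sq_nonneg)
    finally have "ennreal ((norm (f x - f y))\<^sup>2) \<le>
        ennreal ((2 * s)\<^sup>2) * ennreal (integral {0..1} (\<lambda>t. grad_sq f (y + t *\<^sub>R (x - y))))"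
      by (subst ennreal_mult[symmetric])
        (auto intro!: ennreal_leI integral_nonneg integrable_continuous_real c simp: grad_sq_nonneg)
    also have "ennreal (integral {0..1} (\<lambda>t. grad_sq f (y + t *\<^sub>R (x - y)))) =
        (\<integral>\<^sup>+t\<in>{0..1}. ennreal (grad_sq f (y + t *\<^sub>R (x - y))) \<partial>lborel)"
      by (intro nn_integral_has_integral_lebesgue'[symmetric] integrable_integral integrable_continuous_real c)
        (simp add: grad_sq_nonneg)
    also have "\<dots> = (\<integral>\<^sup>+t\<in>{0..1}. G (y + t *\<^sub>R (x - y)) \<partial>lborel)"
      using seg by (intro nn_integral_cong) (auto simp: G_def indicator_def)
    finally show ?thesis .
  qed
  define I where "I t = (\<integral>\<^sup>+x. (\<integral>\<^sup>+y. indicator ?B x * (indicator ?B y * G (y + t *\<^sub>R (x - y))) \<partial>lborel) \<partial>lborel)" for t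
  \<comment> \<open>Up to \<open>1 / 2\<close> the variable \<open>y\<close> is integrated first;
    beyond it \<open>x\<close> is, after exchanging the integrals.\<close>
  have I_le: "I t \<le> emeasure lborel ?B * (2 ^ DIM('e) * ?g)" if t: "t \<in> {0..1}" for t
  proof (cases "t \<le> 1 / 2")
    case True
    have "I t \<le> (\<integral>\<^sup>+x. indicator ?B x * (2 ^ DIM('e) * ?g) \<partial>lborel)"
      unfolding I_def
    proof (rule nn_integral_mono)
      fix x
      have "(\<integral>\<^sup>+y. indicator ?B x * (indicator ?B y * G (y + t *\<^sub>R (x - y))) \<partial>lborel)
          = indicator ?B x * (\<integral>\<^sup>+y. indicator ?B y * G (y + t *\<^sub>R (x - y)) \<partial>lborel)"
        by (rule nn_integral_cmult) measurable
      also have "\<dots> \<le> indicator ?B x * (\<integral>\<^sup>+y. G (t *\<^sub>R x + (1 - t) *\<^sub>R y) \<partial>lborel)"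
        by (intro mult_left_mono nn_integral_mono) (auto simp: indicator_def algebra_simps)
      also have "\<dots> \<le> indicator ?B x * (2 ^ DIM('e) * ?g)"
        by (intro mult_left_mono nn_integral_lborel_affine) (use True in auto)
      finally show "(\<integral>\<^sup>+y. indicator ?B x * (indicator ?B y * G (y + t *\<^sub>R (x - y))) \<partial>lborel)
          \<le> indicator ?B x * (2 ^ DIM('e) * ?g)" .
    qed
    then show ?thesis by (simp add: nn_integral_multc)
  next
    case False
    have "I t = (\<integral>\<^sup>+y. (\<integral>\<^sup>+x. indicator ?B x * (indicator ?B y * G (y + t *\<^sub>R (x - y))) \<partial>lborel) \<partial>lborel)"
      unfolding I_def by (rule lborel_pair.Fubini'[symmetric]) measurable
    also have "\<dots> \<le> (\<integral>\<^sup>+y. indicator ?B y * (2 ^ DIM('e) * ?g) \<partial>lborel)"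
    proof (rule nn_integral_mono)
      fix y
      have "(\<integral>\<^sup>+x. indicator ?B x * (indicator ?B y * G (y + t *\<^sub>R (x - y))) \<partial>lborel)
          = (\<integral>\<^sup>+x. indicator ?B y * (indicator ?B x * G (y + t *\<^sub>R (x - y))) \<partial>lborel)"
        by (simp add: mult.left_commute)
      also have "\<dots> = indicator ?B y * (\<integral>\<^sup>+x. indicator ?B x * G (y + t *\<^sub>R (x - y)) \<partial>lborel)"
        by (rule nn_integral_cmult) measurable
      also have "\<dots> \<le> indicator ?B y * (\<integral>\<^sup>+x. G ((1 - t) *\<^sub>R y + t *\<^sub>R x) \<partial>lborel)"
        by (intro mult_left_mono nn_integral_mono) (auto simp: indicator_def algebra_simps)
      also have "\<dots> \<le> indicator ?B y * (2 ^ DIM('e) * ?g)"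
        by (intro mult_left_mono nn_integral_lborel_affine) (use False in auto)
      finally show "(\<integral>\<^sup>+x. indicator ?B x * (indicator ?B y * G (y + t *\<^sub>R (x - y))) \<partial>lborel)
          \<le> indicator ?B y * (2 ^ DIM('e) * ?g)" .
    qed
    finally show ?thesis by (simp add: nn_integral_multc)
  qed
  let ?c = "ennreal ((2 * s)\<^sup>2)"
  have "(\<integral>\<^sup>+x\<in>?B. (\<integral>\<^sup>+y\<in>?B. ennreal ((norm (f x - f y))\<^sup>2) \<partial>lborel) \<partial>lborel) \<le>
      (\<integral>\<^sup>+x. (\<integral>\<^sup>+y. (\<integral>\<^sup>+t. ?c * (indicator {0..1} t * (indicator ?B x * (indicator ?B y * G (y + t *\<^sub>R (x - y))))) \<partial>lborel) \<partial>lborel) \<partial>lborel)"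
  proof (rule nn_integral_mono)
    fix x
    show "(\<integral>\<^sup>+y\<in>?B. ennreal ((norm (f x - f y))\<^sup>2) \<partial>lborel) * indicator ?B x \<le>
      (\<integral>\<^sup>+y. (\<integral>\<^sup>+t. ?c * (indicator {0..1} t * (indicator ?B x * (indicator ?B y * G (y + t *\<^sub>R (x - y))))) \<partial>lborel) \<partial>lborel)"
    proof (cases "x \<in> ?B")
      case True
      have "ennreal ((norm (f x - f y))\<^sup>2) * indicator ?B y \<le>
          (\<integral>\<^sup>+t. ?c * (indicator {0..1} t * (indicator ?B x * (indicator ?B y * G (y + t *\<^sub>R (x - y))))) \<partial>lborel)" for y
      proof (cases "y \<in> ?B")
        case y: True
        have "(\<integral>\<^sup>+t. ?c * (G (y + t *\<^sub>R (x - y)) * indicator {0..1} t) \<partial>lborel) =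
           ?c * (\<integral>\<^sup>+t\<in>{0..1}. G (y + t *\<^sub>R (x - y)) \<partial>lborel)"
          by (rule nn_integral_cmult) measurable
        then show ?thesis using step[OF True y] True y by (simp add: mult.commute)
      qed simp
      then show ?thesis using True by (simp add: nn_integral_mono)
    qed simp
  qed
  also have "\<dots> = (\<integral>\<^sup>+x. (\<integral>\<^sup>+t. (\<integral>\<^sup>+y. ?c * (indicator {0..1} t * (indicator ?B x * (indicator ?B y * G (y + t *\<^sub>R (x - y))))) \<partial>lborel) \<partial>lborel) \<partial>lborel)"
    by (intro nn_integral_cong lborel_pair.Fubini') measurable
  also have "\<dots> = (\<integral>\<^sup>+t. (\<integral>\<^sup>+x. (\<integral>\<^sup>+y. ?c * (indicator {0..1} t * (indicator ?B x * (indicator ?B y * G (y + t *\<^sub>R (x - y))))) \<partial>lborel) \<partial>lborel) \<partial>lborel)"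
    by (intro lborel_pair.Fubini') measurable
  also have "\<dots> = (\<integral>\<^sup>+t. ?c * (indicator {0..1} t * I t) \<partial>lborel)"
    unfolding I_def by (simp add: nn_integral_cmult)
  also have "\<dots> \<le> (\<integral>\<^sup>+t. ?c * (indicator {0..1} t * (emeasure lborel ?B * (2 ^ DIM('e) * ?g))) \<partial>(lborel::real measure))"
  proof (rule nn_integral_mono, rule mult_left_mono)
    show "indicator {0..1} t * I t \<le> indicator {0..1} t * (emeasure lborel ?B * (2 ^ DIM('e) * ?g))" for t
      using I_le[of t] by (cases "t \<in> {0..1}") auto
  qed simp
  also have "\<dots> = ?c * (emeasure lborel ?B * (2 ^ DIM('e) * ?g))"
    by (simp add: nn_integral_cmult nn_integral_multc)
  also have "\<dots> = ennreal ?K * ?g"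
    by (simp add: eB ennreal_mult ennreal_power[symmetric] mult.assoc)
  finally show "(\<integral>\<^sup>+x\<in>?B. (\<integral>\<^sup>+y\<in>?B. ennreal ((norm (f x - f y))\<^sup>2) \<partial>lborel) \<partial>lborel)
        \<le> ennreal ?K * (\<integral>\<^sup>+z\<in>?B. ennreal (grad_sq f z) \<partial>lborel)"
    unfolding GB .
qed

text \<open>The witness is the integral of the form along the radius from \<open>a\<close>.
  Closedness, here the symmetry \<open>sym\<close>, turns the derivative \<open>L y t v\<close> of
  the integrand into the \<open>t\<close>-derivative of
  \<open>t * (\<omega> (z y t) \<bullet> v)\<close>, which integrates to
  \<open>\<omega> y \<bullet> v\<close>.\<close>

lemma poincare_lemma_ball:
  fixes \<omega> :: "'e::euclidean_space \<Rightarrow> 'e"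
  assumes \<omega>: "C1_on (ball a s) \<omega>"
    and sym: "\<And>z v w. z \<in> ball a s \<Longrightarrow>
      frechet_derivative \<omega> (at z) v \<bullet> w = frechet_derivative \<omega> (at z) w \<bullet> v"
  obtains f where "\<And>y. y \<in> ball a s \<Longrightarrow> (f has_derivative (\<lambda>v. \<omega> y \<bullet> v)) (at y)"
proof
  let ?B = "ball a s"
  define z where "z y t = a + t *\<^sub>R (y - a)" for y t
  define F where "F y t = \<omega> (z y t) \<bullet> (y - a)" for y t
  define L where "L y t v = t * (frechet_derivative \<omega> (at (z y t)) v \<bullet> (y - a)) + \<omega> (z y t) \<bullet> v" for y t v
  define f where "f y = integral (cbox 0 1) (F y)" for y
  fix y assume y: "y \<in> ?B"
  have zB: "z y t \<in> ?B" if "y \<in> ?B" "t \<in> {0..1}" for y t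
  proof -
    have "a \<in> ?B" using y by (meson centre_in_ball dist_not_less_zero le_less_trans mem_ball not_le)
    then show ?thesis
      using convexD_alt[OF convex_ball _ that(1), of a t] that by (simp add: z_def algebra_simps)
  qed
  have dz: "((\<lambda>y. z y t) has_derivative (\<lambda>v. t *\<^sub>R v)) (at y within S)" for t y S
    unfolding z_def by (auto intro!: derivative_eq_intros)
  have D\<omega>: "(\<omega> has_derivative frechet_derivative \<omega> (at (z y t))) (at (z y t))"
    if "y \<in> ?B" "t \<in> {0..1}" for y t
    by (rule C1_on_has_derivative[OF \<omega> zB[OF that]])
  have DF: "((\<lambda>y. F y t) has_derivative L y t) (at y within ?B)" if yt: "y \<in> ?B" "t \<in> {0..1}" for y t
  proof -
    have "((\<lambda>y. \<omega> (z y t)) has_derivative (\<lambda>v. frechet_derivative \<omega> (at (z y t)) (t *\<^sub>R v))) (at y within ?B)"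
      by (rule has_derivative_compose[where g=\<omega> and f="\<lambda>y. z y t", OF dz D\<omega>[OF yt]])
    then have "((\<lambda>y. F y t) has_derivative (\<lambda>v. \<omega> (z y t) \<bullet> (v - 0) +
        frechet_derivative \<omega> (at (z y t)) (t *\<^sub>R v) \<bullet> (y - a))) (at y within ?B)"
      unfolding F_def by (intro has_derivative_inner has_derivative_diff has_derivative_ident has_derivative_const)
    then show ?thesis
      using linear_scale[OF has_derivative_linear[OF D\<omega>[OF yt]]]
      by (simp add: L_def[abs_def] add.commute)
  qed
  have blL: "bounded_linear (L y t)" if "y \<in> ?B" "t \<in> {0..1}" for y t
    using DF[OF that] by (rule has_derivative_bounded_linear)
  have contz: "continuous_on (?B \<times> cbox 0 1) (\<lambda>p. z (fst p) (snd p))"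
    unfolding z_def by (intro continuous_intros)
  have zim: "(\<lambda>p. z (fst p) (snd p)) ` (?B \<times> cbox 0 1) \<subseteq> ?B"
    using zB by auto
  have contL: "continuous_on (?B \<times> cbox 0 1) (\<lambda>p. L (fst p) (snd p) v)" for v
    unfolding L_def
    by (intro continuous_intros continuous_on_compose2[OF C1_on_continuous_deriv[OF \<omega>] contz zim]
        continuous_on_compose2[OF C1_on_imp_continuous_on[OF \<omega>] contz zim])
  have contLt: "continuous_on (cbox 0 1) (\<lambda>t. L y t v)" if "y \<in> ?B" for y v
    using continuous_on_compose2[OF contL[of v], of "cbox 0 1" "\<lambda>t. (y, t)"] that
    by (force intro!: continuous_intros)
  have contF: "continuous_on (cbox 0 1) (F y)" if "y \<in> ?B" for y
    unfolding F_def
    by (intro continuous_intros continuous_on_compose2[OF C1_on_imp_continuous_on[OF \<omega>]])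
      (use zB that in \<open>auto simp: z_def intro!: continuous_intros\<close>)
  \<comment> \<open>The rule for differentiating under the integral wants the derivative as a
    continuous family of bounded linear maps; in finite dimension this can be checked on basis
    vectors.\<close>
  have contB: "continuous_on (?B \<times> cbox 0 1) (\<lambda>(y, t). Blinfun (L y t))"
  proof (rule continuous_on_blinfun_componentwise)
    fix b :: 'e
    show "continuous_on (?B \<times> cbox 0 1) (\<lambda>p. blinfun_apply (case p of (y, t) \<Rightarrow> Blinfun (L y t)) b)"
      by (rule continuous_on_eq[OF contL[of b]]) (auto simp: bounded_linear_Blinfun_apply[OF blL])
  qed
  have contBt: "continuous_on (cbox 0 1) (\<lambda>t. Blinfun (L y t))"
    using continuous_on_compose2[OF contB, of "cbox 0 1" "\<lambda>t. (y, t)"] y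
    by (force intro!: continuous_intros)
  have "((\<lambda>y. integral (cbox 0 1) (F y)) has_derivative
      blinfun_apply (integral (cbox 0 1) (\<lambda>t. Blinfun (L y t)))) (at y within ?B)"
  proof (rule leibniz_rule[where fx="\<lambda>y t. Blinfun (L y t)"])
    show "((\<lambda>y. F y t) has_derivative blinfun_apply (Blinfun (L y t))) (at y within ?B)"
      if "y \<in> ?B" "t \<in> cbox 0 1" for y t
      using DF[of y t] blL[of y t] that by (simp add: bounded_linear_Blinfun_apply)
    show "F y integrable_on cbox 0 1" if "y \<in> ?B" for y
      by (intro integrable_continuous contF that)
  qed (use contB y in auto)
  then have "(f has_derivative blinfun_apply (integral (cbox 0 1) (\<lambda>t. Blinfun (L y t)))) (at y)"
    unfolding f_def using y by (simp add: at_within_open[OF _ open_ball])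
  moreover have "blinfun_apply (integral (cbox 0 1) (\<lambda>t. Blinfun (L y t))) v = \<omega> y \<bullet> v" for v
  proof -
    have "blinfun_apply (integral (cbox 0 1) (\<lambda>t. Blinfun (L y t))) v =
        integral (cbox 0 1) (\<lambda>t. blinfun_apply (Blinfun (L y t)) v)"
      by (intro blinfun_apply_integral integrable_continuous contBt)
    also have "\<dots> = integral {0..1} (\<lambda>t. L y t v)"
      using blL[OF y] by (auto simp: bounded_linear_Blinfun_apply intro!: integral_cong)
    also have "\<dots> = 1 * (\<omega> (z y 1) \<bullet> v) - 0 * (\<omega> (z y 0) \<bullet> v)"
    proof (rule integral_unique[OF fundamental_theorem_of_calculus])
      fix t :: real assume t: "t \<in> {0..1}"
      have lin: "frechet_derivative \<omega> (at (z y t)) (h *\<^sub>R u) = h *\<^sub>R frechet_derivative \<omega> (at (z y t)) u" for h u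
        using linear_scale[OF has_derivative_linear[OF D\<omega>[OF y t]]] .
      have "((\<lambda>t. \<omega> (z y t)) has_derivative (\<lambda>h. frechet_derivative \<omega> (at (z y t)) (h *\<^sub>R (y - a)))) (at t within {0..1})"
        by (rule has_derivative_compose[where g=\<omega> and f="z y", OF _ D\<omega>[OF y t]])
          (auto simp: z_def[abs_def] intro!: derivative_eq_intros)
      then have "((\<lambda>t. t * (\<omega> (z y t) \<bullet> v)) has_derivative (\<lambda>h. t * (frechet_derivative \<omega> (at (z y t)) (h *\<^sub>R (y - a)) \<bullet> v)
          + h * (\<omega> (z y t) \<bullet> v))) (at t within {0..1})"
        by (intro has_derivative_mult has_derivative_ident has_derivative_inner_left)
      then show "((\<lambda>t. t * (\<omega> (z y t) \<bullet> v)) has_vector_derivative L y t v) (at t within {0..1})"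
        unfolding has_vector_derivative_def
        by (rule has_derivative_eq_rhs)
          (auto simp: L_def lin sym[OF zB[OF y t], of "y - a"] distrib_left mult.left_commute)
    qed simp
    finally show ?thesis by (simp add: z_def)
  qed
  ultimately show "(f has_derivative (\<lambda>v. \<omega> y \<bullet> v)) (at y)"
    by (auto elim!: has_derivative_eq_rhs simp: fun_eq_iff)
qed

section \<open>Compact Riemannian manifolds\<close>

text \<open>Polarisation of the sum in \<open>conorm_sq\<close>; the cross terms of an expanded
  square need it.\<close>

definition herm :: "real^'n^'n \<Rightarrow> complex^'n \<Rightarrow> complex^'n \<Rightarrow> complex" where
  "herm M \<xi> \<eta> = (\<Sum>i\<in>UNIV. \<Sum>j\<in>UNIV. complex_of_real (M $ i $ j) * \<xi> $ i * cnj (\<eta> $ j))"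

lemma herm_add_left: "herm M (\<xi> + \<xi>') \<eta> = herm M \<xi> \<eta> + herm M \<xi>' \<eta>"
  by (simp add: herm_def algebra_simps sum.distrib)

lemma herm_add_right: "herm M \<xi> (\<eta> + \<eta>') = herm M \<xi> \<eta> + herm M \<xi> \<eta>'"
  by (simp add: herm_def algebra_simps sum.distrib)

lemma herm_scale_left: "herm M (a *s \<xi>) \<eta> = a * herm M \<xi> \<eta>"
  by (simp add: herm_def sum_distrib_left mult_ac)

lemma herm_scale_right: "herm M \<xi> (a *s \<eta>) = cnj a * herm M \<xi> \<eta>"
  by (simp add: herm_def sum_distrib_left mult_ac)

text \<open>Covectors change chart by the transposed Jacobian, and moving both factors onto the
  matrix conjugates it. Together with the transformation law of the inverse metric this gives
  independence of the chart.\<close>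

lemma herm_transform:
  assumes "\<And>i. \<xi> $ i = (\<Sum>k\<in>UNIV. complex_of_real (J $ k $ i) * \<xi>' $ k)"
    and "\<And>i. \<eta> $ i = (\<Sum>k\<in>UNIV. complex_of_real (J $ k $ i) * \<eta>' $ k)"
  shows "herm M \<xi> \<eta> = herm (J ** M ** transpose J) \<xi>' \<eta>'"
proof -
  let ?c = complex_of_real
  have "herm M \<xi> \<eta> = (\<Sum>i\<in>UNIV. \<Sum>j\<in>UNIV. \<Sum>k\<in>UNIV. \<Sum>l\<in>UNIV.
      ?c (J $ k $ i) * ?c (M $ i $ j) * ?c (J $ l $ j) * \<xi>' $ k * cnj (\<eta>' $ l))"
    unfolding herm_def assms
    by (simp add: sum_distrib_left sum_distrib_right mult_ac)
  also have "\<dots> = (\<Sum>i\<in>UNIV. \<Sum>k\<in>UNIV. \<Sum>j\<in>UNIV. \<Sum>l\<in>UNIV.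
      ?c (J $ k $ i) * ?c (M $ i $ j) * ?c (J $ l $ j) * \<xi>' $ k * cnj (\<eta>' $ l))"
    by (intro sum.cong refl sum.swap)
  also have "\<dots> = (\<Sum>k\<in>UNIV. \<Sum>i\<in>UNIV. \<Sum>l\<in>UNIV. \<Sum>j\<in>UNIV.
      ?c (J $ k $ i) * ?c (M $ i $ j) * ?c (J $ l $ j) * \<xi>' $ k * cnj (\<eta>' $ l))"
    by (subst sum.swap) (intro sum.cong refl sum.swap)
  also have "\<dots> = (\<Sum>k\<in>UNIV. \<Sum>l\<in>UNIV. \<Sum>i\<in>UNIV. \<Sum>j\<in>UNIV.
      ?c (J $ k $ i) * ?c (M $ i $ j) * ?c (J $ l $ j) * \<xi>' $ k * cnj (\<eta>' $ l))"
    by (intro sum.cong refl sum.swap)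
  also have "\<dots> = (\<Sum>k\<in>UNIV. \<Sum>l\<in>UNIV. \<Sum>j\<in>UNIV. \<Sum>i\<in>UNIV.
      ?c (J $ k $ i) * ?c (M $ i $ j) * ?c (J $ l $ j) * \<xi>' $ k * cnj (\<eta>' $ l))"
    by (intro sum.cong refl sum.swap)
  also have "\<dots> = herm (J ** M ** transpose J) \<xi>' \<eta>'"
    unfolding herm_def
    by (simp add: matrix_matrix_mult_def transpose_def sum_distrib_right)
  finally show ?thesis .
qed

lemma herm_sym:
  assumes "transpose M = M"
  shows "herm M \<eta> \<xi> = cnj (herm M \<xi> \<eta>)"
proof -
  have "M $ i $ j = M $ j $ i" for i j using assms by (metis transpose_def vec_lambda_beta)
  then show ?thesis
    unfolding herm_def by (subst sum.swap) (simp add: mult_ac)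
qed

text \<open>Reduces positivity on complex covectors to real ones: products of a real with an
  imaginary part only contribute to the imaginary part of the form.\<close>

lemma Re_herm_self:
  "Re (herm M \<xi> \<xi>) = (\<chi> i. Re (\<xi> $ i)) \<bullet> (M *v (\<chi> i. Re (\<xi> $ i))) + (\<chi> i. Im (\<xi> $ i)) \<bullet> (M *v (\<chi> i. Im (\<xi> $ i)))"
  by (simp add: herm_def inner_vec_def matrix_vector_mult_def sum.distrib sum_distrib_left algebra_simps)

lemma matrix_inv_unique:
  fixes M :: "real^'n^'n"
  assumes "M ** N = mat 1"
  shows "matrix_inv M = N"
proof -
  have "invertible M" using assms by (metis invertible_right_inverse)
  then have "matrix_inv M ** M = mat 1" by (rule matrix_inv_mult)
  then have "matrix_inv M ** (M ** N) = N" by (simp add: matrix_mul_assoc)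
  then show ?thesis by (simp add: assms)
qed

definition pos_def :: "real^'n^'n \<Rightarrow> bool" where
  "pos_def H \<longleftrightarrow> transpose H = H \<and> (\<forall>v. v \<noteq> 0 \<longrightarrow> v \<bullet> (H *v v) > 0)"

lemma det_nonzero_if_inner_pos:
  fixes H :: "real^'n^'n"
  assumes "\<And>v. v \<noteq> 0 \<Longrightarrow> v \<bullet> (H *v v) > 0"
  shows "det H \<noteq> 0"
proof
  assume "det H = 0"
  then have "\<not> invertible H" by (simp add: invertible_det_nz)
  then obtain v where "v \<noteq> 0" "H *v v = 0"
    by (metis invertible_left_inverse matrix_left_invertible_ker)
  with assms[of v] show False by simp
qed

text \<open>The segment from the identity to \<open>H\<close> consists of matrices with positive
  quadratic form, hence with nonzero determinant; the sign at the identity persists by the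
  intermediate value theorem.\<close>

lemma det_pos_def:
  assumes "pos_def H"
  shows "det H > 0"
proof (rule ccontr)
  assume "\<not> det H > 0"
  define P where "P t = (1 - t) *\<^sub>R mat 1 + t *\<^sub>R H" for t
  have "continuous_on {0..1} (\<lambda>t. det (P t))"
    unfolding det_def P_def by (intro continuous_intros)
  moreover have "P 0 = mat 1" "P 1 = H" by (auto simp: P_def)
  ultimately obtain t where t: "t \<in> {0..1}" "det (P t) = 0"
    using IVT2'[of "\<lambda>t. det (P t)" 1 0 0] \<open>\<not> det H > 0\<close> by force
  have "v \<bullet> (P t *v v) > 0" if "v \<noteq> 0" for v
  proof -
    have "v \<bullet> (P t *v v) = (1 - t) * (v \<bullet> v) + t * (v \<bullet> (H *v v))"
      by (simp add: P_def matrix_vector_mult_add_rdistrib scaleR_matrix_vector_assoc[symmetric] inner_add_right)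
    also have "\<dots> > 0"
    proof (cases "t = 1")
      case True
      then show ?thesis using assms that by (simp add: pos_def_def)
    next
      case False
      have "0 \<le> t * (v \<bullet> (H *v v))" using t assms that by (simp add: pos_def_def less_imp_le)
      moreover have "0 < (1 - t) * (v \<bullet> v)" using False t that by simp
      ultimately show ?thesis by linarith
    qed
    finally show ?thesis .
  qed
  then show False using det_nonzero_if_inner_pos t(2) by blast
qed

lemma invertible_pos_def: "pos_def H \<Longrightarrow> invertible H"
  using det_pos_def[of H] by (simp add: invertible_det_nz)

lemma transpose_matrix_inv_pos_def:
  assumes "pos_def H"
  shows "transpose (matrix_inv H) = matrix_inv H"
proof -
  have "H ** transpose (matrix_inv H) = transpose (matrix_inv H ** H)"
    using assms by (simp add: matrix_transpose_mul pos_def_def)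
  also have "\<dots> = mat 1" using matrix_inv_mult[OF invertible_pos_def[OF assms]] by simp
  finally show ?thesis using matrix_inv_unique by metis
qed

lemma inner_matrix_inv_pos:
  assumes "pos_def H" "a \<noteq> 0"
  shows "a \<bullet> (matrix_inv H *v a) > 0"
proof -
  let ?v = "matrix_inv H *v a"
  have a: "H *v ?v = a"
    using matrix_inv_mult[OF invertible_pos_def[OF assms(1)]] by (simp add: matrix_vector_mul_assoc)
  then have "?v \<noteq> 0" using assms(2) by auto
  then have "?v \<bullet> (H *v ?v) > 0" using assms(1) by (simp add: pos_def_def)
  then show ?thesis unfolding a by (simp add: inner_commute)
qed

lemma herm_matrix_inv_pos:
  assumes "pos_def H" "\<xi> \<noteq> 0"
  shows "Re (herm (matrix_inv H) \<xi> \<xi>) > 0"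
proof -
  let ?a = "\<chi> i. Re (\<xi> $ i)" and ?b = "\<chi> i. Im (\<xi> $ i)"
  have "?a \<noteq> 0 \<or> ?b \<noteq> 0" using assms(2) by (auto simp: vec_eq_iff complex_eq_iff)
  moreover have "?a \<bullet> (matrix_inv H *v ?a) \<ge> 0" "?b \<bullet> (matrix_inv H *v ?b) \<ge> 0"
    using inner_matrix_inv_pos[OF assms(1)] by (metis inner_zero_left less_imp_le order_refl)+
  ultimately show ?thesis
    unfolding Re_herm_self using inner_matrix_inv_pos[OF assms(1)]
    by (metis add_nonneg_pos add_pos_nonneg)
qed

lemma herm_matrix_inv_nonneg:
  assumes "pos_def H"
  shows "Re (herm (matrix_inv H) \<xi> \<xi>) \<ge> 0"
proof (cases "\<xi> = 0")
  case True
  then show ?thesis by (simp add: herm_def)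
next
  case False
  then show ?thesis by (intro less_imp_le herm_matrix_inv_pos assms)
qed

section \<open>Charts, transition maps and the metric in coordinates\<close>

locale compact_riemannian =
  fixes X :: "'a topology" and \<A> :: "('a, 'n::finite) chart set" and h :: "('a, 'n) metric_field"
  assumes manifold: "smooth_manifold X \<A>"
    and nonempty: "topspace X \<noteq> {}" and compact: "compact_space X" and connected: "connected_space X"
    and metric: "riemannian_metric \<A> h"
begin

lemma chart_dom_open: "c \<in> \<A> \<Longrightarrow> openin X (chart_dom c)"
  and chart_im_open: "c \<in> \<A> \<Longrightarrow> open (chart_im c)"
  and chart_homeo: "c \<in> \<A> \<Longrightarrow>
    homeomorphic_map (subtopology X (chart_dom c)) (top_of_set (chart_im c)) (chart_map c)"
  using manifold by (auto simp: smooth_manifold_def is_chart_def)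

lemma chart_dom_subset: "c \<in> \<A> \<Longrightarrow> chart_dom c \<subseteq> topspace X"
  by (simp add: chart_dom_open openin_subset)

lemma chart_cover: "p \<in> topspace X \<Longrightarrow> \<exists>c\<in>\<A>. p \<in> chart_dom c"
  using manifold by (auto simp: smooth_manifold_def)

lemma chart_at: "p \<in> topspace X \<Longrightarrow> chart_at \<A> p \<in> \<A> \<and> p \<in> chart_dom (chart_at \<A> p)"
  unfolding chart_at_def by (rule someI_ex) (use chart_cover in blast)

lemma chart_inj: "c \<in> \<A> \<Longrightarrow> inj_on (chart_map c) (chart_dom c)"
  using homeomorphic_imp_injective_map[OF chart_homeo] chart_dom_subset by (simp add: Int_absorb1)

lemma chart_inv_map [simp]: "c \<in> \<A> \<Longrightarrow> p \<in> chart_dom c \<Longrightarrow> chart_inv c (chart_map c p) = p"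
  by (simp add: chart_inv_def chart_inj)

lemma chart_map_inv [simp]: "y \<in> chart_im c \<Longrightarrow> chart_map c (chart_inv c y) = y"
  by (simp add: chart_inv_def chart_im_def f_inv_into_f)

lemma chart_inv_in_dom [simp]: "y \<in> chart_im c \<Longrightarrow> chart_inv c y \<in> chart_dom c"
  by (simp add: chart_inv_def chart_im_def inv_into_into)

lemma chart_map_in_im [simp]: "p \<in> chart_dom c \<Longrightarrow> chart_map c p \<in> chart_im c"
  by (simp add: chart_im_def)

lemma chart_inv_in_space: "c \<in> \<A> \<Longrightarrow> y \<in> chart_im c \<Longrightarrow> chart_inv c y \<in> topspace X"
  using chart_inv_in_dom chart_dom_subset by blast

lemma chart_map_image: "c \<in> \<A> \<Longrightarrow> U \<subseteq> chart_dom c \<Longrightarrow> chart_map c ` U = {y \<in> chart_im c. chart_inv c y \<in> U}"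
  by (auto simp: image_iff) (metis chart_map_inv)

lemma chart_inv_image: "c \<in> \<A> \<Longrightarrow> V \<subseteq> chart_im c \<Longrightarrow> chart_inv c ` V = {p \<in> chart_dom c. chart_map c p \<in> V}"
  by (auto simp: image_iff) (use chart_inv_in_dom chart_map_inv chart_inv_map in \<open>metis subsetD\<close>)+

lemma chart_map_open:
  assumes "c \<in> \<A>" "openin X U"
  shows "open (chart_map c ` (U \<inter> chart_dom c))"
proof -
  have "openin (subtopology X (chart_dom c)) (U \<inter> chart_dom c)"
    using assms by (auto simp: openin_subtopology)
  then have "openin (top_of_set (chart_im c)) (chart_map c ` (U \<inter> chart_dom c))"
    using homeomorphic_imp_open_map[OF chart_homeo[OF assms(1)]] by (simp add: open_map_def)
  then show ?thesis using chart_im_open[OF assms(1)] openin_open_eq by blast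
qed

lemma continuous_map_chart: "c \<in> \<A> \<Longrightarrow>
    continuous_map (subtopology X (chart_dom c)) euclidean (chart_map c)"
  using homeomorphic_imp_continuous_map[OF chart_homeo] continuous_map_in_subtopology by blast

lemma continuous_map_chart_inv:
  assumes "c \<in> \<A>"
  shows "continuous_map (top_of_set (chart_im c)) X (chart_inv c)"
  unfolding continuous_map_def
proof (intro conjI allI impI)
  show "chart_inv c \<in> topspace (top_of_set (chart_im c)) \<rightarrow> topspace X"
    using chart_inv_in_space[OF assms] by auto
  fix U assume U: "openin X U"
  have "{y \<in> topspace (top_of_set (chart_im c)). chart_inv c y \<in> U} = chart_map c ` (U \<inter> chart_dom c)"
    using assms by (subst chart_map_image) auto
  then show "openin (top_of_set (chart_im c)) {y \<in> topspace (top_of_set (chart_im c)). chart_inv c y \<in> U}"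
    using chart_map_open[OF assms U] by (auto intro!: open_subset simp: chart_im_def)
qed

lemma chart_inv_open:
  assumes "c \<in> \<A>" "open V"
  shows "openin X (chart_inv c ` (V \<inter> chart_im c))"
proof -
  have "openin (subtopology X (chart_dom c)) {p \<in> topspace (subtopology X (chart_dom c)). chart_map c p \<in> V}"
    using assms by (intro openin_continuous_map_preimage[OF continuous_map_chart]) auto
  moreover have "{p \<in> topspace (subtopology X (chart_dom c)). chart_map c p \<in> V} = chart_inv c ` (V \<inter> chart_im c)"
    using assms chart_dom_subset[OF assms(1)] by (subst chart_inv_image) auto
  ultimately show ?thesis
    using openin_trans_full chart_dom_open assms by metis
qed

lemma chart_inv_compact:
  assumes "c \<in> \<A>" "compact K" "K \<subseteq> chart_im c"
  shows "compactin X (chart_inv c ` K)" "closedin X (chart_inv c ` K)"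
proof -
  show "compactin X (chart_inv c ` K)"
    by (rule image_compactin[OF _ continuous_map_chart_inv[OF assms(1)]])
      (simp add: assms compactin_subtopology)
  then show "closedin X (chart_inv c ` K)"
    using manifold by (auto simp: smooth_manifold_def intro: compactin_imp_closedin)
qed

definition overlap :: "('a, 'n) chart \<Rightarrow> ('a, 'n) chart \<Rightarrow> (real^'n) set" where
  "overlap c c' = chart_map c ` (chart_dom c \<inter> chart_dom c')"

lemma overlap_open: "c \<in> \<A> \<Longrightarrow> c' \<in> \<A> \<Longrightarrow> open (overlap c c')"
  unfolding overlap_def using chart_map_open[OF _ chart_dom_open] by (metis inf_commute)

lemma overlap_iff: "c \<in> \<A> \<Longrightarrow> y \<in> overlap c c' \<longleftrightarrow> y \<in> chart_im c \<and> chart_inv c y \<in> chart_dom c'"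
  unfolding overlap_def by (subst chart_map_image) auto

lemma C1_on_transition: "c \<in> \<A> \<Longrightarrow> c' \<in> \<A> \<Longrightarrow> C1_on (overlap c c') (transition c c')"
  using manifold by (auto simp: smooth_manifold_def overlap_def intro!: smooth_on_imp_C1_on)

lemma transition_map: "c \<in> \<A> \<Longrightarrow> p \<in> chart_dom c \<Longrightarrow> transition c c' (chart_map c p) = chart_map c' p"
  by (simp add: transition_def)

lemma jacobian_apply:
  assumes "c \<in> \<A>" "c' \<in> \<A>" "p \<in> chart_dom c \<inter> chart_dom c'"
  shows "frechet_derivative (transition c c') (at (chart_map c p)) v = jacobian c c' p *v v"
proof -
  have "(transition c c' has_derivative frechet_derivative (transition c c') (at (chart_map c p))) (at (chart_map c p))"
    by (rule C1_on_has_derivative[OF C1_on_transition[OF assms(1,2)]]) (use assms in \<open>auto simp: overlap_def\<close>)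
  from fun_cong[OF matrix_vector_mul(2)[OF has_derivative_linear[OF this]]]
  show ?thesis unfolding jacobian_def by (rule sym)
qed

lemma pos_def_metric: "c \<in> \<A> \<Longrightarrow> p \<in> chart_dom c \<Longrightarrow> pos_def (h c p)"
  using metric unfolding riemannian_metric_def pos_def_def by blast

lemma det_metric_nonzero: "c \<in> \<A> \<Longrightarrow> p \<in> chart_dom c \<Longrightarrow> det (h c p) \<noteq> 0"
  using det_pos_def[OF pos_def_metric, of c p] by simp

lemma metric_transform: "c \<in> \<A> \<Longrightarrow> c' \<in> \<A> \<Longrightarrow> p \<in> chart_dom c \<inter> chart_dom c' \<Longrightarrow>
    h c p = transpose (jacobian c c' p) ** h c' p ** jacobian c c' p"
  using metric unfolding riemannian_metric_def by blast

lemma C1_on_metric: "c \<in> \<A> \<Longrightarrow> C1_on (chart_im c) (\<lambda>y. h c (chart_inv c y) $ i $ j)"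
proof -
  assume "c \<in> \<A>"
  then have "C1_on (chart_im c) (h c \<circ> chart_inv c)"
    using metric unfolding riemannian_metric_def by (blast intro: smooth_on_imp_C1_on)
  then have "C1_on (chart_im c) (\<lambda>y. (h c \<circ> chart_inv c) y $ i $ j)"
    by (intro C1_on_bounded_linear[of "\<lambda>x. x $ j"] C1_on_bounded_linear[of "\<lambda>x. x $ i"] bounded_linear_vec_nth)
  then show ?thesis by simp
qed

lemma C1_on_det_metric: "c \<in> \<A> \<Longrightarrow> C1_on (chart_im c) (\<lambda>y. sqrt (det (h c (chart_inv c y))))"
  by (intro C1_on_sqrt C1_on_det C1_on_metric det_pos_def pos_def_metric chart_inv_in_dom)

lemma C1_on_inv_metric: "c \<in> \<A> \<Longrightarrow> C1_on (chart_im c) (\<lambda>y. matrix_inv (h c (chart_inv c y)) $ i $ j)"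
  by (intro C1_on_matrix_inv C1_on_metric chart_im_open)
    (simp_all add: det_metric_nonzero)

text \<open>Read off from the metric: its determinants in the two charts differ by the square of the
  Jacobian determinant, and they do not vanish.\<close>

lemma jacobian_invertible:
  assumes "c \<in> \<A>" "c' \<in> \<A>" "p \<in> chart_dom c \<inter> chart_dom c'"
  shows "invertible (jacobian c c' p)"
proof -
  have "det (h c p) = det (jacobian c c' p) * det (h c' p) * det (jacobian c c' p)"
    by (subst metric_transform[OF assms]) (simp add: det_mul)
  then show ?thesis
    using det_pos_def[OF pos_def_metric[of c p]] assms by (auto simp: invertible_det_nz)
qed

text \<open>The contravariant law of the inverse metric, in just the shape that
  \<open>herm_transform\<close> produces.\<close>

lemma matrix_inv_metric_transform:
  assumes "c \<in> \<A>" "c' \<in> \<A>" "p \<in> chart_dom c \<inter> chart_dom c'"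
  shows "jacobian c c' p ** matrix_inv (h c p) ** transpose (jacobian c c' p) = matrix_inv (h c' p)"
proof -
  let ?J = "jacobian c c' p" and ?H = "h c p" and ?H' = "h c' p"
  have inv: "invertible ?J" "invertible ?H"
    using jacobian_invertible[OF assms] invertible_pos_def[OF pos_def_metric] assms by auto
  then have it: "invertible (transpose ?J)"
    by (metis transpose_invertible)
  have "transpose ?J ** ?H' ** ?J ** matrix_inv ?H = mat 1"
    using matrix_inv_mult(1)[OF inv(2)] metric_transform[OF assms] by simp
  then have "transpose ?J ** (?H' ** (?J ** matrix_inv ?H)) = mat 1"
    by (simp add: matrix_mul_assoc)
  then have "?H' ** (?J ** matrix_inv ?H) = matrix_inv (transpose ?J)"
    using matrix_inv_unique by metis
  then have "?H' ** (?J ** matrix_inv ?H ** transpose ?J) = mat 1"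
    using matrix_inv_mult(2)[OF it] by (simp add: matrix_mul_assoc)
  then show ?thesis using matrix_inv_unique by metis
qed

text \<open>The law of a density. The absolute value is the one that the change of variables formula
  supplies.\<close>

lemma det_metric_transform:
  assumes "c \<in> \<A>" "c' \<in> \<A>" "p \<in> chart_dom c \<inter> chart_dom c'"
  shows "sqrt (det (h c p)) = \<bar>det (jacobian c c' p)\<bar> * sqrt (det (h c' p))"
proof -
  have "det (h c p) = (det (jacobian c c' p))\<^sup>2 * det (h c' p)"
    by (subst metric_transform[OF assms]) (simp add: det_mul power2_eq_square)
  then show ?thesis by (simp add: real_sqrt_mult)
qed

end

section \<open>The Riemannian volume measure\<close>

lemma disjoint_family_on_image:
  assumes "inj_on f A" "\<And>i. i \<in> I \<Longrightarrow> B i \<subseteq> A" "disjoint_family_on B I"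
  shows "disjoint_family_on (\<lambda>i. f ` B i) I"
  unfolding disjoint_family_on_def
proof (intro ballI impI)
  fix m n assume "m \<in> I" "n \<in> I" "m \<noteq> n"
  then show "f ` B m \<inter> f ` B n = {}"
    using inj_on_image_Int[OF assms(1), of "B m" "B n"] assms(2,3)
    by (simp add: disjoint_family_on_def)
qed

context compact_riemannian
begin

definition dens :: "('a, 'n) chart \<Rightarrow> real^'n \<Rightarrow> real" where
  "dens c y = sqrt (det (h c (chart_inv c y)))"

definition borel_space :: "'a measure" where
  "borel_space = sigma (topspace X) {U. openin X U}"

abbreviation "\<mu> \<equiv> volume_measure X \<A> h"

lemma dens_pos: "c \<in> \<A> \<Longrightarrow> y \<in> chart_im c \<Longrightarrow> dens c y > 0"
  unfolding dens_def real_sqrt_gt_0_iff by (intro det_pos_def pos_def_metric chart_inv_in_dom)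

lemma C1_on_dens: "c \<in> \<A> \<Longrightarrow> C1_on (chart_im c) (dens c)"
  unfolding dens_def[abs_def] by (rule C1_on_det_metric)

lemmas continuous_on_dens = C1_on_imp_continuous_on[OF C1_on_dens]

lemma openin_Pow: "{U. openin X U} \<subseteq> Pow (topspace X)"
  using openin_subset by blast

lemma space_borel_space [simp]: "space borel_space = topspace X"
  and sets_borel_space: "sets borel_space = sigma_sets (topspace X) {U. openin X U}"
  by (simp_all add: borel_space_def sets_measure_of[OF openin_Pow] space_measure_of_conv)

lemma openin_sets [simp]: "openin X U \<Longrightarrow> U \<in> sets borel_space"
  by (simp add: sets_borel_space)

lemma chart_dom_sets [simp]: "c \<in> \<A> \<Longrightarrow> chart_dom c \<in> sets borel_space"
  by (simp add: chart_dom_open)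

definition base_point :: 'a where "base_point = (SOME p. p \<in> topspace X)"

lemma base_point: "base_point \<in> topspace X"
  using nonempty unfolding base_point_def by (metis some_in_eq)

text \<open>The constant value off the chart image makes the inverse chart a Borel map on the whole
  coordinate space, so that measures can be pushed forward along it.\<close>

definition tot_inv :: "('a, 'n) chart \<Rightarrow> real^'n \<Rightarrow> 'a" where
  "tot_inv c y = (if y \<in> chart_im c then chart_inv c y else base_point)"

lemma measurable_tot_inv:
  assumes "c \<in> \<A>"
  shows "tot_inv c \<in> measurable borel borel_space"
  unfolding borel_space_def
proof (rule measurable_measure_of[OF openin_Pow])
  show "tot_inv c \<in> space borel \<rightarrow> topspace X"
    using base_point chart_inv_in_space[OF assms] by (auto simp: tot_inv_def)
  fix U assume "U \<in> {U. openin X U}"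
  then have U: "open (chart_map c ` (U \<inter> chart_dom c))" using chart_map_open[OF assms] by blast
  have "tot_inv c -` U \<inter> space borel =
      chart_map c ` (U \<inter> chart_dom c) \<union> (if base_point \<in> U then - chart_im c else {})"
    using assms by (subst chart_map_image) (auto simp: tot_inv_def split: if_splits)
  also have "\<dots> \<in> sets borel" using U chart_im_open[OF assms] by auto
  finally show "tot_inv c -` U \<inter> space borel \<in> sets borel" .
qed

lemma chart_map_sets:
  assumes "c \<in> \<A>" "E \<in> sets borel_space" "E \<subseteq> chart_dom c"
  shows "chart_map c ` E \<in> sets borel"
proof -
  have "chart_map c ` E = (tot_inv c -` E \<inter> space borel) \<inter> chart_im c"
    using assms by (subst chart_map_image) (auto simp: tot_inv_def)
  then show ?thesis
    using measurable_sets[OF measurable_tot_inv[OF assms(1)] assms(2)] chart_im_open[OF assms(1)] by auto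
qed

definition chart_measure :: "('a, 'n) chart \<Rightarrow> (real^'n) measure" where
  "chart_measure c = density lborel (\<lambda>y. ennreal (indicator (chart_im c) y * dens c y))"

lemma dens_measurable [measurable]: "c \<in> \<A> \<Longrightarrow> (\<lambda>y. indicator (chart_im c) y * dens c y) \<in> borel_measurable borel"
  using borel_measurable_continuous_on_indicator[OF _ continuous_on_dens, of c] chart_im_open[of c] by auto

lemma ennreal_dens_measurable [measurable]:
  "c \<in> \<A> \<Longrightarrow> (\<lambda>y. ennreal (indicator (chart_im c) y * dens c y)) \<in> borel_measurable borel"
  by (rule measurable_compose[OF dens_measurable measurable_ennreal])

lemma emeasure_chart_measure:
  assumes "c \<in> \<A>" "B \<in> sets borel" "B \<subseteq> chart_im c"
  shows "emeasure (chart_measure c) B = (\<integral>\<^sup>+y\<in>B. ennreal (dens c y) \<partial>lborel)"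
proof -
  have "emeasure (chart_measure c) B = (\<integral>\<^sup>+y. ennreal (indicator (chart_im c) y * dens c y) * indicator B y \<partial>lborel)"
    unfolding chart_measure_def
    by (rule emeasure_density) (use assms ennreal_dens_measurable in simp_all)
  also have "\<dots> = (\<integral>\<^sup>+y\<in>B. ennreal (dens c y) \<partial>lborel)"
    using assms by (intro nn_integral_cong) (auto simp: indicator_def)
  finally show ?thesis .
qed

text \<open>Change of variables along the transition map, whose Jacobian is absorbed by the law of
  the density. This compatibility is what makes gluing the chart measures possible.\<close>

lemma chart_measure_eq:
  assumes c: "c \<in> \<A>" "c' \<in> \<A>" and E: "E \<in> sets borel_space" "E \<subseteq> chart_dom c" "E \<subseteq> chart_dom c'"
  shows "emeasure (chart_measure c) (chart_map c ` E) = emeasure (chart_measure c') (chart_map c' ` E)"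
proof -
  let ?S = "chart_map c ` E" and ?T = "transition c c'"
  have S: "?S \<in> sets borel" "chart_map c' ` E \<in> sets borel" using chart_map_sets c E by auto
  have sub: "?S \<subseteq> chart_im c" "chart_map c' ` E \<subseteq> chart_im c'" using E by auto
  have Tp: "?T (chart_map c p) = chart_map c' p" if "p \<in> E" for p
    using that E(2) transition_map[OF c(1)] by blast
  then have T: "?T ` ?S = chart_map c' ` E"
    by (simp add: image_image)
  let ?J = "\<lambda>x. \<bar>det (matrix (frechet_derivative ?T (at x)))\<bar>"
  have J: "?J x * dens c' (?T x) = dens c x" if x: "x \<in> ?S" for x
  proof -
    obtain p where p: "p \<in> E" "x = chart_map c p" using x by blast
    have "sqrt (det (h c p)) = \<bar>det (Defs.jacobian c c' p)\<bar> * sqrt (det (h c' p))"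
      using p E by (intro det_metric_transform c) auto
    then show ?thesis
      unfolding p(2) Tp[OF p(1)] using p E c by (simp add: jacobian_def dens_def subset_iff)
  qed
  have "(\<integral>\<^sup>+y\<in>?T ` ?S. ennreal (dens c' y) \<partial>lborel) = (\<integral>\<^sup>+x\<in>?S. ennreal (?J x * dens c' (?T x)) \<partial>lborel)"
  proof (rule nn_integral_change_of_variables)
    show "(?T has_derivative frechet_derivative ?T (at x)) (at x)" if "x \<in> ?S" for x
      by (rule C1_on_has_derivative[OF C1_on_transition[OF c]]) (use that E in \<open>auto simp: overlap_def\<close>)
    show "inj_on ?T ?S"
      using inj_on_subset[OF chart_inj[OF c(2)] E(3)] Tp by (auto simp: inj_on_def)
    show "0 \<le> dens c' (?T x)" if "x \<in> ?S" for x
      using T that sub dens_pos[OF c(2)] by (metis image_eqI less_imp_le subsetD)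
    show "(\<lambda>y. indicator (?T ` ?S) y * dens c' y) \<in> borel_measurable borel"
      unfolding T using borel_measurable_continuous_on_indicator[OF S(2) continuous_on_subset[OF continuous_on_dens[OF c(2)] sub(2)]]
      by simp
    have "(\<lambda>x. indicator ?S x * (?J x * dens c' (?T x))) = (\<lambda>x. indicator ?S x * dens c x)"
      using J by (auto simp: fun_eq_iff indicator_def)
    then show "(\<lambda>x. indicator ?S x * (?J x * dens c' (?T x))) \<in> borel_measurable borel"
      using borel_measurable_continuous_on_indicator[OF S(1) continuous_on_subset[OF continuous_on_dens[OF c(1)] sub(1)]]
      by simp
  qed (use S T in auto)
  also have "\<dots> = (\<integral>\<^sup>+x\<in>?S. ennreal (dens c x) \<partial>lborel)"
    using J by (intro nn_integral_cong) (auto simp: indicator_def)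
  finally show ?thesis
    using c S sub T by (simp add: emeasure_chart_measure)
qed

lemma finite_chart_cover: "\<exists>cs. set cs \<subseteq> \<A> \<and> (\<Union>c\<in>set cs. chart_dom c) = topspace X"
proof -
  have "compactin X (topspace X)" using compact by (simp add: compact_space_def)
  moreover have "openin X U" if "U \<in> chart_dom ` \<A>" for U
    using that chart_dom_open by auto
  moreover have "topspace X \<subseteq> \<Union> (chart_dom ` \<A>)"
    using chart_cover by auto
  ultimately have "\<exists>F. finite F \<and> F \<subseteq> chart_dom ` \<A> \<and> topspace X \<subseteq> \<Union> F"
    by (rule compactinD)
  then obtain F where F: "finite F" "F \<subseteq> chart_dom ` \<A>" "topspace X \<subseteq> \<Union> F" by blast
  obtain G where G: "finite G" "G \<subseteq> \<A>" "F = chart_dom ` G" using finite_subset_image[OF F(1,2)] by blast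
  obtain cs where "set cs = G" using finite_list[OF G(1)] by blast
  then show ?thesis using F G chart_dom_subset by (intro exI[of _ cs]) blast
qed

definition cover :: "('a, 'n) chart list" where
  "cover = (SOME cs. set cs \<subseteq> \<A> \<and> (\<Union>c\<in>set cs. chart_dom c) = topspace X)"

text \<open>Makes the finite cover disjoint: a point goes to the first chart that contains
  it.\<close>

definition piece :: "nat \<Rightarrow> 'a set" where
  "piece k = chart_dom (cover ! k) - (\<Union>j<k. chart_dom (cover ! j))"

lemma cover: "set cover \<subseteq> \<A>" "(\<Union>c\<in>set cover. chart_dom c) = topspace X"
  using someI_ex[OF finite_chart_cover] by (simp_all add: cover_def)

lemma cover_nth: "k < length cover \<Longrightarrow> cover ! k \<in> \<A>"
  using cover(1) by (meson nth_mem subsetD)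

lemma piece_sets: "k < length cover \<Longrightarrow> piece k \<in> sets borel_space"
  unfolding piece_def by (intro sets.Diff sets.finite_UN) (auto simp: cover_nth)

lemma piece_subset: "piece k \<subseteq> chart_dom (cover ! k)"
  by (auto simp: piece_def)

lemma disjoint_piece: "disjoint_family_on piece {..<length cover}"
  unfolding disjoint_family_on_def piece_def
  by (auto simp: set_eq_iff) (metis lessThan_iff linorder_neqE_nat)

lemma UN_piece: "(\<Union>k<length cover. piece k) = topspace X"
proof
  show "(\<Union>k<length cover. piece k) \<subseteq> topspace X"
    using piece_sets[THEN sets.sets_into_space] by auto
  show "topspace X \<subseteq> (\<Union>k<length cover. piece k)"
  proof
    fix p assume "p \<in> topspace X"
    then obtain c where "c \<in> set cover" "p \<in> chart_dom c" using cover(2) by blast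
    then have ex: "\<exists>k. k < length cover \<and> p \<in> chart_dom (cover ! k)"
      by (auto simp: in_set_conv_nth)
    define k where "k = (LEAST k. k < length cover \<and> p \<in> chart_dom (cover ! k))"
    have "k < length cover \<and> p \<in> chart_dom (cover ! k)" unfolding k_def by (rule LeastI_ex[OF ex])
    moreover have "p \<notin> chart_dom (cover ! j)" if "j < k" for j
      using not_less_Least[OF that[unfolded k_def]] that calculation by simp
    ultimately show "p \<in> (\<Union>k<length cover. piece k)" by (auto simp: piece_def)
  qed
qed

lemma emeasure_eq_sum_piece:
  assumes "sets M = sets borel_space" "E \<in> sets borel_space"
  shows "emeasure M E = (\<Sum>k<length cover. emeasure M (E \<inter> piece k))"
proof -
  have "E = (\<Union>k<length cover. E \<inter> piece k)"
    using sets.sets_into_space[OF assms(2)] UN_piece by auto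
  moreover have "(\<Sum>k<length cover. emeasure M (E \<inter> piece k)) = emeasure M (\<Union>k<length cover. E \<inter> piece k)"
    using assms disjoint_piece piece_sets
    by (intro sum_emeasure) (auto simp: disjoint_family_on_def)
  ultimately show ?thesis by simp
qed

text \<open>Needed because the volume is defined by a definite description. Chart measures are
  summed over the disjoint pieces of a finite cover; for a set inside an arbitrary chart of the
  atlas, each piece is moved into that chart by \<open>chart_measure_eq\<close>.\<close>

lemma ex_volume_measure: "\<exists>M. is_volume_measure X \<A> h M"
proof -
  let ?N = "length cover"
  define m where "m E = (\<Sum>k<?N. emeasure (chart_measure (cover ! k)) (chart_map (cover ! k) ` (E \<inter> piece k)))" for E
  define M where "M = measure_of (topspace X) {U. openin X U} m"
  note sp = openin_Pow
  have setsM: "sets M = sets borel_space" and spaceM: "space M = topspace X"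
    using sp by (simp_all add: M_def sets_borel_space sets_measure_of space_measure_of_conv)
  have img: "chart_map (cover ! k) ` (E \<inter> piece k) \<in> sets borel" if "k < ?N" "E \<in> sets borel_space" for k E
    using that piece_sets piece_subset by (intro chart_map_sets cover_nth) auto
  have cm: "emeasure M E = m E" if E: "E \<in> sets borel_space" for E
  proof (rule emeasure_measure_of[OF M_def sp])
    show "positive (sets M) m" by (simp add: positive_def m_def)
    show "countably_additive (sets M) m"
    proof (rule countably_additiveI)
      fix A :: "nat \<Rightarrow> 'a set"
      assume A: "range A \<subseteq> sets M" "disjoint_family A" "\<Union> (range A) \<in> sets M"
      have A': "A i \<in> sets borel_space" for i using A(1) setsM by auto
      have "(\<Sum>i. m (A i)) = (\<Sum>k<?N. \<Sum>i. emeasure (chart_measure (cover ! k)) (chart_map (cover ! k) ` (A i \<inter> piece k)))"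
        unfolding m_def by (rule suminf_sum) simp
      also have "\<dots> = m (\<Union> (range A))"
        unfolding m_def
      proof (rule sum.cong[OF refl])
        fix k assume "k \<in> {..<?N}"
        then have k: "k < ?N" by simp
        have "(\<Sum>i. emeasure (chart_measure (cover ! k)) (chart_map (cover ! k) ` (A i \<inter> piece k))) =
            emeasure (chart_measure (cover ! k)) (\<Union>i. chart_map (cover ! k) ` (A i \<inter> piece k))"
        proof (rule suminf_emeasure)
          show "range (\<lambda>i. chart_map (cover ! k) ` (A i \<inter> piece k)) \<subseteq> sets (chart_measure (cover ! k))"
            using img[OF k A'] by (auto simp: chart_measure_def)
          have "inj_on (chart_map (cover ! k)) (piece k)"
            using inj_on_subset[OF chart_inj[OF cover_nth[OF k]] piece_subset] .
          then show "disjoint_family (\<lambda>i. chart_map (cover ! k) ` (A i \<inter> piece k))"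
            by (rule disjoint_family_on_image) (use A(2) in \<open>auto simp: disjoint_family_on_def\<close>)
        qed
        also have "(\<Union>i. chart_map (cover ! k) ` (A i \<inter> piece k)) = chart_map (cover ! k) ` (\<Union> (range A) \<inter> piece k)"
          by auto
        finally show "(\<Sum>i. emeasure (chart_measure (cover ! k)) (chart_map (cover ! k) ` (A i \<inter> piece k))) =
          emeasure (chart_measure (cover ! k)) (chart_map (cover ! k) ` (\<Union> (range A) \<inter> piece k))" .
      qed
      finally show "(\<Sum>i. m (A i)) = m (\<Union> (range A))" .
    qed
    show "E \<in> sets M" using E setsM by simp
  qed
  have "emeasure M E = (\<integral>\<^sup>+ y\<in>chart_map c ` E. ennreal (sqrt (det (h c (chart_inv c y)))) \<partial>lborel)"
    if c: "c \<in> \<A>" and E: "E \<in> sets M" "E \<subseteq> chart_dom c" for c E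
  proof -
    have E': "E \<in> sets borel_space" using E setsM by simp
    have "emeasure M E = (\<Sum>k<?N. emeasure (chart_measure c) (chart_map c ` (E \<inter> piece k)))"
      unfolding cm[OF E'] m_def
      using piece_sets piece_subset E E' c by (intro sum.cong refl chart_measure_eq cover_nth) auto
    also have "\<dots> = emeasure (chart_measure c) (\<Union>k<?N. chart_map c ` (E \<inter> piece k))"
    proof (rule sum_emeasure)
      show "(\<lambda>k. chart_map c ` (E \<inter> piece k)) ` {..<?N} \<subseteq> sets (chart_measure c)"
        using E E' piece_sets by (auto simp: chart_measure_def intro!: chart_map_sets[OF c])
      have "inj_on (chart_map c) E" using inj_on_subset[OF chart_inj[OF c] E(2)] .
      then show "disjoint_family_on (\<lambda>k. chart_map c ` (E \<inter> piece k)) {..<?N}"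
        by (rule disjoint_family_on_image) (use disjoint_piece in \<open>auto simp: disjoint_family_on_def\<close>)
    qed simp
    also have "(\<Union>k<?N. chart_map c ` (E \<inter> piece k)) = chart_map c ` E"
      using UN_piece E chart_dom_subset[OF c] by blast
    also have "emeasure (chart_measure c) (chart_map c ` E) = (\<integral>\<^sup>+y\<in>chart_map c ` E. ennreal (dens c y) \<partial>lborel)"
      using chart_map_sets[OF c E' E(2)] E(2) by (intro emeasure_chart_measure c) auto
    finally show ?thesis by (simp add: dens_def)
  qed
  then have "is_volume_measure X \<A> h M"
    unfolding is_volume_measure_def using setsM spaceM by (simp add: sets_borel_space)
  then show ?thesis ..
qed

text \<open>Every piece lies in a single chart, where the defining property prescribes the values;
  the pieces add up.\<close>

lemma volume_measure_unique:
  assumes M: "is_volume_measure X \<A> h M" and M': "is_volume_measure X \<A> h M'"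
  shows "M = M'"
proof (rule measure_eqI)
  have s: "sets M = sets borel_space" "sets M' = sets borel_space"
    using M M' by (simp_all add: is_volume_measure_def sets_borel_space)
  then show "sets M = sets M'" by simp
  fix E assume "E \<in> sets M"
  then have E: "E \<in> sets borel_space" using s by simp
  have "emeasure M (E \<inter> piece k) = emeasure M' (E \<inter> piece k)" if k: "k < length cover" for k
  proof -
    have "E \<inter> piece k \<in> sets borel_space" "E \<inter> piece k \<subseteq> chart_dom (cover ! k)"
      using E piece_sets[OF k] piece_subset by auto
    then show ?thesis using M M' cover_nth[OF k] s unfolding is_volume_measure_def by simp
  qed
  then show "emeasure M E = emeasure M' E"
    using emeasure_eq_sum_piece[OF s(1) E] emeasure_eq_sum_piece[OF s(2) E] by simp
qed

lemma is_volume_measure: "is_volume_measure X \<A> h \<mu>"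
  unfolding volume_measure_def
  using theI'[of "is_volume_measure X \<A> h"] ex_volume_measure volume_measure_unique by blast

lemma sets_volume [simp, measurable_cong]: "sets \<mu> = sets borel_space"
  and space_volume [simp]: "space \<mu> = topspace X"
  using is_volume_measure by (simp_all add: is_volume_measure_def sets_borel_space)

lemma emeasure_volume:
  assumes "c \<in> \<A>" "E \<in> sets borel_space" "E \<subseteq> chart_dom c"
  shows "emeasure \<mu> E = emeasure (chart_measure c) (chart_map c ` E)"
proof -
  have "emeasure \<mu> E = (\<integral>\<^sup>+y\<in>chart_map c ` E. ennreal (dens c y) \<partial>lborel)"
    using is_volume_measure assms unfolding is_volume_measure_def dens_def by simp
  then show ?thesis
    using chart_map_sets[OF assms] assms by (subst emeasure_chart_measure) auto
qed

text \<open>An identity of measures instead of a formula for sets: both the non-negative and the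
  Bochner integral over a chart domain follow from it by pushing forward.\<close>

lemma density_volume_eq:
  assumes c: "c \<in> \<A>"
  shows "density \<mu> (\<lambda>p. ennreal (indicator (chart_dom c) p)) = distr (chart_measure c) borel_space (tot_inv c)"
proof (rule measure_eqI)
  have tm [measurable]: "tot_inv c \<in> measurable borel borel_space" by (rule measurable_tot_inv[OF c])
  fix E assume "E \<in> sets (density \<mu> (\<lambda>p. ennreal (indicator (chart_dom c) p)))"
  then have E: "E \<in> sets borel_space" by simp
  have eq: "(\<lambda>p. ennreal (indicator (chart_dom c) p)) = indicator (chart_dom c)"
    by (auto simp: indicator_def)
  have "emeasure (density \<mu> (\<lambda>p. ennreal (indicator (chart_dom c) p))) E = emeasure \<mu> (chart_dom c \<inter> E)"
    unfolding eq using E c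
    by (subst emeasure_density)
      (auto simp: indicator_inter_arith[symmetric] simp del: nn_integral_indicator
        intro!: borel_measurable_indicator nn_integral_indicator)
  also have "\<dots> = emeasure (chart_measure c) (chart_map c ` (chart_dom c \<inter> E))"
    using E c by (intro emeasure_volume) auto
  also have "\<dots> = emeasure (chart_measure c) (tot_inv c -` E)"
  proof -
    have B: "chart_map c ` (chart_dom c \<inter> E) = tot_inv c -` E \<inter> chart_im c"
      using c by (subst chart_map_image) (auto simp: tot_inv_def)
    have t: "tot_inv c -` E \<in> sets borel" using measurable_sets[OF tm E] by simp
    have i: "chart_im c \<in> sets borel" using chart_im_open[OF c] by simp
    show ?thesis
      unfolding B chart_measure_def using t i dens_measurable[OF c]
      by (subst (1 2) emeasure_density) (auto intro!: nn_integral_cong simp: indicator_def)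
  qed
  also have "\<dots> = emeasure (distr (chart_measure c) borel_space (tot_inv c)) E"
    using E by (subst emeasure_distr) (auto simp: chart_measure_def)
  finally show "emeasure (density \<mu> (\<lambda>p. ennreal (indicator (chart_dom c) p))) E =
    emeasure (distr (chart_measure c) borel_space (tot_inv c)) E" .
qed simp

lemma nn_integral_volume_chart:
  assumes c: "c \<in> \<A>" and f: "f \<in> borel_measurable borel_space" and E: "E \<in> sets borel_space" "E \<subseteq> chart_dom c"
  shows "(\<integral>\<^sup>+p\<in>E. f p \<partial>\<mu>) = (\<integral>\<^sup>+y\<in>chart_map c ` E. f (chart_inv c y) * ennreal (dens c y) \<partial>lborel)"
proof -
  have tm [measurable]: "tot_inv c \<in> measurable borel borel_space" by (rule measurable_tot_inv[OF c])
  note [measurable] = dens_measurable[OF c] f E(1)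
  have [measurable]: "chart_dom c \<in> sets borel_space" using c by simp
  let ?f = "\<lambda>p. f p * indicator E p"
  have "(\<integral>\<^sup>+p\<in>E. f p \<partial>\<mu>) = (\<integral>\<^sup>+p. ennreal (indicator (chart_dom c) p) * ?f p \<partial>\<mu>)"
    using E by (intro nn_integral_cong) (auto simp: indicator_def)
  also have "\<dots> = (\<integral>\<^sup>+p. ?f p \<partial>density \<mu> (\<lambda>p. ennreal (indicator (chart_dom c) p)))"
    by (subst nn_integral_density) auto
  also have "\<dots> = (\<integral>\<^sup>+y. ?f (tot_inv c y) \<partial>chart_measure c)"
    unfolding density_volume_eq[OF c] by (rule nn_integral_distr) (auto simp: chart_measure_def)
  also have "\<dots> = (\<integral>\<^sup>+y. ennreal (indicator (chart_im c) y * dens c y) * ?f (tot_inv c y) \<partial>lborel)"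
    unfolding chart_measure_def by (subst nn_integral_density) auto
  also have "\<dots> = (\<integral>\<^sup>+y\<in>chart_map c ` E. f (chart_inv c y) * ennreal (dens c y) \<partial>lborel)"
    unfolding chart_map_image[OF c E(2)]
    by (intro nn_integral_cong) (auto simp: indicator_def tot_inv_def mult.commute)
  finally show ?thesis .
qed

lemma integral_volume_chart:
  fixes f :: "'a \<Rightarrow> complex"
  assumes c: "c \<in> \<A>" and f: "f \<in> borel_measurable borel_space" and supp: "\<And>p. p \<in> topspace X \<Longrightarrow> p \<notin> chart_dom c \<Longrightarrow> f p = 0"
  shows "(\<integral>p. f p \<partial>\<mu>) = (\<integral>y. indicator (chart_im c) y *\<^sub>R (dens c y *\<^sub>R f (chart_inv c y)) \<partial>lborel)"
proof -
  have tm [measurable]: "tot_inv c \<in> measurable borel borel_space" by (rule measurable_tot_inv[OF c])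
  note [measurable] = dens_measurable[OF c] f
  have [measurable]: "chart_dom c \<in> sets borel_space" using c by simp
  have "(\<integral>p. f p \<partial>\<mu>) = (\<integral>p. indicator (chart_dom c) p *\<^sub>R f p \<partial>\<mu>)"
    using supp by (intro Bochner_Integration.integral_cong) (auto simp: indicator_def)
  also have "\<dots> = (\<integral>p. f p \<partial>density \<mu> (\<lambda>p. ennreal (indicator (chart_dom c) p)))"
    by (subst integral_density) auto
  also have "\<dots> = (\<integral>y. f (tot_inv c y) \<partial>chart_measure c)"
    unfolding density_volume_eq[OF c] by (rule integral_distr) (auto simp: chart_measure_def)
  also have "\<dots> = (\<integral>y. (indicator (chart_im c) y * dens c y) *\<^sub>R f (tot_inv c y) \<partial>lborel)"
    unfolding chart_measure_def
  proof (rule integral_density)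
    show "AE y in lborel. 0 \<le> indicator (chart_im c) y * dens c y"
      using dens_pos[OF c] by (auto simp: indicator_def less_imp_le)
  qed measurable
  also have "\<dots> = (\<integral>y. indicator (chart_im c) y *\<^sub>R (dens c y *\<^sub>R f (chart_inv c y)) \<partial>lborel)"
    by (intro Bochner_Integration.integral_cong) (auto simp: indicator_def tot_inv_def)
  finally show ?thesis .
qed

section \<open>Coordinate balls, positivity and finiteness of the volume\<close>

text \<open>Asking for a closed ball inside the chart gives compactness, hence two-sided bounds for
  the density and uniform ellipticity of the inverse metric.\<close>

lemma coord_ball:
  assumes "openin X U" "p \<in> U"
  obtains c s where "c \<in> \<A>" "p \<in> chart_dom c" "0 < s" "cball (chart_map c p) s \<subseteq> chart_map c ` (U \<inter> chart_dom c)"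
proof -
  obtain c where c: "c \<in> \<A>" "p \<in> chart_dom c"
    using assms chart_cover openin_subset by blast
  then have "chart_map c p \<in> chart_map c ` (U \<inter> chart_dom c)" using assms by blast
  then show thesis using that c open_contains_cball chart_map_open[OF c(1) assms(1)] by meson
qed

lemma coord_ball_open:
  assumes "c \<in> \<A>" "ball a s \<subseteq> chart_im c"
  shows "openin X (chart_inv c ` ball a s)" "chart_inv c ` ball a s \<subseteq> chart_dom c"
    "chart_map c ` (chart_inv c ` ball a s) = ball a s"
  using chart_inv_open[OF assms(1), of "ball a s"] assms
  by (auto simp: Int_absorb2 image_image subset_iff)

lemma emeasure_coord_ball:
  assumes c: "c \<in> \<A>" and s: "0 < s" "cball a s \<subseteq> chart_im c"
  shows "emeasure \<mu> (chart_inv c ` ball a s) < \<infinity>" "emeasure \<mu> (chart_inv c ` ball a s) > 0"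
proof -
  have b: "ball a s \<subseteq> chart_im c" using s(2) ball_subset_cball by blast
  have eq: "emeasure \<mu> (chart_inv c ` ball a s) = (\<integral>\<^sup>+y\<in>ball a s. ennreal (dens c y) \<partial>lborel)"
    using coord_ball_open[OF c b] b
    by (subst emeasure_volume[OF c]) (auto intro!: emeasure_chart_measure c)
  have cont: "continuous_on (cball a s) (dens c)"
    using continuous_on_subset[OF continuous_on_dens[OF c] s(2)] .
  obtain y0 where y0: "y0 \<in> cball a s" "\<And>y. y \<in> cball a s \<Longrightarrow> dens c y \<le> dens c y0"
    using continuous_attains_sup[OF compact_cball _ cont] s by force
  obtain y1 where y1: "y1 \<in> cball a s" "\<And>y. y \<in> cball a s \<Longrightarrow> dens c y1 \<le> dens c y"
    using continuous_attains_inf[OF compact_cball _ cont] s by force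
  have "(\<integral>\<^sup>+y\<in>ball a s. ennreal (dens c y) \<partial>lborel) \<le> (\<integral>\<^sup>+y\<in>ball a s. ennreal (dens c y0) \<partial>lborel)"
    using y0 by (intro nn_integral_mono) (auto simp: indicator_def ennreal_leI)
  also have "\<dots> = ennreal (dens c y0) * emeasure lborel (ball a s)"
    by (rule nn_integral_cmult_indicator) simp
  also have "\<dots> < \<infinity>" using emeasure_bounded_finite[of "ball a s"] by (simp add: ennreal_mult_less_top)
  finally show "emeasure \<mu> (chart_inv c ` ball a s) < \<infinity>" unfolding eq .
  have "0 < ennreal (dens c y1) * emeasure lborel (ball a s)"
    using dens_pos[OF c, of y1] y1(1) s content_ball_pos[OF s(1), of a]
    by (auto simp: ennreal_zero_less_mult_iff emeasure_lborel_ball_finite measure_def zero_less_iff_neq_zero)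
  also have "\<dots> = (\<integral>\<^sup>+y\<in>ball a s. ennreal (dens c y1) \<partial>lborel)"
    by (rule nn_integral_cmult_indicator[symmetric]) simp
  also have "\<dots> \<le> (\<integral>\<^sup>+y\<in>ball a s. ennreal (dens c y) \<partial>lborel)"
    using y1 by (intro nn_integral_mono) (auto simp: indicator_def ennreal_leI)
  finally show "emeasure \<mu> (chart_inv c ` ball a s) > 0" unfolding eq .
qed

lemma emeasure_open_pos:
  assumes "openin X U" "U \<noteq> {}"
  shows "emeasure \<mu> U > 0"
proof -
  obtain p where "p \<in> U" using assms by blast
  then obtain c s where c: "c \<in> \<A>" "p \<in> chart_dom c" "0 < s" "cball (chart_map c p) s \<subseteq> chart_map c ` (U \<inter> chart_dom c)"
    using coord_ball[OF assms(1)] by blast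
  have im: "cball (chart_map c p) s \<subseteq> chart_im c" using c(4) by (auto simp: chart_im_def)
  have "chart_inv c ` ball (chart_map c p) s \<subseteq> U"
  proof
    fix q assume "q \<in> chart_inv c ` ball (chart_map c p) s"
    then obtain y where "y \<in> cball (chart_map c p) s" "q = chart_inv c y" using ball_subset_cball by blast
    then show "q \<in> U" using c(1,4) by auto
  qed
  then have "emeasure \<mu> (chart_inv c ` ball (chart_map c p) s) \<le> emeasure \<mu> U"
    using assms by (intro emeasure_mono) auto
  then show ?thesis using emeasure_coord_ball(2)[OF c(1,3) im] by (meson less_le_trans)
qed

lemma finite_subcover:
  assumes "\<And>p. p \<in> topspace X \<Longrightarrow> openin X (U p) \<and> p \<in> U p"
  obtains P where "finite P" "P \<subseteq> topspace X" "topspace X = (\<Union>p\<in>P. U p)"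
proof -
  have "compactin X (topspace X)" using compact by (simp add: compact_space_def)
  moreover have "openin X V" if "V \<in> U ` topspace X" for V
    using that assms by auto
  moreover have "topspace X \<subseteq> \<Union> (U ` topspace X)"
    using assms by auto
  ultimately have "\<exists>F. finite F \<and> F \<subseteq> U ` topspace X \<and> topspace X \<subseteq> \<Union> F"
    by (rule compactinD)
  then obtain F where F: "finite F" "F \<subseteq> U ` topspace X" "topspace X \<subseteq> \<Union> F" by blast
  obtain P where P: "finite P" "P \<subseteq> topspace X" "F = U ` P" using finite_subset_image[OF F(1,2)] by blast
  moreover have "(\<Union>p\<in>P. U p) \<subseteq> topspace X" using assms P(2) openin_subset by blast
  ultimately show thesis using that F by auto
qed

lemma finite_measure_volume: "finite_measure \<mu>"
proof
  have "\<exists>U. openin X U \<and> p \<in> U \<and> emeasure \<mu> U < \<infinity>" if p: "p \<in> topspace X" for p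
  proof -
    obtain c s where c: "c \<in> \<A>" "p \<in> chart_dom c" "0 < s" "cball (chart_map c p) s \<subseteq> chart_map c ` (topspace X \<inter> chart_dom c)"
      using coord_ball[OF openin_topspace p] by blast
    have im: "cball (chart_map c p) s \<subseteq> chart_im c" using c(4) by (auto simp: chart_im_def)
    then have b: "ball (chart_map c p) s \<subseteq> chart_im c" using ball_subset_cball by blast
    have "p \<in> chart_inv c ` ball (chart_map c p) s"
      using c by (intro image_eqI[of _ _ "chart_map c p"]) auto
    then show ?thesis using emeasure_coord_ball(1)[OF c(1,3) im] coord_ball_open(1)[OF c(1) b] by blast
  qed
  then have "\<exists>U. \<forall>p\<in>topspace X. openin X (U p) \<and> p \<in> U p \<and> emeasure \<mu> (U p) < \<infinity>"
    by (intro bchoice) blast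
  then obtain U where U: "\<forall>p\<in>topspace X. openin X (U p) \<and> p \<in> U p \<and> emeasure \<mu> (U p) < \<infinity>" ..
  obtain P where P: "finite P" "P \<subseteq> topspace X" "topspace X = (\<Union>p\<in>P. U p)"
    by (rule finite_subcover[of U]) (use U in simp_all)
  have "emeasure \<mu> (\<Union>p\<in>P. U p) \<le> (\<Sum>p\<in>P. emeasure \<mu> (U p))"
  proof (rule emeasure_subadditive_finite[OF P(1)])
    show "U ` P \<subseteq> sets \<mu>" using U P(2) by auto
  qed
  also have "\<dots> < \<infinity>"
  proof -
    have "emeasure \<mu> (U p) < \<infinity>" if "p \<in> P" for p using that U P(2) by blast
    then show ?thesis using P(1) by (auto simp: less_top)
  qed
  finally show "emeasure \<mu> (space \<mu>) \<noteq> \<infinity>" using P(3) by simp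
qed

sublocale volume: finite_measure \<mu> by (rule finite_measure_volume)

lemma vol_pos: "vol X \<A> h > 0"
  using emeasure_open_pos[OF openin_topspace nonempty]
  by (simp add: vol_def volume.emeasure_eq_measure)

end

section \<open>Functions and covector fields on the manifold\<close>

lemma frechet_derivative_cong_open:
  assumes "f differentiable (at x)" "open S" "x \<in> S" "\<And>y. y \<in> S \<Longrightarrow> f y = g y"
  shows "frechet_derivative g (at x) = frechet_derivative f (at x)"
proof -
  have "(f has_derivative frechet_derivative f (at x)) (at x)"
    using assms(1) by (simp add: frechet_derivative_works)
  then have "(g has_derivative frechet_derivative f (at x)) (at x)"
    by (rule has_derivative_transform_within_open[OF _ assms(2-4)])
  then show ?thesis by (rule frechet_derivative_at[symmetric])
qed

lemma frechet_derivative_zero_open: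
  assumes "open S" "x \<in> S" "\<And>y. y \<in> S \<Longrightarrow> g y = 0"
  shows "frechet_derivative g (at x) = (\<lambda>_. 0)"
proof -
  have "((\<lambda>_. 0) has_derivative (\<lambda>_. 0)) (at x)" by simp
  then have "(g has_derivative (\<lambda>_. 0)) (at x)"
    by (rule has_derivative_transform_within_open[OF _ assms(1,2)]) (simp add: assms(3))
  then show ?thesis by (rule frechet_derivative_at[symmetric])
qed

lemma integrable_directional_derivative:
  fixes f :: "'e::euclidean_space \<Rightarrow> 'b::{banach,second_countable_topology}"
  assumes f: "C1_on UNIV f" and supp: "\<And>x. R < norm x \<Longrightarrow> f x = 0"
  shows "integrable lborel (\<lambda>x. frechet_derivative f (at x) v)"
proof -
  have "integrable lborel (\<lambda>x. indicator (cball 0 R) x *\<^sub>R frechet_derivative f (at x) v)"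
    by (rule borel_integrable_compact) (auto intro: continuous_on_subset[OF C1_on_continuous_deriv[OF f]])
  moreover have "indicator (cball 0 R) x *\<^sub>R frechet_derivative f (at x) v = frechet_derivative f (at x) v" for x
  proof (cases "R < norm x")
    case True
    have "open {x :: 'e. R < norm x}" by (intro open_Collect_less continuous_intros)
    from frechet_derivative_zero_open[OF this, of x f] show ?thesis using supp True by simp
  qed simp
  ultimately show ?thesis by simp
qed

context compact_riemannian
begin

definition cont :: "('a \<Rightarrow> 'f::topological_space) \<Rightarrow> bool" where
  "cont f \<longleftrightarrow> (\<forall>c\<in>\<A>. continuous_on (chart_im c) (\<lambda>y. f (chart_inv c y)))"

definition C1 :: "('a \<Rightarrow> 'f::real_normed_vector) \<Rightarrow> bool" where
  "C1 f \<longleftrightarrow> (\<forall>c\<in>\<A>. C1_on (chart_im c) (\<lambda>y. f (chart_inv c y)))"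

lemma C1_D: "C1 f \<Longrightarrow> c \<in> \<A> \<Longrightarrow> C1_on (chart_im c) (\<lambda>y. f (chart_inv c y))"
  by (simp add: C1_def)

lemma smooth_function_imp_C1: "smooth_function \<A> f \<Longrightarrow> C1 f"
  by (auto simp: smooth_function_def C1_def o_def intro: smooth_on_imp_C1_on)

lemma C1_imp_cont: "C1 f \<Longrightarrow> cont f"
  by (simp add: C1_def cont_def C1_on_imp_continuous_on)

lemma cont_imp_continuous_map:
  assumes "cont f"
  shows "continuous_map X euclidean f"
  unfolding continuous_map_def
proof (intro conjI allI impI)
  fix V :: "'b set" assume "openin euclidean V"
  then have V: "open V" by simp
  show "openin X {p \<in> topspace X. f p \<in> V}"
  proof (subst openin_subopen, intro ballI)
    fix p assume p: "p \<in> {p \<in> topspace X. f p \<in> V}"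
    then obtain c where c: "c \<in> \<A>" "p \<in> chart_dom c" using chart_cover by blast
    let ?W = "chart_im c \<inter> (\<lambda>y. f (chart_inv c y)) -` V"
    have "open ?W"
      using assms c by (intro continuous_open_preimage chart_im_open V) (auto simp: cont_def)
    then have "openin X (chart_inv c ` (?W \<inter> chart_im c))" by (rule chart_inv_open[OF c(1)])
    moreover have "p \<in> chart_inv c ` (?W \<inter> chart_im c)"
      using p c by (intro image_eqI[of _ _ "chart_map c p"]) auto
    moreover have "chart_inv c ` (?W \<inter> chart_im c) \<subseteq> {p \<in> topspace X. f p \<in> V}"
      using chart_inv_in_space[OF c(1)] by auto
    ultimately show "\<exists>T. openin X T \<and> p \<in> T \<and> T \<subseteq> {p \<in> topspace X. f p \<in> V}" by blast
  qed
qed simp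

lemma openin_Collect_cont:
  assumes "cont f" "open V"
  shows "openin X {p \<in> topspace X. f p \<in> V}"
  using openin_continuous_map_preimage[OF cont_imp_continuous_map[OF assms(1)]] assms(2) by simp

lemma cont_measurable:
  assumes "cont f"
  shows "f \<in> borel_measurable borel_space"
proof (rule borel_measurableI)
  fix S :: "'b set" assume "open S"
  moreover have "f -` S \<inter> space borel_space = {p \<in> topspace X. f p \<in> S}" by auto
  ultimately show "f -` S \<inter> space borel_space \<in> sets borel_space"
    using openin_Collect_cont[OF assms] by simp
qed

lemma cont_measurable_volume [measurable]: "cont f \<Longrightarrow> f \<in> borel_measurable \<mu>"
  using cont_measurable measurable_cong_sets[OF sets_volume refl] by blast

lemma cont_bounded:
  fixes f :: "'a \<Rightarrow> 'b::real_normed_vector"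
  assumes "cont f"
  shows "\<exists>B>0. \<forall>p\<in>topspace X. norm (f p) \<le> B"
proof -
  have "compactin euclidean (f ` topspace X)"
    by (rule image_compactin[OF _ cont_imp_continuous_map[OF assms]]) (use compact in \<open>simp add: compact_space_def\<close>)
  then have "bounded (f ` topspace X)" by (simp add: compact_imp_bounded)
  then obtain B where "B > 0" "\<forall>x\<in>f ` topspace X. norm x \<le> B" unfolding bounded_pos by blast
  then show ?thesis by auto
qed

lemma cont_integrable:
  fixes f :: "'a \<Rightarrow> 'b::{banach,second_countable_topology}"
  assumes "cont f"
  shows "integrable \<mu> f"
proof -
  obtain B where "\<forall>p\<in>topspace X. norm (f p) \<le> B" using cont_bounded[OF assms] by blast
  then show ?thesis
    by (intro volume.integrable_const_bound[of _ B]) (auto intro: cont_measurable_volume[OF assms])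
qed

lemma cont_const [simp]: "cont (\<lambda>p. a)" by (simp add: cont_def)

lemma cont_add: "cont f \<Longrightarrow> cont g \<Longrightarrow> cont (\<lambda>p. f p + g p)" for f g :: "'a \<Rightarrow> 'b::real_normed_vector"
  by (simp add: cont_def continuous_on_add)

lemma cont_diff: "cont f \<Longrightarrow> cont g \<Longrightarrow> cont (\<lambda>p. f p - g p)" for f g :: "'a \<Rightarrow> 'b::real_normed_vector"
  by (simp add: cont_def continuous_on_diff)

lemma cont_mult: "cont f \<Longrightarrow> cont g \<Longrightarrow> cont (\<lambda>p. f p * g p)" for f g :: "'a \<Rightarrow> 'b::real_normed_algebra"
  by (simp add: cont_def continuous_on_mult)

lemma cont_compose: "cont f \<Longrightarrow> continuous_on UNIV \<phi> \<Longrightarrow> cont (\<lambda>p. \<phi> (f p))"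
  unfolding cont_def by (auto intro: continuous_on_compose2)

lemma C1_sum: "(\<And>i. i \<in> I \<Longrightarrow> C1 (f i)) \<Longrightarrow> C1 (\<lambda>p. \<Sum>i\<in>I. f i p)"
  by (simp add: C1_def C1_on_sum)

lemma C1_scaleR: "C1 f \<Longrightarrow> C1 g \<Longrightarrow> C1 (\<lambda>p. f p *\<^sub>R g p)"
  by (simp add: C1_def C1_on_scaleR)

text \<open>The common home of \<open>diff_fun u\<close>, \<open>complexify A\<close> and the
  magnetic differential: complex components, continuous in each chart, with the law of a covector.
  Unlike \<open>one_form\<close>, it is stable under multiplication by continuous complex
  functions.\<close>

definition cofield :: "(('a, 'n) chart \<Rightarrow> 'a \<Rightarrow> complex^'n) \<Rightarrow> bool" where
  "cofield \<xi> \<longleftrightarrow> (\<forall>c\<in>\<A>. \<forall>i. continuous_on (chart_im c) (\<lambda>y. \<xi> c (chart_inv c y) $ i)) \<and>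
    (\<forall>c\<in>\<A>. \<forall>c'\<in>\<A>. \<forall>p\<in>chart_dom c \<inter> chart_dom c'. \<forall>i.
      \<xi> c p $ i = (\<Sum>k\<in>UNIV. complex_of_real (Defs.jacobian c c' p $ k $ i) * \<xi> c' p $ k))"

lemma cofieldD:
  assumes "cofield \<xi>"
  shows "c \<in> \<A> \<Longrightarrow> continuous_on (chart_im c) (\<lambda>y. \<xi> c (chart_inv c y) $ i)"
    and "c \<in> \<A> \<Longrightarrow> c' \<in> \<A> \<Longrightarrow> p \<in> chart_dom c \<inter> chart_dom c' \<Longrightarrow>
      \<xi> c p $ i = (\<Sum>k\<in>UNIV. complex_of_real (Defs.jacobian c c' p $ k $ i) * \<xi> c' p $ k)"
  using assms unfolding cofield_def by blast+

definition pair :: "(('a, 'n) chart \<Rightarrow> 'a \<Rightarrow> complex^'n) \<Rightarrow> (('a, 'n) chart \<Rightarrow> 'a \<Rightarrow> complex^'n) \<Rightarrow> 'a \<Rightarrow> complex" where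
  "pair \<xi> \<eta> p = (let c = chart_at \<A> p in herm (matrix_inv (h c p)) (\<xi> c p) (\<eta> c p))"

lemma conorm_sq_eq: "conorm_sq \<A> h \<xi> p = Re (pair \<xi> \<xi> p)"
  by (simp add: conorm_sq_def pair_def herm_def Let_def)

text \<open>The Jacobians that carry the covectors to chart \<open>c\<close> cancel against those of
  the inverse metric, so the chart selected by \<open>chart_at\<close> may be exchanged for any
  other around \<open>p\<close>.\<close>

lemma pair_eq:
  assumes "cofield \<xi>" "cofield \<eta>" "c \<in> \<A>" "p \<in> chart_dom c"
  shows "pair \<xi> \<eta> p = herm (matrix_inv (h c p)) (\<xi> c p) (\<eta> c p)"
proof -
  let ?c = "chart_at \<A> p"
  have "p \<in> topspace X" using assms chart_dom_subset by blast
  then have c: "?c \<in> \<A>" "p \<in> chart_dom ?c \<inter> chart_dom c" using chart_at assms by auto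
  have "pair \<xi> \<eta> p = herm (Defs.jacobian ?c c p ** matrix_inv (h ?c p) ** transpose (Defs.jacobian ?c c p)) (\<xi> c p) (\<eta> c p)"
    unfolding pair_def Let_def
    by (rule herm_transform) (use assms c in \<open>unfold cofield_def, blast+\<close>)
  then show ?thesis using matrix_inv_metric_transform[OF c(1) assms(3) c(2)] by simp
qed

lemma cont_pair:
  assumes "cofield \<xi>" "cofield \<eta>"
  shows "cont (pair \<xi> \<eta>)"
  unfolding cont_def
proof
  fix c assume c: "c \<in> \<A>"
  have "continuous_on (chart_im c) (\<lambda>y. herm (matrix_inv (h c (chart_inv c y))) (\<xi> c (chart_inv c y)) (\<eta> c (chart_inv c y)))"
    unfolding herm_def
    by (intro continuous_intros C1_on_imp_continuous_on[OF C1_on_inv_metric[OF c]]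
        cofieldD(1)[OF assms(1) c] cofieldD(1)[OF assms(2) c])
  then show "continuous_on (chart_im c) (\<lambda>y. pair \<xi> \<eta> (chart_inv c y))"
    by (rule continuous_on_eq) (simp add: pair_eq[OF assms c])
qed

lemma pair_nonneg: "p \<in> topspace X \<Longrightarrow> 0 \<le> Re (pair \<xi> \<xi> p)"
  unfolding pair_def Let_def using chart_at by (intro herm_matrix_inv_nonneg pos_def_metric) auto

lemma cont_conorm_sq: "cofield \<xi> \<Longrightarrow> cont (conorm_sq \<A> h \<xi>)"
  unfolding conorm_sq_eq[abs_def] by (rule cont_compose[OF cont_pair]) (auto intro!: continuous_intros)

lemma diff_fun_nth: "c \<in> \<A> \<Longrightarrow> p \<in> chart_dom c \<Longrightarrow>
    diff_fun u c p $ i = frechet_derivative (\<lambda>y. u (chart_inv c y)) (at (chart_map c p)) (axis i 1)"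
  by (simp add: diff_fun_def partial_deriv_def o_def)

lemma deriv_transition:
  assumes u: "C1 u" and c: "c \<in> \<A>" "c' \<in> \<A>" and p: "p \<in> chart_dom c \<inter> chart_dom c'"
  shows "frechet_derivative (\<lambda>y. u (chart_inv c y)) (at (chart_map c p)) v =
    frechet_derivative (\<lambda>y. u (chart_inv c' y)) (at (chart_map c' p)) (Defs.jacobian c c' p *v v)"
proof -
  let ?x = "chart_map c p" and ?T = "transition c c'" and ?F = "\<lambda>y. u (chart_inv c' y)"
  have x: "?x \<in> overlap c c'" "?T ?x = chart_map c' p" using p c by (auto simp: overlap_def transition_map)
  have "((\<lambda>y. ?F (?T y)) has_derivative
      (\<lambda>v. frechet_derivative ?F (at (?T ?x)) (frechet_derivative ?T (at ?x) v))) (at ?x)"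
    by (rule has_derivative_compose_C1[OF C1_on_transition[OF c] C1_D[OF u c(2)] x(1)]) (use x p in simp)
  then have "((\<lambda>y. u (chart_inv c y)) has_derivative
      (\<lambda>v. frechet_derivative ?F (at (?T ?x)) (frechet_derivative ?T (at ?x) v))) (at ?x)"
    by (rule has_derivative_transform_within_open[OF _ overlap_open[OF c] x(1)])
      (use c in \<open>auto simp: overlap_iff transition_def\<close>)
  from frechet_derivative_at[OF this, symmetric] show ?thesis
    by (simp add: x(2) jacobian_apply[OF c p])
qed

lemma cofield_diff_fun:
  assumes u: "C1 u"
  shows "cofield (diff_fun u)"
  unfolding cofield_def
proof (intro conjI ballI allI)
  fix c i assume c: "c \<in> \<A>"
  show "continuous_on (chart_im c) (\<lambda>y. diff_fun u c (chart_inv c y) $ i)"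
    by (rule continuous_on_eq[OF C1_on_continuous_deriv[OF C1_D[OF u c], of "axis i 1"]])
      (simp add: diff_fun_nth c)
next
  fix c c' p i assume c: "c \<in> \<A>" "c' \<in> \<A>" and p: "p \<in> chart_dom c \<inter> chart_dom c'"
  let ?D = "frechet_derivative (\<lambda>y. u (chart_inv c' y)) (at (chart_map c' p))" and ?J = "Defs.jacobian c c' p"
  have D: "linear ?D"
    by (rule has_derivative_linear[OF C1_on_has_derivative[OF C1_D[OF u c(2)]]]) (use p in simp)
  have "diff_fun u c p $ i = ?D (?J *v axis i 1)"
    using p c by (simp add: diff_fun_nth deriv_transition[OF u c p])
  also have "?J *v axis i 1 = (\<Sum>k\<in>UNIV. ?J $ k $ i *\<^sub>R axis k 1)"
    unfolding matrix_vector_mult_basis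
    by (simp add: column_def vec_eq_iff axis_def if_distrib[of "\<lambda>x. _ * x"] cong: if_cong)
  also have "?D \<dots> = (\<Sum>k\<in>UNIV. ?J $ k $ i *\<^sub>R ?D (axis k 1))"
    by (simp add: linear_sum[OF D] linear_scale[OF D])
  also have "\<dots> = (\<Sum>k\<in>UNIV. complex_of_real (?J $ k $ i) * diff_fun u c' p $ k)"
    using p c by (simp add: diff_fun_nth scaleR_conv_of_real)
  finally show "diff_fun u c p $ i = (\<Sum>k\<in>UNIV. complex_of_real (?J $ k $ i) * diff_fun u c' p $ k)" .
qed

lemma one_form_C1_on:
  assumes "one_form \<A> A" "c \<in> \<A>"
  shows "C1_on (chart_im c) (\<lambda>y. A c (chart_inv c y))" "C1_on (chart_im c) (\<lambda>y. A c (chart_inv c y) $ i)"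
proof -
  show "C1_on (chart_im c) (\<lambda>y. A c (chart_inv c y))"
    using assms by (auto simp: one_form_def o_def intro: smooth_on_imp_C1_on)
  from C1_on_bounded_linear[OF bounded_linear_vec_nth this]
  show "C1_on (chart_im c) (\<lambda>y. A c (chart_inv c y) $ i)" .
qed

lemma cofield_complexify:
  assumes A: "one_form \<A> A"
  shows "cofield (complexify A)"
  unfolding cofield_def
proof (intro conjI ballI allI)
  fix c i assume c: "c \<in> \<A>"
  show "continuous_on (chart_im c) (\<lambda>y. complexify A c (chart_inv c y) $ i)"
    unfolding complexify_def vec_lambda_beta
    by (intro continuous_intros C1_on_imp_continuous_on[OF one_form_C1_on(2)[OF A c]])
next
  fix c c' p i assume c: "c \<in> \<A>" "c' \<in> \<A>" and p: "p \<in> chart_dom c \<inter> chart_dom c'"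
  have "A c p = transpose (Defs.jacobian c c' p) *v A c' p"
    using A c p unfolding one_form_def by blast
  then show "complexify A c p $ i = (\<Sum>k\<in>UNIV. complex_of_real (Defs.jacobian c c' p $ k $ i) * complexify A c' p $ k)"
    by (simp add: complexify_def matrix_vector_mult_def transpose_def)
qed

lemma cofield_add:
  assumes "cofield \<xi>" "cofield \<eta>"
  shows "cofield (\<lambda>c p. \<xi> c p + \<eta> c p)"
  unfolding cofield_def vector_add_component
proof (intro conjI ballI allI continuous_on_add cofieldD(1) assms)
  fix c c' p i assume *: "c \<in> \<A>" "c' \<in> \<A>" "p \<in> chart_dom c \<inter> chart_dom c'"
  show "\<xi> c p $ i + \<eta> c p $ i =
      (\<Sum>k\<in>UNIV. complex_of_real (Defs.jacobian c c' p $ k $ i) * (\<xi> c' p $ k + \<eta> c' p $ k))"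
    by (simp only: cofieldD(2)[OF assms(1) *] cofieldD(2)[OF assms(2) *] distrib_left sum.distrib)
qed

lemma cofield_scale:
  assumes "cont f" "cofield \<xi>"
  shows "cofield (\<lambda>c p. f p *s \<xi> c p)"
  unfolding cofield_def vector_smult_component
proof (intro conjI ballI allI continuous_on_mult cofieldD(1) assms)
  show "continuous_on (chart_im c) (\<lambda>y. f (chart_inv c y))" if "c \<in> \<A>" for c
    using assms(1) that by (simp add: cont_def)
  fix c c' p i assume *: "c \<in> \<A>" "c' \<in> \<A>" "p \<in> chart_dom c \<inter> chart_dom c'"
  show "f p * \<xi> c p $ i = (\<Sum>k\<in>UNIV. complex_of_real (Defs.jacobian c c' p $ k $ i) * (f p * \<xi> c' p $ k))"
    by (simp only: cofieldD(2)[OF assms(2) *] sum_distrib_left mult.left_commute)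
qed

lemma pair_add_left: "pair (\<lambda>c p. \<xi> c p + \<xi>' c p) \<eta> p = pair \<xi> \<eta> p + pair \<xi>' \<eta> p"
  and pair_add_right: "pair \<xi> (\<lambda>c p. \<eta> c p + \<eta>' c p) p = pair \<xi> \<eta> p + pair \<xi> \<eta>' p"
  and pair_scale_left: "pair (\<lambda>c p. f p *s \<xi> c p) \<eta> p = f p * pair \<xi> \<eta> p"
  and pair_scale_right: "pair \<xi> (\<lambda>c p. f p *s \<eta> c p) p = cnj (f p) * pair \<xi> \<eta> p"
  by (simp_all add: pair_def Let_def herm_add_left herm_add_right herm_scale_left herm_scale_right)

lemma pair_sym: "p \<in> topspace X \<Longrightarrow> pair \<eta> \<xi> p = cnj (pair \<xi> \<eta> p)"
  unfolding pair_def Let_def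
  using chart_at by (intro herm_sym transpose_matrix_inv_pos_def pos_def_metric) auto

lemma diff_fun_add:
  assumes "C1 u" "C1 v" "c \<in> \<A>" "p \<in> chart_dom c"
  shows "diff_fun (\<lambda>p. u p + v p) c p = diff_fun u c p + diff_fun v c p"
proof -
  have "((\<lambda>y. u (chart_inv c y) + v (chart_inv c y)) has_derivative
    (\<lambda>w. frechet_derivative (\<lambda>y. u (chart_inv c y)) (at (chart_map c p)) w +
      frechet_derivative (\<lambda>y. v (chart_inv c y)) (at (chart_map c p)) w)) (at (chart_map c p))"
    using assms by (intro has_derivative_add C1_on_has_derivative[OF C1_D]) auto
  from frechet_derivative_at[OF this, symmetric] show ?thesis
    using assms by (simp add: vec_eq_iff diff_fun_nth)
qed

text \<open>Functions may take any values at points of the type outside the manifold; near a chart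
  point only the values on it enter the differential.\<close>

lemma diff_fun_cong:
  assumes "C1 u" "\<And>p. p \<in> topspace X \<Longrightarrow> u p = v p" "c \<in> \<A>" "p \<in> chart_dom c"
  shows "diff_fun v c p = diff_fun u c p"
proof -
  have "frechet_derivative (\<lambda>y. v (chart_inv c y)) (at (chart_map c p)) = frechet_derivative (\<lambda>y. u (chart_inv c y)) (at (chart_map c p))"
  proof (rule frechet_derivative_cong_open)
    show "(\<lambda>y. u (chart_inv c y)) differentiable at (chart_map c p)"
      using C1_on_has_derivative[OF C1_D[OF assms(1,3)], of "chart_map c p"] assms(4) by (auto intro: differentiableI)
    show "open (chart_im c)" by (rule chart_im_open[OF assms(3)])
  qed (use assms chart_inv_in_space in auto)
  then show ?thesis using assms by (simp add: vec_eq_iff diff_fun_nth)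
qed

end

section \<open>Integration by parts and the Poincare inequality\<close>

text \<open>A function cannot exceed its average everywhere. This selects the constant in the
  Poincare inequality as a value of the function itself.\<close>

lemma nn_integral_mean_value:
  assumes [measurable]: "U \<in> sets M" "G \<in> borel_measurable M"
    and U: "0 < emeasure M U" "emeasure M U < \<infinity>"
  shows "\<exists>y\<in>U. emeasure M U * G y \<le> (\<integral>\<^sup>+x\<in>U. G x \<partial>M)"
proof (rule ccontr)
  let ?I = "\<integral>\<^sup>+x\<in>U. G x \<partial>M" and ?m = "emeasure M U"
  assume "\<not> ?thesis"
  then have lt: "?I < ?m * G y" if "y \<in> U" for y using that by (auto simp: not_le)
  have "U \<noteq> {}" using U(1) by auto
  then obtain y0 where "y0 \<in> U" by blast
  from lt[OF this] have Ifin: "?I < \<infinity>" by (metis infinity_ennreal_def leD top_greatest linorder_less_linear less_top)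
  obtain m where m: "?m = ennreal m" "0 < m" using U by (cases ?m) auto
  obtain i where i: "?I = ennreal i" "0 \<le> i" using Ifin by (cases ?I) auto
  \<comment> \<open>The average of \<open>G\<close> over \<open>U\<close>. If \<open>G\<close>
    exceeded it throughout \<open>U\<close>, then \<open>G - k\<close> would be positive there with
    integral zero, and \<open>U\<close> would be a null set.\<close>
  define k where "k = ennreal (i / m)"
  have km: "k * ?m = ?I"
    unfolding k_def m i using m i by (simp add: ennreal_mult[symmetric])
  have kfin: "k \<noteq> \<infinity>" by (simp add: k_def)
  have Gk: "k < G y" if "y \<in> U" for y
    using lt[OF that] unfolding km[symmetric] by (metis leD leI mult.commute mult_right_mono zero_le)
  have "?I = (\<integral>\<^sup>+x. (G x - k) * indicator U x + k * indicator U x \<partial>M)"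
    using Gk kfin by (intro nn_integral_cong) (auto simp: indicator_def less_imp_le diff_add_cancel_ennreal)
  also have "\<dots> = (\<integral>\<^sup>+x. (G x - k) * indicator U x \<partial>M) + k * ?m"
    by (subst nn_integral_add) (auto simp: nn_integral_cmult_indicator)
  finally have "ennreal i = (\<integral>\<^sup>+x. (G x - k) * indicator U x \<partial>M) + ennreal i"
    unfolding km i .
  then have "(\<integral>\<^sup>+x. (G x - k) * indicator U x \<partial>M) = 0"
    using i(2) by (cases "\<integral>\<^sup>+x. (G x - k) * indicator U x \<partial>M") (auto simp flip: ennreal_plus)
  then have "AE x in M. (G x - k) * indicator U x = 0"
    by (subst (asm) nn_integral_0_iff_AE) auto
  moreover have "(G x - k) * indicator U x \<noteq> 0" if "x \<in> U" for x
    using Gk[OF that] that by (simp add: diff_eq_0_iff_ennreal not_le)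
  ultimately have AE: "AE x in M. x \<notin> U" by (auto elim: eventually_mono)
  have eq: "{x \<in> space M. \<not> x \<notin> U} = U" using sets.sets_into_space[OF assms(1)] by auto
  have "emeasure M U = 0" by (rule iffD1[OF AE_iff_measurable[OF assms(1) eq] AE])
  then show False using U(1) by simp
qed

text \<open>One variable of the double integral is frozen at a point where the inner integral does
  not exceed its average; the constant \<open>m\<close> is the value of \<open>f\<close> at that
  point.\<close>

lemma poincare_ball_mean:
  fixes a :: "'e::euclidean_space"
  assumes "0 < s"
  obtains K where "0 \<le> K"
    "\<And>f :: 'e \<Rightarrow> 'b::{banach,second_countable_topology}. C1_on (ball a s) f \<Longrightarrow>
      \<exists>m. (\<integral>\<^sup>+x\<in>ball a s. ennreal ((norm (f x - m))\<^sup>2) \<partial>lborel)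
        \<le> ennreal K * (\<integral>\<^sup>+z\<in>ball a s. ennreal (grad_sq f z) \<partial>lborel)"
proof -
  let ?B = "ball a s"
  obtain K where K: "0 \<le> K"
    "\<And>S (f :: 'e \<Rightarrow> 'b::{banach,second_countable_topology}). C1_on S f \<Longrightarrow> ?B \<subseteq> S \<Longrightarrow>
      (\<integral>\<^sup>+x\<in>?B. (\<integral>\<^sup>+y\<in>?B. ennreal ((norm (f x - f y))\<^sup>2) \<partial>lborel) \<partial>lborel)
        \<le> ennreal K * (\<integral>\<^sup>+z\<in>?B. ennreal (grad_sq f z) \<partial>lborel)"
    using poincare_ball[of a s] by blast
  let ?m = "measure lborel ?B"
  have mpos: "?m > 0" using content_ball_pos[OF assms, of a] by (simp add: measure_def)
  have em: "emeasure lborel ?B = ennreal ?m"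
    by (intro emeasure_eq_ennreal_measure) (use emeasure_bounded_finite[of ?B] in auto)
  show thesis
  proof (rule that[of "K / ?m"])
    show "0 \<le> K / ?m" using K(1) by simp
    fix f :: "'e \<Rightarrow> 'b" assume f: "C1_on ?B f"
    let ?I = "\<integral>\<^sup>+z\<in>?B. ennreal (grad_sq f z) \<partial>lborel"
    \<comment> \<open>Extension by zero gives a Borel function, so the inner integral becomes
      measurable in \<open>x\<close>.\<close>
    define g where "g x = indicator ?B x *\<^sub>R f x" for x
    have g [measurable]: "g \<in> borel_measurable borel"
      unfolding g_def[abs_def] by (intro borel_measurable_continuous_on_indicator C1_on_imp_continuous_on f) simp
    have [measurable]: "?B \<in> sets borel" by simp
    define G where "G x = (\<integral>\<^sup>+y. ennreal ((norm (g x - g y))\<^sup>2) * indicator ?B y \<partial>lborel)" for x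
    have [measurable]: "G \<in> borel_measurable borel" unfolding G_def[abs_def] by measurable
    have GB: "G x = (\<integral>\<^sup>+y\<in>?B. ennreal ((norm (f x - f y))\<^sup>2) \<partial>lborel)" if "x \<in> ?B" for x
      unfolding G_def using that by (intro nn_integral_cong) (auto simp: g_def indicator_def)
    have "\<exists>x\<in>?B. emeasure lborel ?B * G x \<le> (\<integral>\<^sup>+x\<in>?B. G x \<partial>lborel)"
      by (rule nn_integral_mean_value) (use mpos em in auto)
    then obtain x where x: "x \<in> ?B" "ennreal ?m * G x \<le> (\<integral>\<^sup>+x\<in>?B. G x \<partial>lborel)" unfolding em by blast
    have "(\<integral>\<^sup>+x\<in>?B. G x \<partial>lborel) = (\<integral>\<^sup>+x\<in>?B. (\<integral>\<^sup>+y\<in>?B. ennreal ((norm (f x - f y))\<^sup>2) \<partial>lborel) \<partial>lborel)"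
      by (intro nn_integral_cong) (auto simp: GB indicator_def)
    also have "\<dots> \<le> ennreal K * ?I" by (rule K(2)[OF f subset_refl])
    finally have "ennreal ?m * G x \<le> ennreal K * ?I" using x(2) by (rule order_trans[rotated])
    then have "ennreal (1 / ?m) * (ennreal ?m * G x) \<le> ennreal (1 / ?m) * (ennreal K * ?I)"
      by (rule mult_left_mono) simp
    then have "G x \<le> ennreal (K / ?m) * ?I"
      using mpos K(1) by (simp add: mult.assoc[symmetric] ennreal_mult[symmetric])
    moreover have "G x = (\<integral>\<^sup>+y\<in>?B. ennreal ((norm (f y - f x))\<^sup>2) \<partial>lborel)"
      unfolding GB[OF x(1)] by (simp add: norm_minus_commute)
    ultimately show "\<exists>m. (\<integral>\<^sup>+x\<in>?B. ennreal ((norm (f x - m))\<^sup>2) \<partial>lborel) \<le> ennreal (K / ?m) * ?I"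
      by auto
  qed
qed

section \<open>Integration by parts against a co-closed form\<close>

text \<open>Squaring removes the kink of the positive part; this is the profile of the bump
  functions.\<close>

lemma C1_on_max_sq: "C1_on UNIV (\<lambda>t::real. (max 0 t)\<^sup>2)"
proof (rule C1_on_real)
  show "((\<lambda>t::real. (max 0 t)\<^sup>2) has_real_derivative 2 * max 0 t) (at t)" for t
  proof (cases t "0::real" rule: linorder_cases)
    case less
    have "((\<lambda>_. 0) has_real_derivative 0) (at t)" by simp
    then have "((\<lambda>t::real. (max 0 t)\<^sup>2) has_real_derivative 0) (at t)"
      by (rule has_field_derivative_transform_within_open[of _ _ _ "{..<0}"]) (use less in auto)
    then show ?thesis using less by simp
  next
    case greater
    have "((\<lambda>t. t\<^sup>2) has_real_derivative 2 * t) (at t)" by (auto intro!: derivative_eq_intros)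
    then have "((\<lambda>t::real. (max 0 t)\<^sup>2) has_real_derivative 2 * t) (at t)"
      by (rule has_field_derivative_transform_within_open[of _ _ _ "{0<..}"]) (use greater in auto)
    then show ?thesis using greater by simp
  next
    case equal
    have "((\<lambda>y::real. ((max 0 y)\<^sup>2 - (max 0 0)\<^sup>2) / (y - 0)) \<longlongrightarrow> 0) (at 0)"
    proof (rule Lim_null_comparison[where g="\<lambda>y. \<bar>y\<bar>"])
      show "\<forall>\<^sub>F y in at 0. norm (((max 0 y)\<^sup>2 - (max 0 0)\<^sup>2) / (y - 0)) \<le> \<bar>y::real\<bar>"
        by (rule always_eventually) (auto simp: max_def power2_eq_square)
    qed (auto intro!: tendsto_eq_intros)
    then show ?thesis using equal by (simp add: has_field_derivative_iff)
  qed
qed (intro continuous_intros)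

context compact_riemannian
begin

text \<open>The vector field dual to \<open>A\<close>, weighted with the density and multiplied by
  \<open>f\<close>, has components \<open>\<psi> i\<close> that extend by zero to C1 functions of
  compact support. Since \<open>A\<close> is co-closed, the divergence is the density times the
  pairing, and a compactly supported divergence integrates to zero.\<close>

lemma integral_pair_local:
  fixes f :: "'a \<Rightarrow> complex"
  assumes A: "one_form \<A> A" "co_closed \<A> h A" and f: "C1 f"
    and c: "c \<in> \<A>" and K: "compact K" "K \<subseteq> chart_im c"
    and supp: "\<And>p. p \<in> topspace X \<Longrightarrow> p \<notin> chart_inv c ` K \<Longrightarrow> f p = 0"
  shows "(\<integral>p. pair (diff_fun f) (complexify A) p \<partial>\<mu>) = 0"
proof -
  let ?N = "pair (diff_fun f) (complexify A)"
  define F where "F y = f (chart_inv c y)" for y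
  define G where "G i y = sqrt (det (h c (chart_inv c y))) * (matrix_inv (h c (chart_inv c y)) *v A c (chart_inv c y)) $ i" for i y
  define \<psi> where "\<psi> i y = (if y \<in> chart_im c then F y * complex_of_real (G i y) else 0)" for i y
  have cof: "cofield (diff_fun f)" "cofield (complexify A)" by (intro cofield_diff_fun cofield_complexify f A)+
  have im: "open (chart_im c)" by (rule chart_im_open[OF c])
  have nK: "open (- K)" using K(1) by (simp add: compact_imp_closed open_Compl)
  \<comment> \<open>The compact set is closed because the space is Hausdorff, so \<open>f\<close>
    vanishes on an open neighbourhood of \<open>p\<close> and its differential at \<open>p\<close>
    is zero as well.\<close>
  have N0: "?N p = 0" if p: "p \<in> topspace X" "p \<notin> chart_inv c ` K" for p
  proof -
    let ?c = "chart_at \<A> p"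
    have c': "?c \<in> \<A>" "p \<in> chart_dom ?c" using chart_at[OF p(1)] by auto
    let ?U = "topspace X - chart_inv c ` K"
    have "openin X ?U" using chart_inv_compact(2)[OF c K] by blast
    then have V: "open (chart_map ?c ` (?U \<inter> chart_dom ?c))" by (rule chart_map_open[OF c'(1)])
    have "frechet_derivative (\<lambda>y. f (chart_inv ?c y)) (at (chart_map ?c p)) = (\<lambda>_. 0)"
      by (rule frechet_derivative_zero_open[OF V]) (use p c' supp in auto)
    then have "diff_fun f ?c p = 0" by (simp add: vec_eq_iff diff_fun_nth c')
    then show ?thesis by (simp add: pair_def herm_def)
  qed
  have FK: "F y = 0" if "y \<in> chart_im c" "y \<notin> K" for y
  proof -
    have "chart_inv c y \<notin> chart_inv c ` K"
    proof
      assume "chart_inv c y \<in> chart_inv c ` K"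
      then obtain z where "z \<in> K" "chart_inv c y = chart_inv c z" by blast
      then have "y = z" using that K(2) chart_map_inv by (metis subsetD)
      then show False using \<open>z \<in> K\<close> that by simp
    qed
    then show ?thesis unfolding F_def using supp chart_inv_in_space[OF c that(1)] by blast
  qed
  have C1F: "C1_on (chart_im c) F" unfolding F_def[abs_def] by (rule C1_D[OF f c])
  have C1G: "C1_on (chart_im c) (G i)" for i
    unfolding G_def[abs_def] matrix_vector_mult_def vec_lambda_beta
    by (intro C1_on_mult C1_on_sum C1_on_det_metric C1_on_inv_metric one_form_C1_on(2)[OF A(1)] c)
  have C1cG: "C1_on (chart_im c) (\<lambda>y. complex_of_real (G i y))" for i
    by (rule C1_on_bounded_linear[OF bounded_linear_of_real C1G])
  have "chart_im c \<union> - K = UNIV" using K(2) by auto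
  moreover have "C1_on (chart_im c \<union> - K) (\<psi> i)" for i
  proof (rule C1_on_Un[OF _ _ im nK])
    show "C1_on (chart_im c) (\<psi> i)"
      by (rule C1_on_cong[OF C1_on_mult[OF C1F C1cG[of i]] im]) (simp add: \<psi>_def)
    show "C1_on (- K) (\<psi> i)"
      by (rule C1_on_cong[OF C1_on_const[of _ 0] nK]) (auto simp: \<psi>_def FK)
  qed
  ultimately have C1\<psi>: "C1_on UNIV (\<psi> i)" for i by simp
  obtain R where R: "\<And>y. y \<in> K \<Longrightarrow> norm y \<le> R" using compact_imp_bounded[OF K(1)] bounded_iff by blast
  have supp\<psi>: "\<psi> i y = 0" if "R < norm y" for i y
    using R[of y] that FK[of y] by (auto simp: \<psi>_def)
  \<comment> \<open>By the product rule, differentiating the weighted vector field gives the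
    codifferential, which is zero, and differentiating \<open>F\<close> gives the pairing.\<close>
  have sum: "(\<Sum>i\<in>UNIV. frechet_derivative (\<psi> i) (at y) (axis i 1)) =
      indicator (chart_im c) y *\<^sub>R (dens c y *\<^sub>R ?N (chart_inv c y))" for y
  proof (cases "y \<in> chart_im c")
    case False
    then have y: "y \<in> - K" using K(2) by blast
    have "frechet_derivative (\<psi> i) (at y) = (\<lambda>_. 0)" for i
      by (rule frechet_derivative_zero_open[OF nK y]) (auto simp: \<psi>_def FK)
    then show ?thesis using False by simp
  next
    case y: True
    let ?p = "chart_inv c y"
    have p: "?p \<in> chart_dom c" using y by simp
    have D: "frechet_derivative (\<psi> i) (at y) v =
      F y * complex_of_real (frechet_derivative (G i) (at y) v) + frechet_derivative F (at y) v * complex_of_real (G i y)" for i v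
    proof -
      have "((\<lambda>y. F y * complex_of_real (G i y)) has_derivative
        (\<lambda>v. F y * complex_of_real (frechet_derivative (G i) (at y) v) + frechet_derivative F (at y) v * complex_of_real (G i y))) (at y)"
        by (rule has_derivative_mult[OF C1_on_has_derivative[OF C1F y]
            bounded_linear.has_derivative[OF bounded_linear_of_real C1_on_has_derivative[OF C1G y]]])
      then have "(\<psi> i has_derivative
        (\<lambda>v. F y * complex_of_real (frechet_derivative (G i) (at y) v) + frechet_derivative F (at y) v * complex_of_real (G i y))) (at y)"
        by (rule has_derivative_transform_within_open[OF _ im y]) (simp add: \<psi>_def)
      from frechet_derivative_at[OF this, symmetric] show ?thesis by simp
    qed
    have "codiff h A c ?p = 0" using A(2) c p unfolding co_closed_def by blast
    then have div: "(\<Sum>i\<in>UNIV. frechet_derivative (G i) (at y) (axis i 1)) = 0"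
      using dens_pos[OF c y] y by (simp add: codiff_def partial_deriv_def Let_def G_def[abs_def] dens_def)
    have "(\<Sum>i\<in>UNIV. frechet_derivative (\<psi> i) (at y) (axis i 1)) =
        F y * complex_of_real (\<Sum>i\<in>UNIV. frechet_derivative (G i) (at y) (axis i 1)) +
        (\<Sum>i\<in>UNIV. frechet_derivative F (at y) (axis i 1) * complex_of_real (G i y))"
      by (simp add: D sum.distrib sum_distrib_left)
    also have "\<dots> = (\<Sum>i\<in>UNIV. diff_fun f c ?p $ i * complex_of_real (G i y))"
      unfolding div using y c by (simp add: diff_fun_nth F_def[abs_def])
    also have "\<dots> = dens c y *\<^sub>R herm (matrix_inv (h c ?p)) (diff_fun f c ?p) (complexify A c ?p)"
      by (simp add: G_def herm_def complexify_def matrix_vector_mult_def dens_def scaleR_conv_of_real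
          sum_distrib_left sum_distrib_right mult_ac)
    also have "\<dots> = dens c y *\<^sub>R ?N ?p" using pair_eq[OF cof c p] by simp
    finally show ?thesis using y by simp
  qed
  have "(\<integral>p. ?N p \<partial>\<mu>) = (\<integral>y. indicator (chart_im c) y *\<^sub>R (dens c y *\<^sub>R ?N (chart_inv c y)) \<partial>lborel)"
  proof (rule integral_volume_chart[OF c])
    show "?N \<in> borel_measurable borel_space" by (intro cont_measurable cont_pair cof)
    show "?N p = 0" if "p \<in> topspace X" "p \<notin> chart_dom c" for p
      using that K(2) by (intro N0) auto
  qed
  also have "\<dots> = (\<integral>y. (\<Sum>i\<in>UNIV. frechet_derivative (\<psi> i) (at y) (axis i 1)) \<partial>lborel)"
    by (simp only: sum)
  also have "\<dots> = (\<Sum>i\<in>UNIV. \<integral>y. frechet_derivative (\<psi> i) (at y) (axis i 1) \<partial>lborel)"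
    by (rule Bochner_Integration.integral_sum) (rule integrable_directional_derivative[OF C1\<psi> supp\<psi>])
  also have "\<dots> = 0"
    by (simp add: integral_directional_derivative[OF C1\<psi> supp\<psi>])
  finally show ?thesis .
qed

text \<open>The profile of \<open>C1_on_max_sq\<close> is applied to \<open>s\<^sup>2\<close> minus
  the squared coordinate distance. The support lies in a compact set, which is closed in the
  manifold; this makes the extension by zero C1 also where another chart leaves the domain of
  \<open>c\<close>.\<close>

lemma ex_bump:
  assumes "p \<in> topspace X"
  shows "\<exists>\<eta> :: 'a \<Rightarrow> real. C1 \<eta> \<and> (\<forall>q. 0 \<le> \<eta> q) \<and> 0 < \<eta> p \<and>
    (\<exists>c\<in>\<A>. \<exists>K. compact K \<and> K \<subseteq> chart_im c \<and> (\<forall>q\<in>topspace X. q \<notin> chart_inv c ` K \<longrightarrow> \<eta> q = 0))"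
proof -
  obtain c s where c: "c \<in> \<A>" "p \<in> chart_dom c" "0 < s" "cball (chart_map c p) s \<subseteq> chart_map c ` (topspace X \<inter> chart_dom c)"
    using coord_ball[OF openin_topspace assms] by blast
  define a where "a = chart_map c p"
  define b where "b y = (max 0 (s\<^sup>2 - (y - a) \<bullet> (y - a)))\<^sup>2" for y
  define \<eta> where "\<eta> q = (if q \<in> chart_dom c then b (chart_map c q) else 0)" for q
  let ?K = "cball a s"
  have K: "?K \<subseteq> chart_im c" using c(4) by (auto simp: chart_im_def a_def)
  have C1b: "C1_on UNIV b"
    unfolding b_def[abs_def]
    by (rule C1_on_compose[OF _ C1_on_max_sq])
      (intro C1_on_diff[of UNIV "\<lambda>_. s\<^sup>2"] C1_on_inner C1_on_const subset_UNIV
        C1_on_diff[of UNIV "\<lambda>y. y"] C1_on_linear[OF bounded_linear_ident])+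
  have b0: "b y = 0" if "y \<notin> ?K" for y
  proof -
    have "s < norm (y - a)" using that by (simp add: dist_norm norm_minus_commute)
    then have "s\<^sup>2 \<le> (y - a) \<bullet> (y - a)" using c(3) by (simp add: power_mono flip: power2_norm_eq_inner)
    then show ?thesis by (simp add: b_def)
  qed
  have supp: "\<eta> q = 0" if "q \<notin> chart_inv c ` ?K" for q
  proof (cases "q \<in> chart_dom c")
    case True
    have "chart_map c q \<notin> ?K"
      using that True c(1) by (metis chart_inv_map image_eqI)
    then show ?thesis using True by (simp add: \<eta>_def b0)
  qed (simp add: \<eta>_def)
  have "C1 \<eta>"
    unfolding C1_def
  proof
    fix c' assume c': "c' \<in> \<A>"
    show "C1_on (chart_im c') (\<lambda>y. \<eta> (chart_inv c' y))"
    proof (rule C1_on_Union)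
      fix y assume y: "y \<in> chart_im c'"
      show "\<exists>T. open T \<and> y \<in> T \<and> C1_on T (\<lambda>y. \<eta> (chart_inv c' y))"
      proof (cases "chart_inv c' y \<in> chart_dom c")
        case True
        have "C1_on (overlap c' c) (\<lambda>y. b (transition c' c y))"
          by (rule C1_on_compose[OF C1_on_transition[OF c' c(1)] C1b]) simp
        then have "C1_on (overlap c' c) (\<lambda>y. \<eta> (chart_inv c' y))"
          by (rule C1_on_cong[OF _ overlap_open[OF c' c(1)]])
            (simp add: overlap_iff[OF c'] \<eta>_def transition_def)
        moreover have "y \<in> overlap c' c" using y True by (simp add: overlap_iff[OF c'])
        ultimately show ?thesis using overlap_open[OF c' c(1)] by blast
      next
        case False
        let ?U = "topspace X - chart_inv c ` ?K"
        let ?T = "chart_map c' ` (?U \<inter> chart_dom c')"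
        have "openin X ?U" using chart_inv_compact(2)[OF c(1) compact_cball K] by blast
        then have T: "open ?T" by (rule chart_map_open[OF c'])
        have "chart_inv c' y \<notin> chart_inv c ` ?K" using False K by auto
        then have "chart_inv c' y \<in> ?U \<inter> chart_dom c'" using y c' chart_inv_in_space by simp
        then have "y \<in> ?T" using y by (metis chart_map_inv image_eqI)
        moreover have "C1_on ?T (\<lambda>y. \<eta> (chart_inv c' y))"
          by (rule C1_on_cong[OF C1_on_const[of _ 0] T]) (use c' supp in auto)
        ultimately show ?thesis using T by blast
      qed
    qed
  qed
  moreover have "0 \<le> \<eta> q" for q by (simp add: \<eta>_def b_def)
  moreover have "0 < \<eta> p" using c by (simp add: \<eta>_def b_def a_def)
  ultimately show ?thesis using c(1) K supp by (intro exI[of _ \<eta>]) (auto intro!: bexI[of _ c] exI[of _ ?K])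
qed

text \<open>A partition of unity reduces to the local case: \<open>f\<close> is a finite sum of
  functions supported in single charts, and the pairing is additive in the differential.\<close>

lemma integral_pair_diff_coclosed:
  fixes f :: "'a \<Rightarrow> complex"
  assumes A: "one_form \<A> A" "co_closed \<A> h A" and f: "C1 f"
  shows "(\<integral>p. pair (diff_fun f) (complexify A) p \<partial>\<mu>) = 0"
proof -
  let ?N = "\<lambda>f. pair (diff_fun f) (complexify A)"
  have "\<exists>\<eta> :: 'a \<Rightarrow> 'a \<Rightarrow> real. \<forall>p\<in>topspace X. C1 (\<eta> p) \<and> (\<forall>q. 0 \<le> \<eta> p q) \<and> 0 < \<eta> p p \<and>
    (\<exists>c\<in>\<A>. \<exists>K. compact K \<and> K \<subseteq> chart_im c \<and> (\<forall>q\<in>topspace X. q \<notin> chart_inv c ` K \<longrightarrow> \<eta> p q = 0))"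
    by (rule bchoice) (use ex_bump in simp)
  then obtain \<eta> :: "'a \<Rightarrow> 'a \<Rightarrow> real" where \<eta>: "\<forall>p\<in>topspace X. C1 (\<eta> p) \<and> (\<forall>q. 0 \<le> \<eta> p q) \<and> 0 < \<eta> p p \<and>
    (\<exists>c\<in>\<A>. \<exists>K. compact K \<and> K \<subseteq> chart_im c \<and> (\<forall>q\<in>topspace X. q \<notin> chart_inv c ` K \<longrightarrow> \<eta> p q = 0))" ..
  obtain P where P: "finite P" "P \<subseteq> topspace X" "topspace X = (\<Union>p\<in>P. {q \<in> topspace X. \<eta> p q \<in> {0<..}})"
  proof (rule finite_subcover[of "\<lambda>p. {q \<in> topspace X. \<eta> p q \<in> {0<..}}"])
    fix p assume p: "p \<in> topspace X"
    then have "cont (\<eta> p)" using \<eta> by (blast intro: C1_imp_cont)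
    then have "openin X {q \<in> topspace X. \<eta> p q \<in> {0<..}}" by (rule openin_Collect_cont) simp
    then show "openin X {q \<in> topspace X. \<eta> p q \<in> {0<..}} \<and> p \<in> {q \<in> topspace X. \<eta> p q \<in> {0<..}}"
      using p \<eta> by simp
  qed simp
  define S where "S q = (\<Sum>p\<in>P. \<eta> p q)" for q
  have S: "S q > 0" if q: "q \<in> topspace X" for q
  proof -
    have "q \<in> (\<Union>p\<in>P. {q \<in> topspace X. \<eta> p q \<in> {0<..}})" using q P(3) by simp
    then obtain p where p: "p \<in> P" "\<eta> p q > 0" by auto
    then show ?thesis unfolding S_def using P(1,2) \<eta> by (intro sum_pos2[of P p]) auto
  qed
  have C1S: "C1 S" unfolding S_def[abs_def] by (rule C1_sum) (use P \<eta> in blast)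
  \<comment> \<open>With \<open>f\<close> divided once by the sum \<open>S\<close> of the bumps, the
    products \<open>\<eta> p q *\<^sub>R g q\<close> add up to \<open>f\<close>, so the bumps
    themselves stay unnormalised.\<close>
  define g where "g q = inverse (S q) *\<^sub>R f q" for q
  have C1g: "C1 g"
    unfolding g_def[abs_def]
  proof (rule C1_scaleR[OF _ f])
    show "C1 (\<lambda>q. inverse (S q))"
      unfolding C1_def using C1S S chart_inv_in_space by (auto simp: C1_def intro!: C1_on_inverse less_imp_neq[symmetric])
  qed
  have C1\<eta>g: "C1 (\<lambda>q. \<eta> p q *\<^sub>R g q)" if "p \<in> P" for p
    by (rule C1_scaleR[OF _ C1g]) (use that P \<eta> in blast)
  have zero: "(\<integral>q. ?N (\<lambda>q. \<eta> p q *\<^sub>R g q) q \<partial>\<mu>) = 0" if p: "p \<in> P" for p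
  proof -
    have "\<exists>c\<in>\<A>. \<exists>K. compact K \<and> K \<subseteq> chart_im c \<and> (\<forall>q\<in>topspace X. q \<notin> chart_inv c ` K \<longrightarrow> \<eta> p q = 0)"
      by (rule conjunct2[OF conjunct2[OF conjunct2[OF bspec[OF \<eta> subsetD[OF P(2) p]]]]])
    then show ?thesis
    proof (elim bexE exE conjE)
      fix c K assume cK: "c \<in> \<A>" "compact K" "K \<subseteq> chart_im c"
        and 0: "\<forall>q\<in>topspace X. q \<notin> chart_inv c ` K \<longrightarrow> \<eta> p q = 0"
      show ?thesis
      proof (rule integral_pair_local[OF A C1\<eta>g[OF p] cK])
        fix q assume q: "q \<in> topspace X" "q \<notin> chart_inv c ` K"
        have "\<eta> p q = 0" by (rule mp[OF bspec[OF 0 q(1)] q(2)])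
        then show "\<eta> p q *\<^sub>R g q = 0" by simp
      qed
    qed
  qed
  \<comment> \<open>Additivity of the differential is available for two C1 functions, so the finite
    sum is built up by induction over subsets of \<open>P\<close>.\<close>
  have "(\<integral>q. ?N (\<lambda>q. \<Sum>p\<in>Q. \<eta> p q *\<^sub>R g q) q \<partial>\<mu>) = 0" if "finite Q" "Q \<subseteq> P" for Q
    using that
  proof (induction Q)
    case empty
    have "?N (\<lambda>q. \<Sum>p\<in>{}. \<eta> p q *\<^sub>R g q) q = 0" for q
      by (simp add: pair_def herm_def diff_fun_def partial_deriv_def o_def frechet_derivative_const)
    then show ?case by simp
  next
    case (insert p Q)
    let ?u = "\<lambda>q. \<eta> p q *\<^sub>R g q" and ?v = "\<lambda>q. \<Sum>p\<in>Q. \<eta> p q *\<^sub>R g q"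
    have u: "C1 ?u" using insert.prems by (intro C1\<eta>g) simp
    have v: "C1 ?v" using insert.prems by (intro C1_sum C1\<eta>g) auto
    have "?N (\<lambda>q. ?u q + ?v q) q = ?N ?u q + ?N ?v q" if "q \<in> topspace X" for q
      using chart_at[OF that] by (simp add: pair_def Let_def diff_fun_add[OF u v] herm_add_left)
    then have "(\<integral>q. ?N (\<lambda>q. ?u q + ?v q) q \<partial>\<mu>) = (\<integral>q. ?N ?u q + ?N ?v q \<partial>\<mu>)"
      by (intro Bochner_Integration.integral_cong) auto
    also have "\<dots> = (\<integral>q. ?N ?u q \<partial>\<mu>) + (\<integral>q. ?N ?v q \<partial>\<mu>)"
      by (intro Bochner_Integration.integral_add cont_integrable cont_pair cofield_diff_fun cofield_complexify u v A)
    also have "\<dots> = 0" using zero insert by simp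
    finally show ?case using insert.hyps by simp
  qed
  from this[OF P(1) subset_refl] have "(\<integral>q. ?N (\<lambda>q. \<Sum>p\<in>P. \<eta> p q *\<^sub>R g q) q \<partial>\<mu>) = 0" .
  moreover have "?N (\<lambda>q. \<Sum>p\<in>P. \<eta> p q *\<^sub>R g q) q = ?N f q" if "q \<in> topspace X" for q
  proof -
    have "(\<Sum>p\<in>P. \<eta> p q *\<^sub>R g q) = f q" if "q \<in> topspace X" for q
    proof -
      have "(\<Sum>p\<in>P. \<eta> p q *\<^sub>R g q) = S q *\<^sub>R g q" by (simp only: S_def scaleR_sum_left)
      then show ?thesis using S[OF that] by (simp add: g_def)
    qed
    then have "diff_fun (\<lambda>q. \<Sum>p\<in>P. \<eta> p q *\<^sub>R g q) (chart_at \<A> q) q = diff_fun f (chart_at \<A> q) q"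
      by (intro diff_fun_cong[OF f]) (use chart_at[OF that] in simp_all)
    then show ?thesis by (simp only: pair_def Let_def)
  qed
  then have "(\<integral>q. ?N (\<lambda>q. \<Sum>p\<in>P. \<eta> p q *\<^sub>R g q) q \<partial>\<mu>) = (\<integral>q. ?N f q \<partial>\<mu>)"
    by (intro Bochner_Integration.integral_cong) simp_all
  ultimately show ?thesis by simp
qed

end

section \<open>The Poincare inequality on the manifold\<close>

lemma norm_add_sq_le: "(norm (x + y))\<^sup>2 \<le> 2 * (norm x)\<^sup>2 + 2 * (norm y)\<^sup>2" for x y :: "'a::real_normed_vector"
proof -
  have "(norm (x + y))\<^sup>2 \<le> (norm x + norm y)\<^sup>2" by (intro power_mono norm_triangle_ineq) simp
  also have "\<dots> \<le> 2 * (norm x)\<^sup>2 + 2 * (norm y)\<^sup>2"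
    using zero_le_power2[of "norm x - norm y"] by (simp add: power2_eq_square algebra_simps)
  finally show ?thesis .
qed

lemma norm_vec_sq: "(norm x)\<^sup>2 = (\<Sum>i\<in>UNIV. (norm (x $ i))\<^sup>2)" for x :: "'a::real_normed_vector^'n"
  by (simp add: norm_vec_def L2_set_def sum_nonneg)

lemma grad_sq_vec:
  fixes f :: "real^'n \<Rightarrow> 'f::real_normed_vector"
  shows "grad_sq f y = (\<Sum>i\<in>UNIV. (norm (frechet_derivative f (at y) (axis i 1)))\<^sup>2)"
  unfolding grad_sq_def
  by (subst sum.reindex_bij_betw[where h="\<lambda>i. axis i 1" and S=UNIV, symmetric])
    (auto simp: bij_betw_def inj_on_def axis_eq_axis Basis_vec_def)

context compact_riemannian
begin

text \<open>By homogeneity it suffices to look at unit covectors, and a positive continuous function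
  on the compact product of ball and sphere has a positive minimum. The density is included because
  the energies to be compared are integrals over coordinates.\<close>

lemma elliptic:
  assumes c: "c \<in> \<A>" and s: "0 < s" "cball a s \<subseteq> chart_im c"
  shows "\<exists>e>0. \<forall>y\<in>cball a s. \<forall>\<xi>. e * (norm \<xi>)\<^sup>2 \<le> Re (herm (matrix_inv (h c (chart_inv c y))) \<xi> \<xi>) * dens c y"
proof -
  let ?S = "cball a s \<times> sphere (0 :: complex^'n) 1"
  let ?\<Phi> = "\<lambda>y \<xi>. Re (herm (matrix_inv (h c (chart_inv c y))) \<xi> \<xi>) * dens c y"
  have sub: "fst ` ?S \<subseteq> chart_im c" using s(2) by auto
  have cf: "continuous_on ?S fst" by (intro continuous_intros)
  have "continuous_on ?S (\<lambda>p. ?\<Phi> (fst p) (snd p))"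
    unfolding herm_def
    by (intro continuous_intros continuous_on_compose2[OF C1_on_imp_continuous_on[OF C1_on_inv_metric[OF c]] cf sub]
      continuous_on_compose2[OF continuous_on_dens[OF c] cf sub])
  moreover have "compact ?S" by (intro compact_Times compact_cball compact_sphere)
  moreover have "(a, axis undefined 1) \<in> ?S" using s(1)
    by (simp add: norm_vec_def L2_set_def axis_def if_distrib[of cmod] if_distrib[of "\<lambda>x. x\<^sup>2"] cong: if_cong)
  ultimately obtain p where p: "p \<in> ?S" "\<forall>q\<in>?S. ?\<Phi> (fst p) (snd p) \<le> ?\<Phi> (fst q) (snd q)"
    using continuous_attains_inf[of ?S "\<lambda>p. ?\<Phi> (fst p) (snd p)"] by blast
  let ?e = "?\<Phi> (fst p) (snd p)"
  have im: "fst p \<in> chart_im c" using p(1) s(2) by auto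
  have "snd p \<noteq> 0" using p(1) by auto
  then have "?e > 0"
    by (intro mult_pos_pos herm_matrix_inv_pos pos_def_metric[OF c] dens_pos[OF c]) (use im in auto)
  moreover have "?e * (norm \<xi>)\<^sup>2 \<le> ?\<Phi> y \<xi>" if y: "y \<in> cball a s" for y \<xi>
  proof (cases "\<xi> = 0")
    case False
    define \<zeta> where "\<zeta> = complex_of_real (1 / norm \<xi>) *s \<xi>"
    have "\<zeta> = (1 / norm \<xi>) *\<^sub>R \<xi>" by (simp add: \<zeta>_def vec_eq_iff scaleR_conv_of_real[where 'a=complex])
    then have "norm \<zeta> = 1" using False by simp
    then have "(y, \<zeta>) \<in> ?S" using y by simp
    then have le: "?e \<le> ?\<Phi> y \<zeta>" using p(2) by fastforce
    have \<xi>: "\<xi> = complex_of_real (norm \<xi>) *s \<zeta>" using False by (simp add: \<zeta>_def vec_eq_iff)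
    have eq: "?\<Phi> y \<xi> = (norm \<xi>)\<^sup>2 * ?\<Phi> y \<zeta>"
      by (subst (1 2) \<xi>) (simp add: herm_scale_left herm_scale_right power2_eq_square)
    have "?e * (norm \<xi>)\<^sup>2 \<le> ?\<Phi> y \<zeta> * (norm \<xi>)\<^sup>2" by (rule mult_right_mono[OF le]) simp
    then show ?thesis unfolding eq by (simp only: mult.commute)
  qed (simp add: herm_def)
  ultimately show ?thesis by blast
qed

lemma dens_bounds:
  assumes c: "c \<in> \<A>" and s: "0 < s" "cball a s \<subseteq> chart_im c"
  shows "\<exists>d>0. \<exists>D>0. \<forall>y\<in>cball a s. d \<le> dens c y \<and> dens c y \<le> D"
proof -
  have cont: "continuous_on (cball a s) (dens c)"
    using continuous_on_subset[OF continuous_on_dens[OF c] s(2)] .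
  obtain y0 where y0: "y0 \<in> cball a s" "\<forall>y\<in>cball a s. dens c y \<le> dens c y0"
    using continuous_attains_sup[OF compact_cball _ cont] s by force
  obtain y1 where y1: "y1 \<in> cball a s" "\<forall>y\<in>cball a s. dens c y1 \<le> dens c y"
    using continuous_attains_inf[OF compact_cball _ cont] s by force
  have "dens c y0 > 0" "dens c y1 > 0" using dens_pos[OF c] y0(1) y1(1) s(2) by auto
  then show ?thesis using y0 y1 by blast
qed

text \<open>The chaining form of connectedness: a set that swallows every suitable neighbourhood
  which it meets is open, and so is its complement.\<close>

lemma connected_induct:
  assumes S: "S \<subseteq> topspace X" "S \<noteq> {}"
    and loc: "\<And>p. p \<in> topspace X \<Longrightarrow> \<exists>V. openin X V \<and> p \<in> V \<and> (V \<inter> S \<noteq> {} \<longrightarrow> V \<subseteq> S)"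
  shows "S = topspace X"
proof -
  have "openin X S"
    by (subst openin_subopen) (use loc S(1) in blast)
  moreover have "openin X (topspace X - S)"
  proof (subst openin_subopen, intro ballI)
    fix p assume p: "p \<in> topspace X - S"
    then obtain V where "openin X V" "p \<in> V" "V \<inter> S \<noteq> {} \<longrightarrow> V \<subseteq> S" using loc by blast
    then show "\<exists>T. openin X T \<and> p \<in> T \<and> T \<subseteq> topspace X - S"
      using p openin_subset by (intro exI[of _ V]) blast
  qed
  ultimately show ?thesis
    using connected S unfolding connected_space_clopen_in closedin_def by blast
qed

abbreviation energy :: "('a \<Rightarrow> complex) \<Rightarrow> real" where
  "energy f \<equiv> (\<integral>p. conorm_sq \<A> h (diff_fun f) p \<partial>\<mu>)"

text \<open>The constant \<open>m\<close> may depend on \<open>f\<close>, but \<open>C\<close> may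
  not. The right side is the energy over the whole manifold although the left side only sees
  \<open>U\<close>; so a union changes nothing but the constant.\<close>

definition poincare_on :: "'a set \<Rightarrow> bool" where
  "poincare_on U \<longleftrightarrow> (\<exists>C\<ge>0. \<forall>f. C1 f \<longrightarrow>
    (\<exists>m. (\<integral>p. indicator U p * (cmod (f p - m))\<^sup>2 \<partial>\<mu>) \<le> C * energy f))"

lemma cont_dist_sq: "cont f \<Longrightarrow> cont (\<lambda>p. (cmod (f p - m))\<^sup>2)"
  by (rule cont_compose) (auto intro!: continuous_intros)

lemma integrable_indicator_cont:
  fixes g :: "'a \<Rightarrow> real"
  assumes "openin X U" "cont g"
  shows "integrable \<mu> (\<lambda>p. indicator U p * g p)"
  using integrable_mult_indicator[OF _ cont_integrable[OF assms(2)], of U] assms(1) by simp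

lemma conorm_nonneg: "p \<in> topspace X \<Longrightarrow> 0 \<le> conorm_sq \<A> h \<xi> p"
  by (simp add: conorm_sq_eq pair_nonneg)

lemma energy_nonneg: "0 \<le> energy f"
  by (intro integral_nonneg_AE AE_I2) (simp add: conorm_nonneg)

text \<open>For functions that are controlled on one coordinate ball only, such as local potentials;
  off the ball \<open>g\<close> is arbitrary.\<close>

lemma measurable_on_coord_ball:
  fixes g :: "'a \<Rightarrow> real"
  assumes c: "c \<in> \<A>" and b: "ball a s \<subseteq> chart_im c" and g: "continuous_on (ball a s) (\<lambda>y. g (chart_inv c y))"
  shows "(\<lambda>q. indicator (chart_inv c ` ball a s) q *\<^sub>R g q) \<in> borel_measurable borel_space"
proof (rule borel_measurableI)
  let ?U = "chart_inv c ` ball a s"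
  fix T :: "real set" assume T: "open T"
  note U = coord_ball_open[OF c b]
  have "open (ball a s \<inter> (\<lambda>y. g (chart_inv c y)) -` T)"
    by (rule continuous_open_preimage[OF g _ T]) simp
  from chart_inv_open[OF c this] have V: "openin X (chart_inv c ` (ball a s \<inter> (\<lambda>y. g (chart_inv c y)) -` T))"
    using b by (simp add: Int_absorb2 le_infI1)
  have "(\<lambda>q. indicator ?U q *\<^sub>R g q) -` T \<inter> space borel_space =
      chart_inv c ` (ball a s \<inter> (\<lambda>y. g (chart_inv c y)) -` T) \<union> (if 0 \<in> T then topspace X - ?U else {})"
  proof (rule set_eqI)
    fix x
    show "x \<in> (\<lambda>q. indicator ?U q *\<^sub>R g q) -` T \<inter> space borel_space \<longleftrightarrow>
      x \<in> chart_inv c ` (ball a s \<inter> (\<lambda>y. g (chart_inv c y)) -` T) \<union> (if 0 \<in> T then topspace X - ?U else {})"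
    proof (cases "x \<in> ?U")
      case True
      then have "x \<in> topspace X" using openin_subset[OF U(1)] by blast
      moreover have "x \<in> chart_inv c ` (ball a s \<inter> (\<lambda>y. g (chart_inv c y)) -` T) \<longleftrightarrow> g x \<in> T"
        using True by blast
      ultimately show ?thesis using True by simp
    next
      case False
      then have "x \<notin> chart_inv c ` (ball a s \<inter> (\<lambda>y. g (chart_inv c y)) -` T)" by blast
      then show ?thesis using False by simp
    qed
  qed
  also have "\<dots> \<in> sets borel_space"
  proof (cases "0 \<in> T")
    case True
    have "topspace X - ?U \<in> sets borel_space"
      using sets.compl_sets[OF openin_sets[OF U(1)]] by simp
    then show ?thesis using V True by (simp add: sets.Un)
  qed (use V in simp)
  finally show "(\<lambda>q. indicator ?U q *\<^sub>R g q) -` T \<inter> space borel_space \<in> sets borel_space" .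
qed

text \<open>On the ball the differential of \<open>f\<close> may be the restriction of any global
  covector field \<open>\<xi>\<close>. Thus the estimate covers both functions on the manifold and
  local potentials of a form, with the global norm of the form on the right.\<close>

lemma chart_ball_poincare:
  assumes c: "c \<in> \<A>" and s: "0 < s" and im: "cball a s \<subseteq> chart_im c"
  shows "\<exists>C\<ge>0. \<forall>(f :: 'a \<Rightarrow> complex) \<xi>. C1_on (ball a s) (\<lambda>y. f (chart_inv c y)) \<longrightarrow> cofield \<xi> \<longrightarrow>
    (\<forall>y\<in>ball a s. \<forall>i. frechet_derivative (\<lambda>y. f (chart_inv c y)) (at y) (axis i 1) = \<xi> c (chart_inv c y) $ i) \<longrightarrow>
    (\<exists>m. (\<integral>\<^sup>+q\<in>chart_inv c ` ball a s. ennreal ((cmod (f q - m))\<^sup>2) \<partial>\<mu>) \<le> ennreal (C * (\<integral>p. conorm_sq \<A> h \<xi> p \<partial>\<mu>)))"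
proof -
  let ?B = "ball a s" and ?U = "chart_inv c ` ball a s"
  have b: "?B \<subseteq> chart_im c" using im ball_subset_cball by blast
  note U = coord_ball_open[OF c b]
  obtain e where e: "e > 0" "\<forall>y\<in>cball a s. \<forall>\<xi>. e * (norm \<xi>)\<^sup>2 \<le> Re (herm (matrix_inv (h c (chart_inv c y))) \<xi> \<xi>) * dens c y"
    using elliptic[OF c s im] by blast
  obtain D where D: "D > 0" "\<forall>y\<in>cball a s. dens c y \<le> D"
    using dens_bounds[OF c s im] by blast
  obtain K where K: "0 \<le> K" "\<And>f :: real^'n \<Rightarrow> complex. C1_on ?B f \<Longrightarrow>
      \<exists>m. (\<integral>\<^sup>+x\<in>?B. ennreal ((norm (f x - m))\<^sup>2) \<partial>lborel) \<le> ennreal K * (\<integral>\<^sup>+z\<in>?B. ennreal (grad_sq f z) \<partial>lborel)"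
    by (rule poincare_ball_mean[OF s, of a, where ?'b=complex]) blast
  show ?thesis
  \<comment> \<open>\<open>D\<close> bounds the density when passing to coordinates,
    \<open>K\<close> is the Euclidean constant, and \<open>e\<close> compares the Euclidean gradient
    with the Riemannian energy density on the way back.\<close>
  proof (intro exI[of _ "D * K / e"] conjI allI impI)
    show "0 \<le> D * K / e" using D(1) K(1) e(1) by simp
    fix f :: "'a \<Rightarrow> complex" and \<xi>
    define F where "F y = f (chart_inv c y)" for y
    assume "C1_on ?B (\<lambda>y. f (chart_inv c y))" and \<xi>: "cofield \<xi>"
      and "\<forall>y\<in>?B. \<forall>i. frechet_derivative (\<lambda>y. f (chart_inv c y)) (at y) (axis i 1) = \<xi> c (chart_inv c y) $ i"
    then have C1F: "C1_on ?B F" and dF: "\<And>y i. y \<in> ?B \<Longrightarrow> frechet_derivative F (at y) (axis i 1) = \<xi> c (chart_inv c y) $ i"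
      by (simp_all add: F_def[abs_def])
    let ?k = "conorm_sq \<A> h \<xi>" and ?E = "\<integral>p. conorm_sq \<A> h \<xi> p \<partial>\<mu>"
    have E0: "0 \<le> ?E" by (intro integral_nonneg_AE AE_I2) (simp add: conorm_nonneg)
    obtain m where m: "(\<integral>\<^sup>+x\<in>?B. ennreal ((norm (F x - m))\<^sup>2) \<partial>lborel) \<le> ennreal K * (\<integral>\<^sup>+z\<in>?B. ennreal (grad_sq F z) \<partial>lborel)"
      using K(2)[OF C1F] by blast
    have cF: "continuous_on ?B (\<lambda>y. (cmod (F y - m))\<^sup>2)"
      by (intro continuous_intros C1_on_imp_continuous_on[OF C1F])
    have cc: "cont ?k" by (intro cont_conorm_sq \<xi>)
    have grad: "ennreal (grad_sq F y) \<le> ennreal (1 / e) * (ennreal (?k (chart_inv c y)) * ennreal (dens c y))"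
      if y: "y \<in> ?B" for y
    proof -
      have yi: "y \<in> chart_im c" using y b by blast
      have "grad_sq F y = (norm (\<xi> c (chart_inv c y)))\<^sup>2"
        by (simp add: grad_sq_vec dF[OF y] norm_vec_sq)
      moreover have "?k (chart_inv c y) = Re (herm (matrix_inv (h c (chart_inv c y))) (\<xi> c (chart_inv c y)) (\<xi> c (chart_inv c y)))"
        using yi by (simp add: conorm_sq_eq pair_eq[OF \<xi> \<xi> c])
      ultimately have "e * grad_sq F y \<le> ?k (chart_inv c y) * dens c y"
        using e(2) y by simp
      then have "grad_sq F y \<le> (1 / e) * (?k (chart_inv c y) * dens c y)"
        using e(1) by (simp add: field_simps)
      then have "ennreal (grad_sq F y) \<le> ennreal ((1 / e) * (?k (chart_inv c y) * dens c y))"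
        by (rule ennreal_leI)
      also have "\<dots> = ennreal (1 / e) * (ennreal (?k (chart_inv c y)) * ennreal (dens c y))"
        using e(1) dens_pos[OF c yi] conorm_nonneg[OF chart_inv_in_space[OF c yi]]
        by (simp add: ennreal_mult[symmetric])
      finally show ?thesis .
    qed
    have "(\<integral>\<^sup>+q\<in>?U. ennreal ((cmod (f q - m))\<^sup>2) \<partial>\<mu>) = (\<integral>\<^sup>+q\<in>?U. ennreal (indicator ?U q *\<^sub>R (cmod (f q - m))\<^sup>2) \<partial>\<mu>)"
      by (intro nn_integral_cong) (simp add: indicator_def)
    also have "\<dots> = (\<integral>\<^sup>+y\<in>chart_map c ` ?U. ennreal (indicator ?U (chart_inv c y) *\<^sub>R (cmod (f (chart_inv c y) - m))\<^sup>2) * ennreal (dens c y) \<partial>lborel)"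
      by (rule nn_integral_volume_chart[OF c measurable_compose[OF measurable_on_coord_ball[OF c b] measurable_ennreal]
          openin_sets[OF U(1)] U(2)]) (use cF in \<open>simp add: F_def\<close>)
    also have "\<dots> \<le> (\<integral>\<^sup>+y. ennreal D * (ennreal ((norm (F y - m))\<^sup>2) * indicator ?B y) \<partial>lborel)"
      unfolding U(3) using D(2)
      by (intro nn_integral_mono) (auto simp: indicator_def F_def mult.commute[of "ennreal D"] intro!: mult_left_mono ennreal_leI)
    also have "\<dots> = ennreal D * (\<integral>\<^sup>+x\<in>?B. ennreal ((norm (F x - m))\<^sup>2) \<partial>lborel)"
    proof (rule nn_integral_cmult)
      have "(\<lambda>y. indicator ?B y *\<^sub>R (norm (F y - m))\<^sup>2) \<in> borel_measurable borel"
        by (intro borel_measurable_continuous_on_indicator cF) simp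
      from measurable_compose[OF this measurable_ennreal]
      have "(\<lambda>y. ennreal (indicator ?B y *\<^sub>R (norm (F y - m))\<^sup>2)) \<in> borel_measurable lborel" by simp
      moreover have "ennreal (indicator ?B y *\<^sub>R (norm (F y - m))\<^sup>2) = ennreal ((norm (F y - m))\<^sup>2) * indicator ?B y" for y
        by (cases "y \<in> ?B") simp_all
      ultimately show "(\<lambda>y. ennreal ((norm (F y - m))\<^sup>2) * indicator ?B y) \<in> borel_measurable lborel"
        by (simp only:)
    qed
    also have "\<dots> \<le> ennreal D * (ennreal K * (\<integral>\<^sup>+z\<in>?B. ennreal (grad_sq F z) \<partial>lborel))"
      by (intro mult_left_mono m) simp
    also have "\<dots> \<le> ennreal D * (ennreal K * (\<integral>\<^sup>+y. ennreal (1 / e) * (ennreal (?k (chart_inv c y)) * ennreal (dens c y) * indicator ?B y) \<partial>lborel))"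
      using grad by (intro mult_left_mono nn_integral_mono) (auto simp: indicator_def)
    also have "(\<integral>\<^sup>+y. ennreal (1 / e) * (ennreal (?k (chart_inv c y)) * ennreal (dens c y) * indicator ?B y) \<partial>lborel)
      = ennreal (1 / e) * (\<integral>\<^sup>+y\<in>?B. ennreal (?k (chart_inv c y)) * ennreal (dens c y) \<partial>lborel)"
    proof (rule nn_integral_cmult)
      have cB: "continuous_on ?B (\<lambda>y. ?k (chart_inv c y))"
        using cc c continuous_on_subset[OF _ b] by (auto simp: cont_def)
      have "(\<lambda>y. indicator ?B y *\<^sub>R (?k (chart_inv c y) * dens c y)) \<in> borel_measurable borel"
        by (intro borel_measurable_continuous_on_indicator continuous_intros cB
            continuous_on_subset[OF continuous_on_dens[OF c] b]) simp
      from measurable_compose[OF this measurable_ennreal]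
      have "(\<lambda>y. ennreal (indicator ?B y *\<^sub>R (?k (chart_inv c y) * dens c y))) \<in> borel_measurable lborel" by simp
      moreover have "ennreal (indicator ?B y *\<^sub>R (?k (chart_inv c y) * dens c y)) =
        ennreal (?k (chart_inv c y)) * ennreal (dens c y) * indicator ?B y" for y
      proof (cases "y \<in> ?B")
        case True
        then have "y \<in> chart_im c" using b by blast
        then show ?thesis
          using True dens_pos[OF c] conorm_nonneg[OF chart_inv_in_space[OF c]]
          by (simp add: ennreal_mult less_imp_le)
      qed simp
      ultimately show "(\<lambda>y. ennreal (?k (chart_inv c y)) * ennreal (dens c y) * indicator ?B y) \<in> borel_measurable lborel"
        by simp
    qed
    also have "(\<integral>\<^sup>+y\<in>?B. ennreal (?k (chart_inv c y)) * ennreal (dens c y) \<partial>lborel)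
      = (\<integral>\<^sup>+p\<in>?U. ennreal (?k p) \<partial>\<mu>)"
      using nn_integral_volume_chart[OF c measurable_compose[OF cont_measurable[OF cc] measurable_ennreal]
          openin_sets[OF U(1)] U(2)]
      by (simp only: U(3))
    also have "\<dots> \<le> (\<integral>\<^sup>+p. ennreal (?k p) \<partial>\<mu>)"
      by (intro nn_integral_mono) (simp add: indicator_def)
    also have "\<dots> = ennreal ?E"
      by (rule nn_integral_eq_integral[OF cont_integrable[OF cc]]) (rule AE_I2, simp add: conorm_nonneg)
    finally have "(\<integral>\<^sup>+q\<in>?U. ennreal ((cmod (f q - m))\<^sup>2) \<partial>\<mu>) \<le> ennreal D * (ennreal K * (ennreal (1 / e) * ennreal ?E))"
      by (simp add: mult_left_mono)
    also have "\<dots> = ennreal (D * K / e * ?E)"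
      using D(1) K(1) e(1) E0 by (simp add: ennreal_mult[symmetric])
    finally show "\<exists>m. (\<integral>\<^sup>+q\<in>?U. ennreal ((cmod (f q - m))\<^sup>2) \<partial>\<mu>) \<le> ennreal (D * K / e * ?E)" ..
  qed
qed

lemma local_poincare:
  assumes "p \<in> topspace X"
  shows "\<exists>U. openin X U \<and> p \<in> U \<and> poincare_on U"
proof -
  obtain c s where c: "c \<in> \<A>" "p \<in> chart_dom c" "0 < s" "cball (chart_map c p) s \<subseteq> chart_map c ` (topspace X \<inter> chart_dom c)"
    using coord_ball[OF openin_topspace assms] by blast
  let ?B = "ball (chart_map c p) s" and ?U = "chart_inv c ` ball (chart_map c p) s"
  have im: "cball (chart_map c p) s \<subseteq> chart_im c" using c(4) by (auto simp: chart_im_def)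
  then have b: "?B \<subseteq> chart_im c" using ball_subset_cball by blast
  note U = coord_ball_open[OF c(1) b]
  have pU: "p \<in> ?U" using c by (intro image_eqI[of _ _ "chart_map c p"]) auto
  obtain C where C: "C \<ge> 0" "\<And>(f :: 'a \<Rightarrow> complex) \<xi>. C1_on ?B (\<lambda>y. f (chart_inv c y)) \<Longrightarrow> cofield \<xi> \<Longrightarrow>
    (\<forall>y\<in>?B. \<forall>i. frechet_derivative (\<lambda>y. f (chart_inv c y)) (at y) (axis i 1) = \<xi> c (chart_inv c y) $ i) \<Longrightarrow>
    \<exists>m. (\<integral>\<^sup>+q\<in>?U. ennreal ((cmod (f q - m))\<^sup>2) \<partial>\<mu>) \<le> ennreal (C * (\<integral>p. conorm_sq \<A> h \<xi> p \<partial>\<mu>))"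
    using chart_ball_poincare[OF c(1,3) im] by blast
  have "\<exists>m. (\<integral>q. indicator ?U q * (cmod (f q - m))\<^sup>2 \<partial>\<mu>) \<le> C * energy f" if f: "C1 f" for f
  proof -
    have "\<exists>m. (\<integral>\<^sup>+q\<in>?U. ennreal ((cmod (f q - m))\<^sup>2) \<partial>\<mu>) \<le> ennreal (C * energy f)"
    proof (rule C(2)[OF C1_on_subset[OF C1_D[OF f c(1)] b] cofield_diff_fun[OF f]], intro ballI allI)
      fix y i assume "y \<in> ?B"
      then have "y \<in> chart_im c" using b by blast
      then show "frechet_derivative (\<lambda>y. f (chart_inv c y)) (at y) (axis i 1) = diff_fun f c (chart_inv c y) $ i"
        using c(1) by (simp add: diff_fun_nth)
    qed
    then obtain m where m: "(\<integral>\<^sup>+q\<in>?U. ennreal ((cmod (f q - m))\<^sup>2) \<partial>\<mu>) \<le> ennreal (C * energy f)" ..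
    have "ennreal (\<integral>q. indicator ?U q * (cmod (f q - m))\<^sup>2 \<partial>\<mu>) = (\<integral>\<^sup>+q. ennreal (indicator ?U q * (cmod (f q - m))\<^sup>2) \<partial>\<mu>)"
      by (rule nn_integral_eq_integral[symmetric, OF integrable_indicator_cont[OF U(1) cont_dist_sq[OF C1_imp_cont[OF f]]]]) simp
    also have "\<dots> = (\<integral>\<^sup>+q\<in>?U. ennreal ((cmod (f q - m))\<^sup>2) \<partial>\<mu>)"
      by (intro nn_integral_cong) (simp add: indicator_def)
    also note m
    finally have "(\<integral>q. indicator ?U q * (cmod (f q - m))\<^sup>2 \<partial>\<mu>) \<le> C * energy f"
      using C(1) energy_nonneg[of f] by (subst (asm) ennreal_le_iff) auto
    then show ?thesis ..
  qed
  then have "poincare_on ?U" unfolding poincare_on_def using C(1) by blast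
  then show ?thesis using U(1) pU by blast
qed

text \<open>On the overlap, which has positive volume, both constants are close to \<open>f\<close>
  in mean square. Hence they are close to each other, and one of them serves for the union.\<close>

lemma poincare_on_Un:
  assumes U: "openin X U" "poincare_on U" and V: "openin X V" "poincare_on V" and ne: "U \<inter> V \<noteq> {}"
  shows "poincare_on (U \<union> V)"
proof -
  obtain C1' where C1': "C1' \<ge> 0" "\<And>f. C1 f \<Longrightarrow> \<exists>m. (\<integral>p. indicator U p * (cmod (f p - m))\<^sup>2 \<partial>\<mu>) \<le> C1' * energy f"
    using U(2) unfolding poincare_on_def by blast
  obtain C2' where C2': "C2' \<ge> 0" "\<And>f. C1 f \<Longrightarrow> \<exists>m. (\<integral>p. indicator V p * (cmod (f p - m))\<^sup>2 \<partial>\<mu>) \<le> C2' * energy f"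
    using V(2) unfolding poincare_on_def by blast
  have UV: "openin X (U \<inter> V)" using U V by blast
  let ?o = "measure \<mu> (U \<inter> V)" and ?v = "measure \<mu> V"
  have o: "?o > 0" using emeasure_open_pos[OF UV ne] by (simp add: volume.emeasure_eq_measure)
  \<comment> \<open>The factor \<open>(2 * C1' + 2 * C2') / ?o\<close> bounds the squared distance
    of the two constants by the energy. Replacing \<open>m2\<close> by \<open>m1\<close> on
    \<open>V\<close> doubles \<open>C2'\<close> and adds twice the volume of \<open>V\<close> times
    that distance.\<close>
  let ?C = "C1' + 2 * C2' + 2 * ?v * ((2 * C1' + 2 * C2') / ?o)"
  show ?thesis
    unfolding poincare_on_def
  proof (intro exI[of _ ?C] conjI allI impI)
    show "0 \<le> ?C" using C1'(1) C2'(1) o by simp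
    fix f :: "'a \<Rightarrow> complex" assume f: "C1 f"
    obtain m1 where m1: "(\<integral>p. indicator U p * (cmod (f p - m1))\<^sup>2 \<partial>\<mu>) \<le> C1' * energy f" using C1'(2)[OF f] by blast
    obtain m2 where m2: "(\<integral>p. indicator V p * (cmod (f p - m2))\<^sup>2 \<partial>\<mu>) \<le> C2' * energy f" using C2'(2)[OF f] by blast
    let ?I = "\<lambda>W m. \<integral>p. indicator W p * (cmod (f p - m))\<^sup>2 \<partial>\<mu>"
    have int: "integrable \<mu> (\<lambda>p. indicator W p * (cmod (f p - m))\<^sup>2)" if "openin X W" for W m
      by (intro integrable_indicator_cont that cont_dist_sq C1_imp_cont f)
    let ?d = "(cmod (m1 - m2))\<^sup>2"
    have intc: "integrable \<mu> (\<lambda>p. indicator W p * ?d)" "(\<integral>p. indicator W p * ?d \<partial>\<mu>) = measure \<mu> W * ?d" if "openin X W" for W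
      using that integrable_indicator_cont[OF that cont_const] sets.sets_into_space[of W \<mu>] by (auto simp: Int_absorb2)
    have "?o * ?d = (\<integral>p. indicator (U \<inter> V) p * ?d \<partial>\<mu>)" by (rule intc(2)[OF UV, symmetric])
    also have "\<dots> \<le> (\<integral>p. 2 * (indicator U p * (cmod (f p - m1))\<^sup>2) + 2 * (indicator V p * (cmod (f p - m2))\<^sup>2) \<partial>\<mu>)"
    proof (rule integral_mono)
      show "indicator (U \<inter> V) p * ?d \<le> 2 * (indicator U p * (cmod (f p - m1))\<^sup>2) + 2 * (indicator V p * (cmod (f p - m2))\<^sup>2)" for p
        using norm_add_sq_le[of "f p - m2" "m1 - f p"] by (auto simp: indicator_def norm_minus_commute)
    qed (intro Bochner_Integration.integrable_add integrable_mult_right int U V intc UV)+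
    also have "\<dots> = 2 * ?I U m1 + 2 * ?I V m2"
      using int[OF U(1), of m1] int[OF V(1), of m2] by simp
    also have "\<dots> \<le> (2 * C1' + 2 * C2') * energy f" using m1 m2 by (simp add: distrib_right)
    finally have d: "?d \<le> (2 * C1' + 2 * C2') / ?o * energy f" using o by (simp add: field_simps)
    have "?I (U \<union> V) m1 \<le> (\<integral>p. indicator U p * (cmod (f p - m1))\<^sup>2 + (2 * (indicator V p * (cmod (f p - m2))\<^sup>2) + 2 * (indicator V p * ?d)) \<partial>\<mu>)"
    proof (rule integral_mono)
      show "indicator (U \<union> V) p * (cmod (f p - m1))\<^sup>2 \<le> indicator U p * (cmod (f p - m1))\<^sup>2 + (2 * (indicator V p * (cmod (f p - m2))\<^sup>2) + 2 * (indicator V p * ?d))" for p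
        using norm_add_sq_le[of "f p - m2" "m2 - m1"] by (auto simp: indicator_def norm_minus_commute)
    qed (intro Bochner_Integration.integrable_add integrable_mult_right int U V intc openin_Un)+
    also have "\<dots> = ?I U m1 + (2 * ?I V m2 + 2 * (?v * ?d))"
      using int[OF U(1), of m1] int[OF V(1), of m2] intc[OF V(1)] by simp
    also have "\<dots> \<le> C1' * energy f + (2 * (C2' * energy f) + 2 * (?v * ((2 * C1' + 2 * C2') / ?o * energy f)))"
      using m1 m2 mult_left_mono[OF d, of ?v] by (intro add_mono) auto
    also have "\<dots> = ?C * energy f" by (simp add: algebra_simps)
    finally show "\<exists>m. ?I (U \<union> V) m \<le> ?C * energy f" by blast
  qed
qed

text \<open>All sets of the final cover contain the point \<open>p0\<close>, so any two of them meet
  and they can be merged one at a time.\<close>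

lemma poincare_on_space: "poincare_on (topspace X)"
proof -
  obtain p0 where p0: "p0 \<in> topspace X" using nonempty by blast
  define S where "S = {q \<in> topspace X. \<exists>U. openin X U \<and> p0 \<in> U \<and> q \<in> U \<and> poincare_on U}"
  have "S = topspace X"
  proof (rule connected_induct)
    show "S \<noteq> {}" using local_poincare[OF p0] p0 by (auto simp: S_def)
    fix p assume "p \<in> topspace X"
    then obtain V where V: "openin X V" "p \<in> V" "poincare_on V" using local_poincare by blast
    have "V \<subseteq> S" if VS: "V \<inter> S \<noteq> {}"
    proof -
      from VS obtain q U where U: "q \<in> V" "openin X U" "p0 \<in> U" "q \<in> U" "poincare_on U" by (auto simp: S_def)
      have "poincare_on (U \<union> V)" by (rule poincare_on_Un) (use U V in auto)
      moreover have "openin X (U \<union> V)" using U V by blast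
      ultimately show ?thesis using U V openin_subset unfolding S_def by blast
    qed
    then show "\<exists>V. openin X V \<and> p \<in> V \<and> (V \<inter> S \<noteq> {} \<longrightarrow> V \<subseteq> S)" using V by blast
  qed (auto simp: S_def)
  then have "\<forall>q\<in>topspace X. \<exists>U. openin X U \<and> p0 \<in> U \<and> q \<in> U \<and> poincare_on U" by (auto simp: S_def)
  then have "\<exists>U. \<forall>q\<in>topspace X. openin X (U q) \<and> p0 \<in> U q \<and> q \<in> U q \<and> poincare_on (U q)" by (rule bchoice)
  then obtain U where U: "\<forall>q\<in>topspace X. openin X (U q) \<and> p0 \<in> U q \<and> q \<in> U q \<and> poincare_on (U q)" ..
  obtain P where P: "finite P" "P \<subseteq> topspace X" "topspace X = (\<Union>p\<in>P. U p)"
    by (rule finite_subcover[of U]) (use U in simp_all)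
  have "openin X (\<Union>p\<in>Q. U p) \<and> p0 \<in> (\<Union>p\<in>Q. U p) \<and> poincare_on (\<Union>p\<in>Q. U p)" if "finite Q" "Q \<noteq> {}" "Q \<subseteq> P" for Q
    using that
  proof (induction Q rule: finite_ne_induct)
    case (singleton q)
    then show ?case using U P(2) by auto
  next
    case (insert q Q)
    have q: "openin X (U q)" "p0 \<in> U q" "poincare_on (U q)" using insert.prems P(2) U by auto
    have Q: "openin X (\<Union>p\<in>Q. U p)" "p0 \<in> (\<Union>p\<in>Q. U p)" "poincare_on (\<Union>p\<in>Q. U p)" using insert by auto
    have "poincare_on (U q \<union> (\<Union>p\<in>Q. U p))" by (rule poincare_on_Un) (use q Q in auto)
    moreover have "openin X (U q \<union> (\<Union>p\<in>Q. U p))" using q Q by blast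
    ultimately show ?case using q by simp
  qed
  moreover have "P \<noteq> {}" using P(3) nonempty by auto
  ultimately show ?thesis using P by auto
qed

lemma poincare:
  "\<exists>C>0. \<forall>f. C1 f \<longrightarrow> (\<exists>m. (\<integral>p. (cmod (f p - m))\<^sup>2 \<partial>\<mu>) \<le> C * energy f)"
proof -
  obtain C where C: "C \<ge> 0" "\<And>f. C1 f \<Longrightarrow> \<exists>m. (\<integral>p. indicator (topspace X) p * (cmod (f p - m))\<^sup>2 \<partial>\<mu>) \<le> C * energy f"
    using poincare_on_space unfolding poincare_on_def by blast
  have "\<exists>m. (\<integral>p. (cmod (f p - m))\<^sup>2 \<partial>\<mu>) \<le> (C + 1) * energy f" if f: "C1 f" for f
  proof -
    obtain m where "(\<integral>p. indicator (topspace X) p * (cmod (f p - m))\<^sup>2 \<partial>\<mu>) \<le> C * energy f"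
      using C(2)[OF f] by blast
    moreover have "(\<integral>p. indicator (topspace X) p * (cmod (f p - m))\<^sup>2 \<partial>\<mu>) = (\<integral>p. (cmod (f p - m))\<^sup>2 \<partial>\<mu>)"
      by (intro Bochner_Integration.integral_cong) auto
    ultimately show ?thesis using energy_nonneg[of f] by (intro exI[of _ m]) (simp add: distrib_right)
  qed
  then show ?thesis using C(1) by (intro exI[of _ "C + 1"]) auto
qed

end

section \<open>Bounds for the lowest eigenvalue\<close>

lemma smooth_on_const: "smooth_on S (\<lambda>_. a)"
proof -
  have "Ck_on k S (\<lambda>_. a)" for k and a :: 'b
    by (induction k arbitrary: a) (simp_all add: frechet_derivative_const)
  then show ?thesis by (simp add: smooth_on_def)
qed

context compact_riemannian
begin

text \<open>By continuity the integrand is positive on a non-empty open set, and such sets have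
  positive volume.\<close>

lemma integral_pos_if_pos:
  fixes g :: "'a \<Rightarrow> real"
  assumes g: "cont g" and nn: "\<And>p. p \<in> topspace X \<Longrightarrow> 0 \<le> g p" and p: "p \<in> topspace X" "0 < g p"
  shows "0 < (\<integral>p. g p \<partial>\<mu>)"
proof -
  have ge: "0 \<le> (\<integral>p. g p \<partial>\<mu>)" by (intro integral_nonneg_AE AE_I2) (simp add: nn)
  have "(\<integral>p. g p \<partial>\<mu>) \<noteq> 0"
  proof
    assume "(\<integral>p. g p \<partial>\<mu>) = 0"
    moreover have "AE p in \<mu>. 0 \<le> g p" by (rule AE_I2) (simp add: nn)
    ultimately have AE: "AE p in \<mu>. g p = 0"
      using integral_nonneg_eq_0_iff_AE[OF cont_integrable[OF g]] by simp
    let ?U = "{q \<in> topspace X. g q \<in> {0<..}}"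
    have U: "openin X ?U" by (rule openin_Collect_cont[OF g]) simp
    have AE': "AE p in \<mu>. p \<notin> ?U" using AE by eventually_elim simp
    have eq: "{p \<in> space \<mu>. \<not> p \<notin> ?U} = ?U" by auto
    have S: "?U \<in> sets \<mu>" using U by simp
    have "emeasure \<mu> ?U = 0" by (rule iffD1[OF AE_iff_measurable[OF S eq] AE'])
    moreover have "?U \<noteq> {}" using p by auto
    ultimately show False using emeasure_open_pos[OF U] by simp
  qed
  then show ?thesis using ge by simp
qed

lemma l2_norm_sq: "(l2_norm X \<A> h A)\<^sup>2 = (\<integral>p. conorm_sq \<A> h (complexify A) p \<partial>\<mu>)"
  unfolding l2_norm_def
  by (rule real_sqrt_pow2) (intro integral_nonneg_AE AE_I2, simp add: conorm_nonneg)

lemma measure_space_vol: "measure \<mu> (topspace X) = vol X \<A> h"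
  by (simp add: vol_def)

lemma integral_const_vol: "(\<integral>p. (a :: real) \<partial>\<mu>) = vol X \<A> h * a"
  using lebesgue_integral_const[of \<mu> a] by (simp add: measure_space_vol)

text \<open>Brings the magnetic differential into the form of a sum to which the closure rules of
  \<open>cofield\<close> and the rules of \<open>pair\<close> apply.\<close>

lemma magnetic_diff_eq:
  "magnetic_diff (\<lambda>c p. r *\<^sub>R A c p) u =
    (\<lambda>c p. diff_fun u c p + (- (\<i> * complex_of_real r * u p)) *s complexify A c p)"
  by (simp add: fun_eq_iff vec_eq_iff magnetic_diff_def complexify_def algebra_simps)

lemma cofield_magnetic_diff:
  assumes "one_form \<A> A" "C1 u"
  shows "cofield (magnetic_diff (\<lambda>c p. r *\<^sub>R A c p) u)"
  unfolding magnetic_diff_eq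
proof (intro cofield_add cofield_diff_fun cofield_scale cofield_complexify assms)
  show "cont (\<lambda>p. - (\<i> * complex_of_real r * u p))"
    by (rule cont_compose[OF C1_imp_cont[OF assms(2)], where \<phi>="\<lambda>z. - (\<i> * complex_of_real r * z)"])
      (intro continuous_intros)
qed

lemma cont_cmod_sq: "cont u \<Longrightarrow> cont (\<lambda>p. (cmod (u p))\<^sup>2)"
  by (rule cont_compose) (auto intro!: continuous_intros)

lemma rayleigh_denominator_pos:
  assumes "C1 u" "p \<in> topspace X" "u p \<noteq> 0"
  shows "0 < (\<integral>p. (cmod (u p))\<^sup>2 \<partial>\<mu>)"
  by (rule integral_pos_if_pos[OF cont_cmod_sq[OF C1_imp_cont[OF assms(1)]] _ assms(2)]) (use assms in auto)

lemma rayleigh_nonneg: "0 \<le> rayleigh X \<A> h A u"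
  unfolding rayleigh_def
  by (intro divide_nonneg_nonneg integral_nonneg_AE AE_I2) (simp_all add: conorm_nonneg)

lemma rayleigh_one: "rayleigh X \<A> h (\<lambda>c p. r *\<^sub>R A c p) (\<lambda>_. 1) = (l2_norm X \<A> h A)\<^sup>2 / vol X \<A> h * r\<^sup>2"
proof -
  have 0: "diff_fun (\<lambda>_. 1) c p = 0" for c :: "('a, 'n) chart" and p
    by (simp add: diff_fun_def partial_deriv_def o_def frechet_derivative_const vec_eq_iff)
  have mag: "magnetic_diff (\<lambda>c p. r *\<^sub>R A c p) (\<lambda>_. 1) = (\<lambda>c p. (- (\<i> * complex_of_real r)) *s complexify A c p)"
    unfolding magnetic_diff_eq by (simp add: fun_eq_iff vec_eq_iff 0)
  have "conorm_sq \<A> h (magnetic_diff (\<lambda>c p. r *\<^sub>R A c p) (\<lambda>_. 1)) p = r\<^sup>2 * conorm_sq \<A> h (complexify A) p" for p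
    unfolding mag conorm_sq_eq pair_scale_left[where f="\<lambda>_. - (\<i> * complex_of_real r)"]
      pair_scale_right[where f="\<lambda>_. - (\<i> * complex_of_real r)"]
    by (simp add: power2_eq_square)
  then show ?thesis by (simp add: rayleigh_def l2_norm_sq measure_space_vol)
qed

lemma lambda1_upper:
  "lambda1 X \<A> h (\<lambda>c p. r *\<^sub>R A c p) \<le> (l2_norm X \<A> h A)\<^sup>2 / vol X \<A> h * r\<^sup>2"
  unfolding lambda1_def rayleigh_one[symmetric]
proof (rule cInf_lower)
  have "smooth_function \<A> (\<lambda>_. 1 :: complex)" by (simp add: smooth_function_def o_def smooth_on_const)
  then show "rayleigh X \<A> h (\<lambda>c p. r *\<^sub>R A c p) (\<lambda>_. 1)
      \<in> {rayleigh X \<A> h (\<lambda>c p. r *\<^sub>R A c p) u |u. smooth_function \<A> u \<and> (\<exists>p\<in>topspace X. u p \<noteq> 0)}"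
    using nonempty by fastforce
  show "bdd_below {rayleigh X \<A> h (\<lambda>c p. r *\<^sub>R A c p) u |u. smooth_function \<A> u \<and> (\<exists>p\<in>topspace X. u p \<noteq> 0)}"
    by (rule bdd_belowI[of _ 0]) (auto simp: rayleigh_nonneg)
qed

text \<open>The cross term with the constant part \<open>m\<close> of \<open>u = m + w\<close> vanishes because \<open>A\<close> is co-closed;
  the term linear in \<open>w\<close> is absorbed by the Poincare inequality at the price of \<open>O(r\<^sup>4)\<close>.\<close>

lemma magnetic_energy_lower:
  fixes u :: "'a \<Rightarrow> complex"
  assumes A: "one_form \<A> A" "co_closed \<A> h A" and u: "C1 u"
    and B: "B > 0" "\<And>p. p \<in> topspace X \<Longrightarrow> conorm_sq \<A> h (complexify A) p \<le> B"
    and P: "P > 0" "\<And>f. C1 f \<Longrightarrow> \<exists>m. (\<integral>p. (cmod (f p - m))\<^sup>2 \<partial>\<mu>) \<le> P * energy f"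
    and r: "r\<^sup>2 * B \<le> 1 / (8 * P)"
  shows "((l2_norm X \<A> h A)\<^sup>2 / vol X \<A> h * r\<^sup>2 - 8 * P * B\<^sup>2 * r ^ 4) * (\<integral>p. (cmod (u p))\<^sup>2 \<partial>\<mu>)
    \<le> (\<integral>p. conorm_sq \<A> h (magnetic_diff (\<lambda>c p. r *\<^sub>R A c p) u) p \<partial>\<mu>)"
proof -
  let ?V = "vol X \<A> h" and ?L = "(l2_norm X \<A> h A)\<^sup>2"
  let ?a = "conorm_sq \<A> h (complexify A)"
  have V: "?V > 0" by (rule vol_pos)
  \<comment> \<open>The mean of \<open>u\<close>, which makes \<open>w\<close> orthogonal to the
    constants.\<close>
  define m where "m = (1 / ?V) *\<^sub>R (\<integral>p. u p \<partial>\<mu>)"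
  define w where "w p = u p - m" for p
  have cu: "cont u" by (rule C1_imp_cont[OF u])
  have cw: "cont w" unfolding w_def[abs_def] by (intro cont_diff cu cont_const)
  have ca: "cont ?a" by (intro cont_conorm_sq cofield_complexify A)
  have cA: "cofield (complexify A)" and cdu: "cofield (diff_fun u)" by (intro cofield_complexify cofield_diff_fun A u)+
  have intc: "(\<integral>p. (a :: complex) \<partial>\<mu>) = ?V *\<^sub>R a" for a
    using lebesgue_integral_const[of \<mu> a] by (simp add: measure_space_vol)
  have w0: "(\<integral>p. w p \<partial>\<mu>) = 0"
  proof -
    have "(\<integral>p. w p \<partial>\<mu>) = (\<integral>p. u p \<partial>\<mu>) - (\<integral>p. m \<partial>\<mu>)"
      unfolding w_def by (rule Bochner_Integration.integral_diff) (intro cont_integrable cu cont_const)+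
    then show ?thesis using V by (simp add: m_def measure_space_vol)
  qed
  have w_lin: "(\<integral>p. Re (cnj k * w p) \<partial>\<mu>) = 0" for k
  proof -
    have "(\<integral>p. Re (cnj k * w p) \<partial>\<mu>) = Re (\<integral>p. cnj k * w p \<partial>\<mu>)"
      by (rule integral_Re) (intro cont_integrable cont_mult cont_const cw)
    then show ?thesis using w0 by simp
  qed
  have cRe: "cont (\<lambda>p. Re (cnj k * w p))" for k
    by (rule cont_compose[OF cw, where \<phi>="\<lambda>z. Re (cnj k * z)"]) (intro continuous_intros)
  \<comment> \<open>Pythagoras, since \<open>w\<close> has integral zero. It is used for the norm of
    \<open>u\<close> and for comparing the mean with other constants.\<close>
  have expand: "(\<integral>p. (cmod (w p + k))\<^sup>2 \<partial>\<mu>) = (\<integral>p. (cmod (w p))\<^sup>2 \<partial>\<mu>) + ?V * (cmod k)\<^sup>2" for k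
  proof -
    have "(cmod (w p + k))\<^sup>2 = (cmod (w p))\<^sup>2 + 2 * Re (cnj k * w p) + (cmod k)\<^sup>2" for p
      unfolding cmod_power2 by (simp add: power2_eq_square algebra_simps)
    then have "(\<integral>p. (cmod (w p + k))\<^sup>2 \<partial>\<mu>) = (\<integral>p. (cmod (w p))\<^sup>2 + 2 * Re (cnj k * w p) + (cmod k)\<^sup>2 \<partial>\<mu>)"
      by simp
    also have "\<dots> = (\<integral>p. (cmod (w p))\<^sup>2 \<partial>\<mu>) + (\<integral>p. 2 * Re (cnj k * w p) \<partial>\<mu>) + (\<integral>p. (cmod k)\<^sup>2 \<partial>\<mu>)"
      by (subst Bochner_Integration.integral_add
          | intro Bochner_Integration.integrable_add cont_integrable cont_cmod_sq cw cont_const cont_mult cRe)+ simp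
    finally show ?thesis unfolding integral_mult_right_zero w_lin by (simp add: measure_space_vol)
  qed
  define W where "W = (\<integral>p. (cmod (w p))\<^sup>2 \<partial>\<mu>)"
  define Q where "Q = energy u"
  have W0: "W \<ge> 0" unfolding W_def by (intro integral_nonneg_AE AE_I2) simp
  have norm_u: "(\<integral>p. (cmod (u p))\<^sup>2 \<partial>\<mu>) = W + ?V * (cmod m)\<^sup>2"
    using expand[of m] by (simp add: w_def W_def)
  \<comment> \<open>The Poincare inequality comes with an unspecified constant \<open>m'\<close>. By
    \<open>expand\<close> the mean is the best constant, so the inequality holds for it too.\<close>
  have WQ: "W \<le> P * Q"
  proof -
    obtain m' where m': "(\<integral>p. (cmod (u p - m'))\<^sup>2 \<partial>\<mu>) \<le> P * Q" using P(2)[OF u] unfolding Q_def by blast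
    have "(\<integral>p. (cmod (u p - m'))\<^sup>2 \<partial>\<mu>) = W + ?V * (cmod (m - m'))\<^sup>2"
      using expand[of "m - m'"] by (simp add: w_def W_def)
    moreover have "0 \<le> ?V * (cmod (m - m'))\<^sup>2" using V by simp
    ultimately show ?thesis using m' by linarith
  qed
  \<comment> \<open>Three error terms of size \<open>\<epsilon> * W\<close> occur: one each from
    \<open>xi_ge\<close> and \<open>cross\<close>, and one from the part \<open>W\<close> of the
    norm of \<open>u\<close>. The Poincare inequality bounds \<open>4 * \<epsilon> * W\<close> by
    \<open>Q / 2\<close>, which covers them.\<close>
  define \<epsilon> where "\<epsilon> = 1 / (8 * P)"
  have \<epsilon>: "\<epsilon> > 0" "r\<^sup>2 * B \<le> \<epsilon>" using P(1) r by (auto simp: \<epsilon>_def)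
  \<comment> \<open>The magnetic differential splits into \<open>\<xi>\<close> and the constant
    \<open>k\<close> times \<open>A\<close>. All terms with \<open>w\<close> are collected in
    \<open>\<xi>\<close>, and adding \<open>\<eta>\<close> to it gives back the differential of
    \<open>u\<close>.\<close>
  define \<eta> where "\<eta> = (\<lambda>c p. (\<i> * complex_of_real r * w p) *s complexify A c p)"
  define \<xi> where "\<xi> = (\<lambda>c p. diff_fun u c p + (- (\<i> * complex_of_real r * w p)) *s complexify A c p)"
  define k where "k = - (\<i> * complex_of_real r * m)"
  have cscal: "cont (\<lambda>p. - (\<i> * complex_of_real r * w p))"
    by (rule cont_compose[OF cw, where \<phi>="\<lambda>z. - (\<i> * complex_of_real r * z)"]) (intro continuous_intros)
  have cxi: "cofield \<xi>" unfolding \<xi>_def by (intro cofield_add cdu cofield_scale cscal cA)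
  have mag: "magnetic_diff (\<lambda>c p. r *\<^sub>R A c p) u = (\<lambda>c p. \<xi> c p + k *s complexify A c p)"
    unfolding magnetic_diff_eq by (simp add: fun_eq_iff vec_eq_iff \<xi>_def w_def k_def algebra_simps)
  let ?D = "conorm_sq \<A> h (magnetic_diff (\<lambda>c p. r *\<^sub>R A c p) u)"
  let ?du = "\<lambda>p. pair (diff_fun u) (complexify A) p"
  \<comment> \<open>The mixed term of the differential of \<open>u\<close> with \<open>A\<close>
    integrates to zero; it is therefore kept as it is, while the mixed term with \<open>w\<close>
    will be estimated.\<close>
  have point: "?D p = conorm_sq \<A> h \<xi> p + 2 * Re (cnj k * ?du p) + 2 * r\<^sup>2 * Re (cnj m * w p) * ?a p + r\<^sup>2 * (cmod m)\<^sup>2 * ?a p"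
    if p: "p \<in> topspace X" for p
  proof -
    have im: "Im (pair (complexify A) (complexify A) p) = 0"
      using pair_sym[OF p, of "complexify A" "complexify A"] by (metis Im_complex_of_real Reals_cnj_iff complex_is_Real_iff)
    have pA: "pair (complexify A) (complexify A) p = complex_of_real (?a p)"
      by (simp add: conorm_sq_eq complex_eq_iff im)
    let ?Z = "cnj k * pair \<xi> (complexify A) p"
    have "pair (magnetic_diff (\<lambda>c p. r *\<^sub>R A c p) u) (magnetic_diff (\<lambda>c p. r *\<^sub>R A c p) u) p =
        pair \<xi> \<xi> p + ?Z + cnj ?Z + k * cnj k * complex_of_real (?a p)"
      unfolding mag by (simp add: pair_add_left pair_add_right pair_scale_left[where f="\<lambda>_. k"]
          pair_scale_right[where f="\<lambda>_. k"] pA pair_sym[OF p, of \<xi> "complexify A"] algebra_simps)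
    moreover have "k * cnj k = complex_of_real (r\<^sup>2 * (cmod m)\<^sup>2)"
      unfolding of_real_mult complex_norm_square by (simp add: k_def power2_eq_square algebra_simps)
    ultimately have D: "?D p = conorm_sq \<A> h \<xi> p + 2 * Re ?Z + r\<^sup>2 * (cmod m)\<^sup>2 * ?a p"
      unfolding conorm_sq_eq[of "magnetic_diff (\<lambda>c p. r *\<^sub>R A c p) u"] conorm_sq_eq[of \<xi>] by simp
    have kw: "cnj k * - (\<i> * complex_of_real r * w p) = complex_of_real (r\<^sup>2) * (cnj m * w p)"
      by (simp add: k_def power2_eq_square algebra_simps)
    have "pair \<xi> (complexify A) p = ?du p + (- (\<i> * complex_of_real r * w p)) * complex_of_real (?a p)"
      unfolding \<xi>_def by (simp only: pair_add_left pair_scale_left pA)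
    then have "?Z = cnj k * ?du p + (cnj k * - (\<i> * complex_of_real r * w p)) * complex_of_real (?a p)"
      by (simp only: distrib_left mult.assoc)
    then have "?Z = cnj k * ?du p + complex_of_real (r\<^sup>2) * (cnj m * w p) * complex_of_real (?a p)"
      unfolding kw .
    then have "Re ?Z = Re (cnj k * ?du p) + r\<^sup>2 * Re (cnj m * w p) * ?a p"
      by (simp only: plus_complex.sel Re_complex_of_real Im_complex_of_real times_complex.sel mult_zero_right mult_zero_left diff_zero)
    then show ?thesis using D by (simp only: distrib_left mult.assoc)
  qed
  \<comment> \<open>The squared length of \<open>\<xi> + \<eta>\<close> is at most twice the sum of
    the two squared lengths, and that of \<open>\<eta>\<close> is small because
    \<open>r\<^sup>2 * B\<close> is at most \<open>\<epsilon>\<close>.\<close>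
  have xi_ge: "conorm_sq \<A> h \<xi> p \<ge> conorm_sq \<A> h (diff_fun u) p / 2 - \<epsilon> * (cmod (w p))\<^sup>2" if p: "p \<in> topspace X" for p
  proof -
    have du: "diff_fun u c p = \<xi> c p + \<eta> c p" for c by (simp add: \<xi>_def \<eta>_def vec_eq_iff)
    have "0 \<le> Re (pair (\<lambda>c p. \<xi> c p + (- 1) *s \<eta> c p) (\<lambda>c p. \<xi> c p + (- 1) *s \<eta> c p) p)"
      by (rule pair_nonneg[OF p])
    from this[unfolded pair_add_left pair_add_right pair_scale_left[where f="\<lambda>_. - 1"]
        pair_scale_right[where f="\<lambda>_. - 1"] pair_sym[OF p, of \<xi> \<eta>]]
    have 1: "2 * Re (pair \<xi> \<eta> p) \<le> Re (pair \<xi> \<xi> p) + Re (pair \<eta> \<eta> p)"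
      by (simp add: pair_sym[OF p, of \<xi> \<eta>])
    have "Re (pair (diff_fun u) (diff_fun u) p) = Re (pair (\<lambda>c p. \<xi> c p + \<eta> c p) (\<lambda>c p. \<xi> c p + \<eta> c p) p)"
      by (simp add: pair_def Let_def du)
    also have "\<dots> = Re (pair \<xi> \<xi> p) + Re (pair \<eta> \<eta> p) + 2 * Re (pair \<xi> \<eta> p)"
      by (simp add: pair_add_left pair_add_right pair_sym[OF p, of \<xi> \<eta>])
    finally have 2: "conorm_sq \<A> h (diff_fun u) p \<le> 2 * conorm_sq \<A> h \<xi> p + 2 * conorm_sq \<A> h \<eta> p"
      using 1 by (simp add: conorm_sq_eq)
    have "conorm_sq \<A> h \<eta> p = r\<^sup>2 * (cmod (w p))\<^sup>2 * ?a p"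
      unfolding conorm_sq_eq \<eta>_def pair_scale_left pair_scale_right cmod_power2
      by (simp add: power2_eq_square algebra_simps)
    also have "\<dots> \<le> r\<^sup>2 * (cmod (w p))\<^sup>2 * B" by (rule mult_left_mono[OF B(2)[OF p]]) simp
    also have "\<dots> \<le> \<epsilon> * (cmod (w p))\<^sup>2" using mult_right_mono[OF \<epsilon>(2), of "(cmod (w p))\<^sup>2"] by (simp add: mult_ac)
    finally show ?thesis using 2 by simp
  qed
  \<comment> \<open>Young's inequality, weighted so that only \<open>\<epsilon>\<close> times the
    squared modulus of \<open>w\<close> is spent; its other half is the source of the error of order
    \<open>r ^ 4\<close>.\<close>
  have cross: "2 * r\<^sup>2 * Re (cnj m * w p) * ?a p \<ge> - (\<epsilon> * (cmod (w p))\<^sup>2 + r ^ 4 * B\<^sup>2 / \<epsilon> * (cmod m)\<^sup>2)"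
    if p: "p \<in> topspace X" for p
  proof -
    have "- Re (cnj m * w p) \<le> cmod (- (cnj m * w p))" using complex_Re_le_cmod[of "- (cnj m * w p)"] by simp
    then have "- Re (cnj m * w p) * ?a p \<le> cmod m * cmod (w p) * ?a p"
      by (intro mult_right_mono conorm_nonneg p) (simp add: norm_mult)
    also have "\<dots> \<le> cmod m * cmod (w p) * B" by (intro mult_left_mono B p) simp
    finally have F: "- Re (cnj m * w p) * ?a p \<le> cmod m * cmod (w p) * B" .
    have "- (2 * r\<^sup>2 * Re (cnj m * w p) * ?a p) = 2 * r\<^sup>2 * (- Re (cnj m * w p) * ?a p)"
      by (simp only: mult_minus_left mult_minus_right mult.assoc)
    also have "\<dots> \<le> 2 * r\<^sup>2 * (cmod m * cmod (w p) * B)" by (rule mult_left_mono[OF F]) simp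
    also have "\<dots> \<le> \<epsilon> * (cmod (w p))\<^sup>2 + r ^ 4 * B\<^sup>2 / \<epsilon> * (cmod m)\<^sup>2"
    proof -
      have "0 \<le> (\<epsilon> * cmod (w p) - r\<^sup>2 * B * cmod m)\<^sup>2 / \<epsilon>" using \<epsilon>(1) by simp
      also have "\<dots> = \<epsilon> * (cmod (w p))\<^sup>2 + r ^ 4 * B\<^sup>2 / \<epsilon> * (cmod m)\<^sup>2 - 2 * r\<^sup>2 * (cmod m * cmod (w p) * B)"
        using \<epsilon>(1) by (simp add: power2_eq_square power4_eq_xxxx field_simps)
      finally show ?thesis by simp
    qed
    finally show ?thesis by simp
  qed
  let ?R = "r ^ 4 * B\<^sup>2 / \<epsilon> * (cmod m)\<^sup>2"
  have low: "conorm_sq \<A> h (diff_fun u) p / 2 - 2 * \<epsilon> * (cmod (w p))\<^sup>2 + 2 * Re (cnj k * ?du p) + r\<^sup>2 * (cmod m)\<^sup>2 * ?a p - ?R \<le> ?D p"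
    if "p \<in> topspace X" for p
    using point[OF that] xi_ge[OF that] cross[OF that] by linarith
  have cdu2: "cont (conorm_sq \<A> h (diff_fun u))" by (rule cont_conorm_sq[OF cdu])
  have cpr: "cont (\<lambda>p. Re (cnj k * ?du p))"
    by (rule cont_compose[OF cont_pair[OF cdu cA], where \<phi>="\<lambda>z. Re (cnj k * z)"]) (intro continuous_intros)
  have "(\<integral>p. Re (cnj k * ?du p) \<partial>\<mu>) = Re (\<integral>p. cnj k * ?du p \<partial>\<mu>)"
    by (rule integral_Re) (intro cont_integrable cont_mult cont_const cont_pair cdu cA)
  then have zero: "(\<integral>p. Re (cnj k * ?du p) \<partial>\<mu>) = 0"
    using integral_pair_diff_coclosed[OF A u] by simp
  let ?G = "\<lambda>p. conorm_sq \<A> h (diff_fun u) p * (1 / 2) + (cmod (w p))\<^sup>2 * (- 2 * \<epsilon>) + Re (cnj k * ?du p) * 2 + ?a p * (r\<^sup>2 * (cmod m)\<^sup>2) + - ?R"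
  have "(\<integral>p. ?G p \<partial>\<mu>) = Q / 2 - 2 * \<epsilon> * W + r\<^sup>2 * (cmod m)\<^sup>2 * ?L - ?V * ?R"
  proof -
    have i: "integrable \<mu> (conorm_sq \<A> h (diff_fun u))" "integrable \<mu> (\<lambda>p. (cmod (w p))\<^sup>2)"
      "integrable \<mu> (\<lambda>p. Re (cnj k * ?du p))" "integrable \<mu> ?a" "integrable \<mu> (\<lambda>p. - ?R)"
      by (intro cont_integrable cdu2 cont_cmod_sq cw cpr ca cont_const)+
    have "has_bochner_integral \<mu> ?G (Q * (1 / 2) + W * (- 2 * \<epsilon>) + 0 * 2 + ?L * (r\<^sup>2 * (cmod m)\<^sup>2) + ?V * - ?R)"
      unfolding Q_def W_def l2_norm_sq zero[symmetric] integral_const_vol[symmetric]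
      by (intro has_bochner_integral_add has_bochner_integral_mult_left has_bochner_integral_integrable i)
    then show ?thesis by (simp add: has_bochner_integral_integral_eq mult_ac)
  qed
  moreover have "(\<integral>p. ?G p \<partial>\<mu>) \<le> (\<integral>p. ?D p \<partial>\<mu>)"
  proof (rule integral_mono)
    show "integrable \<mu> ?G"
      by (intro Bochner_Integration.integrable_add integrable_mult_left cont_integrable cdu2 cont_cmod_sq cw cpr ca cont_const)
    show "integrable \<mu> ?D" by (intro cont_integrable cont_conorm_sq cofield_magnetic_diff A u)
    show "?G p \<le> ?D p" if "p \<in> space \<mu>" for p
      using low[of p] that by (simp add: mult_ac)
  qed
  moreover have "(?L / ?V * r\<^sup>2 - 8 * P * B\<^sup>2 * r ^ 4) * (W + ?V * (cmod m)\<^sup>2) \<le> Q / 2 - 2 * \<epsilon> * W + r\<^sup>2 * (cmod m)\<^sup>2 * ?L - ?V * ?R"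
  proof -
    have "?L \<le> ?V * B"
      unfolding l2_norm_sq integral_const_vol[symmetric]
      by (rule integral_mono) (use B(2) in \<open>auto intro!: cont_integrable ca\<close>)
    then have LB: "?L / ?V \<le> B" using V by (simp add: divide_le_eq mult.commute)
    have "?L / ?V * r\<^sup>2 * W \<le> B * r\<^sup>2 * W" by (intro mult_right_mono LB W0) simp
    also have "\<dots> \<le> \<epsilon> * W" using mult_right_mono[OF \<epsilon>(2) W0] by (simp add: mult_ac)
    finally have 1: "?L / ?V * r\<^sup>2 * W \<le> \<epsilon> * W" .
    have 2: "4 * \<epsilon> * W \<le> Q / 2" using WQ P(1) by (simp add: \<epsilon>_def field_simps)
    have 3: "0 \<le> 8 * P * B\<^sup>2 * r ^ 4 * W" using P(1) W0 by (simp add: zero_le_even_power)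
    have 4: "8 * P * B\<^sup>2 * r ^ 4 * (?V * (cmod m)\<^sup>2) = ?V * ?R" by (simp add: \<epsilon>_def)
    have 5: "?L / ?V * r\<^sup>2 * (?V * (cmod m)\<^sup>2) = r\<^sup>2 * (cmod m)\<^sup>2 * ?L" using V by simp
    have "(?L / ?V * r\<^sup>2 - 8 * P * B\<^sup>2 * r ^ 4) * (W + ?V * (cmod m)\<^sup>2) =
      ?L / ?V * r\<^sup>2 * W + ?L / ?V * r\<^sup>2 * (?V * (cmod m)\<^sup>2) - 8 * P * B\<^sup>2 * r ^ 4 * W - 8 * P * B\<^sup>2 * r ^ 4 * (?V * (cmod m)\<^sup>2)"
      by (simp only: left_diff_distrib distrib_left)
    then show ?thesis using 1 2 3 \<epsilon>(1) W0 mult_nonneg_nonneg[of \<epsilon> W] unfolding 4 5 by linarith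
  qed
  ultimately show ?thesis unfolding norm_u by linarith
qed

lemma lambda1_lower:
  assumes A: "one_form \<A> A" "co_closed \<A> h A"
  shows "\<exists>\<rho>>0. \<exists>C>0. \<forall>r. 0 < r \<and> r < \<rho> \<longrightarrow>
    (l2_norm X \<A> h A)\<^sup>2 / vol X \<A> h * r\<^sup>2 - C * r ^ 4 \<le> lambda1 X \<A> h (\<lambda>c p. r *\<^sub>R A c p)"
proof -
  obtain P where P: "P > 0" "\<And>f. C1 f \<Longrightarrow> \<exists>m. (\<integral>p. (cmod (f p - m))\<^sup>2 \<partial>\<mu>) \<le> P * energy f"
    using poincare by blast
  obtain B where B: "B > 0" "\<forall>p\<in>topspace X. norm (conorm_sq \<A> h (complexify A) p) \<le> B"
    using cont_bounded[OF cont_conorm_sq[OF cofield_complexify[OF A(1)]]] by blast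
  have B': "conorm_sq \<A> h (complexify A) p \<le> B" if "p \<in> topspace X" for p
    using B(2) that by fastforce
  \<comment> \<open>Below this radius \<open>r\<^sup>2 * B\<close> is at most
    \<open>1 / (8 * P)\<close>, the smallness that \<open>magnetic_energy_lower\<close> asks
    for.\<close>
  define \<rho> where "\<rho> = sqrt (1 / (8 * P * B))"
  have \<rho>: "\<rho> > 0" unfolding \<rho>_def using P(1) B(1) by (intro real_sqrt_gt_zero divide_pos_pos mult_pos_pos) auto
  have C: "8 * P * B\<^sup>2 > 0" using P(1) B(1) by simp
  have main: "\<forall>r. 0 < r \<and> r < \<rho> \<longrightarrow>
    (l2_norm X \<A> h A)\<^sup>2 / vol X \<A> h * r\<^sup>2 - 8 * P * B\<^sup>2 * r ^ 4 \<le> lambda1 X \<A> h (\<lambda>c p. r *\<^sub>R A c p)"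
  proof (intro allI impI)
    fix r assume r: "0 < r \<and> r < \<rho>"
    then have "r\<^sup>2 \<le> \<rho>\<^sup>2" by (intro power_mono) auto
    also have "\<rho>\<^sup>2 = 1 / (8 * P * B)" unfolding \<rho>_def using P(1) B(1) by (intro real_sqrt_pow2) auto
    finally have rB: "r\<^sup>2 * B \<le> 1 / (8 * P)" using P(1) B(1) by (simp add: field_simps)
    show "(l2_norm X \<A> h A)\<^sup>2 / vol X \<A> h * r\<^sup>2 - 8 * P * B\<^sup>2 * r ^ 4 \<le> lambda1 X \<A> h (\<lambda>c p. r *\<^sub>R A c p)"
      unfolding lambda1_def
    proof (rule cInf_greatest)
      have "smooth_function \<A> (\<lambda>_. 1 :: complex)" by (simp add: smooth_function_def o_def smooth_on_const)
      then show "{rayleigh X \<A> h (\<lambda>c p. r *\<^sub>R A c p) u |u. smooth_function \<A> u \<and> (\<exists>p\<in>topspace X. u p \<noteq> 0)} \<noteq> {}"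
        using nonempty by fastforce
      fix x assume "x \<in> {rayleigh X \<A> h (\<lambda>c p. r *\<^sub>R A c p) u |u. smooth_function \<A> u \<and> (\<exists>p\<in>topspace X. u p \<noteq> 0)}"
      then obtain u p where u: "x = rayleigh X \<A> h (\<lambda>c p. r *\<^sub>R A c p) u" "smooth_function \<A> u" "p \<in> topspace X" "u p \<noteq> 0"
        by blast
      have C1u: "C1 u" by (rule smooth_function_imp_C1[OF u(2)])
      show "(l2_norm X \<A> h A)\<^sup>2 / vol X \<A> h * r\<^sup>2 - 8 * P * B\<^sup>2 * r ^ 4 \<le> x"
        unfolding u(1) rayleigh_def
        by (subst pos_le_divide_eq[OF rayleigh_denominator_pos[OF C1u u(3,4)]])
          (rule magnetic_energy_lower[OF A C1u B(1) B' P rB])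
    qed
  qed
  show ?thesis
    by (rule exI[of _ \<rho>], rule conjI[OF \<rho>], rule exI[of _ "8 * P * B\<^sup>2"], rule conjI[OF C main])
qed

end

section \<open>Harmonic forms with integral flux\<close>

text \<open>Regularity at a single time, so that finitely many exceptional times can be left out and
  reparametrised curves can be treated point by point.\<close>

definition loc_C1 :: "(real \<Rightarrow> 'v::real_normed_vector) \<Rightarrow> real \<Rightarrow> bool" where
  "loc_C1 f t \<longleftrightarrow> (\<exists>S. open S \<and> t \<in> S \<and> f C1_differentiable_on S)"

lemma loc_C1_cong:
  assumes "loc_C1 f t" "open S" "t \<in> S" "\<And>s. s \<in> S \<Longrightarrow> f s = g s"
  shows "loc_C1 g t"
proof -
  obtain T where T: "open T" "t \<in> T" "f C1_differentiable_on T" using assms(1) unfolding loc_C1_def by blast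
  from T(3)[unfolded C1_differentiable_on_def]
  obtain D where D: "\<forall>x\<in>T. (f has_vector_derivative D x) (at x)" "continuous_on T D"
    by (elim exE conjE) (rule that, assumption+)
  have "(g has_vector_derivative D x) (at x)" if "x \<in> S \<inter> T" for x
    by (rule has_vector_derivative_transform_within_open[OF bspec[OF D(1) IntD2[OF that]] assms(2) IntD1[OF that] assms(4)])
  then have "g C1_differentiable_on S \<inter> T"
    unfolding C1_differentiable_on_def using continuous_on_subset[OF D(2)] by (intro exI[of _ D] conjI ballI) auto
  then show ?thesis
    unfolding loc_C1_def using T(1,2) assms(2,3) by (intro exI[of _ "S \<inter> T"] conjI open_Int) simp_all
qed

lemma loc_C1_affine:
  assumes "loc_C1 f (k * t + d)"
  shows "loc_C1 (\<lambda>s. f (k * s + d)) t"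
    and "vector_derivative (\<lambda>s. f (k * s + d)) (at t) = k *\<^sub>R vector_derivative f (at (k * t + d))"
proof -
  from assms[unfolded loc_C1_def C1_differentiable_on_def]
  obtain T D where T: "open T" "k * t + d \<in> T" "\<forall>x\<in>T. (f has_vector_derivative D x) (at x)" "continuous_on T D"
    by (elim exE conjE) (rule that, assumption+)
  let ?S = "(\<lambda>s. k * s + d) -` T"
  have S: "open ?S" "t \<in> ?S"
    using T(1,2) by (auto intro!: open_vimage continuous_intros)
  have der: "((\<lambda>s. f (k * s + d)) has_vector_derivative k *\<^sub>R D (k * s + d)) (at s)" if "s \<in> ?S" for s
  proof -
    have "((\<lambda>s. k * s + d) has_vector_derivative k) (at s)"
      by (auto intro!: derivative_eq_intros simp: has_vector_derivative_def)
    from vector_diff_chain_at[OF this bspec[OF T(3) vimageD[OF that]]] show ?thesis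
      by (simp only: o_def)
  qed
  have cont: "continuous_on ?S (\<lambda>s. k *\<^sub>R D (k * s + d))"
    by (intro continuous_intros continuous_on_compose2[OF T(4)] image_vimage_subset)
  show "loc_C1 (\<lambda>s. f (k * s + d)) t"
    unfolding loc_C1_def C1_differentiable_on_def
    by (intro exI[of _ ?S] conjI exI[of _ "\<lambda>s. k *\<^sub>R D (k * s + d)"] ballI S cont der)
  show "vector_derivative (\<lambda>s. f (k * s + d)) (at t) = k *\<^sub>R vector_derivative f (at (k * t + d))"
    using vector_derivative_at[OF der[OF S(2)]] vector_derivative_at[OF bspec[OF T(3) T(2)]] by simp
qed

lemma loc_C1_imp_C1_differentiable_on:
  assumes "\<And>t. t \<in> S \<Longrightarrow> loc_C1 f t"
  shows "f C1_differentiable_on S"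
  unfolding C1_differentiable_on_eq
proof
  show "\<forall>t\<in>S. f differentiable at t"
    using assms unfolding loc_C1_def C1_differentiable_on_eq by blast
  show "continuous_on S (\<lambda>t. vector_derivative f (at t))"
  proof (rule continuous_at_imp_continuous_on, rule ballI)
    fix t assume "t \<in> S"
    then obtain T where "open T" "t \<in> T" "continuous_on T (\<lambda>t. vector_derivative f (at t))"
      using assms unfolding loc_C1_def C1_differentiable_on_eq by blast
    then show "isCont (\<lambda>t. vector_derivative f (at t)) t" using continuous_on_eq_continuous_at by blast
  qed
qed

context compact_riemannian
begin

definition integrand :: "('a, 'n) covector_field \<Rightarrow> (real \<Rightarrow> 'a) \<Rightarrow> real \<Rightarrow> real" where
  "integrand \<omega> \<gamma> t = (let c = chart_at \<A> (\<gamma> t) in \<omega> c (\<gamma> t) \<bullet> vector_derivative (chart_map c \<circ> \<gamma>) (at t))"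

text \<open>The condition concerns single interior times instead of subintervals: derivatives are
  two-sided here, and nothing is known about the curve outside \<open>{0..1}\<close>.\<close>

definition piecewise_C1_path :: "(real \<Rightarrow> 'a) \<Rightarrow> real set \<Rightarrow> bool" where
  "piecewise_C1_path \<gamma> F \<longleftrightarrow> pathin X \<gamma> \<and> finite F \<and>
    (\<forall>t\<in>{0<..<1} - F. \<forall>c\<in>\<A>. \<gamma> t \<in> chart_dom c \<longrightarrow> loc_C1 (chart_map c \<circ> \<gamma>) t)"

text \<open>A relation, because the value depends on the path. Existence of the integral is part of
  it, so that values add up when paths are joined.\<close>

definition path_integral :: "('a, 'n) covector_field \<Rightarrow> 'a \<Rightarrow> 'a \<Rightarrow> real \<Rightarrow> bool" where
  "path_integral \<omega> p q s \<longleftrightarrow> (\<exists>\<gamma> F. piecewise_C1_path \<gamma> F \<and> \<gamma> 0 = p \<and> \<gamma> 1 = q \<and> (integrand \<omega> \<gamma> has_integral s) {0..1})"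

lemma pathin_in_space: "pathin X \<gamma> \<Longrightarrow> t \<in> {0..1} \<Longrightarrow> \<gamma> t \<in> topspace X"
  unfolding pathin_def continuous_map_def by auto

lemma path_integral_closed:
  assumes "path_integral \<omega> p p s" "\<omega> \<in> flux_lattice X \<A> h"
  shows "s / (2 * pi) \<in> \<int>"
proof -
  obtain \<gamma> F where \<gamma>: "piecewise_C1_path \<gamma> F" "\<gamma> 0 = p" "\<gamma> 1 = p" "(integrand \<omega> \<gamma> has_integral s) {0..1}"
    using assms(1) unfolding path_integral_def by blast
  have path: "pathin X \<gamma>" and F: "finite F"
    and loc: "\<And>t c. t \<in> {0<..<1} - F \<Longrightarrow> c \<in> \<A> \<Longrightarrow> \<gamma> t \<in> chart_dom c \<Longrightarrow> loc_C1 (chart_map c \<circ> \<gamma>) t"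
    using \<gamma>(1) unfolding piecewise_C1_path_def by auto
  have "(chart_map c \<circ> \<gamma>) piecewise_C1_differentiable_on {a..b}"
    if c: "c \<in> \<A>" and ab: "0 \<le> a" "a < b" "b \<le> 1" "\<gamma> ` {a..b} \<subseteq> chart_dom c" for c a b
    unfolding piecewise_C1_differentiable_on_def
  \<comment> \<open>The endpoints join the exceptional times, since \<open>piecewise_C1_path\<close>
    is silent about them.\<close>
  proof (intro conjI exI[of _ "insert 0 (insert 1 F)"])
    have "continuous_map (top_of_set {a..b}) X \<gamma>"
      using continuous_map_from_subtopology_mono[OF path[unfolded pathin_def], of "{a..b}"] ab by auto
    then have "continuous_map (top_of_set {a..b}) (subtopology X (chart_dom c)) \<gamma>"
      using ab by (auto simp: continuous_map_in_subtopology)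
    then have "continuous_map (top_of_set {a..b}) euclidean (chart_map c \<circ> \<gamma>)"
      by (rule continuous_map_compose) (rule continuous_map_chart[OF c])
    then show "continuous_on {a..b} (chart_map c \<circ> \<gamma>)" by simp
    show "finite (insert 0 (insert 1 F))" using F by simp
    show "(chart_map c \<circ> \<gamma>) C1_differentiable_on {a..b} - insert 0 (insert 1 F)"
      by (rule loc_C1_imp_C1_differentiable_on, rule loc) (use ab c in auto)
  qed
  then have "closed_curve X \<A> \<gamma>" unfolding closed_curve_def using path \<gamma>(2,3) by simp
  then have "curve_integral \<A> \<omega> \<gamma> / (2 * pi) \<in> \<int>" using assms(2) unfolding flux_lattice_def by blast
  moreover have "curve_integral \<A> \<omega> \<gamma> = s"
    using integral_unique[OF \<gamma>(4)] unfolding curve_integral_def integrand_def[abs_def] .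
  ultimately show ?thesis by simp
qed

text \<open>Both paths are run at double speed; the factor 2 in the velocity makes up for the halved
  interval.\<close>

lemma path_integral_join:
  assumes "path_integral \<omega> p q s" "path_integral \<omega> q r t"
  shows "path_integral \<omega> p r (s + t)"
proof -
  obtain \<gamma>1 F1 where 1: "piecewise_C1_path \<gamma>1 F1" "\<gamma>1 0 = p" "\<gamma>1 1 = q" "(integrand \<omega> \<gamma>1 has_integral s) {0..1}"
    using assms(1) unfolding path_integral_def by blast
  obtain \<gamma>2 F2 where 2: "piecewise_C1_path \<gamma>2 F2" "\<gamma>2 0 = q" "\<gamma>2 1 = r" "(integrand \<omega> \<gamma>2 has_integral t) {0..1}"
    using assms(2) unfolding path_integral_def by blast
  \<comment> \<open>The summands \<open>0\<close> and \<open>- 1\<close> bring the arguments into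
    the shape \<open>k * t + d\<close> of \<open>loc_C1_affine\<close>.\<close>
  define \<gamma> where "\<gamma> x = (if x \<le> 1/2 then \<gamma>1 (2 * x + 0) else \<gamma>2 (2 * x + - 1))" for x :: real
  \<comment> \<open>Besides the rescaled exceptional times, the junction at \<open>1/2\<close> can
    be a corner.\<close>
  define F where "F = insert (1/2) ((\<lambda>x. x / 2) ` F1 \<union> (\<lambda>x. (x + 1) / 2) ` F2)"
  let ?T01 = "top_of_set {0..1::real}"
  have "pathin X \<gamma>"
    unfolding pathin_def
  proof -
    have g: "continuous_map ?T01 X \<gamma>1" "continuous_map ?T01 X \<gamma>2"
      using 1(1) 2(1) unfolding piecewise_C1_path_def pathin_def by auto
    have "continuous_map ?T01 X (\<lambda>x. if x \<le> 1/2 then (\<gamma>1 \<circ> (\<lambda>t. 2 * t)) x else (\<gamma>2 \<circ> (\<lambda>t. 2 * t - 1)) x)"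
    proof (intro continuous_map_cases_le continuous_map_compose, force, force)
      show "continuous_map (subtopology ?T01 {x \<in> topspace ?T01. x \<le> 1/2}) ?T01 ((*) 2)"
        by (auto simp: continuous_map_in_subtopology continuous_map_from_subtopology)
      have "continuous_map
             (subtopology (top_of_set {0..1}) {x. 0 \<le> x \<and> x \<le> 1 \<and> 1 \<le> x * 2})
             euclideanreal (\<lambda>t. 2 * t - 1)"
        by (intro continuous_intros) (force intro: continuous_map_from_subtopology)
      then show "continuous_map (subtopology ?T01 {x \<in> topspace ?T01. 1/2 \<le> x}) ?T01 (\<lambda>t. 2 * t - 1)"
        by (force simp: continuous_map_in_subtopology)
      show "(\<gamma>1 \<circ> (*) 2) x = (\<gamma>2 \<circ> (\<lambda>t. 2 * t - 1)) x" if "x \<in> topspace ?T01" "x = 1/2" for x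
        using 1(3) 2(2) unfolding that(2) by simp
    qed (auto simp: g)
    moreover have "(\<lambda>x. if x \<le> 1/2 then (\<gamma>1 \<circ> (\<lambda>t. 2 * t)) x else (\<gamma>2 \<circ> (\<lambda>t. 2 * t - 1)) x) = \<gamma>"
      by (auto simp: \<gamma>_def fun_eq_iff)
    ultimately show "continuous_map ?T01 X \<gamma>" by (simp only:)
  qed
  note path = this
  have left: "\<gamma> s = \<gamma>1 (2 * s + 0)" if "s < 1/2" for s using that by (simp add: \<gamma>_def)
  have right: "\<gamma> s = \<gamma>2 (2 * s + - 1)" if "1/2 < s" for s using that by (simp add: \<gamma>_def)
  have L: "loc_C1 (chart_map c \<circ> \<gamma>) x \<and> vector_derivative (chart_map c \<circ> \<gamma>) (at x) = 2 *\<^sub>R vector_derivative (chart_map c \<circ> \<gamma>1) (at (2 * x + 0))"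
    if x: "0 < x" "x < 1/2" "x \<notin> F" and c: "c \<in> \<A>" "\<gamma> x \<in> chart_dom c" for x c
  proof -
    have "2 * x \<notin> F1"
    proof
      assume "2 * x \<in> F1"
      then have "(2 * x) / 2 \<in> (\<lambda>x. x / 2) ` F1" by blast
      then show False using x(3) by (simp add: F_def)
    qed
    then have loc: "loc_C1 (chart_map c \<circ> \<gamma>1) (2 * x + 0)"
      using 1(1) x c left[OF x(2)] unfolding piecewise_C1_path_def by simp
    have S: "open {..<1/2::real}" "x \<in> {..<1/2}" using x by auto
    have eq: "((\<lambda>s. (chart_map c \<circ> \<gamma>1) (2 * s + 0)) s) = (chart_map c \<circ> \<gamma>) s" if "s \<in> {..<1/2}" for s
      using that left by simp
    have l: "loc_C1 (chart_map c \<circ> \<gamma>) x"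
      by (rule loc_C1_cong[OF loc_C1_affine(1)[OF loc] S eq])
    have "(\<lambda>s. (chart_map c \<circ> \<gamma>1) (2 * s + 0)) differentiable at x"
      using loc_C1_affine(1)[OF loc] unfolding loc_C1_def C1_differentiable_on_eq by blast
    then have "((\<lambda>s. (chart_map c \<circ> \<gamma>1) (2 * s + 0)) has_vector_derivative
        vector_derivative (\<lambda>s. (chart_map c \<circ> \<gamma>1) (2 * s + 0)) (at x)) (at x)"
      by (simp add: vector_derivative_works)
    from vector_derivative_at[OF has_vector_derivative_transform_within_open[OF this S eq]]
    show ?thesis using l loc_C1_affine(2)[OF loc] by (simp add: o_def)
  qed
  have R: "loc_C1 (chart_map c \<circ> \<gamma>) x \<and> vector_derivative (chart_map c \<circ> \<gamma>) (at x) = 2 *\<^sub>R vector_derivative (chart_map c \<circ> \<gamma>2) (at (2 * x + - 1))"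
    if x: "1/2 < x" "x < 1" "x \<notin> F" and c: "c \<in> \<A>" "\<gamma> x \<in> chart_dom c" for x c
  proof -
    have "2 * x + - 1 \<notin> F2"
    proof
      assume "2 * x + - 1 \<in> F2"
      then have "(2 * x + - 1 + 1) / 2 \<in> (\<lambda>x. (x + 1) / 2) ` F2" by blast
      then show False using x(3) by (simp add: F_def)
    qed
    then have loc: "loc_C1 (chart_map c \<circ> \<gamma>2) (2 * x + - 1)"
      using 2(1) x c right[OF x(1)] unfolding piecewise_C1_path_def by simp
    have S: "open {1/2::real<..}" "x \<in> {1/2<..}" using x by auto
    have eq: "((\<lambda>s. (chart_map c \<circ> \<gamma>2) (2 * s + - 1)) s) = (chart_map c \<circ> \<gamma>) s" if "s \<in> {1/2<..}" for s
      using that right by simp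
    have l: "loc_C1 (chart_map c \<circ> \<gamma>) x"
      by (rule loc_C1_cong[OF loc_C1_affine(1)[OF loc] S eq])
    have "(\<lambda>s. (chart_map c \<circ> \<gamma>2) (2 * s + - 1)) differentiable at x"
      using loc_C1_affine(1)[OF loc] unfolding loc_C1_def C1_differentiable_on_eq by blast
    then have "((\<lambda>s. (chart_map c \<circ> \<gamma>2) (2 * s + - 1)) has_vector_derivative
        vector_derivative (\<lambda>s. (chart_map c \<circ> \<gamma>2) (2 * s + - 1)) (at x)) (at x)"
      by (simp add: vector_derivative_works)
    from vector_derivative_at[OF has_vector_derivative_transform_within_open[OF this S eq]]
    show ?thesis using l loc_C1_affine(2)[OF loc] by (simp add: o_def)
  qed
  have finF: "finite F" using 1(1) 2(1) unfolding F_def piecewise_C1_path_def by simp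
  have "piecewise_C1_path \<gamma> F"
    unfolding piecewise_C1_path_def
  proof (intro conjI ballI impI path finF)
    fix x c assume x: "x \<in> {0<..<1} - F" and c: "c \<in> \<A>" "\<gamma> x \<in> chart_dom c"
    then have "x < 1/2 \<or> 1/2 < x" by (auto simp: F_def)
    then show "loc_C1 (chart_map c \<circ> \<gamma>) x" using L[of x c] R[of x c] x c by auto
  qed
  moreover have "(integrand \<omega> \<gamma> has_integral s) {0..1/2}"
  proof (rule has_integral_spike_finite[of "insert 0 F"])
    show "finite (insert 0 F)" using finF by simp
    show "integrand \<omega> \<gamma> x = 2 * integrand \<omega> \<gamma>1 (2 * x + 0)" if "x \<in> {0..1/2} - insert 0 F" for x
    proof -
      have x: "0 < x" "x < 1/2" "x \<notin> F" using that by (auto simp: F_def less_le)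
      have "\<gamma> x \<in> topspace X" using pathin_in_space[OF path] x by simp
      note c = chart_at[OF this]
      show ?thesis
        using L[OF x conjunct1[OF c] conjunct2[OF c]] by (simp add: integrand_def Let_def left[OF x(2)])
    qed
    have "((\<lambda>x. integrand \<omega> \<gamma>1 (2 *\<^sub>R x + 0)) has_integral (s /\<^sub>R 2 ^ DIM(real))) (cbox ((0 - 0) /\<^sub>R 2) ((1 - 0) /\<^sub>R 2))"
      by (rule has_integral_affinity') (use 1(4) in auto)
    then have "((\<lambda>x. integrand \<omega> \<gamma>1 (2 * x + 0)) has_integral (s / 2)) {0..1/2}" by simp
    from has_integral_mult_right[OF this, of 2]
    show "((\<lambda>x. 2 * integrand \<omega> \<gamma>1 (2 * x + 0)) has_integral s) {0..1/2}" by simp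
  qed
  moreover have "(integrand \<omega> \<gamma> has_integral t) {1/2..1}"
  proof (rule has_integral_spike_finite[of "insert 1 F"])
    show "finite (insert 1 F)" using finF by simp
    show "integrand \<omega> \<gamma> x = 2 * integrand \<omega> \<gamma>2 (2 * x + - 1)" if "x \<in> {1/2..1} - insert 1 F" for x
    proof -
      have x: "1/2 < x" "x < 1" "x \<notin> F" using that by (auto simp: F_def less_le)
      have "\<gamma> x \<in> topspace X" using pathin_in_space[OF path] x by simp
      note c = chart_at[OF this]
      show ?thesis
        using R[OF x conjunct1[OF c] conjunct2[OF c]] by (simp add: integrand_def Let_def right[OF x(1)])
    qed
    have "((\<lambda>x. integrand \<omega> \<gamma>2 (2 *\<^sub>R x + - 1)) has_integral (t /\<^sub>R 2 ^ DIM(real))) (cbox ((0 - - 1) /\<^sub>R 2) ((1 - - 1) /\<^sub>R 2))"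
      by (rule has_integral_affinity') (use 2(4) in auto)
    then have "((\<lambda>x. integrand \<omega> \<gamma>2 (2 * x + - 1)) has_integral (t / 2)) {1/2..1}" by simp
    from has_integral_mult_right[OF this, of 2]
    show "((\<lambda>x. 2 * integrand \<omega> \<gamma>2 (2 * x + - 1)) has_integral t) {1/2..1}" by simp
  qed
  ultimately have "(integrand \<omega> \<gamma> has_integral (s + t)) {0..1}"
    by (intro has_integral_combine[of 0 "1/2" 1]) auto
  moreover have "\<gamma> 0 = p" "\<gamma> 1 = r" using 1(2) 2(3) by (auto simp: \<gamma>_def)
  ultimately show ?thesis unfolding path_integral_def using \<open>piecewise_C1_path \<gamma> F\<close> by blast
qed

lemma inner_jacobian:
  assumes "one_form \<A> \<omega>" "c \<in> \<A>" "c' \<in> \<A>" "p \<in> chart_dom c" "p \<in> chart_dom c'"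
  shows "\<omega> c' p \<bullet> (Defs.jacobian c c' p *v v) = \<omega> c p \<bullet> v"
proof -
  have "\<omega> c p = transpose (Defs.jacobian c c' p) *v \<omega> c' p"
    using assms unfolding one_form_def by blast
  also have "\<dots> \<bullet> v = \<omega> c' p \<bullet> (Defs.jacobian c c' p *v v)"
    by (simp add: dot_lmul_matrix)
  finally show ?thesis by simp
qed

text \<open>In chart \<open>c\<close> the path is a straight segment, and its integrand is the
  derivative of \<open>f\<close> along it. By definition the integrand uses the chart that
  \<open>chart_at\<close> selects at each time, which may jump; \<open>inner_jacobian\<close> moves
  it to \<open>c\<close>.\<close>

lemma path_integral_segment:
  assumes \<omega>: "one_form \<A> \<omega>" and c: "c \<in> \<A>" and b: "ball a s \<subseteq> chart_im c"
    and f: "\<And>y. y \<in> ball a s \<Longrightarrow> (f has_derivative (\<lambda>v. \<omega> c (chart_inv c y) \<bullet> v)) (at y)"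
    and y: "y0 \<in> ball a s" "y1 \<in> ball a s"
  shows "path_integral \<omega> (chart_inv c y0) (chart_inv c y1) (f y1 - f y0)"
proof -
  define l where "l t = y0 + t *\<^sub>R (y1 - y0)" for t
  define \<gamma> where "\<gamma> t = chart_inv c (l t)" for t
  have lB: "l t \<in> ball a s" if "t \<in> {0..1}" for t
    using convexD_alt[OF convex_ball y, of t] that by (simp add: l_def algebra_simps)
  have cl: "continuous_on UNIV l" unfolding l_def by (intro continuous_intros)
  have dl: "(l has_vector_derivative (y1 - y0)) (at t)" for t
    unfolding l_def[abs_def] has_vector_derivative_def by (auto intro!: derivative_eq_intros)
  have path: "pathin X \<gamma>"
    unfolding pathin_def \<gamma>_def[abs_def]
    by (rule continuous_map_compose[OF _ continuous_map_chart_inv[OF c], unfolded o_def])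
      (use lB b in \<open>auto simp: continuous_map_in_subtopology intro: continuous_on_subset[OF cl]\<close>)
  have key: "loc_C1 (chart_map c' \<circ> \<gamma>) t \<and>
      vector_derivative (chart_map c' \<circ> \<gamma>) (at t) = Defs.jacobian c c' (\<gamma> t) *v (y1 - y0)"
    if t: "t \<in> {0..1}" and c': "c' \<in> \<A>" "\<gamma> t \<in> chart_dom c'" for t c'
  proof -
    let ?T = "transition c c'" and ?S = "l -` overlap c c'"
    have S: "open ?S" "t \<in> ?S"
      using c' lB[OF t] b overlap_open[OF c c'(1)]
      by (auto simp: overlap_iff[OF c] \<gamma>_def intro!: open_vimage cl)
    have der: "((chart_map c' \<circ> \<gamma>) has_vector_derivative frechet_derivative ?T (at (l r)) (y1 - y0)) (at r)" if "r \<in> ?S" for r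
    proof -
      have D: "(?T has_derivative frechet_derivative ?T (at (l r))) (at (l r))"
        by (rule C1_on_has_derivative[OF C1_on_transition[OF c c'(1)]]) (use that in simp)
      have "((\<lambda>r. ?T (l r)) has_derivative (\<lambda>h. frechet_derivative ?T (at (l r)) (h *\<^sub>R (y1 - y0)))) (at r)"
        by (rule has_derivative_compose[where f=l and g="?T", OF dl[unfolded has_vector_derivative_def] D])
      then show ?thesis
        using linear_scale[OF has_derivative_linear[OF D]]
        by (simp add: has_vector_derivative_def transition_def \<gamma>_def[abs_def] o_def)
    qed
    have cont: "continuous_on ?S (\<lambda>r. frechet_derivative ?T (at (l r)) (y1 - y0))"
      by (rule continuous_on_compose2[OF C1_on_continuous_deriv[OF C1_on_transition[OF c c'(1)]] continuous_on_subset[OF cl]]) auto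
    have "loc_C1 (chart_map c' \<circ> \<gamma>) t"
      unfolding loc_C1_def C1_differentiable_on_def
      by (intro exI[of _ ?S] conjI exI[of _ "\<lambda>r. frechet_derivative ?T (at (l r)) (y1 - y0)"] ballI S cont der)
    moreover have "frechet_derivative ?T (at (l t)) (y1 - y0) = Defs.jacobian c c' (\<gamma> t) *v (y1 - y0)"
      using jacobian_apply[OF c c'(1), of "\<gamma> t"] lB[OF t] b c' by (simp add: \<gamma>_def subset_iff)
    ultimately show ?thesis using vector_derivative_at[OF der[OF S(2)]] by simp
  qed
  have "piecewise_C1_path \<gamma> {}"
    unfolding piecewise_C1_path_def
  proof (intro conjI ballI impI path)
    fix t c' assume "t \<in> {0<..<1} - ({} :: real set)" "c' \<in> \<A>" "\<gamma> t \<in> chart_dom c'"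
    then show "loc_C1 (chart_map c' \<circ> \<gamma>) t" by (intro conjunct1[OF key]) simp_all
  qed simp
  moreover have "(integrand \<omega> \<gamma> has_integral (f (l 1) - f (l 0))) {0..1}"
  proof (rule fundamental_theorem_of_calculus)
    fix t :: real assume t: "t \<in> {0..1}"
    let ?c = "chart_at \<A> (\<gamma> t)"
    have c': "?c \<in> \<A>" "\<gamma> t \<in> chart_dom ?c" using chart_at[OF pathin_in_space[OF path t]] by auto
    have dom: "\<gamma> t \<in> chart_dom c" using lB[OF t] b by (auto simp: \<gamma>_def)
    have "integrand \<omega> \<gamma> t = \<omega> ?c (\<gamma> t) \<bullet> (Defs.jacobian c ?c (\<gamma> t) *v (y1 - y0))"
      using key[OF t c'] by (simp add: integrand_def Let_def)
    also have "\<dots> = \<omega> c (\<gamma> t) \<bullet> (y1 - y0)" by (rule inner_jacobian[OF \<omega> c c'(1) dom c'(2)])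
    finally have eq: "integrand \<omega> \<gamma> t = \<omega> c (chart_inv c (l t)) \<bullet> (y1 - y0)" by (simp add: \<gamma>_def)
    have "((\<lambda>t. f (l t)) has_derivative (\<lambda>h. \<omega> c (chart_inv c (l t)) \<bullet> (h *\<^sub>R (y1 - y0)))) (at t)"
      by (rule has_derivative_compose[where f=l and g=f, OF dl[unfolded has_vector_derivative_def] f[OF lB[OF t]]])
    then show "((\<lambda>t. f (l t)) has_vector_derivative integrand \<omega> \<gamma> t) (at t within {0..1})"
      unfolding eq has_vector_derivative_def inner_scaleR_right real_scaleR_def
      by (rule has_derivative_at_withinI)
  qed simp
  ultimately show ?thesis
    unfolding path_integral_def by (intro exI[of _ \<gamma>] exI[of _ "{}"]) (simp add: \<gamma>_def l_def)
qed

end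

section \<open>The map \<open>cis\<close> near 1\<close>

text \<open>A chord is at most as long as its arc.\<close>

lemma norm_cis_diff_le: "cmod (cis x - cis y) \<le> \<bar>x - y\<bar>"
proof -
  have "cis x - cis y = cis y * (cis (x - y) - 1)" by (simp add: right_diff_distrib cis_mult)
  then have "cmod (cis x - cis y) = cmod (exp (\<i> * complex_of_real (x - y)) - 1)"
    by (simp add: norm_mult cis_conv_exp)
  also have "\<dots> = 2 * \<bar>sin ((x - y) / 2)\<bar>" by (rule dist_exp_i_1)
  also have "\<dots> \<le> \<bar>x - y\<bar>" using abs_sin_x_le_abs_x[of "(x - y) / 2"] by simp
  finally show ?thesis .
qed

lemma cis_eq_1_iff: "cis x = 1 \<longleftrightarrow> (\<exists>n::int. x = 2 * pi * n)"
proof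
  assume "cis x = 1"
  then have "cos x = 1" by (metis cis.sel(1) one_complex.sel(1))
  then show "\<exists>n::int. x = 2 * pi * n" by (auto simp: cos_one_2pi_int mult_ac)
qed auto

text \<open>On \<open>{- pi..pi}\<close> without a neighbourhood of 0 the distance of
  \<open>cis\<close> from 1 has a positive minimum by compactness. A general \<open>m\<close> is
  brought into this interval by subtracting the nearest multiple of \<open>2 * pi\<close>.\<close>

lemma cis_near_1:
  assumes "0 < \<eta>"
  shows "\<exists>\<delta>>0. \<forall>m. cmod (cis m - 1) < \<delta> \<longrightarrow> (\<exists>k::int. \<bar>m - 2 * pi * k\<bar> < \<eta>)"
proof -
  let ?S = "{- pi..pi} \<inter> {d. \<eta> \<le> \<bar>d\<bar>}"
  have comp: "compact ?S"
    by (intro compact_Int_closed compact_Icc closed_Collect_le continuous_intros)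
  have cont: "continuous_on ?S (\<lambda>d. cmod (cis d - 1))" by (intro continuous_intros)
  have pos: "0 < cmod (cis d - 1)" if "d \<in> ?S" for d
  proof -
    have "cis d \<noteq> 1"
    proof
      assume "cis d = 1"
      then obtain n :: int where n: "d = 2 * pi * n" by (auto simp: cis_eq_1_iff)
      then have "n \<noteq> 0" using that assms by auto
      then have "1 \<le> \<bar>real_of_int n\<bar>" by linarith
      then have "2 * pi * 1 \<le> 2 * pi * \<bar>real_of_int n\<bar>" by (intro mult_left_mono) auto
      then have "2 * pi \<le> \<bar>d\<bar>" by (simp add: n abs_mult)
      moreover have "\<bar>d\<bar> \<le> pi" using that by auto
      ultimately show False using pi_gt_zero by linarith
    qed
    then show ?thesis by simp
  qed
  have "\<exists>\<delta>>0. \<forall>d\<in>?S. \<delta> \<le> cmod (cis d - 1)"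
  proof (cases "?S = {}")
    case False
    obtain d where "d \<in> ?S" "\<forall>x\<in>?S. cmod (cis d - 1) \<le> cmod (cis x - 1)"
      using continuous_attains_inf[OF comp False cont] by blast
    then show ?thesis using pos by (intro exI[of _ "cmod (cis d - 1)"]) simp
  qed (auto intro: exI[of _ 1])
  then obtain \<delta> where \<delta>: "0 < \<delta>" "\<forall>d\<in>?S. \<delta> \<le> cmod (cis d - 1)" by (elim exE conjE) (rule that, assumption+)
  show ?thesis
  proof (intro exI[of _ \<delta>] conjI allI impI \<delta>(1))
    fix m assume m: "cmod (cis m - 1) < \<delta>"
    define k where "k = round (m / (2 * pi))"
    define d where "d = m - 2 * pi * k"
    have "\<bar>real_of_int k - m / (2 * pi)\<bar> \<le> 1 / 2" unfolding k_def by (rule of_int_round_abs_le)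
    then have "(2 * pi) * \<bar>real_of_int k - m / (2 * pi)\<bar> \<le> (2 * pi) * (1 / 2)" by (intro mult_left_mono) auto
    also have "(2 * pi) * \<bar>real_of_int k - m / (2 * pi)\<bar> = \<bar>(2 * pi) * (real_of_int k - m / (2 * pi))\<bar>"
      by (simp add: abs_mult)
    also have "(2 * pi) * (real_of_int k - m / (2 * pi)) = - d" by (simp add: d_def right_diff_distrib)
    finally have dpi: "\<bar>d\<bar> \<le> pi" by simp
    have md: "cis m = cis d"
    proof -
      have "cis m = cis (d + 2 * pi * real_of_int k)" by (simp add: d_def)
      also have "\<dots> = cis d * cis (2 * pi * real_of_int k)" by (rule cis_mult[symmetric])
      finally show ?thesis by simp
    qed
    have "\<bar>d\<bar> < \<eta>"
    proof (rule ccontr)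
      assume "\<not> \<bar>d\<bar> < \<eta>"
      then have "d \<in> ?S" using dpi by auto
      from bspec[OF \<delta>(2) this] show False using m unfolding md by linarith
    qed
    then show "\<exists>k::int. \<bar>m - 2 * pi * k\<bar> < \<eta>" by (intro exI[of _ k]) (simp add: d_def)
  qed
qed

section \<open>Local potentials and the phase of a lattice element\<close>

context compact_riemannian
begin

text \<open>Tested in every chart of the atlas, so that potentials found in different coordinate
  balls can be compared and glued.\<close>

definition potential :: "('a, 'n) covector_field \<Rightarrow> 'a set \<Rightarrow> ('a \<Rightarrow> real) \<Rightarrow> bool" where
  "potential \<omega> U g \<longleftrightarrow> (\<forall>c\<in>\<A>. \<forall>y\<in>chart_im c. chart_inv c y \<in> U \<longrightarrow>
    ((\<lambda>y. g (chart_inv c y)) has_derivative (\<lambda>v. \<omega> c (chart_inv c y) \<bullet> v)) (at y))"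

lemma potentialD: "potential \<omega> U g \<Longrightarrow> c \<in> \<A> \<Longrightarrow> y \<in> chart_im c \<Longrightarrow> chart_inv c y \<in> U \<Longrightarrow>
    ((\<lambda>y. g (chart_inv c y)) has_derivative (\<lambda>v. \<omega> c (chart_inv c y) \<bullet> v)) (at y)"
  by (simp add: potential_def)

text \<open>The chain rule along the transition map; the law of a one-form turns the derivative in
  chart \<open>c\<close> into the one in chart \<open>c'\<close>.\<close>

lemma potential_chart:
  assumes \<omega>: "one_form \<A> \<omega>" and c: "c \<in> \<A>" and b: "ball a s \<subseteq> chart_im c"
    and f: "\<And>y. y \<in> ball a s \<Longrightarrow> (f has_derivative (\<lambda>v. \<omega> c (chart_inv c y) \<bullet> v)) (at y)"
  shows "potential \<omega> (chart_inv c ` ball a s) (\<lambda>q. f (chart_map c q))"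
  unfolding potential_def
proof (intro ballI impI)
  fix c' y assume c': "c' \<in> \<A>" "y \<in> chart_im c'" "chart_inv c' y \<in> chart_inv c ` ball a s"
  let ?p = "chart_inv c' y" and ?T = "transition c' c"
  note U = coord_ball_open[OF c b]
  have dom: "?p \<in> chart_dom c'" "?p \<in> chart_dom c" using c' U(2) by auto
  have Ty: "?T y = chart_map c ?p" by (simp add: transition_def)
  have z: "chart_map c ?p \<in> ball a s" using imageI[OF c'(3), of "chart_map c"] U(3) by simp
  have D: "(?T has_derivative frechet_derivative ?T (at y)) (at y)"
    by (rule C1_on_has_derivative[OF C1_on_transition[OF c'(1) c]]) (use c' dom in \<open>simp add: overlap_iff\<close>)
  have "((\<lambda>y. f (?T y)) has_derivative (\<lambda>v. \<omega> c (chart_inv c (chart_map c ?p)) \<bullet> frechet_derivative ?T (at y) v)) (at y)"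
    by (rule has_derivative_compose[where f="?T" and g=f, OF D]) (use f[OF z] in \<open>simp add: Ty\<close>)
  moreover have "\<omega> c (chart_inv c (chart_map c ?p)) \<bullet> frechet_derivative ?T (at y) v = \<omega> c' ?p \<bullet> v" for v
  proof -
    have "frechet_derivative ?T (at y) v = Defs.jacobian c' c ?p *v v"
      using jacobian_apply[OF c'(1) c, of ?p v] dom c' by simp
    then show ?thesis using inner_jacobian[OF \<omega> c'(1) c dom] c dom by simp
  qed
  ultimately show "((\<lambda>y. f (chart_map c (chart_inv c' y))) has_derivative (\<lambda>v. \<omega> c' ?p \<bullet> v)) (at y)"
    by (simp add: transition_def)
qed

lemma potential_diff_const:
  assumes g: "potential \<omega> U g" "potential \<omega> U' g'" and c: "c \<in> \<A>" and b: "ball a s \<subseteq> chart_im c"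
    and V: "chart_inv c ` ball a s \<subseteq> U" "chart_inv c ` ball a s \<subseteq> U'"
  shows "\<exists>k. \<forall>x\<in>chart_inv c ` ball a s. g x - g' x = k"
proof -
  have "\<exists>k. \<forall>y\<in>ball a s. g (chart_inv c y) - g' (chart_inv c y) = k"
  proof (rule has_derivative_zero_constant[OF convex_ball])
    fix y assume y: "y \<in> ball a s"
    then have y': "y \<in> chart_im c" "chart_inv c y \<in> U" "chart_inv c y \<in> U'" using b V by auto
    have "((\<lambda>y. g (chart_inv c y) - g' (chart_inv c y)) has_derivative
      (\<lambda>v. \<omega> c (chart_inv c y) \<bullet> v - \<omega> c (chart_inv c y) \<bullet> v)) (at y)"
      by (intro has_derivative_diff potentialD[OF g(1) c] potentialD[OF g(2) c] y')
    then show "((\<lambda>y. g (chart_inv c y) - g' (chart_inv c y)) has_derivative (\<lambda>v. 0)) (at y within ball a s)"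
      by (simp add: has_derivative_at_withinI)
  qed
  then show ?thesis by simp
qed

text \<open>\<open>closed_form\<close> compares partial derivatives along the axes; expansion in
  coordinates gives the symmetry in arbitrary directions that \<open>poincare_lemma_ball\<close>
  asks for.\<close>

lemma ex_potential:
  assumes \<omega>: "one_form \<A> \<omega>" "closed_form \<A> \<omega>" and c: "c \<in> \<A>" and b: "ball a s \<subseteq> chart_im c"
  shows "\<exists>f. \<forall>y\<in>ball a s. (f has_derivative (\<lambda>v. \<omega> c (chart_inv c y) \<bullet> v)) (at y)"
proof -
  let ?\<Omega> = "\<lambda>y. \<omega> c (chart_inv c y)"
  have C1: "C1_on (ball a s) ?\<Omega>" by (rule C1_on_subset[OF one_form_C1_on(1)[OF \<omega>(1) c] b])
  have sym: "frechet_derivative ?\<Omega> (at z) v \<bullet> w = frechet_derivative ?\<Omega> (at z) w \<bullet> v" if z: "z \<in> ball a s" for z v w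
  proof -
    have D: "(?\<Omega> has_derivative frechet_derivative ?\<Omega> (at z)) (at z)" by (rule C1_on_has_derivative[OF C1 z])
    let ?P = "\<lambda>i j. frechet_derivative (\<lambda>y. ?\<Omega> y $ j) (at z) (axis i 1)"
    have comp: "frechet_derivative ?\<Omega> (at z) u $ j = frechet_derivative (\<lambda>y. ?\<Omega> y $ j) (at z) u" for u j
      using frechet_derivative_at[OF bounded_linear.has_derivative[OF bounded_linear_vec_nth D, of j]] by (metis)
    have P: "?P i j = ?P j i" for i j
    proof -
      have zc: "z \<in> chart_im c" using z b by blast
      from \<omega>(2)[unfolded closed_form_def, rule_format, OF c chart_inv_in_dom[OF zc], of i j]
      show ?thesis by (simp add: partial_deriv_def zc)
    qed
    have ex: "frechet_derivative ?\<Omega> (at z) u \<bullet> w = (\<Sum>j\<in>UNIV. \<Sum>i\<in>UNIV. u $ i * w $ j * ?P i j)" for u w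
    proof -
      have lin: "linear (frechet_derivative ?\<Omega> (at z))" by (rule has_derivative_linear[OF D])
      have "u = (\<Sum>i\<in>UNIV. u $ i *\<^sub>R axis i 1)"
        by (simp add: vec_eq_iff axis_def if_distrib[of "\<lambda>x. _ * x"] cong: if_cong)
      then have "frechet_derivative ?\<Omega> (at z) u = (\<Sum>i\<in>UNIV. u $ i *\<^sub>R frechet_derivative ?\<Omega> (at z) (axis i 1))"
        using linear_sum[OF lin, of "\<lambda>i. u $ i *\<^sub>R axis i 1" UNIV] linear_scale[OF lin] by simp
      then show ?thesis
        by (simp add: inner_vec_def comp sum_distrib_left sum_distrib_right mult_ac)
    qed
    show ?thesis unfolding ex by (subst sum.swap) (simp add: P[symmetric] mult_ac)
  qed
  show ?thesis
    by (rule poincare_lemma_ball[OF C1 sym]) (assumption, blast)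
qed

lemma coord_ball_at:
  assumes "p \<in> topspace X"
  obtains c s where "c \<in> \<A>" "p \<in> chart_dom c" "0 < s" "cball (chart_map c p) s \<subseteq> chart_im c"
proof -
  obtain c s where "c \<in> \<A>" "p \<in> chart_dom c" "0 < s" "cball (chart_map c p) s \<subseteq> chart_map c ` (topspace X \<inter> chart_dom c)"
    using coord_ball[OF openin_topspace assms] .
  moreover have "chart_map c ` (topspace X \<inter> chart_dom c) \<subseteq> chart_im c" by (auto simp: chart_im_def)
  ultimately show thesis using that by (meson order_trans)
qed

lemma flux_latticeD:
  assumes "\<omega> \<in> flux_lattice X \<A> h"
  shows "one_form \<A> \<omega>" "closed_form \<A> \<omega>" "co_closed \<A> h \<omega>"
  using assms unfolding flux_lattice_def harmonic_form_def by auto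

text \<open>The phase \<open>S\<close> is the integral of \<open>\<omega>\<close> along some path from a base point; closing up two such paths
  shows that it is well defined modulo \<open>2\<pi>\<close>, whereas \<open>S\<close> itself need not be continuous.\<close>

lemma ex_phase:
  assumes L: "\<omega> \<in> flux_lattice X \<A> h"
  shows "\<exists>S :: 'a \<Rightarrow> real. \<forall>c\<in>\<A>. \<forall>a s f. ball a s \<subseteq> chart_im c \<longrightarrow>
    (\<forall>y\<in>ball a s. (f has_derivative (\<lambda>v. \<omega> c (chart_inv c y) \<bullet> v)) (at y)) \<longrightarrow>
    (\<exists>\<alpha>. \<forall>y\<in>ball a s. cis (S (chart_inv c y)) = cis (f y + \<alpha>))"
proof -
  note \<omega> = flux_latticeD[OF L]
  obtain p0 where p0: "p0 \<in> topspace X" using nonempty by blast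
  \<comment> \<open>Inside a coordinate ball a local potential exists, and any two points are joined
    by a coordinate segment, in either order.\<close>
  have seg: "\<exists>U. openin X U \<and> p \<in> U \<and> (\<forall>x\<in>U. \<forall>y\<in>U. \<exists>s. path_integral \<omega> x y s)" if p: "p \<in> topspace X" for p
  proof -
    obtain c s where c: "c \<in> \<A>" "p \<in> chart_dom c" "0 < s" "cball (chart_map c p) s \<subseteq> chart_im c"
      using coord_ball_at[OF p] .
    then have b: "ball (chart_map c p) s \<subseteq> chart_im c" using ball_subset_cball by blast
    obtain f where f: "\<forall>y\<in>ball (chart_map c p) s. (f has_derivative (\<lambda>v. \<omega> c (chart_inv c y) \<bullet> v)) (at y)"
      using ex_potential[OF \<omega>(1,2) c(1) b] ..
    let ?U = "chart_inv c ` ball (chart_map c p) s"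
    have "p \<in> ?U" using c by (intro image_eqI[of _ _ "chart_map c p"]) auto
    moreover have "\<exists>s. path_integral \<omega> x y s" if xy: "x \<in> ?U" "y \<in> ?U" for x y
    proof -
      obtain x0 y0 where "x0 \<in> ball (chart_map c p) s" "y0 \<in> ball (chart_map c p) s" "x = chart_inv c x0" "y = chart_inv c y0"
        using xy by (elim imageE) (rule that, assumption+)
      then show ?thesis using path_integral_segment[OF \<omega>(1) c(1) b bspec[OF f]] by (intro exI) simp
    qed
    ultimately show ?thesis using coord_ball_open(1)[OF c(1) b] by blast
  qed
  \<comment> \<open>Paths from \<open>p0\<close> and paths to \<open>p0\<close> are recorded
    separately, so that no path has to be reversed.\<close>
  define R where "R = {q \<in> topspace X. (\<exists>s. path_integral \<omega> p0 q s) \<and> (\<exists>s. path_integral \<omega> q p0 s)}"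
  have "R = topspace X"
  proof (rule connected_induct)
    show "R \<noteq> {}" using seg[OF p0] p0 by (auto simp: R_def)
    fix p assume "p \<in> topspace X"
    from seg[OF this] obtain U where U: "openin X U" "p \<in> U" "\<forall>x\<in>U. \<forall>y\<in>U. \<exists>s. path_integral \<omega> x y s"
      by (elim exE conjE) (rule that, assumption+)
    have "U \<subseteq> R" if UR: "U \<inter> R \<noteq> {}"
    proof
      fix x assume x: "x \<in> U"
      obtain q where q: "q \<in> U" "q \<in> R" using UR by blast
      obtain s1 where s1: "path_integral \<omega> p0 q s1" using q(2) by (auto simp: R_def)
      obtain s2 where s2: "path_integral \<omega> q p0 s2" using q(2) by (auto simp: R_def)
      obtain s3 where s3: "path_integral \<omega> q x s3" using bspec[OF bspec[OF U(3) q(1)] x] ..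
      obtain s4 where s4: "path_integral \<omega> x q s4" using bspec[OF bspec[OF U(3) x] q(1)] ..
      have "x \<in> topspace X" using x openin_subset[OF U(1)] by (rule subsetD[rotated])
      then show "x \<in> R"
        using path_integral_join[OF s1 s3] path_integral_join[OF s4 s2] by (auto simp: R_def)
    qed
    then show "\<exists>V. openin X V \<and> p \<in> V \<and> (V \<inter> R \<noteq> {} \<longrightarrow> V \<subseteq> R)" using U by blast
  qed (auto simp: R_def)
  then have reach: "\<exists>s. path_integral \<omega> p0 q s" "\<exists>s. path_integral \<omega> q p0 s" if "q \<in> topspace X" for q
    using that unfolding R_def by auto
  \<comment> \<open>The same way back \<open>r\<close> closes both paths and cancels in the
    difference.\<close>
  have uniq: "cis s = cis t" if st: "path_integral \<omega> p0 q s" "path_integral \<omega> p0 q t" "q \<in> topspace X" for q s t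
  proof -
    obtain r where r: "path_integral \<omega> q p0 r" using reach(2)[OF st(3)] ..
    have "(s + r) / (2 * pi) \<in> \<int>" "(t + r) / (2 * pi) \<in> \<int>"
      using path_integral_closed[OF path_integral_join[OF st(1) r] L] path_integral_closed[OF path_integral_join[OF st(2) r] L] by auto
    then have "(s + r) / (2 * pi) - (t + r) / (2 * pi) \<in> \<int>" by (rule Ints_diff)
    then have n: "(s - t) / (2 * pi) \<in> \<int>" by (simp add: diff_divide_distrib[symmetric])
    have "cis s = cis t * cis (2 * pi * ((s - t) / (2 * pi)))" by (simp add: cis_mult)
    then show ?thesis using n by (simp only: cis_multiple_2pi mult_1_right)
  qed
  define S where "S q = (SOME s. path_integral \<omega> p0 q s)" for q
  have S: "path_integral \<omega> p0 q (S q)" if "q \<in> topspace X" for q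
    unfolding S_def by (rule someI_ex[OF reach(1)[OF that]])
  show ?thesis
  proof (intro exI[of _ S] ballI allI impI)
    fix c a s f
    assume c: "c \<in> \<A>" and b: "ball a s \<subseteq> chart_im c"
      and f: "\<forall>y\<in>ball a s. (f has_derivative (\<lambda>v. \<omega> c (chart_inv c y) \<bullet> v)) (at y)"
    \<comment> \<open>The constant is fixed at the centre of the ball: a path to the centre is
      prolonged by a coordinate segment to \<open>y\<close>.\<close>
    have "cis (S (chart_inv c y)) = cis (f y + (S (chart_inv c a) - f a))" if y: "y \<in> ball a s" for y
    proof -
      have a: "a \<in> ball a s" using y by (metis centre_in_ball dist_not_less_zero le_less_trans mem_ball not_le)
      have sp: "chart_inv c a \<in> topspace X" "chart_inv c y \<in> topspace X"
        using a y b chart_inv_in_space[OF c] by blast+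
      have "path_integral \<omega> p0 (chart_inv c y) (S (chart_inv c a) + (f y - f a))"
        by (rule path_integral_join[OF S[OF sp(1)] path_integral_segment[OF \<omega>(1) c b bspec[OF f] a y]])
      from uniq[OF S[OF sp(2)] this sp(2)] show ?thesis by (simp add: algebra_simps)
    qed
    then show "\<exists>\<alpha>. \<forall>y\<in>ball a s. cis (S (chart_inv c y)) = cis (f y + \<alpha>)" by blast
  qed
qed

text \<open>The Poincare inequality makes \<open>f\<close> nearly constant on the ball, and the constant is close to a
  multiple of \<open>2\<pi>\<close> because \<open>cis f\<close> is close to \<open>1\<close>.\<close>

lemma shift_small:
  assumes c: "c \<in> \<A>" and s: "0 < s" and im: "cball a s \<subseteq> chart_im c" and b: "0 < b"
  shows "\<exists>\<epsilon>>0. \<forall>\<omega> f. one_form \<A> \<omega> \<longrightarrow> (\<integral>p. conorm_sq \<A> h (complexify \<omega>) p \<partial>\<mu>) < \<epsilon> \<longrightarrow>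
    (\<forall>y\<in>ball a s. (f has_derivative (\<lambda>v. \<omega> c (chart_inv c y) \<bullet> v)) (at y)) \<longrightarrow>
    (\<integral>\<^sup>+q\<in>chart_inv c ` ball a s. ennreal ((cmod (cis (f (chart_map c q)) - 1))\<^sup>2) \<partial>\<mu>) \<le> ennreal \<epsilon> \<longrightarrow>
    (\<exists>k::int. (\<integral>\<^sup>+q\<in>chart_inv c ` ball a s. ennreal ((f (chart_map c q) - 2 * pi * k)\<^sup>2) \<partial>\<mu>) < ennreal b)"
proof -
  let ?B = "ball a s" and ?W = "chart_inv c ` ball a s"
  have bb: "?B \<subseteq> chart_im c" using im ball_subset_cball by blast
  note U = coord_ball_open[OF c bb]
  define w where "w = measure \<mu> ?W"
  have w: "w > 0" using emeasure_coord_ball(2)[OF c s im] by (simp add: w_def volume.emeasure_eq_measure)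
  have em: "emeasure \<mu> ?W = ennreal w" by (simp add: w_def volume.emeasure_eq_measure)
  from chart_ball_poincare[OF c s im] obtain C where C: "C \<ge> 0" and C': "\<forall>(f :: 'a \<Rightarrow> complex) \<xi>. C1_on ?B (\<lambda>y. f (chart_inv c y)) \<longrightarrow> cofield \<xi> \<longrightarrow>
    (\<forall>y\<in>?B. \<forall>i. frechet_derivative (\<lambda>y. f (chart_inv c y)) (at y) (axis i 1) = \<xi> c (chart_inv c y) $ i) \<longrightarrow>
    (\<exists>m. (\<integral>\<^sup>+q\<in>?W. ennreal ((cmod (f q - m))\<^sup>2) \<partial>\<mu>) \<le> ennreal (C * (\<integral>p. conorm_sq \<A> h \<xi> p \<partial>\<mu>)))"
    by (elim exE conjE) (rule that, assumption+)
  \<comment> \<open>Replacing the constant by a multiple of \<open>2 * pi\<close> at distance less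
    than \<open>\<eta>\<close> costs at most \<open>2 * \<eta>\<^sup>2 * w\<close>, a quarter of
    \<open>b\<close>.\<close>
  define \<eta> where "\<eta> = sqrt (b / (8 * w))"
  have \<eta>: "\<eta> > 0" "\<eta>\<^sup>2 = b / (8 * w)" using b w by (simp_all add: \<eta>_def)
  obtain \<delta> where \<delta>: "\<delta> > 0" "\<forall>m. cmod (cis m - 1) < \<delta> \<longrightarrow> (\<exists>k::int. \<bar>m - 2 * pi * k\<bar> < \<eta>)"
    using cis_near_1[OF \<eta>(1)] by (elim exE conjE) (rule that, assumption+)
  \<comment> \<open>The first bound keeps the oscillation term \<open>2 * (C * \<epsilon>)\<close>
    below a quarter of \<open>b\<close>; the second forces \<open>cis\<close> of the constant to
    within \<open>\<delta>\<close> of 1.\<close>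
  define \<epsilon> where "\<epsilon> = min (b / (8 * (C + 1))) (\<delta>\<^sup>2 * w / (4 * (C + 1)))"
  have \<epsilon>: "\<epsilon> > 0" using b C \<delta>(1) w by (simp add: \<epsilon>_def)
  have "\<epsilon> \<le> b / (8 * (C + 1))" by (simp add: \<epsilon>_def)
  then have "\<epsilon> * (8 * (C + 1)) \<le> b" by (subst (asm) pos_le_divide_eq) (use C in auto)
  then have \<epsilon>1: "8 * C * \<epsilon> + 8 * \<epsilon> \<le> b" using C by (simp add: algebra_simps)
  have "\<epsilon> \<le> \<delta>\<^sup>2 * w / (4 * (C + 1))" by (simp add: \<epsilon>_def)
  then have "\<epsilon> * (4 * (C + 1)) \<le> \<delta>\<^sup>2 * w" by (subst (asm) pos_le_divide_eq) (use C in auto)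
  then have \<epsilon>2: "4 * C * \<epsilon> + 4 * \<epsilon> \<le> \<delta>\<^sup>2 * w" using C by (simp add: algebra_simps)
  show ?thesis
  proof (intro exI[of _ \<epsilon>] conjI allI impI \<epsilon>)
    fix \<omega> f
    let ?E = "\<integral>p. conorm_sq \<A> h (complexify \<omega>) p \<partial>\<mu>"
    assume \<omega>: "one_form \<A> \<omega>" and E: "?E < \<epsilon>"
      and f: "\<forall>y\<in>?B. (f has_derivative (\<lambda>v. \<omega> c (chart_inv c y) \<bullet> v)) (at y)"
      and near: "(\<integral>\<^sup>+q\<in>?W. ennreal ((cmod (cis (f (chart_map c q)) - 1))\<^sup>2) \<partial>\<mu>) \<le> ennreal \<epsilon>"
    let ?F = "\<lambda>q. complex_of_real (f (chart_map c q))"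
    have DF: "((\<lambda>y. ?F (chart_inv c y)) has_derivative (\<lambda>v. complex_of_real (\<omega> c (chart_inv c y) \<bullet> v))) (at y)" if y: "y \<in> ?B" for y
    proof (rule has_derivative_transform_within_open[of _ _ _ _ ?B])
      show "((\<lambda>y. complex_of_real (f y)) has_derivative (\<lambda>v. complex_of_real (\<omega> c (chart_inv c y) \<bullet> v))) (at y)"
        by (rule bounded_linear.has_derivative[OF bounded_linear_of_real bspec[OF f y]])
    qed (use y bb in auto)
    have c\<omega>: "continuous_on ?B (\<lambda>y. \<omega> c (chart_inv c y))"
      by (rule continuous_on_subset[OF C1_on_imp_continuous_on[OF one_form_C1_on(1)[OF \<omega> c]] bb])
    have C1F: "C1_on ?B (\<lambda>y. ?F (chart_inv c y))"
      by (rule C1_onI[where D="\<lambda>y v. complex_of_real (\<omega> c (chart_inv c y) \<bullet> v)"])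
        (use DF in \<open>auto intro!: continuous_intros c\<omega>\<close>)
    have comp: "\<forall>y\<in>?B. \<forall>i. frechet_derivative (\<lambda>y. ?F (chart_inv c y)) (at y) (axis i 1) = complexify \<omega> c (chart_inv c y) $ i"
    proof (intro ballI allI)
      fix y i assume "y \<in> ?B"
      from frechet_derivative_at[OF DF[OF this], symmetric]
      show "frechet_derivative (\<lambda>y. ?F (chart_inv c y)) (at y) (axis i 1) = complexify \<omega> c (chart_inv c y) $ i"
        by (simp add: complexify_def inner_axis)
    qed
    have "\<exists>m. (\<integral>\<^sup>+q\<in>?W. ennreal ((cmod (?F q - m))\<^sup>2) \<partial>\<mu>) \<le> ennreal (C * ?E)"
      by (rule C'[rule_format, OF C1F cofield_complexify[OF \<omega>]]) (use comp in blast)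
    then obtain m where m: "(\<integral>\<^sup>+q\<in>?W. ennreal ((cmod (?F q - m))\<^sup>2) \<partial>\<mu>) \<le> ennreal (C * ?E)" ..
    \<comment> \<open>\<open>f\<close> is real, so passing to the real part of the constant does not
      increase its distance from \<open>f\<close>.\<close>
    define m0 where "m0 = Re m"
    have cf: "continuous_on ?B f"
      by (rule continuous_at_imp_continuous_on, rule ballI, rule has_derivative_continuous, rule bspec[OF f])
    have cfi: "continuous_on ?B (\<lambda>y. f (chart_map c (chart_inv c y)))"
      by (rule continuous_on_eq[OF cf]) (use bb in auto)
    define P where "P q = ennreal (indicator ?W q *\<^sub>R (f (chart_map c q) - m0)\<^sup>2)" for q
    define Q where "Q q = ennreal (indicator ?W q *\<^sub>R (cmod (cis (f (chart_map c q)) - 1))\<^sup>2)" for q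
    have "(\<lambda>q. indicator ?W q *\<^sub>R (f (chart_map c q) - m0)\<^sup>2) \<in> borel_measurable borel_space"
      by (rule measurable_on_coord_ball[OF c bb]) (intro continuous_intros cfi)
    then have [measurable]: "P \<in> borel_measurable \<mu>" unfolding P_def[abs_def] by measurable
    have "(\<lambda>q. indicator ?W q *\<^sub>R (cmod (cis (f (chart_map c q)) - 1))\<^sup>2) \<in> borel_measurable borel_space"
      by (rule measurable_on_coord_ball[OF c bb]) (intro continuous_intros cfi)
    then have [measurable]: "Q \<in> borel_measurable \<mu>" unfolding Q_def[abs_def] by measurable
    have W [measurable]: "?W \<in> sets \<mu>" using U(1) by simp
    have "(\<integral>\<^sup>+q. P q \<partial>\<mu>) \<le> (\<integral>\<^sup>+q\<in>?W. ennreal ((cmod (?F q - m))\<^sup>2) \<partial>\<mu>)"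
    proof (rule nn_integral_mono)
      fix q
      have "\<bar>f (chart_map c q) - m0\<bar> \<le> cmod (?F q - m)"
        using abs_Re_le_cmod[of "?F q - m"] by (simp add: m0_def)
      then have "(f (chart_map c q) - m0)\<^sup>2 \<le> (cmod (?F q - m))\<^sup>2"
        by (metis abs_ge_zero power2_abs power_mono)
      then show "P q \<le> ennreal ((cmod (?F q - m))\<^sup>2) * indicator ?W q"
        by (simp add: P_def indicator_def ennreal_leI)
    qed
    also have "\<dots> \<le> ennreal (C * \<epsilon>)"
      using m C E by (meson ennreal_leI less_imp_le mult_left_mono order_trans)
    finally have P: "(\<integral>\<^sup>+q. P q \<partial>\<mu>) \<le> ennreal (C * \<epsilon>)" .
    have "(\<integral>\<^sup>+q. Q q \<partial>\<mu>) = (\<integral>\<^sup>+q\<in>?W. ennreal ((cmod (cis (f (chart_map c q)) - 1))\<^sup>2) \<partial>\<mu>)"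
      by (intro nn_integral_cong) (simp add: Q_def indicator_def)
    with near have Q: "(\<integral>\<^sup>+q. Q q \<partial>\<mu>) \<le> ennreal \<epsilon>" by simp
    \<comment> \<open>The number \<open>cis m0\<close> is compared with 1 by way of
      \<open>cis\<close> of \<open>f\<close>, in mean square over the ball: \<open>P\<close>
      controls the first distance and \<open>Q\<close> the second.\<close>
    have "ennreal ((cmod (cis m0 - 1))\<^sup>2) * ennreal w = (\<integral>\<^sup>+q\<in>?W. ennreal ((cmod (cis m0 - 1))\<^sup>2) \<partial>\<mu>)"
      unfolding em[symmetric] by (rule nn_integral_cmult_indicator[symmetric, OF W])
    also have "\<dots> \<le> (\<integral>\<^sup>+q. 2 * P q + 2 * Q q \<partial>\<mu>)"
    proof (rule nn_integral_mono)
      fix q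
      let ?x = "f (chart_map c q)"
      have "(cmod (cis m0 - 1))\<^sup>2 \<le> 2 * (cmod (cis m0 - cis ?x))\<^sup>2 + 2 * (cmod (cis ?x - 1))\<^sup>2"
        using norm_add_sq_le[of "cis m0 - cis ?x" "cis ?x - 1"] by simp
      moreover have "(cmod (cis m0 - cis ?x))\<^sup>2 \<le> \<bar>m0 - ?x\<bar>\<^sup>2" by (intro power_mono norm_cis_diff_le) simp
      ultimately have "(cmod (cis m0 - 1))\<^sup>2 \<le> 2 * (?x - m0)\<^sup>2 + 2 * (cmod (cis ?x - 1))\<^sup>2"
        by (simp add: power2_commute)
      then have "ennreal ((cmod (cis m0 - 1))\<^sup>2) \<le> ennreal (2 * (?x - m0)\<^sup>2 + 2 * (cmod (cis ?x - 1))\<^sup>2)" by (rule ennreal_leI)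
      also have "\<dots> = 2 * ennreal ((?x - m0)\<^sup>2) + 2 * ennreal ((cmod (cis ?x - 1))\<^sup>2)"
        by (simp add: ennreal_plus ennreal_mult)
      finally show "ennreal ((cmod (cis m0 - 1))\<^sup>2) * indicator ?W q \<le> 2 * P q + 2 * Q q"
        by (simp add: P_def Q_def indicator_def)
    qed
    also have "\<dots> = 2 * (\<integral>\<^sup>+q. P q \<partial>\<mu>) + 2 * (\<integral>\<^sup>+q. Q q \<partial>\<mu>)"
      by (simp add: nn_integral_add nn_integral_cmult)
    also have "\<dots> \<le> 2 * ennreal (C * \<epsilon>) + 2 * ennreal \<epsilon>" by (intro add_mono mult_left_mono P Q) simp_all
    also have "\<dots> = ennreal (2 * (C * \<epsilon>) + 2 * \<epsilon>)" using C \<epsilon> by (simp add: ennreal_plus ennreal_mult)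
    finally have F: "ennreal ((cmod (cis m0 - 1))\<^sup>2) * ennreal w \<le> ennreal (2 * (C * \<epsilon>) + 2 * \<epsilon>)" .
    have "ennreal ((cmod (cis m0 - 1))\<^sup>2 * w) \<le> ennreal (2 * (C * \<epsilon>) + 2 * \<epsilon>)"
      by (rule order_trans[OF eq_refl F], rule ennreal_mult) (use w in simp_all)
    then have "(cmod (cis m0 - 1))\<^sup>2 * w \<le> 2 * (C * \<epsilon>) + 2 * \<epsilon>"
      by (rule iffD1[OF ennreal_le_iff, rotated]) (use C \<epsilon> in simp)
    also have "\<dots> < \<delta>\<^sup>2 * w" using \<epsilon>2 \<epsilon> mult_nonneg_nonneg[OF C less_imp_le[OF \<epsilon>]] by (simp only: mult.assoc)
    finally have "(cmod (cis m0 - 1))\<^sup>2 < \<delta>\<^sup>2" using w by simp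
    then have "cmod (cis m0 - 1) < \<delta>" using \<delta>(1) by (rule power2_less_imp_less[OF _ less_imp_le])
    then obtain k :: int where k: "\<bar>m0 - 2 * pi * k\<bar> < \<eta>" using \<delta>(2) by blast
    have k2: "(m0 - 2 * pi * k)\<^sup>2 \<le> b / (8 * w)"
      unfolding \<eta>(2)[symmetric] using k by (metis abs_ge_zero less_imp_le power2_abs power_mono)
    have "(\<integral>\<^sup>+q\<in>?W. ennreal ((f (chart_map c q) - 2 * pi * k)\<^sup>2) \<partial>\<mu>) \<le> (\<integral>\<^sup>+q. 2 * P q + ennreal (b / (4 * w)) * indicator ?W q \<partial>\<mu>)"
    proof (rule nn_integral_mono)
      fix q
      let ?x = "f (chart_map c q)"
      have "(?x - 2 * pi * k)\<^sup>2 \<le> 2 * (?x - m0)\<^sup>2 + 2 * (m0 - 2 * pi * k)\<^sup>2"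
        using norm_add_sq_le[of "?x - m0" "m0 - 2 * pi * k"] by simp
      also have "\<dots> \<le> 2 * (?x - m0)\<^sup>2 + b / (4 * w)" using k2 by simp
      finally have "ennreal ((?x - 2 * pi * k)\<^sup>2) \<le> ennreal (2 * (?x - m0)\<^sup>2 + b / (4 * w))" by (rule ennreal_leI)
      also have "\<dots> = 2 * ennreal ((?x - m0)\<^sup>2) + ennreal (b / (4 * w))"
        using b w by (simp add: ennreal_plus ennreal_mult)
      finally show "ennreal ((?x - 2 * pi * k)\<^sup>2) * indicator ?W q \<le> 2 * P q + ennreal (b / (4 * w)) * indicator ?W q"
        by (simp add: P_def indicator_def)
    qed
    also have "\<dots> = 2 * (\<integral>\<^sup>+q. P q \<partial>\<mu>) + ennreal (b / (4 * w)) * emeasure \<mu> ?W"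
      using W by (simp add: nn_integral_add nn_integral_cmult)
    also have "\<dots> \<le> 2 * ennreal (C * \<epsilon>) + ennreal (b / (4 * w)) * ennreal w"
      unfolding em by (intro add_mono mult_left_mono P) simp_all
    also have "\<dots> = ennreal (2 * (C * \<epsilon>) + b / (4 * w) * w)"
    proof -
      have "ennreal (b / (4 * w)) * ennreal w = ennreal (b / (4 * w) * w)"
        by (rule ennreal_mult[symmetric]) (use b w in simp_all)
      moreover have "2 * ennreal (C * \<epsilon>) = ennreal (2 * (C * \<epsilon>))"
        by (subst ennreal_mult) (use C \<epsilon> in simp_all)
      moreover have "ennreal (2 * (C * \<epsilon>)) + ennreal (b / (4 * w) * w) = ennreal (2 * (C * \<epsilon>) + b / (4 * w) * w)"
        by (rule ennreal_plus[symmetric]) (use C \<epsilon> b w in simp_all)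
      ultimately show ?thesis by (simp only:)
    qed
    also have "\<dots> < ennreal b"
    proof (rule ennreal_lessI[OF b])
      show "2 * (C * \<epsilon>) + b / (4 * w) * w < b" proof -
        have "b / (4 * w) * w = b / 4" using w by simp
        then show ?thesis using \<epsilon>1 \<epsilon> b by (simp only: mult.assoc)
      qed
    qed
    finally show "\<exists>k::int. (\<integral>\<^sup>+q\<in>?W. ennreal ((f (chart_map c q) - 2 * pi * k)\<^sup>2) \<partial>\<mu>) < ennreal b" ..
  qed
qed

text \<open>Locally \<open>cis S\<close> is \<open>cis\<close> of a potential of
  \<open>\<omega>\<close> plus a constant, so its differential is \<open>\<omega>\<close> times the
  function \<open>\<i> * cis (S q)\<close>, which has modulus 1.\<close>

lemma conorm_phase:
  fixes S :: "'a \<Rightarrow> real"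
  assumes L: "\<omega> \<in> flux_lattice X \<A> h"
    and S: "\<forall>c\<in>\<A>. \<forall>a s f. ball a s \<subseteq> chart_im c \<longrightarrow>
      (\<forall>y\<in>ball a s. (f has_derivative (\<lambda>v. \<omega> c (chart_inv c y) \<bullet> v)) (at y)) \<longrightarrow>
      (\<exists>\<alpha>. \<forall>y\<in>ball a s. cis (S (chart_inv c y)) = cis (f y + \<alpha>))"
  shows "C1 (\<lambda>q. cis (S q))"
    and "p \<in> topspace X \<Longrightarrow> conorm_sq \<A> h (diff_fun (\<lambda>q. cis (S q))) p = conorm_sq \<A> h (complexify \<omega>) p"
proof -
  note \<omega> = flux_latticeD[OF L]
  let ?u = "\<lambda>q. cis (S q)"
  have D: "((\<lambda>y. ?u (chart_inv c y)) has_derivative (\<lambda>v. (\<omega> c (chart_inv c y) \<bullet> v) *\<^sub>R (\<i> * ?u (chart_inv c y)))) (at y)"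
    if c: "c \<in> \<A>" and y: "y \<in> chart_im c" for c y
  proof -
    obtain s where s: "0 < s" "ball y s \<subseteq> chart_im c"
      using chart_im_open[OF c] y open_contains_ball by blast
    obtain f where f: "\<forall>z\<in>ball y s. (f has_derivative (\<lambda>v. \<omega> c (chart_inv c z) \<bullet> v)) (at z)"
      using ex_potential[OF \<omega>(1,2) c s(2)] ..
    obtain \<alpha> where \<alpha>: "\<forall>z\<in>ball y s. cis (S (chart_inv c z)) = cis (f z + \<alpha>)"
      using S[rule_format, OF c s(2)] f by blast
    have yb: "y \<in> ball y s" using s(1) by simp
    have "((\<lambda>z. f z + \<alpha>) has_derivative (\<lambda>v. \<omega> c (chart_inv c y) \<bullet> v)) (at y)"
      using has_derivative_add[OF bspec[OF f yb] has_derivative_const[of \<alpha>]] by simp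
    from has_derivative_cis[OF this]
    have "((\<lambda>z. cis (f z + \<alpha>)) has_derivative (\<lambda>v. (\<omega> c (chart_inv c y) \<bullet> v) *\<^sub>R (\<i> * cis (f y + \<alpha>)))) (at y)" .
    then have "((\<lambda>z. cis (S (chart_inv c z))) has_derivative (\<lambda>v. (\<omega> c (chart_inv c y) \<bullet> v) *\<^sub>R (\<i> * cis (f y + \<alpha>)))) (at y)"
      by (rule has_derivative_transform_within_open[OF _ open_ball yb]) (use \<alpha> in simp)
    then show ?thesis using bspec[OF \<alpha> yb] by simp
  qed
  show C1u: "C1 ?u"
    unfolding C1_def
  proof
    fix c assume c: "c \<in> \<A>"
    have cu: "continuous_on (chart_im c) (\<lambda>y. ?u (chart_inv c y))"
      by (rule continuous_at_imp_continuous_on, rule ballI, rule has_derivative_continuous, rule D[OF c])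
    show "C1_on (chart_im c) (\<lambda>y. ?u (chart_inv c y))"
      by (rule C1_onI[OF D[OF c]], assumption)
        (intro continuous_intros cu C1_on_imp_continuous_on[OF one_form_C1_on(1)[OF \<omega>(1) c]])
  qed
  show "conorm_sq \<A> h (diff_fun ?u) p = conorm_sq \<A> h (complexify \<omega>) p" if p: "p \<in> topspace X"
  proof -
    let ?c = "chart_at \<A> p"
    have c: "?c \<in> \<A>" "p \<in> chart_dom ?c" using chart_at[OF p] by auto
    have "diff_fun ?u ?c p = (\<i> * ?u p) *s complexify \<omega> ?c p"
      using frechet_derivative_at[OF D[OF c(1) chart_map_in_im[OF c(2)]], symmetric] c
      by (simp add: vec_eq_iff diff_fun_nth complexify_def inner_axis scaleR_conv_of_real mult_ac)
    then have "pair (diff_fun ?u) (diff_fun ?u) p = (\<i> * ?u p) * cnj (\<i> * ?u p) * pair (complexify \<omega>) (complexify \<omega>) p"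
      by (simp add: pair_def Let_def herm_scale_left herm_scale_right)
    also have "(\<i> * ?u p) * cnj (\<i> * ?u p) = 1"
      unfolding complex_norm_square[symmetric] by (simp add: norm_mult)
    finally show ?thesis by (simp add: conorm_sq_eq)
  qed
qed

section \<open>Isolation of the zero form in the lattice\<close>

text \<open>The Poincare constant \<open>m\<close> is replaced by the value of \<open>u\<close> at a
  point where the deviation does not exceed its average. For a phase function that value has modulus
  1 and can be rotated to 1. The factor 4 arises because the split through \<open>m\<close> uses the
  bound for each half, with weight 2.\<close>

lemma near_constant:
  assumes u: "C1 u" and P: "\<exists>m. (\<integral>p. (cmod (u p - m))\<^sup>2 \<partial>\<mu>) \<le> I"
  shows "\<exists>y\<in>topspace X. (\<integral>p. (cmod (u p - u y))\<^sup>2 \<partial>\<mu>) \<le> 4 * I"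
proof -
  obtain m where m: "(\<integral>p. (cmod (u p - m))\<^sup>2 \<partial>\<mu>) \<le> I" using P ..
  let ?g = "\<lambda>p. (cmod (u p - m))\<^sup>2" and ?V = "vol X \<A> h"
  let ?J = "\<integral>p. ?g p \<partial>\<mu>"
  have cg: "cont ?g" by (intro cont_dist_sq C1_imp_cont u)
  have V: "?V > 0" by (rule vol_pos)
  have "\<exists>y\<in>topspace X. ?V * ?g y \<le> ?J"
  proof (rule ccontr)
    assume "\<not> ?thesis"
    then have lt: "?J / ?V < ?g y" if "y \<in> topspace X" for y
      using that V by (auto simp: not_le divide_less_eq mult.commute)
    obtain p where p: "p \<in> topspace X" using nonempty by blast
    have "0 < (\<integral>p. ?g p - ?J / ?V \<partial>\<mu>)"
      by (rule integral_pos_if_pos[OF cont_diff[OF cg cont_const] _ p]) (use lt p in \<open>auto simp: less_imp_le\<close>)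
    also have "(\<integral>p. ?g p - ?J / ?V \<partial>\<mu>) = ?J - (\<integral>p. ?J / ?V \<partial>\<mu>)"
      by (rule Bochner_Integration.integral_diff) (intro cont_integrable cg cont_const)+
    also have "\<dots> = 0" unfolding integral_const_vol using V by simp
    finally show False by simp
  qed
  then obtain y where y: "y \<in> topspace X" "?V * ?g y \<le> ?J" ..
  have "(\<integral>p. (cmod (u p - u y))\<^sup>2 \<partial>\<mu>) \<le> (\<integral>p. 2 * ?g p + 2 * ?g y \<partial>\<mu>)"
  proof (rule integral_mono)
    show "integrable \<mu> (\<lambda>p. (cmod (u p - u y))\<^sup>2)" by (intro cont_integrable cont_dist_sq C1_imp_cont u)
    show "integrable \<mu> (\<lambda>p. 2 * ?g p + 2 * ?g y)" by (intro cont_integrable cont_add cont_mult cg cont_const)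
    show "(cmod (u p - u y))\<^sup>2 \<le> 2 * ?g p + 2 * ?g y" for p
      using norm_add_sq_le[of "u p - m" "m - u y"] by (simp add: norm_minus_commute)
  qed
  also have "\<dots> = (\<integral>p. 2 * ?g p \<partial>\<mu>) + (\<integral>p. 2 * ?g y \<partial>\<mu>)"
    by (rule Bochner_Integration.integral_add) (intro cont_integrable cont_mult cg cont_const)+
  also have "\<dots> = 2 * ?J + 2 * (?V * ?g y)" unfolding integral_const_vol by simp
  finally show ?thesis using y m by (intro bexI[of _ y]) auto
qed

text \<open>Guarantees room for comparing potentials: each common point of the half-size balls lies
  in a coordinate ball contained in both full balls, with volume bounded below independently of the
  point. The closed half-size balls meet in a compact set, so finitely many such balls
  suffice.\<close>

lemma overlap_volume:
  assumes d: "c \<in> \<A>" "0 < s" "cball a s \<subseteq> chart_im c" and d': "c' \<in> \<A>" "0 < s'" "cball a' s' \<subseteq> chart_im c'"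
  shows "\<exists>v>0. \<forall>x. x \<in> chart_inv c ` ball a (s / 2) \<longrightarrow> x \<in> chart_inv c' ` ball a' (s' / 2) \<longrightarrow>
    (\<exists>e\<in>\<A>. \<exists>b t. ball b t \<subseteq> chart_im e \<and> x \<in> chart_inv e ` ball b t \<and>
      chart_inv e ` ball b t \<subseteq> chart_inv c ` ball a s \<and> chart_inv e ` ball b t \<subseteq> chart_inv c' ` ball a' s' \<and>
      v \<le> measure \<mu> (chart_inv e ` ball b t))"
proof -
  let ?K = "chart_inv c ` cball a (s / 2) \<inter> chart_inv c' ` cball a' (s' / 2)"
  let ?W = "chart_inv c ` ball a s" and ?W' = "chart_inv c' ` ball a' s'"
  let ?good = "\<lambda>e b t. e \<in> \<A> \<and> 0 < t \<and> cball b t \<subseteq> chart_im e \<and>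
      chart_inv e ` ball b t \<subseteq> ?W \<and> chart_inv e ` ball b t \<subseteq> ?W'"
  have b: "ball a s \<subseteq> chart_im c" "ball a' s' \<subseteq> chart_im c'" using d(3) d'(3) ball_subset_cball by blast+
  have W: "openin X ?W" "openin X ?W'" using coord_ball_open(1)[OF d(1) b(1)] coord_ball_open(1)[OF d'(1) b(2)] .
  have half: "cball a (s / 2) \<subseteq> ball a s" "cball a' (s' / 2) \<subseteq> ball a' s'" using d(2) d'(2) by auto
  have clK: "closedin X ?K"
    by (intro closedin_Int chart_inv_compact(2) d(1) d'(1) compact_cball) (use half b in blast)+
  have KW: "?K \<subseteq> ?W \<inter> ?W'" using half by blast
  \<comment> \<open>Points off \<open>?K\<close> receive neighbourhoods that miss it. Thus a
    subcover of the whole space can be used, and a member containing a point of \<open>?K\<close>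
    must be one of the good balls.\<close>
  have ex: "\<exists>U. openin X U \<and> x \<in> U \<and> (x \<in> ?K \<longrightarrow> (\<exists>e b t. ?good e b t \<and> U = chart_inv e ` ball b t)) \<and> (x \<notin> ?K \<longrightarrow> U \<inter> ?K = {})"
    if x: "x \<in> topspace X" for x
  proof (cases "x \<in> ?K")
    case True
    have op: "openin X (?W \<inter> ?W')" using W by blast
    obtain e t where e: "e \<in> \<A>" "x \<in> chart_dom e" "0 < t" "cball (chart_map e x) t \<subseteq> chart_map e ` ((?W \<inter> ?W') \<inter> chart_dom e)"
      using coord_ball[OF op subsetD[OF KW True]] .
    let ?b = "chart_map e x"
    have im: "cball ?b t \<subseteq> chart_im e" using e(4) by (auto simp: chart_im_def)
    have sub: "chart_inv e ` ball ?b t \<subseteq> ?W \<inter> ?W'"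
    proof
      fix z assume "z \<in> chart_inv e ` ball ?b t"
      then obtain y where y: "y \<in> cball ?b t" "z = chart_inv e y" using ball_subset_cball by blast
      then obtain q where "q \<in> (?W \<inter> ?W') \<inter> chart_dom e" "y = chart_map e q" using e(4) by blast
      then show "z \<in> ?W \<inter> ?W'" using y(2) e(1) by simp
    qed
    have "ball ?b t \<subseteq> chart_im e" using im ball_subset_cball by blast
    note U = coord_ball_open(1)[OF e(1) this]
    have xU: "x \<in> chart_inv e ` ball ?b t" using e by (intro image_eqI[of _ _ "chart_map e x"]) auto
    have good: "?good e ?b t" using e(1,3) im sub by blast
    show ?thesis
      by (rule exI[of _ "chart_inv e ` ball ?b t"], intro conjI impI U xU) (use True good in blast)+
  next
    case False
    have "openin X (topspace X - ?K)" using clK by blast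
    then show ?thesis using False x by (intro exI[of _ "topspace X - ?K"] conjI impI) auto
  qed
  have "\<exists>U. \<forall>x\<in>topspace X. openin X (U x) \<and> x \<in> U x \<and> (x \<in> ?K \<longrightarrow> (\<exists>e b t. ?good e b t \<and> U x = chart_inv e ` ball b t)) \<and> (x \<notin> ?K \<longrightarrow> U x \<inter> ?K = {})"
    by (rule bchoice, rule ballI, rule ex)
  then obtain U where U: "\<forall>x\<in>topspace X. openin X (U x) \<and> x \<in> U x \<and> (x \<in> ?K \<longrightarrow> (\<exists>e b t. ?good e b t \<and> U x = chart_inv e ` ball b t)) \<and> (x \<notin> ?K \<longrightarrow> U x \<inter> ?K = {})" ..
  obtain Q where Q: "finite Q" "Q \<subseteq> topspace X" "topspace X = (\<Union>x\<in>Q. U x)"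
    by (rule finite_subcover[of U]) (use U in simp_all)
  \<comment> \<open>The inserted 1 keeps the set non-empty in case no chosen ball belongs to
    \<open>?K\<close>.\<close>
  define v where "v = Min (insert 1 ((\<lambda>x. measure \<mu> (U x)) ` (Q \<inter> ?K)))"
  have fin: "finite (insert 1 ((\<lambda>x. measure \<mu> (U x)) ` (Q \<inter> ?K)))" using Q(1) by simp
  have Uq: "\<exists>e b t. ?good e b t \<and> U q = chart_inv e ` ball b t" if q: "q \<in> Q \<inter> ?K" for q
  proof -
    have "q \<in> topspace X" using q Q(2) by blast
    from bspec[OF U this] q show ?thesis by simp
  qed
  have "0 < measure \<mu> (U q)" if q: "q \<in> Q \<inter> ?K" for q
  proof -
    obtain e b t where "?good e b t" and Ueq: "U q = chart_inv e ` ball b t" using Uq[OF q] by (elim exE conjE) (rule that, simp, assumption)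
    then show ?thesis
      using emeasure_coord_ball(2)[of e t b] unfolding Ueq by (simp add: volume.emeasure_eq_measure)
  qed
  then have v: "v > 0" unfolding v_def using fin by (subst Min_gr_iff) auto
  show ?thesis
  proof (intro exI[of _ v] conjI v allI impI)
    fix x assume x: "x \<in> chart_inv c ` ball a (s / 2)" "x \<in> chart_inv c' ` ball a' (s' / 2)"
    then have xK: "x \<in> ?K" using ball_subset_cball by blast
    have "x \<in> topspace X" using xK KW openin_subset[OF W(1)] by blast
    then obtain q where q: "q \<in> Q" "x \<in> U q" using Q(3) by auto
    have qX: "q \<in> topspace X" using q Q(2) by blast
    have "q \<in> ?K" using bspec[OF U qX] q(2) xK by blast
    then have qK: "q \<in> Q \<inter> ?K" using q(1) by blast
    obtain e b t where good: "?good e b t" and Ueq: "U q = chart_inv e ` ball b t" using Uq[OF qK] by (elim exE conjE) (rule that, simp, assumption)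
    have "v \<le> measure \<mu> (U q)" unfolding v_def using fin qK by (intro Min_le) auto
    moreover have "ball b t \<subseteq> chart_im e" using good ball_subset_cball by blast
    ultimately show "\<exists>e\<in>\<A>. \<exists>b t. ball b t \<subseteq> chart_im e \<and> x \<in> chart_inv e ` ball b t \<and>
      chart_inv e ` ball b t \<subseteq> ?W \<and> chart_inv e ` ball b t \<subseteq> ?W' \<and> v \<le> measure \<mu> (chart_inv e ` ball b t)"
      using good q(2) unfolding Ueq by (intro bexI[of _ e] exI[of _ b] exI[of _ t] conjI) simp_all
  qed
qed

text \<open>If \<open>\<omega>\<close> is the differential of \<open>G\<close>, its squared norm is
  the integral of the pairing of a differential with a co-closed form, which integration by parts
  makes zero.\<close>

lemma exact_imp_zero:
  assumes \<omega>: "one_form \<A> \<omega>" "co_closed \<A> h \<omega>" and G: "potential \<omega> (topspace X) G"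
  shows "(\<integral>p. conorm_sq \<A> h (complexify \<omega>) p \<partial>\<mu>) = 0"
proof -
  let ?f = "\<lambda>q. complex_of_real (G q)"
  have D: "((\<lambda>y. ?f (chart_inv c y)) has_derivative (\<lambda>v. complex_of_real (\<omega> c (chart_inv c y) \<bullet> v))) (at y)"
    if "c \<in> \<A>" "y \<in> chart_im c" for c y
    by (rule bounded_linear.has_derivative[OF bounded_linear_of_real potentialD[OF G that chart_inv_in_space[OF that]]])
  have "C1 ?f"
    unfolding C1_def
  proof
    fix c assume c: "c \<in> \<A>"
    show "C1_on (chart_im c) (\<lambda>y. ?f (chart_inv c y))"
      by (rule C1_onI[OF D[OF c]], assumption)
        (intro continuous_intros C1_on_imp_continuous_on[OF one_form_C1_on(1)[OF \<omega>(1) c]])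
  qed
  from integral_pair_diff_coclosed[OF \<omega> this]
  have 0: "(\<integral>p. pair (diff_fun ?f) (complexify \<omega>) p \<partial>\<mu>) = 0" .
  have eq: "pair (diff_fun ?f) (complexify \<omega>) p = pair (complexify \<omega>) (complexify \<omega>) p" if p: "p \<in> topspace X" for p
  proof -
    let ?c = "chart_at \<A> p"
    have c: "?c \<in> \<A>" "p \<in> chart_dom ?c" using chart_at[OF p] by auto
    have "diff_fun ?f ?c p = complexify \<omega> ?c p"
      using frechet_derivative_at[OF D[OF c(1) chart_map_in_im[OF c(2)]], symmetric] c
      by (simp add: vec_eq_iff diff_fun_nth complexify_def inner_axis)
    then show ?thesis by (simp add: pair_def Let_def)
  qed
  have "(\<integral>p. pair (complexify \<omega>) (complexify \<omega>) p \<partial>\<mu>) = (\<integral>p. pair (diff_fun ?f) (complexify \<omega>) p \<partial>\<mu>)"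
    by (intro Bochner_Integration.integral_cong) (simp_all add: eq)
  then have "Re (\<integral>p. pair (complexify \<omega>) (complexify \<omega>) p \<partial>\<mu>) = 0" using 0 by simp
  then show ?thesis
    unfolding conorm_sq_eq
    by (subst integral_Re) (intro cont_integrable cont_pair cofield_complexify \<omega>, assumption)
qed

lemma open_chart_preimage:
  assumes c: "c \<in> \<A>" and U: "openin X U"
  shows "open {y \<in> chart_im c. chart_inv c y \<in> U}"
proof -
  have "openin (top_of_set (chart_im c)) {y \<in> topspace (top_of_set (chart_im c)). chart_inv c y \<in> U}"
    by (rule openin_continuous_map_preimage[OF continuous_map_chart_inv[OF c] U])
  then show ?thesis using chart_im_open[OF c] openin_open_trans by auto
qed

text \<open>On the common ball the potentials differ by some \<open>2 * pi * n\<close>. If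
  \<open>n\<close> were nonzero, the squared difference would integrate to at least
  \<open>4 * pi\<^sup>2 * v\<close> there, whereas the two smallness assumptions bound the integral
  by less than that. This is the origin of the threshold \<open>pi\<^sup>2 * v\<close>.\<close>

lemma shift_agree:
  assumes g: "potential \<omega> W G" "potential \<omega> W' G'"
    and meas: "(\<lambda>q. indicator W q *\<^sub>R G q) \<in> borel_measurable borel_space"
      "(\<lambda>q. indicator W' q *\<^sub>R G' q) \<in> borel_measurable borel_space"
    and e: "e \<in> \<A>" "ball b t \<subseteq> chart_im e" "x \<in> chart_inv e ` ball b t"
      "chart_inv e ` ball b t \<subseteq> W" "chart_inv e ` ball b t \<subseteq> W'"
    and v: "0 < v" "v \<le> measure \<mu> (chart_inv e ` ball b t)"
    and small: "(\<integral>\<^sup>+q\<in>W. ennreal ((G q)\<^sup>2) \<partial>\<mu>) < ennreal (pi\<^sup>2 * v)"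
      "(\<integral>\<^sup>+q\<in>W'. ennreal ((G' q)\<^sup>2) \<partial>\<mu>) < ennreal (pi\<^sup>2 * v)"
    and cis: "cis (G x) = cis (G' x)"
  shows "G x = G' x"
proof (rule ccontr)
  assume neq: "G x \<noteq> G' x"
  let ?V = "chart_inv e ` ball b t"
  obtain k where k: "\<forall>y\<in>?V. G y - G' y = k"
    using potential_diff_const[OF g e(1,2,4,5)] ..
  have kx: "k = G x - G' x" using bspec[OF k e(3)] by simp
  have "cis k = 1" unfolding kx using cis by (simp add: cis_divide[symmetric])
  then obtain n :: int where n: "k = 2 * pi * n" unfolding cis_eq_1_iff ..
  have "n \<noteq> 0" using neq n kx by auto
  then have "1 \<le> \<bar>real_of_int n\<bar>" by linarith
  from power_mono[OF this, of 2] have "1 \<le> (real_of_int n)\<^sup>2" by simp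
  then have k2: "4 * pi\<^sup>2 \<le> k\<^sup>2" by (simp add: n power_mult_distrib)
  define P where "P q = ennreal ((indicator W q *\<^sub>R G q)\<^sup>2)" for q
  define Q where "Q q = ennreal ((indicator W' q *\<^sub>R G' q)\<^sup>2)" for q
  have [measurable]: "P \<in> borel_measurable \<mu>" "Q \<in> borel_measurable \<mu>"
    using meas unfolding P_def[abs_def] Q_def[abs_def] by measurable
  have IP: "(\<integral>\<^sup>+q. P q \<partial>\<mu>) = (\<integral>\<^sup>+q\<in>W. ennreal ((G q)\<^sup>2) \<partial>\<mu>)"
    by (intro nn_integral_cong) (simp add: P_def indicator_def)
  have IQ: "(\<integral>\<^sup>+q. Q q \<partial>\<mu>) = (\<integral>\<^sup>+q\<in>W'. ennreal ((G' q)\<^sup>2) \<partial>\<mu>)"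
    by (intro nn_integral_cong) (simp add: Q_def indicator_def)
  obtain p where p: "0 \<le> p" "(\<integral>\<^sup>+q. P q \<partial>\<mu>) = ennreal p"
    using small(1) unfolding IP[symmetric] by (cases "\<integral>\<^sup>+q. P q \<partial>\<mu>" rule: ennreal_cases) auto
  obtain r where r: "0 \<le> r" "(\<integral>\<^sup>+q. Q q \<partial>\<mu>) = ennreal r"
    using small(2) unfolding IQ[symmetric] by (cases "\<integral>\<^sup>+q. Q q \<partial>\<mu>" rule: ennreal_cases) auto
  have plt: "p < pi\<^sup>2 * v" using small(1) unfolding IP[symmetric] p(2) using p(1) by (simp add: ennreal_less_iff)
  have rlt: "r < pi\<^sup>2 * v" using small(2) unfolding IQ[symmetric] r(2) using r(1) by (simp add: ennreal_less_iff)
  have V: "?V \<in> sets \<mu>" using coord_ball_open(1)[OF e(1,2)] by simp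
  have "ennreal (4 * pi\<^sup>2 * v) \<le> ennreal (4 * pi\<^sup>2) * emeasure \<mu> ?V"
    unfolding volume.emeasure_eq_measure
    by (subst ennreal_mult[symmetric]) (use v in \<open>auto intro!: ennreal_leI mult_left_mono\<close>)
  also have "\<dots> = (\<integral>\<^sup>+q\<in>?V. ennreal (4 * pi\<^sup>2) \<partial>\<mu>)"
    by (rule nn_integral_cmult_indicator[symmetric, OF V])
  also have "\<dots> \<le> (\<integral>\<^sup>+q. 2 * P q + 2 * Q q \<partial>\<mu>)"
  proof (rule nn_integral_mono)
    fix q
    show "ennreal (4 * pi\<^sup>2) * indicator ?V q \<le> 2 * P q + 2 * Q q"
    proof (cases "q \<in> ?V")
      case True
      then have W: "q \<in> W" "q \<in> W'" using e(4,5) by blast+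
      have "4 * pi\<^sup>2 \<le> (G q - G' q)\<^sup>2" using k2 bspec[OF k True] by simp
      also have "\<dots> \<le> 2 * (G q)\<^sup>2 + 2 * (G' q)\<^sup>2"
        using norm_add_sq_le[of "G q" "- G' q"] by simp
      finally have "ennreal (4 * pi\<^sup>2) \<le> ennreal (2 * (G q)\<^sup>2 + 2 * (G' q)\<^sup>2)" by (rule ennreal_leI)
      also have "\<dots> = 2 * ennreal ((G q)\<^sup>2) + 2 * ennreal ((G' q)\<^sup>2)"
        by (simp add: ennreal_plus ennreal_mult)
      finally show ?thesis using True W by (simp add: P_def Q_def)
    qed simp
  qed
  also have "\<dots> = 2 * (\<integral>\<^sup>+q. P q \<partial>\<mu>) + 2 * (\<integral>\<^sup>+q. Q q \<partial>\<mu>)"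
    by (simp add: nn_integral_add nn_integral_cmult)
  also have "\<dots> = ennreal (2 * p + 2 * r)"
    unfolding p(2) r(2) using p(1) r(1) by (simp add: ennreal_plus ennreal_mult)
  finally have "4 * pi\<^sup>2 * v \<le> 2 * p + 2 * r"
    by (rule iffD1[OF ennreal_le_iff, rotated]) (use p(1) r(1) in simp)
  then show False using plt rlt by linarith
qed

lemma potential_glue:
  assumes G: "\<And>p. p \<in> P \<Longrightarrow> potential \<omega> (W p) (G p)" and V: "\<And>p. p \<in> P \<Longrightarrow> V p \<subseteq> W p" "\<And>p. p \<in> P \<Longrightarrow> openin X (V p)"
    and cover: "topspace X = (\<Union>p\<in>P. V p)"
    and agree: "\<And>p p' x. p \<in> P \<Longrightarrow> p' \<in> P \<Longrightarrow> x \<in> V p \<Longrightarrow> x \<in> V p' \<Longrightarrow> G p x = G p' x"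
  shows "\<exists>H. potential \<omega> (topspace X) H"
proof -
  \<comment> \<open>Any member of the cover that contains \<open>x\<close> will do, because the
    functions agree wherever members meet.\<close>
  define H where "H x = G (SOME p. p \<in> P \<and> x \<in> V p) x" for x
  have H: "H x = G p x" if "p \<in> P" "x \<in> V p" for p x
  proof -
    have "(SOME p. p \<in> P \<and> x \<in> V p) \<in> P \<and> x \<in> V (SOME p. p \<in> P \<and> x \<in> V p)"
      by (rule someI[of "\<lambda>p. p \<in> P \<and> x \<in> V p"]) (use that in simp)
    then show ?thesis unfolding H_def by (intro agree) (use that in simp_all)
  qed
  have "potential \<omega> (topspace X) H"
    unfolding potential_def
  proof (intro ballI impI)
    fix c y assume c: "c \<in> \<A>" and y: "y \<in> chart_im c" "chart_inv c y \<in> topspace X"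
    obtain p where p: "p \<in> P" "chart_inv c y \<in> V p" using y(2) unfolding cover by blast
    have "chart_inv c y \<in> W p" using V(1)[OF p(1)] p(2) by blast
    note D = potentialD[OF G[OF p(1)] c y(1) this]
    show "((\<lambda>y. H (chart_inv c y)) has_derivative (\<lambda>v. \<omega> c (chart_inv c y) \<bullet> v)) (at y)"
      by (rule has_derivative_transform_within_open[OF D open_chart_preimage[OF c V(2)[OF p(1)]]])
        (use y p H[OF p(1)] in simp_all)
  qed
  then show ?thesis by (rule exI[of _ H])
qed

text \<open>The thresholds are chosen against the direction of the argument: \<open>v\<close> bounds
  overlap volumes of a fixed finite cover from below, \<open>e0\<close> makes every shifted
  potential small compared with \<open>pi\<^sup>2 * v\<close>, and \<open>\<epsilon>\<close> makes
  the phase function close enough to a constant. All are fixed before \<open>\<omega>\<close>.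
  Half-size balls cover the manifold while the potentials live on full balls, so that common points
  have room around them.\<close>

lemma flux_lattice_discrete:
  "\<exists>\<epsilon>>0. \<forall>\<omega>\<in>flux_lattice X \<A> h. (\<integral>p. conorm_sq \<A> h (complexify \<omega>) p \<partial>\<mu>) < \<epsilon> \<longrightarrow>
    (\<integral>p. conorm_sq \<A> h (complexify \<omega>) p \<partial>\<mu>) = 0"
proof -
  have "\<exists>d. \<forall>p\<in>topspace X. fst (d p) \<in> \<A> \<and> p \<in> chart_dom (fst (d p)) \<and> 0 < snd (d p) \<and>
      cball (chart_map (fst (d p)) p) (snd (d p)) \<subseteq> chart_im (fst (d p))"
  proof (rule bchoice, rule ballI)
    fix p assume p: "p \<in> topspace X"
    obtain c s where "c \<in> \<A>" "p \<in> chart_dom c" "0 < s" "cball (chart_map c p) s \<subseteq> chart_im c"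
      by (rule coord_ball_at[OF p])
    then show "\<exists>d. fst d \<in> \<A> \<and> p \<in> chart_dom (fst d) \<and> 0 < snd d \<and> cball (chart_map (fst d) p) (snd d) \<subseteq> chart_im (fst d)"
      by (intro exI[of _ "(c, s)"]) simp
  qed
  then obtain d where d: "\<forall>p\<in>topspace X. fst (d p) \<in> \<A> \<and> p \<in> chart_dom (fst (d p)) \<and> 0 < snd (d p) \<and>
      cball (chart_map (fst (d p)) p) (snd (d p)) \<subseteq> chart_im (fst (d p))" ..
  define c where "c p = fst (d p)" for p
  define s where "s p = snd (d p)" for p
  define a where "a p = chart_map (c p) p" for p
  have c: "c p \<in> \<A>" and pc: "p \<in> chart_dom (c p)" and s: "0 < s p" and im: "cball (a p) (s p) \<subseteq> chart_im (c p)"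
    if "p \<in> topspace X" for p
    using bspec[OF d that] by (simp_all add: c_def s_def a_def)
  have bb: "ball (a p) (s p) \<subseteq> chart_im (c p)" "ball (a p) (s p / 2) \<subseteq> chart_im (c p)"
    "ball (a p) (s p / 2) \<subseteq> ball (a p) (s p)" if "p \<in> topspace X" for p
  proof -
    show 1: "ball (a p) (s p) \<subseteq> chart_im (c p)" using im[OF that] ball_subset_cball by (rule order_trans[rotated])
    show 2: "ball (a p) (s p / 2) \<subseteq> ball (a p) (s p)" using s[OF that] by (intro subset_ball) simp
    show "ball (a p) (s p / 2) \<subseteq> chart_im (c p)" by (rule order_trans[OF 2 1])
  qed
  define W where "W p = chart_inv (c p) ` ball (a p) (s p)" for p
  define V where "V p = chart_inv (c p) ` ball (a p) (s p / 2)" for p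
  have V: "openin X (V p) \<and> p \<in> V p" if p: "p \<in> topspace X" for p
    using coord_ball_open(1)[OF c[OF p] bb(2)[OF p]] s[OF p] c[OF p] pc[OF p]
    unfolding V_def by (auto simp: a_def intro!: image_eqI[of _ _ "chart_map (c p) p"])
  obtain P where P: "finite P" "P \<subseteq> topspace X" "topspace X = (\<Union>p\<in>P. V p)"
    by (rule finite_subcover[OF V])
  define OV where "OV p p' v \<longleftrightarrow> 0 < v \<and> (\<forall>x. x \<in> V p \<longrightarrow> x \<in> V p' \<longrightarrow>
    (\<exists>e\<in>\<A>. \<exists>b t. ball b t \<subseteq> chart_im e \<and> x \<in> chart_inv e ` ball b t \<and>
      chart_inv e ` ball b t \<subseteq> W p \<and> chart_inv e ` ball b t \<subseteq> W p' \<and>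
      v \<le> measure \<mu> (chart_inv e ` ball b t)))" for p p' and v :: real
  have "\<exists>vv. \<forall>z\<in>P \<times> P. OV (fst z) (snd z) (vv z)"
  proof (rule bchoice, rule ballI)
    fix z assume "z \<in> P \<times> P"
    then have z: "fst z \<in> topspace X" "snd z \<in> topspace X" using P(2) by auto
    show "\<exists>v. OV (fst z) (snd z) v"
      unfolding OV_def V_def W_def
      by (rule overlap_volume[OF c[OF z(1)] s[OF z(1)] im[OF z(1)] c[OF z(2)] s[OF z(2)] im[OF z(2)]])
  qed
  then obtain vv where vv: "\<forall>z\<in>P \<times> P. OV (fst z) (snd z) (vv z)" ..
  define v where "v = Min (insert 1 (vv ` (P \<times> P)))"
  have finv: "finite (insert 1 (vv ` (P \<times> P)))" using P(1) by simp
  have vpos: "0 < v"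
    unfolding v_def using finv vv by (subst Min_gr_iff) (auto simp: OV_def)
  have vle: "v \<le> vv z" if "z \<in> P \<times> P" for z unfolding v_def using finv that by (intro Min_le) auto
  define SS where "SS p \<epsilon> \<longleftrightarrow> 0 < \<epsilon> \<and> (\<forall>\<omega> f. one_form \<A> \<omega> \<longrightarrow> (\<integral>p. conorm_sq \<A> h (complexify \<omega>) p \<partial>\<mu>) < \<epsilon> \<longrightarrow>
    (\<forall>y\<in>ball (a p) (s p). (f has_derivative (\<lambda>v. \<omega> (c p) (chart_inv (c p) y) \<bullet> v)) (at y)) \<longrightarrow>
    (\<integral>\<^sup>+q\<in>W p. ennreal ((cmod (cis (f (chart_map (c p) q)) - 1))\<^sup>2) \<partial>\<mu>) \<le> ennreal \<epsilon> \<longrightarrow>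
    (\<exists>k::int. (\<integral>\<^sup>+q\<in>W p. ennreal ((f (chart_map (c p) q) - 2 * pi * k)\<^sup>2) \<partial>\<mu>) < ennreal (pi\<^sup>2 * v)))" for p and \<epsilon> :: real
  have "\<exists>ee. \<forall>p\<in>P. SS p (ee p)"
  proof (rule bchoice, rule ballI)
    fix p assume "p \<in> P"
    then have p: "p \<in> topspace X" using P(2) by auto
    show "\<exists>\<epsilon>. SS p \<epsilon>"
      unfolding SS_def W_def
      by (rule shift_small[OF c[OF p] s[OF p] im[OF p]]) (use vpos in simp)
  qed
  then obtain ee where ee: "\<forall>p\<in>P. SS p (ee p)" ..
  define e0 where "e0 = Min (insert 1 (ee ` P))"
  have fine: "finite (insert 1 (ee ` P))" using P(1) by simp
  have e0: "0 < e0" unfolding e0_def using fine ee by (subst Min_gr_iff) (auto simp: SS_def)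
  have e0le: "e0 \<le> ee p" if "p \<in> P" for p unfolding e0_def using fine that by (intro Min_le) auto
  obtain C where C: "C > 0" "\<forall>f. C1 f \<longrightarrow> (\<exists>m. (\<integral>p. (cmod (f p - m))\<^sup>2 \<partial>\<mu>) \<le> C * energy f)"
    using poincare by (elim exE conjE) (rule that, assumption+)
  \<comment> \<open>Keeps both the bound \<open>4 * (C * ?E)\<close> from
    \<open>near_constant\<close> and the energy \<open>?E\<close> of the form at most
    \<open>e0\<close>.\<close>
  define \<epsilon> where "\<epsilon> = e0 / (4 * C + 1)"
  have \<epsilon>: "0 < \<epsilon>" unfolding \<epsilon>_def using e0 C(1) by simp
  have \<epsilon>eq: "4 * (C * \<epsilon>) + \<epsilon> = e0"
  proof -
    have "(4 * C + 1) * \<epsilon> = e0" unfolding \<epsilon>_def using C(1) by simp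
    then show ?thesis by (simp add: algebra_simps)
  qed
  show ?thesis
  proof (intro exI[of _ \<epsilon>] conjI \<epsilon> ballI impI)
    fix \<omega>
    let ?E = "\<integral>p. conorm_sq \<A> h (complexify \<omega>) p \<partial>\<mu>"
    assume L: "\<omega> \<in> flux_lattice X \<A> h" and E: "?E < \<epsilon>"
    note \<omega> = flux_latticeD[OF L]
    have "C * ?E \<le> C * \<epsilon>" using E C(1) by simp
    then have E4: "4 * (C * ?E) \<le> e0" "?E < e0"
      using \<epsilon>eq \<epsilon> E mult_pos_pos[OF C(1) \<epsilon>] by linarith+
    obtain S :: "'a \<Rightarrow> real" where S: "\<forall>c\<in>\<A>. \<forall>a s f. ball a s \<subseteq> chart_im c \<longrightarrow>
      (\<forall>y\<in>ball a s. (f has_derivative (\<lambda>v. \<omega> c (chart_inv c y) \<bullet> v)) (at y)) \<longrightarrow>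
      (\<exists>\<alpha>. \<forall>y\<in>ball a s. cis (S (chart_inv c y)) = cis (f y + \<alpha>))"
      using ex_phase[OF L] ..
    let ?u = "\<lambda>q. cis (S q)"
    note C1u = conorm_phase(1)[OF L S]
    have en: "energy ?u = ?E"
      by (intro Bochner_Integration.integral_cong) (simp_all add: conorm_phase(2)[OF L S])
    have "\<exists>m. (\<integral>p. (cmod (?u p - m))\<^sup>2 \<partial>\<mu>) \<le> C * ?E"
      using C(2)[rule_format, OF C1u] unfolding en .
    from near_constant[OF C1u this]
    obtain y0 where y0: "(\<integral>p. (cmod (?u p - ?u y0))\<^sup>2 \<partial>\<mu>) \<le> 4 * (C * ?E)" by (elim bexE) (rule that)
    have "integrable \<mu> (\<lambda>q. (cmod (?u q - ?u y0))\<^sup>2)"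
      by (rule cont_integrable[OF cont_dist_sq[OF C1_imp_cont[OF C1u]]])
    then have near: "(\<integral>\<^sup>+q. ennreal ((cmod (?u q - ?u y0))\<^sup>2) \<partial>\<mu>) \<le> ennreal e0"
      by (subst nn_integral_eq_integral) (use y0 E4 in \<open>auto intro!: ennreal_leI\<close>)
    have "\<exists>G. \<forall>p\<in>P. potential \<omega> (W p) (G p) \<and> (\<forall>q\<in>W p. cis (G p q) = ?u q * cis (- S y0)) \<and>
      (\<lambda>q. indicator (W p) q *\<^sub>R G p q) \<in> borel_measurable borel_space \<and>
      (\<integral>\<^sup>+q\<in>W p. ennreal ((G p q)\<^sup>2) \<partial>\<mu>) < ennreal (pi\<^sup>2 * v)"
    proof (rule bchoice, rule ballI)
      fix p assume p: "p \<in> P"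
      then have pX: "p \<in> topspace X" using P(2) by auto
      note cp = c[OF pX] and bp = bb(1)[OF pX]
      let ?B = "ball (a p) (s p)"
      obtain f where f: "\<forall>y\<in>?B. (f has_derivative (\<lambda>v. \<omega> (c p) (chart_inv (c p) y) \<bullet> v)) (at y)"
        using ex_potential[OF \<omega>(1,2) cp bp] ..
      obtain \<alpha> where \<alpha>: "\<forall>y\<in>?B. ?u (chart_inv (c p) y) = cis (f y + \<alpha>)"
        using S[rule_format, OF cp bp] f by blast
      \<comment> \<open>After this shift \<open>cis\<close> of the potential is \<open>cis S\<close>
        rotated by its value at \<open>y0\<close>, hence close to 1 in mean. The rotation is the
        same on all balls, so the potentials agree modulo \<open>2 * pi\<close> where balls
        meet.\<close>
      define g where "g y = f y + (\<alpha> - S y0)" for y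
      have dg: "\<forall>y\<in>?B. (g has_derivative (\<lambda>v. \<omega> (c p) (chart_inv (c p) y) \<bullet> v)) (at y)"
      proof
        fix y assume y: "y \<in> ?B"
        show "(g has_derivative (\<lambda>v. \<omega> (c p) (chart_inv (c p) y) \<bullet> v)) (at y)"
          using has_derivative_add[OF bspec[OF f y] has_derivative_const[of "\<alpha> - S y0"]] by (simp add: g_def[abs_def])
      qed
      have cg: "cis (g (chart_map (c p) q)) = ?u q * cis (- S y0)" if q: "q \<in> W p" for q
      proof -
        obtain y where y: "y \<in> ?B" "q = chart_inv (c p) y" using q unfolding W_def by blast
        have "y \<in> chart_im (c p)" using bp y(1) by blast
        then have "cis (g (chart_map (c p) q)) = cis ((f y + \<alpha>) + - S y0)" by (simp add: y(2) g_def add_diff_eq)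
        also have "\<dots> = cis (f y + \<alpha>) * cis (- S y0)" by (rule cis_mult[symmetric])
        finally show ?thesis using bspec[OF \<alpha> y(1)] y(2) by simp
      qed
      have cg1: "cmod (cis (g (chart_map (c p) q)) - 1) = cmod (?u q - ?u y0)" if q: "q \<in> W p" for q
      proof -
        have "cis (g (chart_map (c p) q)) - 1 = (?u q - ?u y0) * cis (- S y0)"
          unfolding cg[OF q] left_diff_distrib cis_mult by simp
        then show ?thesis by (simp only: norm_mult norm_cis mult_1_right)
      qed
      have "(\<integral>\<^sup>+q\<in>W p. ennreal ((cmod (cis (g (chart_map (c p) q)) - 1))\<^sup>2) \<partial>\<mu>) \<le> (\<integral>\<^sup>+q. ennreal ((cmod (?u q - ?u y0))\<^sup>2) \<partial>\<mu>)"
        by (rule nn_integral_mono) (simp add: indicator_def cg1)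
      also have "\<dots> \<le> ennreal (ee p)"
        by (rule order_trans[OF near ennreal_leI[OF e0le[OF p]]])
      finally have near_p: "(\<integral>\<^sup>+q\<in>W p. ennreal ((cmod (cis (g (chart_map (c p) q)) - 1))\<^sup>2) \<partial>\<mu>) \<le> ennreal (ee p)" .
      have "?E < ee p" using E4(2) e0le[OF p] by (rule less_le_trans)
      from bspec[OF ee p, unfolded SS_def, THEN conjunct2, rule_format, OF \<omega>(1) this bspec[OF dg] near_p]
      obtain k :: int where k: "(\<integral>\<^sup>+q\<in>W p. ennreal ((g (chart_map (c p) q) - 2 * pi * k)\<^sup>2) \<partial>\<mu>) < ennreal (pi\<^sup>2 * v)" ..
      let ?G = "\<lambda>q. g (chart_map (c p) q) - 2 * pi * k"
      have dG: "((\<lambda>y. g y - 2 * pi * k) has_derivative (\<lambda>v. \<omega> (c p) (chart_inv (c p) y) \<bullet> v)) (at y)" if y: "y \<in> ?B" for y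
        using has_derivative_diff[OF bspec[OF dg y] has_derivative_const[of "2 * pi * k"]] by simp
      have pG: "potential \<omega> (W p) ?G"
        unfolding W_def by (rule potential_chart[OF \<omega>(1) cp bp dG])
      have "continuous_on ?B (\<lambda>y. ?G (chart_inv (c p) y))"
      proof (rule continuous_at_imp_continuous_on, rule ballI, rule has_derivative_continuous)
        fix y assume y: "y \<in> ?B"
        show "((\<lambda>y. ?G (chart_inv (c p) y)) has_derivative (\<lambda>v. \<omega> (c p) (chart_inv (c p) y) \<bullet> v)) (at y)"
          by (rule potentialD[OF pG cp]) (use y bp in \<open>auto simp: W_def\<close>)
      qed
      from measurable_on_coord_ball[OF cp bp this]
      have mG: "(\<lambda>q. indicator (W p) q *\<^sub>R ?G q) \<in> borel_measurable borel_space" unfolding W_def .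
      have cG: "cis (?G q) = ?u q * cis (- S y0)" if q: "q \<in> W p" for q
      proof -
        have "cis (?G q) = cis (g (chart_map (c p) q)) / cis (2 * pi * real_of_int k)" by (rule cis_divide[symmetric])
        then show ?thesis using cg[OF q] by simp
      qed
      show "\<exists>G. potential \<omega> (W p) G \<and> (\<forall>q\<in>W p. cis (G q) = ?u q * cis (- S y0)) \<and>
        (\<lambda>q. indicator (W p) q *\<^sub>R G q) \<in> borel_measurable borel_space \<and>
        (\<integral>\<^sup>+q\<in>W p. ennreal ((G q)\<^sup>2) \<partial>\<mu>) < ennreal (pi\<^sup>2 * v)"
        by (rule exI[of _ ?G]) (intro conjI ballI pG cG mG k)
    qed
    then obtain G where G: "\<forall>p\<in>P. potential \<omega> (W p) (G p) \<and> (\<forall>q\<in>W p. cis (G p q) = ?u q * cis (- S y0)) \<and>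
      (\<lambda>q. indicator (W p) q *\<^sub>R G p q) \<in> borel_measurable borel_space \<and>
      (\<integral>\<^sup>+q\<in>W p. ennreal ((G p q)\<^sup>2) \<partial>\<mu>) < ennreal (pi\<^sup>2 * v)" ..
    have G1: "potential \<omega> (W p) (G p)" and G2: "\<And>q. q \<in> W p \<Longrightarrow> cis (G p q) = ?u q * cis (- S y0)"
      and G3: "(\<lambda>q. indicator (W p) q *\<^sub>R G p q) \<in> borel_measurable borel_space"
      and G4: "(\<integral>\<^sup>+q\<in>W p. ennreal ((G p q)\<^sup>2) \<partial>\<mu>) < ennreal (pi\<^sup>2 * v)" if "p \<in> P" for p
      using bspec[OF G that] by simp_all
    have VW: "V p \<subseteq> W p" if "p \<in> P" for p
      unfolding V_def W_def by (rule image_mono, rule bb(3)) (use that P(2) in blast)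
    have "\<exists>H. potential \<omega> (topspace X) H"
    proof (rule potential_glue[OF G1 VW _ P(3)])
      show "openin X (V p)" if "p \<in> P" for p using V that P(2) by blast
      show "G p x = G p' x" if p: "p \<in> P" "p' \<in> P" and x: "x \<in> V p" "x \<in> V p'" for p p' x
      proof -
        have z: "(p, p') \<in> P \<times> P" using p by simp
        from bspec[OF vv z, unfolded OV_def fst_conv snd_conv, THEN conjunct2, rule_format, OF x]
        obtain e b t where e: "e \<in> \<A>" "ball b t \<subseteq> chart_im e" "x \<in> chart_inv e ` ball b t"
          "chart_inv e ` ball b t \<subseteq> W p" "chart_inv e ` ball b t \<subseteq> W p'"
          and m: "vv (p, p') \<le> measure \<mu> (chart_inv e ` ball b t)"
          by (elim bexE exE conjE) (rule that, assumption+)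
        have xW: "x \<in> W p" "x \<in> W p'" using VW p x by blast+
        show ?thesis
          by (rule shift_agree[OF G1[OF p(1)] G1[OF p(2)] G3[OF p(1)] G3[OF p(2)] e vpos
                order_trans[OF vle[OF z] m] G4[OF p(1)] G4[OF p(2)]])
            (simp only: G2[OF p(1) xW(1)] G2[OF p(2) xW(2)])
      qed
    qed
    then obtain H where "potential \<omega> (topspace X) H" ..
    then show "?E = 0" by (rule exact_imp_zero[OF \<omega>(1,3)])
  qed
qed

section \<open>The distance to the lattice near zero\<close>

lemma zero_in_flux_lattice: "(\<lambda>c p. 0) \<in> flux_lattice X \<A> h"
proof -
  have "one_form \<A> (\<lambda>c p. 0)" by (simp add: one_form_def o_def smooth_on_const)
  moreover have "closed_form \<A> (\<lambda>c p. 0)" by (simp add: closed_form_def partial_deriv_def frechet_derivative_const)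
  moreover have "co_closed \<A> h (\<lambda>c p. 0)"
    by (simp add: co_closed_def codiff_def partial_deriv_def Let_def frechet_derivative_const)
  ultimately show ?thesis
    by (simp add: flux_lattice_def harmonic_form_def curve_integral_def Let_def)
qed

text \<open>The squared length is continuous and non-negative, and positive wherever the form does
  not vanish.\<close>

lemma zero_form_if_norm_zero:
  assumes \<omega>: "one_form \<A> \<omega>" and E: "(\<integral>p. conorm_sq \<A> h (complexify \<omega>) p \<partial>\<mu>) = 0"
  shows "zero_form \<A> \<omega>"
  unfolding zero_form_def
proof (intro ballI, rule ccontr)
  fix c p assume c: "c \<in> \<A>" "p \<in> chart_dom c" and "\<omega> c p \<noteq> 0"
  then have "complexify \<omega> c p \<noteq> 0" by (auto simp: complexify_def vec_eq_iff)
  then have "0 < conorm_sq \<A> h (complexify \<omega>) p"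
    unfolding conorm_sq_eq pair_eq[OF cofield_complexify[OF \<omega>] cofield_complexify[OF \<omega>] c]
    by (rule herm_matrix_inv_pos[OF pos_def_metric[OF c]])
  moreover have "p \<in> topspace X" using c chart_dom_subset by blast
  ultimately have "0 < (\<integral>p. conorm_sq \<A> h (complexify \<omega>) p \<partial>\<mu>)"
    by (intro integral_pos_if_pos[OF cont_conorm_sq[OF cofield_complexify[OF \<omega>]]]) (simp_all add: conorm_nonneg)
  then show False using E by simp
qed

lemma conorm_sq_scale: "conorm_sq \<A> h (\<lambda>c p. complex_of_real r *s \<xi> c p) p = r\<^sup>2 * conorm_sq \<A> h \<xi> p"
  unfolding conorm_sq_eq pair_scale_left[where f="\<lambda>_. complex_of_real r"] pair_scale_right[where f="\<lambda>_. complex_of_real r"]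
  by (simp add: power2_eq_square)

lemma conorm_sq_add_le:
  assumes p: "p \<in> topspace X"
  shows "conorm_sq \<A> h (\<lambda>c p. \<xi> c p + \<eta> c p) p \<le> 2 * conorm_sq \<A> h \<xi> p + 2 * conorm_sq \<A> h \<eta> p"
proof -
  have "0 \<le> conorm_sq \<A> h (\<lambda>c p. \<xi> c p + (-1) *s \<eta> c p) p" by (rule conorm_nonneg[OF p])
  then show ?thesis
    unfolding conorm_sq_eq pair_add_left pair_add_right
      pair_scale_left[where f="\<lambda>_. -1"] pair_scale_right[where f="\<lambda>_. -1"]
    by simp
qed

text \<open>A lattice element that vanishes as a form may still take arbitrary values for charts or
  points that do not count. Hence all zero forms are treated, not only the constant 0.\<close>

lemma l2_norm_zero_form_shift:
  assumes \<omega>: "zero_form \<A> \<omega>"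
  shows "(l2_norm X \<A> h (\<lambda>c p. \<omega> c p - r *\<^sub>R A c p))\<^sup>2 = r\<^sup>2 * (l2_norm X \<A> h A)\<^sup>2"
proof -
  have "conorm_sq \<A> h (complexify (\<lambda>c p. \<omega> c p - r *\<^sub>R A c p)) p = r\<^sup>2 * conorm_sq \<A> h (complexify A) p"
    if p: "p \<in> topspace X" for p
  proof -
    let ?c = "chart_at \<A> p"
    have "\<omega> ?c p = 0" using \<omega> chart_at[OF p] unfolding zero_form_def by blast
    then have "complexify (\<lambda>c p. \<omega> c p - r *\<^sub>R A c p) ?c p = complex_of_real (- r) *s complexify A ?c p"
      by (simp add: complexify_def vec_eq_iff)
    then have "conorm_sq \<A> h (complexify (\<lambda>c p. \<omega> c p - r *\<^sub>R A c p)) p =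
        conorm_sq \<A> h (\<lambda>c p. complex_of_real (- r) *s complexify A c p) p"
      by (simp add: conorm_sq_eq pair_def Let_def)
    then show ?thesis unfolding conorm_sq_scale by simp
  qed
  then have "(\<integral>p. conorm_sq \<A> h (complexify (\<lambda>c p. \<omega> c p - r *\<^sub>R A c p)) p \<partial>\<mu>) = (\<integral>p. r\<^sup>2 * conorm_sq \<A> h (complexify A) p \<partial>\<mu>)"
    by (intro Bochner_Integration.integral_cong) simp_all
  then show ?thesis by (simp add: l2_norm_sq)
qed

text \<open>Keeps long lattice elements away: if the squared norm of \<open>\<omega>\<close> is at
  least \<open>\<epsilon>\<close> and \<open>4 * r\<^sup>2\<close> times that of \<open>A\<close> is
  less than \<open>\<epsilon>\<close>, then \<open>\<omega>\<close> is further from the scaled form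
  than 0 is.\<close>

lemma l2_norm_shift_ge:
  assumes \<omega>: "one_form \<A> \<omega>" and A: "one_form \<A> A"
  shows "(l2_norm X \<A> h \<omega>)\<^sup>2 \<le> 2 * (l2_norm X \<A> h (\<lambda>c p. \<omega> c p - r *\<^sub>R A c p))\<^sup>2 + 2 * (r\<^sup>2 * (l2_norm X \<A> h A)\<^sup>2)"
proof -
  let ?\<xi> = "complexify (\<lambda>c p. \<omega> c p - r *\<^sub>R A c p)" and ?\<eta> = "\<lambda>c p. complex_of_real r *s complexify A c p"
  have eq: "complexify \<omega> = (\<lambda>c p. ?\<xi> c p + ?\<eta> c p)"
    by (simp add: fun_eq_iff vec_eq_iff complexify_def)
  have \<xi>: "?\<xi> = (\<lambda>c p. complexify \<omega> c p + (- complex_of_real r) *s complexify A c p)"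
    by (simp add: fun_eq_iff vec_eq_iff complexify_def)
  have cof: "cofield ?\<xi>"
    unfolding \<xi> by (intro cofield_add cofield_complexify \<omega> A cofield_scale[where f="\<lambda>_. - complex_of_real r"] cont_const)
  have "(\<integral>p. conorm_sq \<A> h (complexify \<omega>) p \<partial>\<mu>) \<le> (\<integral>p. 2 * conorm_sq \<A> h ?\<xi> p + 2 * (r\<^sup>2 * conorm_sq \<A> h (complexify A) p) \<partial>\<mu>)"
  proof (rule integral_mono)
    show "integrable \<mu> (conorm_sq \<A> h (complexify \<omega>))"
      by (rule cont_integrable[OF cont_conorm_sq[OF cofield_complexify[OF \<omega>]]])
    show "integrable \<mu> (\<lambda>p. 2 * conorm_sq \<A> h ?\<xi> p + 2 * (r\<^sup>2 * conorm_sq \<A> h (complexify A) p))"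
      by (intro cont_integrable cont_add cont_mult cont_const cont_conorm_sq cof cofield_complexify A)
    show "conorm_sq \<A> h (complexify \<omega>) p \<le> 2 * conorm_sq \<A> h ?\<xi> p + 2 * (r\<^sup>2 * conorm_sq \<A> h (complexify A) p)"
      if "p \<in> space \<mu>" for p
      unfolding conorm_sq_scale[symmetric]
      by (subst eq, rule conorm_sq_add_le) (use that in simp)
  qed
  also have "\<dots> = (\<integral>p. 2 * conorm_sq \<A> h ?\<xi> p \<partial>\<mu>) + (\<integral>p. 2 * (r\<^sup>2 * conorm_sq \<A> h (complexify A) p) \<partial>\<mu>)"
    by (rule Bochner_Integration.integral_add)
      (intro cont_integrable cont_mult cont_const cont_conorm_sq cof cofield_complexify A)+
  finally show ?thesis by (simp add: l2_norm_sq)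
qed

lemma lattice_dist_sq:
  assumes A: "one_form \<A> A"
  shows "\<exists>\<rho>>0. \<forall>r. 0 < r \<and> r < \<rho> \<longrightarrow>
    (lattice_dist X \<A> h (\<lambda>c p. r *\<^sub>R A c p))\<^sup>2 = r\<^sup>2 * (l2_norm X \<A> h A)\<^sup>2"
proof -
  obtain \<epsilon> where \<epsilon>: "\<epsilon> > 0" "\<forall>\<omega>\<in>flux_lattice X \<A> h. (\<integral>p. conorm_sq \<A> h (complexify \<omega>) p \<partial>\<mu>) < \<epsilon> \<longrightarrow>
    (\<integral>p. conorm_sq \<A> h (complexify \<omega>) p \<partial>\<mu>) = 0"
    using flux_lattice_discrete by (elim exE conjE) (rule that, assumption+)
  let ?L = "(l2_norm X \<A> h A)\<^sup>2"
  have L: "0 < 4 * ?L + 1" using zero_le_power2[of "l2_norm X \<A> h A"] by linarith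
  \<comment> \<open>This radius makes \<open>4 * (r\<^sup>2 * ?L)\<close> smaller than
    \<open>\<epsilon>\<close>; the added 1 avoids a zero denominator when \<open>A\<close> has norm
    0.\<close>
  have \<rho>: "0 < sqrt (\<epsilon> / (4 * ?L + 1))" using \<epsilon>(1) L by simp
  show ?thesis
  proof (intro exI[of _ "sqrt (\<epsilon> / (4 * ?L + 1))"] conjI \<rho> allI impI)
    fix r assume r: "0 < r \<and> r < sqrt (\<epsilon> / (4 * ?L + 1))"
    then have "r\<^sup>2 < (sqrt (\<epsilon> / (4 * ?L + 1)))\<^sup>2" by (intro power_strict_mono) auto
    also have "\<dots> = \<epsilon> / (4 * ?L + 1)" by (rule real_sqrt_pow2) (use \<epsilon>(1) L in simp)
    finally have "r\<^sup>2 * (4 * ?L + 1) < \<epsilon>" using L by (simp only: pos_less_divide_eq)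
    moreover have "r\<^sup>2 * (4 * ?L + 1) = 4 * (r\<^sup>2 * ?L) + r\<^sup>2" by (simp add: algebra_simps)
    ultimately have small: "4 * (r\<^sup>2 * ?L) < \<epsilon>" using zero_le_power2[of r] by linarith
    let ?D = "\<lambda>\<omega>. (l2_norm X \<A> h (\<lambda>c p. \<omega> c p - r *\<^sub>R A c p))\<^sup>2"
    have "Inf {?D \<omega> |\<omega>. \<omega> \<in> flux_lattice X \<A> h} = r\<^sup>2 * ?L"
    proof (rule cInf_eq_minimum)
      have "zero_form \<A> (\<lambda>c p. 0)" by (simp add: zero_form_def)
      from l2_norm_zero_form_shift[OF this, symmetric]
      show "r\<^sup>2 * ?L \<in> {?D \<omega> |\<omega>. \<omega> \<in> flux_lattice X \<A> h}"
        using zero_in_flux_lattice by (intro CollectI exI[of _ "\<lambda>c p. 0"] conjI)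
    next
      fix x assume "x \<in> {?D \<omega> |\<omega>. \<omega> \<in> flux_lattice X \<A> h}"
      then obtain \<omega> where x: "x = ?D \<omega>" and \<omega>: "\<omega> \<in> flux_lattice X \<A> h" by (elim CollectE exE conjE) (rule that)
      show "r\<^sup>2 * ?L \<le> x"
      proof (cases "(l2_norm X \<A> h \<omega>)\<^sup>2 < \<epsilon>")
        case True
        then have "(\<integral>p. conorm_sq \<A> h (complexify \<omega>) p \<partial>\<mu>) = 0"
          using bspec[OF \<epsilon>(2) \<omega>] unfolding l2_norm_sq by (rule rev_mp)
        from zero_form_if_norm_zero[OF flux_latticeD(1)[OF \<omega>] this]
        show ?thesis unfolding x by (simp only: l2_norm_zero_form_shift order_refl)
      next
        case False
        then show ?thesis
          using l2_norm_shift_ge[OF flux_latticeD(1)[OF \<omega>] A, of r] small unfolding x by linarith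
      qed
    qed
    then show "(lattice_dist X \<A> h (\<lambda>c p. r *\<^sub>R A c p))\<^sup>2 = r\<^sup>2 * ?L"
      unfolding lattice_dist_def by simp
  qed
qed

end

theorem theorem3:
  fixes X :: "'a topology"
    and \<A> :: "('a, 'n::finite) chart set"
    and h :: "('a, 'n) metric_field"
    and A :: "('a, 'n) covector_field"
  assumes "smooth_manifold X \<A>"
    and "topspace X \<noteq> {}" and "compact_space X" and "connected_space X"
    and "riemannian_metric \<A> h"
    and "one_form \<A> A" and "co_closed \<A> h A"
  shows "(\<exists>\<rho>>0. \<exists>C>0. \<forall>r. 0 < r \<and> r < \<rho> \<longrightarrow>
            (l2_norm X \<A> h A)\<^sup>2 / vol X \<A> h * r\<^sup>2 - C * r ^ 4
              \<le> lambda1 X \<A> h (\<lambda>c p. r *\<^sub>R A c p) \<and>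
            lambda1 X \<A> h (\<lambda>c p. r *\<^sub>R A c p)
              \<le> (l2_norm X \<A> h A)\<^sup>2 / vol X \<A> h * r\<^sup>2) \<and>
         (\<exists>\<rho>>0. \<forall>r. 0 < r \<and> r < \<rho> \<longrightarrow>
            (lattice_dist X \<A> h (\<lambda>c p. r *\<^sub>R A c p))\<^sup>2 = r\<^sup>2 * (l2_norm X \<A> h A)\<^sup>2) \<and>
         (\<not> zero_form \<A> A \<longrightarrow>
            ((\<lambda>r. vol X \<A> h * lambda1 X \<A> h (\<lambda>c p. r *\<^sub>R A c p) /
                  (lattice_dist X \<A> h (\<lambda>c p. r *\<^sub>R A c p))\<^sup>2) \<longlongrightarrow> 1) (at_right 0))"
proof -
  interpret compact_riemannian X \<A> h
    by unfold_locales (rule assms)+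
  let ?L = "(l2_norm X \<A> h A)\<^sup>2" and ?V = "vol X \<A> h"
  let ?l = "\<lambda>r. lambda1 X \<A> h (\<lambda>c p. r *\<^sub>R A c p)" and ?d = "\<lambda>r. (lattice_dist X \<A> h (\<lambda>c p. r *\<^sub>R A c p))\<^sup>2"
  obtain \<rho> C where \<rho>: "\<rho> > 0" and C: "C > 0"
    and lower: "\<forall>r. 0 < r \<and> r < \<rho> \<longrightarrow> ?L / ?V * r\<^sup>2 - C * r ^ 4 \<le> ?l r"
    using lambda1_lower[OF assms(6,7)] by (elim exE conjE) (rule that, assumption+)
  obtain \<rho>' where \<rho>': "\<rho>' > 0" and dist: "\<forall>r. 0 < r \<and> r < \<rho>' \<longrightarrow> ?d r = r\<^sup>2 * ?L"
    using lattice_dist_sq[OF assms(6)] by (elim exE conjE) (rule that, assumption+)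
  have upper: "?l r \<le> ?L / ?V * r\<^sup>2" for r by (rule lambda1_upper)
  have V: "?V > 0" by (rule vol_pos)
  have "((\<lambda>r. ?V * ?l r / ?d r) \<longlongrightarrow> 1) (at_right 0)" if nz: "\<not> zero_form \<A> A"
  proof -
    have "?L \<noteq> 0" using nz zero_form_if_norm_zero[OF assms(6)] unfolding l2_norm_sq by (rule contrapos_nn)
    then have L: "?L > 0" by simp
    \<comment> \<open>The two-sided bound is divided by \<open>r\<^sup>2 * ?L\<close>, the value of
      the squared distance for small \<open>r\<close>; the error of order \<open>r ^ 4\<close>
      becomes quadratic in \<open>r\<close>.\<close>
    have le: "1 - C * ?V / ?L * r\<^sup>2 \<le> ?V * ?l r / ?d r \<and> ?V * ?l r / ?d r \<le> 1" if r: "0 < r" "r < min \<rho> \<rho>'" for r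
    proof -
      have r2: "0 < r\<^sup>2 * ?L" using r(1) L by simp
      have d: "?d r = r\<^sup>2 * ?L" using dist r by simp
      have "?V * ?l r \<le> ?V * (?L / ?V * r\<^sup>2)" using upper V by (intro mult_left_mono) simp_all
      also have "\<dots> = 1 * (r\<^sup>2 * ?L)" using V by simp
      finally have "?V * ?l r / ?d r \<le> 1" unfolding d using r2 by (simp only: pos_divide_le_eq)
      moreover have "?V * (?L / ?V * r\<^sup>2 - C * r ^ 4) \<le> ?V * ?l r"
        by (rule mult_left_mono) (use lower r V in simp_all)
      moreover have "?V * (?L / ?V * r\<^sup>2 - C * r ^ 4) = (1 - C * ?V / ?L * r\<^sup>2) * (r\<^sup>2 * ?L)"
        using V L by (auto simp: field_simps power4_eq_xxxx power2_eq_square)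
      ultimately show ?thesis unfolding d using r2 by (simp only: pos_le_divide_eq)
    qed
    have m: "0 < min \<rho> \<rho>'" using \<rho> \<rho>' by simp
    show ?thesis
    proof (rule tendsto_sandwich)
      show "\<forall>\<^sub>F r in at_right 0. 1 - C * ?V / ?L * r\<^sup>2 \<le> ?V * ?l r / ?d r"
        unfolding eventually_at_right_field by (intro exI[of _ "min \<rho> \<rho>'"] conjI m allI impI conjunct1[OF le])
      show "\<forall>\<^sub>F r in at_right 0. ?V * ?l r / ?d r \<le> 1"
        unfolding eventually_at_right_field by (intro exI[of _ "min \<rho> \<rho>'"] conjI m allI impI conjunct2[OF le])
      have "((\<lambda>r. 1 - C * ?V / ?L * r\<^sup>2) \<longlongrightarrow> 1 - C * ?V / ?L * 0\<^sup>2) (at_right 0)"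
        by (intro tendsto_intros)
      then show "((\<lambda>r. 1 - C * ?V / ?L * r\<^sup>2) \<longlongrightarrow> 1) (at_right 0)" by simp
      show "((\<lambda>r. 1) \<longlongrightarrow> (1::real)) (at_right (0::real))" by (rule tendsto_const)
    qed
  qed
  moreover have "\<exists>\<rho>>0. \<exists>C>0. \<forall>r. 0 < r \<and> r < \<rho> \<longrightarrow> ?L / ?V * r\<^sup>2 - C * r ^ 4 \<le> ?l r \<and> ?l r \<le> ?L / ?V * r\<^sup>2"
    by (rule exI[of _ \<rho>], rule conjI[OF \<rho>], rule exI[of _ C], rule conjI[OF C])
      (intro allI impI conjI upper, rule lower[rule_format])
  moreover have "\<exists>\<rho>>0. \<forall>r. 0 < r \<and> r < \<rho> \<longrightarrow> ?d r = r\<^sup>2 * ?L"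
    by (rule exI[of _ \<rho>'], rule conjI[OF \<rho>' dist])
  ultimately show ?thesis by (intro conjI impI)
qed

end
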